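(* Let $T>0$, $\tau>0$, $H\in(0,1/2)$, let $X,Y$ be real separable Hilbert spaces, $U$ a separable Hilbert space, $(\Omega,\mathcal F,\mathbb P)$ a complete probability space, and $B^H$ the $Y$-valued $Q$-fractional Brownian motion with Hurst parameter $H$ (defined in the context). Let $r,\rho:[0,+\infty)\to[0,\tau]$ be continuous, $A:D(A)\subset X\to X$ a closed linear operator, $B(t)$, $t\ge 0$, closed linear operators with $D(B(t))\supset D(A)$, $L:U\to X$ a bounded linear operator, and $f,g:[0,+\infty)\times X\to X$, $\sigma:[0,+\infty)\to\mathcal L_2^0(Y,X)$ functions. Let $Z$ denote $D(A)$ with the graph norm $\|y\|_Z=\|Ay\|+\|y\|$. Assume: (1) $A$ is the infinitesimal generator of a $C_0$-semigroup on $X$. (2) For all $t\ge 0$, $B(t)$ is a continuous linear operator from $Z$ into $X$; moreover there is a locally integrable function $c:\mathbb R^+\to\mathbb R^+$ such that for every $y\in Z$ the map $t\mapsto B(t)y$ belongs to $W^{1,1}([0,+\infty),X)$ and $\|\frac{d}{dt}B(t)y\|_X\le c(t)\|y\|_Z$ for $t\ge 0$. (3) There are positive constants $C_1,C_2$ (depending on $T$) such that for all $t\in[0,T]$, $x,y\in X$: $\|f(t,x)-f(t,y)\|\le C_1\|x-y\|$ and $\|f(t,x)\|^2\le C_2(1+\|x\|^2)$. (4) There are constants $C_3,C_4$ (depending on $T$) such that for all $t\in[0,T]$, $x,y\in X$: $\|g(t,x)-g(t,y)\|\le C_3\|x-y\|$ and $\|g(t,x)\|^2\le C_4(1+\|x\|^2)$;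 and for every $x\in\mathcal C([0,T],\mathbb L^2(\Omega,X))$ and every $s\in[0,T]$, $\lim_{t\to s}\mathbb E\|g(t,x(t))-g(s,x(s))\|^2=0$. (5) (i) There are $C_5>0$ and $\gamma>1/2-H$ such that $\|\sigma(t)-\sigma(s)\|_{\mathcal L_2^0}\le C_5|t-s|^\gamma$ for all $t,s\in[0,T]$; (ii) $\sigma(t)y\in D(A)$ for all $t\in[0,T]$ and $y\in Y$; (iii) there is $C_6>0$ such that $\int_0^T\|A\sigma(t)\|_{\mathcal L_2^0}^2\,dt\le C_6$. (6) Let $(R(t))_{t\ge0}$ be the resolvent operator associated with $A$ and $(B(t))_{t\ge 0}$ (defined in the context). The linear operator $W:L^2([0,T],U)\to X$, $Wu=\int_0^T R(T-s)Lu(s)\,ds$, has an inverse operator $W^{-1}$, defined on $X$ and taking values in $L^2([0,T],U)\backslash\ker W$ (see the context), and there are finite positive constants $M_L,M_W$ such that $\|L\|\le M_L$ and $\|W^{-1}\|\le M_W$. Put $D:=\sup_{t\in[0,T]}\|R(t)\|$ and suppose that $$C_3^2+D^2C_1^2T^2+D^2M_L^2M_W^2C_3^2T+D^4M_L^2M_W^2C_1^2T^3<\frac14 .$$ Then the system $$d[x(t)+g(t,x(t-r(t)))]=\big[A[x(t)+g(t,x(t-r(t)))]+Lu(t)\big]dt+\Big[\int_0^tB(t-s)[x(s)+g(s,x(s-r(s)))]\,ds+f(t,x(t-\rho(t)))\Big]dt+\sigma(t)\,dB^H(t),\quad 0\le t\le T,$$ $$x(t)=\varphi(t),\quad -\tau\le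 t\le 0,$$ is controllable on $[-\tau,T]$: for every initial stochastic process $\varphi\in\mathcal C([-\tau,0],\mathbb L^2(\Omega,X))$ and every $x_1\in X$ there exists a stochastic control $u\in L^2([0,T],U)$ such that the mild solution $x(\cdot)$ of the system satisfies $x(T)=x_1$.
   Context: **Resolvent operator.** For $A$ and $(B(t))_{t\ge0}$ as in (1)–(2), a resolvent operator of the Cauchy problem $v'(t)=Av(t)+\int_0^tB(t-s)v(s)\,ds$ ($t\ge0$), $v(0)=v_0\in X$, is a function $R(t)\in\mathcal L(X)$, $t\ge0$, of bounded linear operators such that: (i) $R(0)=I$ and $\|R(t)\|\le Ne^{\beta t}$ for some constants $N,\beta$; (ii) for each $x\in X$, $t\mapsto R(t)x$ is continuous on $[0,\infty)$; (iii) for $x\in Z$, $R(\cdot)x\in\mathcal C^1([0,+\infty);X)\cap\mathcal C([0,+\infty);Z)$ and, for $t\ge 0$, $$R'(t)x=AR(t)x+\int_0^tB(t-s)R(s)x\,ds=R(t)Ax+\int_0^tR(t-s)B(s)x\,ds.$$ Under (1) and (2) it is known that a unique resolvent operator exists. **Fractional Brownian motion.** A one-dimensional fractional Brownian motion $\beta^H$ with Hurst parameter $H\in(0,1/2)$ is a centred Gaussian process on $[0,T]$ with covariance $R_H(s,t)=\frac12(t^{2H}+s^{2H}-|t-s|^{2H})$. It has the representation $\beta^H(t)=\int_0^tK_H(t,s)\,d\beta(s)$ with $\beta$ a Wiener process and, for $t>s$, $$K_H(t,s)=c_H\Big[\big(\tfrac ts\big)^{H-1/2}(t-s)^{H-1/2}-(H-\tfrac12)s^{1/2-H}\int_s^tu^{H-3/2}(u-s)^{H-1/2}du\Big],$$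 where $c_H=\sqrt{\frac{2H}{(1-2H)\,\mathrm{B}(1-2H,H+\frac12)}}$, $\mathrm B(\cdot,\cdot)$ is the Beta function, and $K_H(t,s)=0$ if $t\le s$. Let $Q\in\mathcal L(Y,Y)$ be given by $Qe_n=\lambda_ne_n$, with $\{e_n\}_{n\ge1}$ a complete orthonormal basis of $Y$, $\lambda_n\ge0$, and $\mathrm{tr}\,Q=\sum_n\lambda_n<\infty$. The $Y$-valued $Q$-fractional Brownian motion is $B^H(t)=\sum_{n=1}^\infty\sqrt{\lambda_n}\,e_n\,\beta_n^H(t)$, where the $\beta_n^H$ are real independent fractional Brownian motions with Hurst parameter $H$, $\beta_n^H(t)=\int_0^tK_H(t,s)\,d\beta_n(s)$ with $\beta_n$ standard Brownian motions. **Hilbert–Schmidt operators.** $\mathcal L_2^0=\mathcal L_2^0(Y,X)$ is the space of $Q$-Hilbert–Schmidt operators: $\psi\in\mathcal L(Y,X)$ with $\|\psi\|_{\mathcal L_2^0}^2:=\sum_n\|\sqrt{\lambda_n}\,\psi e_n\|^2<\infty$. The quantity $\|A\sigma(t)\|_{\mathcal L_2^0}^2$ means $\sum_n\lambda_n\|A\sigma(t)e_n\|^2$. **Wiener integral.** For $\phi:[0,T]\to\mathcal L_2^0(Y,X)$ and $t\in[0,T]$, $$\int_0^t\phi(s)\,dB^H(s)=\sum_{n=1}^\infty\int_0^t\sqrt{\lambda_n}\,(K_{H,t}^*(\phi e_n))(s)\,d\beta_n(s),$$ where $(K^*_{H,t}h)(s)=K_H(t,s)h(s)+\int_s^t(h(r)-h(s))\frac{\partial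 K_H}{\partial r}(r,s)\,dr$; it is defined when $\sum_n\lambda_n\|K_{H,t}^*(\phi e_n)\|_{L^2([0,t],X)}^2<\infty$. **Inverse of $W$.** Here $\ker W=\{x\in L^2([0,T],U): Wx=0\}$ and $L^2([0,T],U)\backslash\ker W$ denotes the space $L^2([0,T],U)$ modulo $\ker W$, identified with the orthogonal complement $[\ker W]^\perp$; $W^{-1}$ is the inverse of the restriction of $W$ to $[\ker W]^\perp$, so $W W^{-1}=I$ on $X$. **Mild solution.** $\mathcal C([a,b],\mathbb L^2(\Omega,X))$ denotes the continuous functions from $[a,b]$ into $\mathbb L^2(\Omega,X)$. Given $\varphi$ and a control $u$, an $X$-valued process $\{x(t),t\in[-\tau,T]\}$ is a mild solution of the system if $x(\cdot)\in\mathcal C([-\tau,T],\mathbb L^2(\Omega,X))$, $x(t)=\varphi(t)$ for $-\tau\le t\le0$, and for every $t\in[0,T]$, $\mathbb P$-a.s., $$x(t)=R(t)\big(\varphi(0)+g(0,\varphi(-r(0)))\big)-g(t,x(t-r(t)))+\int_0^tR(t-s)\big[Lu(s)+f(s,x(s-\rho(s)))\big]ds+\int_0^tR(t-s)\sigma(s)\,dB^H(s).$$ A stochastic control is a random function $u$ with values in $L^2([0,T],U)$, the space of admissible control functions.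
   Formalization: For every x, the map t ↦ f(t,x) is assumed Lebesgue measurable on [0,T]; without this the integral of R(t−s)f(s,x(s−ρ(s))) in the mild solution is undefined and the claim fails, e.g. for f(t,x)=h(t)v with h bounded and non-measurable. *)

theory Defs
  imports "HOL-Probability.Probability"
begin

section \<open>Square-integrable functions and mean-square continuous processes\<close>

text \<open>Elements of \<open>L2 M\<close> are representatives; equality in the Lebesgue space is equality almost
  everywhere. The definition is used both for \<open>M\<close> a probability space and for
  \<open>M = lebesgue_on {0..T}\<close>.\<close>

definition L2 :: "'a measure \<Rightarrow> ('a \<Rightarrow> 'b::{real_normed_vector,second_countable_topology}) set" where
  "L2 M = {f \<in> borel_measurable M. integrable M (\<lambda>x. (norm (f x))\<^sup>2)}"

definition L2_norm :: "'a measure \<Rightarrow> ('a \<Rightarrow> 'b::real_normed_vector) \<Rightarrow> real" where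
  "L2_norm M f = sqrt (\<integral>x. (norm (f x))\<^sup>2 \<partial>M)"

definition L2_inner :: "'a measure \<Rightarrow> ('a \<Rightarrow> 'b::real_inner) \<Rightarrow> ('a \<Rightarrow> 'b) \<Rightarrow> real" where
  "L2_inner M f g = (\<integral>x. f x \<bullet> g x \<partial>M)"

definition C_L2 ::
  "'w measure \<Rightarrow> real set \<Rightarrow> (real \<Rightarrow> 'w \<Rightarrow> 'x::{real_normed_vector,second_countable_topology}) set" where
  "C_L2 M S = {x. (\<forall>t\<in>S. x t \<in> L2 M) \<and>
     (\<forall>s\<in>S. ((\<lambda>t. \<integral>\<omega>. (norm (x t \<omega> - x s \<omega>))\<^sup>2 \<partial>M) \<longlongrightarrow> 0) (at s within S))}"

definition measurable_process ::
  "'w measure \<Rightarrow> real set \<Rightarrow> (real \<Rightarrow> 'w \<Rightarrow> 'x::topological_space) \<Rightarrow> bool" where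
  "measurable_process M S x \<longleftrightarrow>
     (\<lambda>(t, \<omega>). x t \<omega>) \<in> borel_measurable (restrict_space borel S \<Otimes>\<^sub>M M)"


section \<open>Unbounded operators, semigroups and resolvent operators\<close>

text \<open>An unbounded operator is given by its domain \<open>D\<close> and a function \<open>A\<close>, whose values outside
  \<open>D\<close> are irrelevant.\<close>

definition closed_linear_operator :: "'x::real_normed_vector set \<Rightarrow> ('x \<Rightarrow> 'x) \<Rightarrow> bool" where
  "closed_linear_operator D A \<longleftrightarrow> subspace D \<and>
     (\<forall>x\<in>D. \<forall>y\<in>D. A (x + y) = A x + A y) \<and>
     (\<forall>a. \<forall>x\<in>D. A (a *\<^sub>R x) = a *\<^sub>R A x) \<and>
     closed ((\<lambda>x. (x, A x)) ` D)"

definition C0_semigroup :: "(real \<Rightarrow> 'x::real_normed_vector \<Rightarrow>\<^sub>L 'x) \<Rightarrow> bool" where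
  "C0_semigroup S \<longleftrightarrow> S 0 = id_blinfun \<and>
     (\<forall>s\<ge>0. \<forall>t\<ge>0. S (s + t) = S s o\<^sub>L S t) \<and>
     (\<forall>x. ((\<lambda>h. S h x) \<longlongrightarrow> x) (at_right 0))"

definition infinitesimal_generator ::
  "'x::real_normed_vector set \<Rightarrow> ('x \<Rightarrow> 'x) \<Rightarrow> (real \<Rightarrow> 'x \<Rightarrow>\<^sub>L 'x) \<Rightarrow> bool" where
  "infinitesimal_generator D A S \<longleftrightarrow>
     D = {x. \<exists>y. ((\<lambda>h. (S h x - x) /\<^sub>R h) \<longlongrightarrow> y) (at_right 0)} \<and>
     (\<forall>x\<in>D. ((\<lambda>h. (S h x - x) /\<^sub>R h) \<longlongrightarrow> A x) (at_right 0))"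

definition graph_norm :: "('x::real_normed_vector \<Rightarrow> 'x) \<Rightarrow> 'x \<Rightarrow> real" where
  "graph_norm A y = norm (A y) + norm y"

text \<open>\<open>v\<close> belongs to \<open>W\<^sup>1\<^sup>,\<^sup>1([0,\<infinity>),X)\<close> and \<open>w\<close> is (a representative of) its derivative; as usual
  in one dimension, \<open>v\<close> is taken to be the absolutely continuous representative.\<close>

definition has_W11_derivative ::
  "(real \<Rightarrow> 'x::{banach,second_countable_topology}) \<Rightarrow> (real \<Rightarrow> 'x) \<Rightarrow> bool" where
  "has_W11_derivative v w \<longleftrightarrow>
     integrable (lebesgue_on {0..}) v \<and> integrable (lebesgue_on {0..}) w \<and>
     (\<forall>t\<ge>0. v t = v 0 + (\<integral>s. w s \<partial>lebesgue_on {0..t}))"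

definition resolvent_operator ::
  "'x::{banach,second_countable_topology} set \<Rightarrow> ('x \<Rightarrow> 'x) \<Rightarrow> (real \<Rightarrow> 'x \<Rightarrow> 'x) \<Rightarrow>
   (real \<Rightarrow> 'x \<Rightarrow>\<^sub>L 'x) \<Rightarrow> bool" where
  "resolvent_operator D A B R \<longleftrightarrow>
     R 0 = id_blinfun \<and>
     (\<exists>N b. \<forall>t\<ge>0. norm (R t) \<le> N * exp (b * t)) \<and>
     (\<forall>x. continuous_on {0..} (\<lambda>t. R t x)) \<and>
     (\<forall>x\<in>D.
        (\<forall>t\<ge>0. R t x \<in> D) \<and>
        (\<forall>t\<ge>0. ((\<lambda>s. graph_norm A (R s x - R t x)) \<longlongrightarrow> 0) (at t within {0..})) \<and>
        (\<exists>R'. continuous_on {0..} R' \<and>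
           (\<forall>t\<ge>0. ((\<lambda>s. R s x) has_vector_derivative R' t) (at t within {0..}) \<and>
              R' t = A (R t x) + (\<integral>s. B (t - s) (R s x) \<partial>lebesgue_on {0..t}) \<and>
              R' t = R t (A x) + (\<integral>s. R (t - s) (B s x) \<partial>lebesgue_on {0..t}))))"


section \<open>Brownian motion and Wiener integrals of deterministic functions\<close>

definition independent_processes ::
  "'w measure \<Rightarrow> real \<Rightarrow> (nat \<Rightarrow> real \<Rightarrow> 'w \<Rightarrow> real) \<Rightarrow> nat set \<Rightarrow> bool" where
  "independent_processes M T X I \<longleftrightarrow>
     prob_space.indep_vars M (\<lambda>_. Pi\<^sub>M {0..T} (\<lambda>_. borel)) (\<lambda>n \<omega>. \<lambda>t\<in>{0..T}. X n t \<omega>) I"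

definition standard_brownian_motion :: "'w measure \<Rightarrow> real \<Rightarrow> (real \<Rightarrow> 'w \<Rightarrow> real) \<Rightarrow> bool" where
  "standard_brownian_motion M T b \<longleftrightarrow>
     (\<forall>t\<in>{0..T}. b t \<in> borel_measurable M) \<and>
     (AE \<omega> in M. b 0 \<omega> = 0) \<and>
     (\<forall>s\<ge>0. \<forall>t\<le>T. s < t \<longrightarrow>
        distributed M lborel (\<lambda>\<omega>. b t \<omega> - b s \<omega>) (normal_density 0 (sqrt (t - s)))) \<and>
     (\<forall>m (a :: nat \<Rightarrow> real). 0 \<le> a 0 \<and> (\<forall>i<m. a i \<le> a (Suc i)) \<and> a m \<le> T \<longrightarrow>
        prob_space.indep_vars M (\<lambda>_. borel) (\<lambda>i \<omega>. b (a (Suc i)) \<omega> - b (a i) \<omega>) {..<m}) \<and>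
     (AE \<omega> in M. continuous_on {0..T} (\<lambda>t. b t \<omega>))"

definition step_function :: "nat \<Rightarrow> (nat \<Rightarrow> real) \<Rightarrow> (nat \<Rightarrow> 'x::real_vector) \<Rightarrow> real \<Rightarrow> 'x" where
  "step_function m a c s = (\<Sum>i<m. indicat_real {a i<..a (Suc i)} s *\<^sub>R c i)"

text \<open>\<open>Z\<close> is the Wiener integral of \<open>h\<close> over \<open>[0,t]\<close> with respect to \<open>b\<close>: the extension of the
  integral of step functions by the isometry between \<open>L2([0,t],X)\<close> and \<open>L2(\<Omega>,X)\<close>. It determines
  \<open>Z\<close> up to a null set.\<close>

definition has_wiener_integral ::
  "'w measure \<Rightarrow> (real \<Rightarrow> 'w \<Rightarrow> real) \<Rightarrow> real \<Rightarrow>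
   (real \<Rightarrow> 'x::{real_normed_vector,second_countable_topology}) \<Rightarrow> ('w \<Rightarrow> 'x) \<Rightarrow> bool" where
  "has_wiener_integral M b t h Z \<longleftrightarrow>
     h \<in> L2 (lebesgue_on {0..t}) \<and> Z \<in> L2 M \<and>
     (\<forall>\<epsilon>>0. \<exists>m a c. a 0 = 0 \<and> a m = t \<and> (\<forall>i<m. a i \<le> a (Suc i)) \<and>
        (\<integral>\<^sup>+s. ennreal ((norm (h s - step_function m a c s))\<^sup>2) \<partial>lebesgue_on {0..t}) < ennreal \<epsilon> \<and>
        (\<integral>\<^sup>+\<omega>. ennreal ((norm (Z \<omega> - (\<Sum>i<m. (b (a (Suc i)) \<omega> - b (a i) \<omega>) *\<^sub>R c i)))\<^sup>2) \<partial>M)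
          < ennreal \<epsilon>)"


section \<open>Fractional Brownian motion\<close>

definition gaussian_rv :: "'w measure \<Rightarrow> ('w \<Rightarrow> real) \<Rightarrow> bool" where
  "gaussian_rv M X \<longleftrightarrow> X \<in> borel_measurable M \<and>
     ((\<exists>\<mu>. AE \<omega> in M. X \<omega> = \<mu>) \<or>
      (\<exists>\<mu> s. s > 0 \<and> distributed M lborel X (normal_density \<mu> s)))"

definition fractional_brownian_motion ::
  "'w measure \<Rightarrow> real \<Rightarrow> real \<Rightarrow> (real \<Rightarrow> 'w \<Rightarrow> real) \<Rightarrow> bool" where
  "fractional_brownian_motion M H T b \<longleftrightarrow>
     (\<forall>F c. finite F \<and> F \<subseteq> {0..T} \<longrightarrow> gaussian_rv M (\<lambda>\<omega>. \<Sum>t\<in>F. c t * b t \<omega>)) \<and>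
     (\<forall>t\<in>{0..T}. (\<integral>\<omega>. b t \<omega> \<partial>M) = 0) \<and>
     (\<forall>s\<in>{0..T}. \<forall>t\<in>{0..T}. (\<integral>\<omega>. b s \<omega> * b t \<omega> \<partial>M) =
        (t powr (2 * H) + s powr (2 * H) - \<bar>t - s\<bar> powr (2 * H)) / 2)"

definition c_H :: "real \<Rightarrow> real" where
  "c_H H = sqrt (2 * H / ((1 - 2 * H) * Beta (1 - 2 * H) (H + 1/2)))"

definition K_H :: "real \<Rightarrow> real \<Rightarrow> real \<Rightarrow> real" where
  "K_H H t s = (if t \<le> s then 0 else
     c_H H * ((t / s) powr (H - 1/2) * (t - s) powr (H - 1/2)
       - (H - 1/2) * s powr (1/2 - H)
         * (\<integral>u. u powr (H - 3/2) * (u - s) powr (H - 1/2) \<partial>lebesgue_on {s..t})))"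

definition K_star :: "real \<Rightarrow> real \<Rightarrow> (real \<Rightarrow> 'x::{banach,second_countable_topology}) \<Rightarrow> real \<Rightarrow> 'x" where
  "K_star H t h s = K_H H t s *\<^sub>R h s +
     (\<integral>r. deriv (\<lambda>r. K_H H r s) r *\<^sub>R (h r - h s) \<partial>lebesgue_on {s..t})"

text \<open>The index set \<open>I\<close> is an arbitrary set of naturals, so that finite-dimensional spaces are covered
  as well.\<close>

definition orthonormal_basis :: "nat set \<Rightarrow> (nat \<Rightarrow> 'y::real_inner) \<Rightarrow> bool" where
  "orthonormal_basis I e \<longleftrightarrow>
     (\<forall>m\<in>I. \<forall>n\<in>I. e m \<bullet> e n = (if m = n then 1 else 0)) \<and> closure (span (e ` I)) = UNIV"

text \<open>\<open>BH\<close> is the \<open>Q\<close>-fractional Brownian motion with eigenvalues \<open>lam\<close> and eigenvectors \<open>e\<close>, driven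
  by the Brownian motions \<open>\<beta> n\<close>; its series converges in mean square.\<close>

definition Q_fractional_brownian_motion ::
  "'w measure \<Rightarrow> real \<Rightarrow> real \<Rightarrow> nat set \<Rightarrow> (nat \<Rightarrow> real) \<Rightarrow> (nat \<Rightarrow> 'y) \<Rightarrow>
   (nat \<Rightarrow> real \<Rightarrow> 'w \<Rightarrow> real) \<Rightarrow>
   (real \<Rightarrow> 'w \<Rightarrow> 'y::{real_normed_vector,second_countable_topology}) \<Rightarrow> bool" where
  "Q_fractional_brownian_motion M H T I lam e \<beta> BH \<longleftrightarrow>
     (\<forall>n\<in>I. standard_brownian_motion M T (\<beta> n)) \<and>
     independent_processes M T \<beta> I \<and>
     (\<exists>\<beta>H. (\<forall>n\<in>I. fractional_brownian_motion M H T (\<beta>H n)) \<and>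
        independent_processes M T \<beta>H I \<and>
        (\<forall>n\<in>I. \<forall>t\<in>{0..T}. has_wiener_integral M (\<beta> n) t (K_H H t) (\<beta>H n t)) \<and>
        (\<forall>t\<in>{0..T}. BH t \<in> L2 M \<and>
           (\<lambda>k. \<integral>\<^sup>+\<omega>. ennreal ((norm (BH t \<omega> -
               (\<Sum>n\<in>I \<inter> {..<k}. (sqrt (lam n) * \<beta>H n t \<omega>) *\<^sub>R e n)))\<^sup>2) \<partial>M) \<longlonglongrightarrow> 0))"


section \<open>Hilbert--Schmidt operators and the integral with respect to $B^H$\<close>

text \<open>The squared \<open>Q\<close>-Hilbert--Schmidt norm, with value \<open>\<infinity>\<close> allowed.\<close>

definition L20_sq ::
  "nat set \<Rightarrow> (nat \<Rightarrow> real) \<Rightarrow> (nat \<Rightarrow> 'y) \<Rightarrow> ('y \<Rightarrow> 'x::real_normed_vector) \<Rightarrow> ennreal" where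
  "L20_sq I lam e \<psi> = (\<Sum>\<^sub>\<infinity>n\<in>I. ennreal (lam n * (norm (\<psi> (e n)))\<^sup>2))"

definition L20 ::
  "nat set \<Rightarrow> (nat \<Rightarrow> real) \<Rightarrow> (nat \<Rightarrow> 'y) \<Rightarrow>
   ('y::real_normed_vector \<Rightarrow>\<^sub>L 'x::real_normed_vector) set" where
  "L20 I lam e = {\<psi>. L20_sq I lam e (blinfun_apply \<psi>) < \<infinity>}"

definition L20_norm ::
  "nat set \<Rightarrow> (nat \<Rightarrow> real) \<Rightarrow> (nat \<Rightarrow> 'y) \<Rightarrow>
   ('y::real_normed_vector \<Rightarrow>\<^sub>L 'x::real_normed_vector) \<Rightarrow> real" where
  "L20_norm I lam e \<psi> = sqrt (enn2real (L20_sq I lam e (blinfun_apply \<psi>)))"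

text \<open>\<open>Z\<close> is the integral of \<open>\<phi>\<close> over \<open>[0,t]\<close> with respect to the \<open>Q\<close>-fractional Brownian motion
  driven by the Brownian motions \<open>\<beta> n\<close>. The first two conditions say that the integral is defined;
  indices with \<open>lam n = 0\<close> do not contribute.\<close>

definition has_fbm_integral ::
  "'w measure \<Rightarrow> real \<Rightarrow> nat set \<Rightarrow> (nat \<Rightarrow> real) \<Rightarrow> (nat \<Rightarrow> 'y) \<Rightarrow>
   (nat \<Rightarrow> real \<Rightarrow> 'w \<Rightarrow> real) \<Rightarrow> real \<Rightarrow>
   (real \<Rightarrow> 'y::real_normed_vector \<Rightarrow>\<^sub>L 'x::{banach,second_countable_topology}) \<Rightarrow>
   ('w \<Rightarrow> 'x) \<Rightarrow> bool" where
  "has_fbm_integral M H I lam e \<beta> t \<phi> Z \<longleftrightarrow>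
     (\<forall>n\<in>I. lam n \<noteq> 0 \<longrightarrow> (AE s in lebesgue_on {0..t}. integrable (lebesgue_on {s..t})
        (\<lambda>r. deriv (\<lambda>r. K_H H r s) r *\<^sub>R (\<phi> r (e n) - \<phi> s (e n))))) \<and>
     (\<Sum>\<^sub>\<infinity>n\<in>I. \<integral>\<^sup>+s. ennreal (lam n * (norm (K_star H t (\<lambda>r. \<phi> r (e n)) s))\<^sup>2)
        \<partial>lebesgue_on {0..t}) < \<infinity> \<and>
     Z \<in> L2 M \<and>
     (\<exists>J. (\<forall>n\<in>I. has_wiener_integral M (\<beta> n) t
             (\<lambda>s. sqrt (lam n) *\<^sub>R K_star H t (\<lambda>r. \<phi> r (e n)) s) (J n)) \<and>
        (\<lambda>k. \<integral>\<^sup>+\<omega>. ennreal ((norm (Z \<omega> - (\<Sum>n\<in>I \<inter> {..<k}. J n \<omega>)))\<^sup>2) \<partial>M) \<longlonglongrightarrow> 0)"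


section \<open>The control operator\<close>

definition W_op ::
  "real \<Rightarrow> (real \<Rightarrow> 'x::{banach,second_countable_topology} \<Rightarrow>\<^sub>L 'x) \<Rightarrow>
   ('u::real_normed_vector \<Rightarrow>\<^sub>L 'x) \<Rightarrow> (real \<Rightarrow> 'u) \<Rightarrow> 'x" where
  "W_op T R L u = (\<integral>s. R (T - s) (L (u s)) \<partial>lebesgue_on {0..T})"

definition ker_W ::
  "real \<Rightarrow> (real \<Rightarrow> 'x::{banach,second_countable_topology} \<Rightarrow>\<^sub>L 'x) \<Rightarrow>
   ('u::{real_normed_vector,second_countable_topology} \<Rightarrow>\<^sub>L 'x) \<Rightarrow> (real \<Rightarrow> 'u) set" where
  "ker_W T R L = {u \<in> L2 (lebesgue_on {0..T}). W_op T R L u = 0}"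

definition ker_W_perp ::
  "real \<Rightarrow> (real \<Rightarrow> 'x::{banach,second_countable_topology} \<Rightarrow>\<^sub>L 'x) \<Rightarrow>
   ('u::{real_inner,second_countable_topology} \<Rightarrow>\<^sub>L 'x) \<Rightarrow> (real \<Rightarrow> 'u) set" where
  "ker_W_perp T R L = {u \<in> L2 (lebesgue_on {0..T}).
     \<forall>v\<in>ker_W T R L. L2_inner (lebesgue_on {0..T}) u v = 0}"

definition inverse_of_W ::
  "real \<Rightarrow> (real \<Rightarrow> 'x::{banach,second_countable_topology} \<Rightarrow>\<^sub>L 'x) \<Rightarrow>
   ('u::{real_inner,second_countable_topology} \<Rightarrow>\<^sub>L 'x) \<Rightarrow> ('x \<Rightarrow> real \<Rightarrow> 'u) \<Rightarrow> bool" where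
  "inverse_of_W T R L Winv \<longleftrightarrow>
     (\<forall>x. Winv x \<in> ker_W_perp T R L \<and> W_op T R L (Winv x) = x) \<and>
     (\<forall>u\<in>ker_W_perp T R L. AE s in lebesgue_on {0..T}. Winv (W_op T R L u) s = u s)"

text \<open>A random element of the separable space \<open>L2([0,T],U)\<close>, given by a jointly measurable
  representative. No adaptedness is required.\<close>

definition stochastic_control ::
  "'w measure \<Rightarrow> real \<Rightarrow> (real \<Rightarrow> 'w \<Rightarrow> 'u::{real_normed_vector,second_countable_topology}) \<Rightarrow> bool" where
  "stochastic_control M T u \<longleftrightarrow> measurable_process M {0..T} u \<and>
     (\<forall>\<omega>\<in>space M. (\<lambda>t. u t \<omega>) \<in> L2 (lebesgue_on {0..T}))"


section \<open>Mild solutions\<close>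

text \<open>The condition \<open>x t = \<phi> t\<close> is an equality in \<open>L2(\<Omega>,X)\<close>. The process \<open>x\<close> is taken to be jointly
  measurable (every mean-square continuous process has such a version), which gives the pathwise
  \<open>ds\<close>-integral its meaning; that this integral and the stochastic integral exist is part of
  the definition.\<close>

definition mild_solution ::
  "'w measure \<Rightarrow> real \<Rightarrow> real \<Rightarrow> real \<Rightarrow> nat set \<Rightarrow> (nat \<Rightarrow> real) \<Rightarrow> (nat \<Rightarrow> 'y) \<Rightarrow>
   (nat \<Rightarrow> real \<Rightarrow> 'w \<Rightarrow> real) \<Rightarrow>
   (real \<Rightarrow> 'x::{banach,second_countable_topology} \<Rightarrow>\<^sub>L 'x) \<Rightarrow>
   ('u::real_normed_vector \<Rightarrow>\<^sub>L 'x) \<Rightarrow> (real \<Rightarrow> 'x \<Rightarrow> 'x) \<Rightarrow> (real \<Rightarrow> 'x \<Rightarrow> 'x) \<Rightarrow>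
   (real \<Rightarrow> 'y::real_normed_vector \<Rightarrow>\<^sub>L 'x) \<Rightarrow> (real \<Rightarrow> real) \<Rightarrow> (real \<Rightarrow> real) \<Rightarrow>
   (real \<Rightarrow> 'w \<Rightarrow> 'x) \<Rightarrow> (real \<Rightarrow> 'w \<Rightarrow> 'u) \<Rightarrow> (real \<Rightarrow> 'w \<Rightarrow> 'x) \<Rightarrow> bool" where
  "mild_solution M \<tau> T H I lam e \<beta> R L f g \<sigma> r \<rho> \<phi> u x \<longleftrightarrow>
     x \<in> C_L2 M {-\<tau>..T} \<and> measurable_process M {-\<tau>..T} x \<and>
     (\<forall>t\<in>{-\<tau>..0}. AE \<omega> in M. x t \<omega> = \<phi> t \<omega>) \<and>
     (\<forall>t\<in>{0..T}.
        (AE \<omega> in M. integrable (lebesgue_on {0..t})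
           (\<lambda>s. R (t - s) (L (u s \<omega>) + f s (x (s - \<rho> s) \<omega>)))) \<and>
        (\<exists>Z. has_fbm_integral M H I lam e \<beta> t (\<lambda>s. R (t - s) o\<^sub>L \<sigma> s) Z \<and>
           (AE \<omega> in M. x t \<omega> = R t (\<phi> 0 \<omega> + g 0 (\<phi> (- r 0) \<omega>)) - g t (x (t - r t) \<omega>)
              + (\<integral>s. R (t - s) (L (u s \<omega>) + f s (x (s - \<rho> s) \<omega>)) \<partial>lebesgue_on {0..t})
              + Z \<omega>)))"

end

(*
  The stochastic convolution of R and sigma is a mean-square continuous process: the derivative of
  K_H is singular of order H - 3/2 on the diagonal, which is compensated by the increments of
  s |-> R (t - s) (sigma s e_n), by Hoelder continuity of sigma with exponent > 1/2 - H and by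
  Lipschitz continuity of R(.)y for y in D(A). The Wiener isometry then transfers convergence in
  L2([0,t]) to convergence in L2(Omega).

  For a process x let u_x be Winv applied, path by path, to the vector which the control has to
  contribute in order that the right-hand side Phi_u(x) of the mild equation ends in x1. By
  Cauchy-Schwarz for four terms the smallness condition makes x |-> Phi_{u_x}(x) a contraction in
  the uniform mean-square norm; its fixed point is a mild solution for the control u = u_x and ends
  in x1. With this control kept fixed, Phi_u is again a contraction, so every mild solution for u
  agrees with the fixed point.
*)

theory Submission
  imports Defs
begin

text \<open>Processes are functions, and the mild equation determines them only up to null sets,
  while the \<open>ds\<close>-integral and the control need jointly measurable representatives.
  Hence the fixed point is sought for a relation between processes, and every image or limit is
  replaced by a measurable version before it is used again. The contraction runs on all of
  \<open>{-\<tau>..T}\<close> at once: the control at an early time depends on \<open>x\<close> up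
  to time \<open>T\<close>, so short subintervals are of no help. Its constant has four terms, that
  of \<open>g\<close>, that of \<open>f\<close>, and both once more after passing through
  \<open>Winv\<close>, \<open>L\<close> and the convolution; their squares are the four summands of
  the smallness condition. Square integrability of \<open>K_H H t\<close> and its dependence on
  \<open>t\<close> are not computed but read off, by the isometry, from the assumed representation
  of fractional Brownian motion. In the singular integral the weight of exponent
  \<open>H - 3/2\<close> is split by Cauchy-Schwarz into exponents shifted by
  \<open>\<delta>\<close> up and down; the bound becomes quadratic in the increments and can be
  summed over the basis.\<close>

section \<open>Square-integrable functions: norm, inner product, completeness\<close>

lemma nn_integral_L2_norm:
  assumes "f \<in> L2 M"
  shows "(\<integral>\<^sup>+x. ennreal ((norm (f x))\<^sup>2) \<partial>M) = ennreal ((L2_norm M f)\<^sup>2)"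
  using assms unfolding L2_def L2_norm_def
  by (subst nn_integral_eq_integral) (auto simp: integral_nonneg_AE)

lemma L2_iff:
  "f \<in> L2 M \<longleftrightarrow> f \<in> borel_measurable M \<and> (\<integral>\<^sup>+x. ennreal ((norm (f x))\<^sup>2) \<partial>M) < \<infinity>"
  unfolding L2_def integrable_iff_bounded by auto

lemma L2_measurable [measurable_dest]: "f \<in> L2 M \<Longrightarrow> f \<in> borel_measurable M"
  by (simp add: L2_def)

lemma L2_integrable_sq: "f \<in> L2 M \<Longrightarrow> integrable M (\<lambda>x. (norm (f x))\<^sup>2)"
  by (simp add: L2_def)

lemma L2_norm_nonneg [simp]: "0 \<le> L2_norm M f"
  by (simp add: L2_norm_def integral_nonneg_AE)

lemma L2_norm_power2: "(L2_norm M f)\<^sup>2 = (\<integral>x. (norm (f x))\<^sup>2 \<partial>M)"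
  by (simp add: L2_norm_def integral_nonneg_AE)

text \<open>Serves the clauses of \<open>has_wiener_integral\<close>, which bound upper integrals of
  squared errors.\<close>

lemma L2_norm_leI:
  assumes "(\<integral>\<^sup>+x. ennreal ((norm (f x))\<^sup>2) \<partial>M) \<le> ennreal (B\<^sup>2)" "0 \<le> B"
  shows "L2_norm M f \<le> B"
proof -
  have "(\<integral>x. (norm (f x))\<^sup>2 \<partial>M) \<le> B\<^sup>2"
  proof (cases "integrable M (\<lambda>x. (norm (f x))\<^sup>2)")
    case True
    have "ennreal (\<integral>x. (norm (f x))\<^sup>2 \<partial>M) \<le> ennreal (B\<^sup>2)"
      using assms(1) nn_integral_eq_integral[OF True] by simp
    then show ?thesis by (simp add: ennreal_le_iff)
  next
    \<comment> \<open>The Bochner integral has its default value 0 here, which is below any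
      square.\<close>
    case False
    then show ?thesis by (simp add: not_integrable_integral_eq)
  qed
  then show ?thesis
    unfolding L2_norm_def using assms(2) by (simp add: real_le_lsqrt)
qed

lemma L2_le_nn:
  assumes "f \<in> borel_measurable M" "(\<integral>\<^sup>+x. ennreal ((norm (f x))\<^sup>2) \<partial>M) \<le> ennreal (B\<^sup>2)" "0 \<le> B"
  shows "f \<in> L2 M" "L2_norm M f \<le> B"
  using assms le_less_trans[OF assms(2)] L2_norm_leI[OF assms(2,3)] by (auto simp: L2_iff)

text \<open>The two functions may take values in different spaces: later, real majorants such as
  \<open>K_H H t\<close> and \<open>\<Gamma>\<close> dominate functions with values in
  \<open>'x\<close>.\<close>

lemma L2_bound:
  assumes "f \<in> L2 M" "g \<in> borel_measurable M" "AE x in M. norm (g x) \<le> C * norm (f x)" "0 \<le> C"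
  shows "g \<in> L2 M" "L2_norm M g \<le> C * L2_norm M f"
proof -
  have "(\<integral>\<^sup>+x. ennreal ((norm (g x))\<^sup>2) \<partial>M) \<le> (\<integral>\<^sup>+x. ennreal (C\<^sup>2) * ennreal ((norm (f x))\<^sup>2) \<partial>M)"
  proof (rule nn_integral_mono_AE)
    show "AE x in M. ennreal ((norm (g x))\<^sup>2) \<le> ennreal (C\<^sup>2) * ennreal ((norm (f x))\<^sup>2)"
      using assms(3) by eventually_elim
        (simp add: ennreal_mult[symmetric] power_mult_distrib[symmetric] assms(4) power_mono)
  qed
  also have "\<dots> = ennreal ((C * L2_norm M f)\<^sup>2)"
    using assms(1,4) by (subst nn_integral_cmult)
      (auto simp: nn_integral_L2_norm power_mult_distrib ennreal_mult dest: L2_measurable)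
  finally show "g \<in> L2 M" "L2_norm M g \<le> C * L2_norm M f"
    using L2_le_nn[OF assms(2), of "C * L2_norm M f"] assms(4) by auto
qed

lemma L2_cong_AE:
  assumes "f \<in> L2 M" "g \<in> borel_measurable M" "AE x in M. g x = f x"
  shows "g \<in> L2 M" "L2_norm M g = L2_norm M f"
proof -
  have "AE x in M. norm (g x) \<le> 1 * norm (f x)" using assms(3) by eventually_elim simp
  then show g: "g \<in> L2 M" using L2_bound[OF assms(1,2), of 1] by auto
  show "L2_norm M g = L2_norm M f"
    unfolding L2_norm_def using assms g
    by (intro arg_cong[where f = sqrt] integral_cong_AE) (auto dest: L2_measurable)
qed

lemma L2_norm_cong:
  "(\<And>x. x \<in> space M \<Longrightarrow> norm (f x) = norm (g x)) \<Longrightarrow> L2_norm M f = L2_norm M g"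
  unfolding L2_norm_def by (intro arg_cong[where f = sqrt] Bochner_Integration.integral_cong) auto

lemma L2_norm_cong_AE:
  assumes "f \<in> borel_measurable M" "g \<in> borel_measurable M" "AE x in M. norm (f x) = norm (g x)"
  shows "L2_norm M f = L2_norm M g"
  unfolding L2_norm_def using assms(1,2)
  by (intro arg_cong[where f = sqrt] integral_cong_AE) (use assms(3) in auto)

lemma L2_0 [simp]: "(\<lambda>x. 0) \<in> L2 M" and L2_norm_0 [simp]: "L2_norm M (\<lambda>x. 0) = 0"
  by (auto simp: L2_def L2_norm_def)

lemma norm_add_sq_le: "(norm (a + b :: 'a::real_normed_vector))\<^sup>2 \<le> 2 * (norm a)\<^sup>2 + 2 * (norm b)\<^sup>2"
proof -
  have "(norm (a + b))\<^sup>2 \<le> (norm a + norm b)\<^sup>2" by (intro power_mono norm_triangle_ineq) auto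
  also have "\<dots> \<le> 2 * (norm a)\<^sup>2 + 2 * (norm b)\<^sup>2"
    using sum_squares_ge_zero[of "norm a - norm b" 0] by (simp add: power2_eq_square algebra_simps)
  finally show ?thesis .
qed

lemma L2_add:
  assumes "f \<in> L2 M" "g \<in> L2 M"
  shows "(\<lambda>x. f x + g x) \<in> L2 M"
proof -
  have [measurable]: "f \<in> borel_measurable M" "g \<in> borel_measurable M" using assms by (auto dest: L2_measurable)
  have "integrable M (\<lambda>x. 2 * (norm (f x))\<^sup>2 + 2 * (norm (g x))\<^sup>2)"
    using assms by (auto simp: L2_def)
  then have "integrable M (\<lambda>x. (norm (f x + g x))\<^sup>2)"
    by (rule Bochner_Integration.integrable_bound) (auto simp: norm_add_sq_le)
  then show ?thesis by (auto simp: L2_def)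
qed

lemma L2_scaleR:
  assumes "f \<in> L2 M" shows "(\<lambda>x. a *\<^sub>R f x) \<in> L2 M"
  using L2_bound(1)[OF assms, of "\<lambda>x. a *\<^sub>R f x" "\<bar>a\<bar>"] assms by (auto dest: L2_measurable)

lemma L2_norm_scaleR: "L2_norm M (\<lambda>x. a *\<^sub>R f x) = \<bar>a\<bar> * L2_norm M f"
  by (simp add: L2_norm_def power_mult_distrib real_sqrt_mult)

lemma L2_minus: "f \<in> L2 M \<Longrightarrow> (\<lambda>x. - f x) \<in> L2 M"
  using L2_scaleR[of f M "-1"] by simp

lemma L2_diff: "f \<in> L2 M \<Longrightarrow> g \<in> L2 M \<Longrightarrow> (\<lambda>x. f x - g x) \<in> L2 M"
  using L2_add[OF _ L2_minus, of f M g] by simp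

lemma L2_sum: "(\<And>i. i \<in> F \<Longrightarrow> f i \<in> L2 M) \<Longrightarrow> (\<lambda>x. \<Sum>i\<in>F. f i x) \<in> L2 M"
  by (induction F rule: infinite_finite_induct) (auto intro: L2_add)

lemma L2_integrable_mult:
  assumes "f \<in> L2 M" "g \<in> L2 M"
  shows "integrable M (\<lambda>x. norm (f x) * norm (g x))"
proof -
  have [measurable]: "f \<in> borel_measurable M" "g \<in> borel_measurable M" using assms by (auto dest: L2_measurable)
  have "integrable M (\<lambda>x. (norm (f x))\<^sup>2 + (norm (g x))\<^sup>2)" using assms by (auto simp: L2_def)
  moreover have "norm (f x) * norm (g x) \<le> (norm (f x))\<^sup>2 + (norm (g x))\<^sup>2" for x
  proof -
    have "2 * (norm (f x) * norm (g x)) \<le> (norm (f x))\<^sup>2 + (norm (g x))\<^sup>2"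
      using sum_squares_bound[of "norm (f x)" "norm (g x)"] by simp
    moreover have "0 \<le> norm (f x) * norm (g x)" by simp
    ultimately show ?thesis by linarith
  qed
  ultimately show ?thesis
    using Bochner_Integration.integrable_bound[of M "\<lambda>x. (norm (f x))\<^sup>2 + (norm (g x))\<^sup>2" "\<lambda>x. norm (f x) * norm (g x)"]
    by simp
qed

lemma L2_Cauchy_Schwarz:
  assumes "f \<in> L2 M" "g \<in> L2 M"
  shows "(\<integral>x. norm (f x) * norm (g x) \<partial>M) \<le> L2_norm M f * L2_norm M g"
proof -
  have [measurable]: "f \<in> borel_measurable M" "g \<in> borel_measurable M" using assms by (auto dest: L2_measurable)
  have "ennreal ((\<integral>x. norm (f x) * norm (g x) \<partial>M)\<^sup>2) = (\<integral>\<^sup>+x. ennreal (norm (f x)) * ennreal (norm (g x)) \<partial>M)\<^sup>2"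
    using nn_integral_eq_integral[OF L2_integrable_mult[OF assms]]
    by (simp add: ennreal_mult ennreal_power integral_nonneg_AE)
  also have "\<dots> \<le> (\<integral>\<^sup>+x. (ennreal (norm (f x)))\<^sup>2 \<partial>M) * (\<integral>\<^sup>+x. (ennreal (norm (g x)))\<^sup>2 \<partial>M)"
    by (rule Cauchy_Schwarz_nn_integral) auto
  also have "\<dots> = ennreal ((L2_norm M f * L2_norm M g)\<^sup>2)"
    using nn_integral_L2_norm[OF assms(1)] nn_integral_L2_norm[OF assms(2)]
    by (simp add: ennreal_power ennreal_mult power_mult_distrib)
  finally have "(\<integral>x. norm (f x) * norm (g x) \<partial>M)\<^sup>2 \<le> (L2_norm M f * L2_norm M g)\<^sup>2"
    by (simp add: ennreal_le_iff)
  then show ?thesis by (rule power2_le_imp_le) simp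
qed

lemma L2_norm_triangle:
  assumes "f \<in> L2 M" "g \<in> L2 M"
  shows "L2_norm M (\<lambda>x. f x + g x) \<le> L2_norm M f + L2_norm M g"
proof -
  have "(\<integral>x. (norm (f x + g x))\<^sup>2 \<partial>M) \<le>
    (\<integral>x. (norm (f x))\<^sup>2 + (2 * (norm (f x) * norm (g x)) + (norm (g x))\<^sup>2) \<partial>M)"
  proof (rule integral_mono)
    show "integrable M (\<lambda>x. (norm (f x + g x))\<^sup>2)" using L2_add[OF assms] by (simp add: L2_def)
    show "integrable M (\<lambda>x. (norm (f x))\<^sup>2 + (2 * (norm (f x) * norm (g x)) + (norm (g x))\<^sup>2))"
      using L2_integrable_mult[OF assms] assms by (auto simp: L2_def)
    fix x
    have "(norm (f x + g x))\<^sup>2 \<le> (norm (f x) + norm (g x))\<^sup>2" by (intro power_mono norm_triangle_ineq) auto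
    then show "(norm (f x + g x))\<^sup>2 \<le> (norm (f x))\<^sup>2 + (2 * (norm (f x) * norm (g x)) + (norm (g x))\<^sup>2)"
      by (simp add: power2_eq_square algebra_simps)
  qed
  also have "\<dots> = (L2_norm M f)\<^sup>2 + (2 * (\<integral>x. norm (f x) * norm (g x) \<partial>M) + (L2_norm M g)\<^sup>2)"
    using L2_integrable_mult[OF assms] assms by (simp add: L2_norm_power2 L2_def)
  also have "\<dots> \<le> (L2_norm M f + L2_norm M g)\<^sup>2"
    using L2_Cauchy_Schwarz[OF assms] by (simp add: power2_eq_square algebra_simps)
  finally show ?thesis
    unfolding L2_norm_def[of M "\<lambda>x. f x + g x"] by (intro real_le_lsqrt) (auto simp: integral_nonneg_AE)
qed

lemma L2_norm_minus_commute: "L2_norm M (\<lambda>x. f x - g x) = L2_norm M (\<lambda>x. g x - f x)"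
  by (intro L2_norm_cong) (simp add: norm_minus_commute)

lemma L2_norm_triangle_diff:
  assumes "f \<in> L2 M" "g \<in> L2 M"
  shows "L2_norm M (\<lambda>x. f x - g x) \<le> L2_norm M f + L2_norm M g"
  using L2_norm_triangle[OF assms(1) L2_minus[OF assms(2)]] L2_norm_scaleR[of M "-1" g] by simp

lemma L2_norm_dist_triangle:
  assumes "f \<in> L2 M" "g \<in> L2 M" "h \<in> L2 M"
  shows "L2_norm M (\<lambda>x. f x - h x) \<le> L2_norm M (\<lambda>x. f x - g x) + L2_norm M (\<lambda>x. g x - h x)"
  using L2_norm_triangle[OF L2_diff[OF assms(1,2)] L2_diff[OF assms(2,3)]] by simp

lemma L2_norm_diff_abs:
  assumes "f \<in> L2 M" "g \<in> L2 M"
  shows "\<bar>L2_norm M f - L2_norm M g\<bar> \<le> L2_norm M (\<lambda>x. f x - g x)"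
  using L2_norm_triangle[OF L2_diff[OF assms] assms(2)] L2_norm_triangle[OF L2_diff[OF assms(2,1)] assms(1)]
    L2_norm_minus_commute[of M f g] by simp

lemma L2_norm_eq_0_AE:
  assumes "f \<in> L2 M" "L2_norm M f = 0"
  shows "AE x in M. f x = 0"
proof -
  have "(\<integral>x. (norm (f x))\<^sup>2 \<partial>M) = 0" using assms(2) L2_norm_power2[of M f] by simp
  then have "AE x in M. (norm (f x))\<^sup>2 = 0"
    using integral_nonneg_eq_0_iff_AE[of M "\<lambda>x. (norm (f x))\<^sup>2"] assms(1) by (auto simp: L2_def)
  then show ?thesis by simp
qed

lemma L2_inner_integrable:
  fixes f g :: "'a \<Rightarrow> 'b::{real_inner, second_countable_topology}"
  assumes "f \<in> L2 M" "g \<in> L2 M"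
  shows "integrable M (\<lambda>x. f x \<bullet> g x)"
proof -
  have [measurable]: "f \<in> borel_measurable M" "g \<in> borel_measurable M" using assms by (auto dest: L2_measurable)
  show ?thesis
    by (rule Bochner_Integration.integrable_bound[OF L2_integrable_mult[OF assms]])
      (auto simp: Cauchy_Schwarz_ineq2)
qed

lemma L2_inner_bound:
  fixes f g :: "'a \<Rightarrow> 'b::{real_inner, second_countable_topology}"
  assumes "f \<in> L2 M" "g \<in> L2 M"
  shows "\<bar>L2_inner M f g\<bar> \<le> L2_norm M f * L2_norm M g"
proof -
  have "\<bar>L2_inner M f g\<bar> \<le> (\<integral>x. \<bar>f x \<bullet> g x\<bar> \<partial>M)" unfolding L2_inner_def by (rule integral_abs_bound)
  also have "\<dots> \<le> (\<integral>x. norm (f x) * norm (g x) \<partial>M)"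
    by (intro integral_mono integrable_abs L2_inner_integrable L2_integrable_mult assms Cauchy_Schwarz_ineq2)
  finally show ?thesis using L2_Cauchy_Schwarz[OF assms] by simp
qed

lemma L2_inner_self:
  fixes f :: "'a \<Rightarrow> 'b::real_inner"
  shows "L2_inner M f f = (L2_norm M f)\<^sup>2"
  unfolding L2_norm_power2 L2_inner_def by (simp add: power2_norm_eq_inner)

lemma L2_inner_diff_left:
  fixes f g h :: "'a \<Rightarrow> 'b::{real_inner, second_countable_topology}"
  assumes "f \<in> L2 M" "g \<in> L2 M" "h \<in> L2 M"
  shows "L2_inner M (\<lambda>x. f x - g x) h = L2_inner M f h - L2_inner M g h"
  unfolding L2_inner_def using assms
  by (simp add: inner_diff_left Bochner_Integration.integral_diff L2_inner_integrable)

lemma L2_inner_commute: "L2_inner M f g = L2_inner M g f"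
  unfolding L2_inner_def by (simp add: inner_commute)

lemma L2_inner_diff_right:
  fixes f g h :: "'a \<Rightarrow> 'b::{real_inner, second_countable_topology}"
  assumes "f \<in> L2 M" "g \<in> L2 M" "h \<in> L2 M"
  shows "L2_inner M h (\<lambda>x. f x - g x) = L2_inner M h f - L2_inner M h g"
  using L2_inner_diff_left[OF assms] by (simp add: L2_inner_commute)

lemma L2_inner_sum_left:
  fixes f :: "'i \<Rightarrow> 'a \<Rightarrow> 'b::{real_inner, second_countable_topology}"
  assumes "\<And>i. i \<in> F \<Longrightarrow> f i \<in> L2 M" "h \<in> L2 M"
  shows "L2_inner M (\<lambda>x. \<Sum>i\<in>F. f i x) h = (\<Sum>i\<in>F. L2_inner M (f i) h)"
  unfolding L2_inner_def using assms
  by (simp add: inner_sum_left Bochner_Integration.integral_sum L2_inner_integrable)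

text \<open>Pythagoras. It is applied to partial sums of integrals driven by independent Brownian
  motions, which turns their norms into partial sums of a numerical series.\<close>

lemma L2_norm_sum_orthogonal:
  fixes f :: "'i \<Rightarrow> 'a \<Rightarrow> 'b::{real_inner, second_countable_topology}"
  assumes "finite F" "\<And>i. i \<in> F \<Longrightarrow> f i \<in> L2 M"
    "\<And>i j. i \<in> F \<Longrightarrow> j \<in> F \<Longrightarrow> i \<noteq> j \<Longrightarrow> L2_inner M (f i) (f j) = 0"
  shows "(L2_norm M (\<lambda>x. \<Sum>i\<in>F. f i x))\<^sup>2 = (\<Sum>i\<in>F. (L2_norm M (f i))\<^sup>2)"
proof -
  have "(L2_norm M (\<lambda>x. \<Sum>i\<in>F. f i x))\<^sup>2 = (\<Sum>i\<in>F. L2_inner M (f i) (\<lambda>x. \<Sum>j\<in>F. f j x))"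
    unfolding L2_inner_self[symmetric] using assms by (intro L2_inner_sum_left L2_sum) auto
  also have "\<dots> = (\<Sum>i\<in>F. \<Sum>j\<in>F. L2_inner M (f j) (f i))"
    using assms by (intro sum.cong refl) (subst L2_inner_commute, auto intro!: L2_inner_sum_left)
  also have "\<dots> = (\<Sum>i\<in>F. (L2_norm M (f i))\<^sup>2)"
  proof (intro sum.cong refl)
    fix i assume i: "i \<in> F"
    have "(\<Sum>j\<in>F. L2_inner M (f j) (f i)) = (\<Sum>j\<in>F. if j = i then (L2_norm M (f i))\<^sup>2 else 0)"
      using assms i by (intro sum.cong refl) (auto simp: L2_inner_self)
    then show "(\<Sum>j\<in>F. L2_inner M (f j) (f i)) = (L2_norm M (f i))\<^sup>2" using assms(1) i by simp
  qed
  finally show ?thesis .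
qed

text \<open>By Fatou's lemma, balls of \<open>L2\<close> are closed under almost everywhere
  convergence. This converts an almost sure limit into a limit in norm without a second extraction
  of subsequences.\<close>

lemma L2_Fatou:
  fixes Y :: "nat \<Rightarrow> 'a \<Rightarrow> 'b::{real_normed_vector, second_countable_topology}"
  assumes "\<And>k. k \<ge> k0 \<Longrightarrow> Y k \<in> L2 M" "\<And>k. k \<ge> k0 \<Longrightarrow> L2_norm M (Y k) \<le> B"
    "AE x in M. (\<lambda>k. Y k x) \<longlonglongrightarrow> Z x" "Z \<in> borel_measurable M"
  shows "Z \<in> L2 M" "L2_norm M Z \<le> B"
proof -
  have B: "0 \<le> B" using assms(2)[of k0] L2_norm_nonneg[of M "Y k0"] by linarith
  have "(\<integral>\<^sup>+x. ennreal ((norm (Z x))\<^sup>2) \<partial>M) = (\<integral>\<^sup>+x. liminf (\<lambda>k. ennreal ((norm (Y (k + k0) x))\<^sup>2)) \<partial>M)"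
  proof (rule nn_integral_cong_AE)
    show "AE x in M. ennreal ((norm (Z x))\<^sup>2) = liminf (\<lambda>k. ennreal ((norm (Y (k + k0) x))\<^sup>2))"
      using assms(3)
    proof eventually_elim
      case (elim x)
      have "(\<lambda>k. ennreal ((norm (Y (k + k0) x))\<^sup>2)) \<longlonglongrightarrow> ennreal ((norm (Z x))\<^sup>2)"
        using LIMSEQ_ignore_initial_segment[OF elim, of k0] by (intro tendsto_intros)
      then show ?case using lim_imp_Liminf[of sequentially] by fastforce
    qed
  qed
  also have "\<dots> \<le> liminf (\<lambda>k. \<integral>\<^sup>+x. ennreal ((norm (Y (k + k0) x))\<^sup>2) \<partial>M)"
  proof (rule nn_integral_liminf)
    fix k show "(\<lambda>x. ennreal ((norm (Y (k + k0) x))\<^sup>2)) \<in> borel_measurable M"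
      using L2_measurable[OF assms(1)[of "k + k0"]] by auto
  qed
  also have "\<dots> \<le> ennreal (B\<^sup>2)"
  proof -
    have "(\<integral>\<^sup>+x. ennreal ((norm (Y (k + k0) x))\<^sup>2) \<partial>M) \<le> ennreal (B\<^sup>2)" for k
      using nn_integral_L2_norm[OF assms(1)[of "k + k0"]] assms(2)[of "k + k0"] B
      by (auto simp: ennreal_le_iff intro!: power_mono)
    then have "liminf (\<lambda>k. \<integral>\<^sup>+x. ennreal ((norm (Y (k + k0) x))\<^sup>2) \<partial>M) \<le> liminf (\<lambda>k::nat. ennreal (B\<^sup>2))"
      by (intro Liminf_mono) auto
    then show ?thesis by (simp add: Liminf_const)
  qed
  finally show "Z \<in> L2 M" "L2_norm M Z \<le> B"
    using L2_le_nn[OF assms(4) _ B] by auto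
qed

context
  fixes M :: "'a measure" and X :: "nat \<Rightarrow> 'a \<Rightarrow> 'b::{banach, second_countable_topology}"
  assumes fin: "finite_measure M" and X: "\<And>k. X k \<in> L2 M"
    and step: "\<And>k. L2_norm M (\<lambda>x. X (Suc k) x - X k x) \<le> (1/2) ^ k"
begin

text \<open>Steps of size (1/2)^k have a finite sum in mean, so the telescoping series converges
  absolutely at almost every point. The full sequence converges, with no subsequence depending on
  the data; this allows one sequence to be used for all times or all paths simultaneously, and its
  pointwise \<open>lim\<close> is then jointly measurable.\<close>

lemma L2_geometric_convergent: "AE x in M. convergent (\<lambda>k. X k x)"
proof -
  interpret finite_measure M by (rule fin)
  have [measurable]: "X k \<in> borel_measurable M" for k using X by (auto dest: L2_measurable)
  let ?c = "L2_norm M (\<lambda>x. 1 :: real)"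
  \<comment> \<open>The measure is finite, so Cauchy-Schwarz against the constant 1 bounds the mean
    by the \<open>L2\<close> norm.\<close>
  have one: "(\<lambda>x. 1 :: real) \<in> L2 M" by (auto simp: L2_def)
  have "(\<integral>\<^sup>+x. (\<Sum>k. ennreal (norm (X (Suc k) x - X k x))) \<partial>M)
      = (\<Sum>k. \<integral>\<^sup>+x. ennreal (norm (X (Suc k) x - X k x)) \<partial>M)"
    by (rule nn_integral_suminf) measurable
  also have "\<dots> \<le> (\<Sum>k. ennreal ((1/2) ^ k * ?c))"
  proof (rule suminf_le)
    fix k
    have d: "(\<lambda>x. X (Suc k) x - X k x) \<in> L2 M" by (intro L2_diff X)
    have "integrable M (\<lambda>x. norm (X (Suc k) x - X k x))"
      using L2_integrable_mult[OF d one] by simp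
    then have "(\<integral>\<^sup>+x. ennreal (norm (X (Suc k) x - X k x)) \<partial>M) = ennreal (\<integral>x. norm (X (Suc k) x - X k x) \<partial>M)"
      by (intro nn_integral_eq_integral) auto
    also have "\<dots> \<le> ennreal ((1/2)^k * ?c)"
      using L2_Cauchy_Schwarz[OF d one] mult_right_mono[OF step[of k], of ?c]
      by (intro ennreal_leI) auto
    finally show "(\<integral>\<^sup>+x. ennreal (norm (X (Suc k) x - X k x)) \<partial>M) \<le> ennreal ((1/2) ^ k * ?c)" .
  qed auto
  also have "\<dots> = ennreal (\<Sum>k. (1/2)^k * ?c)"
    by (rule suminf_ennreal2) (auto intro!: summable_mult2 summable_geometric)
  also have "\<dots> < \<infinity>" by simp
  finally have "AE x in M. (\<Sum>k. ennreal (norm (X (Suc k) x - X k x))) \<noteq> \<infinity>"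
    by (intro nn_integral_noteq_infinite) auto
  then show ?thesis
  proof eventually_elim
    case (elim x)
    have "summable (\<lambda>k. norm (X (Suc k) x - X k x))"
      by (rule summable_suminf_not_top) (use elim in auto)
    then have "summable (\<lambda>k. X (Suc k) x - X k x)" by (rule summable_norm_cancel)
    then have "convergent (\<lambda>n. \<Sum>k<n. X (Suc k) x - X k x)" by (simp add: summable_iff_convergent)
    then have "convergent (\<lambda>n. X n x - X 0 x)" by (simp only: sum_lessThan_telescope[where f = "\<lambda>k. X k x"])
    then obtain l where "(\<lambda>n. X n x - X 0 x) \<longlonglongrightarrow> l" by (auto simp: convergent_def)
    then have "(\<lambda>n. (X n x - X 0 x) + X 0 x) \<longlonglongrightarrow> l + X 0 x" by (intro tendsto_intros)
    then show ?case by (auto simp: convergent_def)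
  qed
qed

text \<open>The subtracted remainder makes the induction close, because each step is exactly
  \<open>2 * (1/2) ^ j - 2 * (1/2) ^ Suc j\<close>.\<close>

lemma L2_geometric_dist: "k \<le> j \<Longrightarrow> L2_norm M (\<lambda>x. X j x - X k x) \<le> 2 * (1/2) ^ k - 2 * (1/2) ^ j"
proof (induction j)
  case (Suc j)
  show ?case
  proof (cases "k = Suc j")
    case False
    then show ?thesis
      using Suc step[of j] L2_norm_dist_triangle[OF X[of "Suc j"] X[of j] X[of k]] by simp
  qed auto
qed auto

text \<open>For fixed \<open>k\<close>, \<open>L2_Fatou\<close> is applied to the differences with
  \<open>X k\<close> as the other index tends to infinity.\<close>

lemma L2_geometric_limit:
  assumes "AE x in M. (\<lambda>k. X k x) \<longlonglongrightarrow> Z x" "Z \<in> borel_measurable M"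
  shows "Z \<in> L2 M" "L2_norm M (\<lambda>x. X k x - Z x) \<le> 2 * (1/2) ^ k"
proof -
  have *: "(\<lambda>x. Z x - X k x) \<in> L2 M" "L2_norm M (\<lambda>x. Z x - X k x) \<le> 2 * (1/2) ^ k" for k
  proof (atomize(full), intro conjI)
    have 1: "(\<lambda>x. X j x - X k x) \<in> L2 M" for j by (intro L2_diff X)
    have 2: "L2_norm M (\<lambda>x. X j x - X k x) \<le> 2 * (1/2) ^ k" if "j \<ge> k" for j
      using L2_geometric_dist[OF that] zero_le_power[of "1/2::real" j] by linarith
    have 3: "AE x in M. (\<lambda>j. X j x - X k x) \<longlonglongrightarrow> Z x - X k x"
      using assms(1) by eventually_elim (intro tendsto_intros)
    have 4: "(\<lambda>x. Z x - X k x) \<in> borel_measurable M"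
      using assms(2) L2_measurable[OF X] by auto
    show "(\<lambda>x. Z x - X k x) \<in> L2 M" "L2_norm M (\<lambda>x. Z x - X k x) \<le> 2 * (1/2) ^ k"
      using L2_Fatou[OF 1 2 3 4] by auto
  qed
  then show "Z \<in> L2 M" using L2_add[OF *(1)[of 0] X[of 0]] by simp
  show "L2_norm M (\<lambda>x. X k x - Z x) \<le> 2 * (1/2) ^ k"
    using *(2)[of k] by (simp add: L2_norm_minus_commute)
qed

end

lemma L2_complete:
  fixes X :: "nat \<Rightarrow> 'a \<Rightarrow> 'b::{banach, second_countable_topology}"
  assumes "finite_measure M" and X: "\<And>k. X k \<in> L2 M"
    and cauchy: "\<And>\<epsilon>. 0 < \<epsilon> \<Longrightarrow> \<exists>N. \<forall>m\<ge>N. \<forall>n\<ge>N. L2_norm M (\<lambda>x. X m x - X n x) < \<epsilon>"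
  obtains Z where "Z \<in> L2 M" "(\<lambda>k. L2_norm M (\<lambda>x. X k x - Z x)) \<longlonglongrightarrow> 0"
proof -
  have "\<forall>k. \<exists>N. \<forall>m\<ge>N. \<forall>n\<ge>N. L2_norm M (\<lambda>x. X m x - X n x) < (1/2) ^ k"
    using cauchy by auto
  then obtain N0 where N0: "\<And>k m n. m \<ge> N0 k \<Longrightarrow> n \<ge> N0 k \<Longrightarrow> L2_norm M (\<lambda>x. X m x - X n x) < (1/2::real) ^ k"
    by metis
  \<comment> \<open>Summing the thresholds makes them monotone while keeping each of them above
    \<open>N0 k\<close>.\<close>
  define N where "N k = (\<Sum>i\<le>k. N0 i)" for k
  have N: "N0 k \<le> N k" "N k \<le> N (Suc k)" for k
    by (auto simp: N_def intro: member_le_sum)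
  define Y where "Y k = X (N k)" for k
  have Y: "Y k \<in> L2 M" for k by (simp add: Y_def X)
  have st: "L2_norm M (\<lambda>x. Y (Suc k) x - Y k x) \<le> (1/2) ^ k" for k
    unfolding Y_def using N0[of k "N (Suc k)" "N k"] N[of k] by auto
  define Z where "Z x = lim (\<lambda>k. Y k x)" for x
  have [measurable]: "Y k \<in> borel_measurable M" for k using Y by (auto dest: L2_measurable)
  have Zm: "Z \<in> borel_measurable M" unfolding Z_def by measurable
  have lim: "AE x in M. (\<lambda>k. Y k x) \<longlonglongrightarrow> Z x"
    using L2_geometric_convergent[OF assms(1) Y st] unfolding Z_def
    by eventually_elim (simp add: convergent_LIMSEQ_iff)
  note L = L2_geometric_limit[OF assms(1) Y st lim Zm]
  have "(\<lambda>k. L2_norm M (\<lambda>x. X k x - Z x)) \<longlonglongrightarrow> 0"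
  proof (rule LIMSEQ_I)
    fix \<epsilon> :: real assume "0 < \<epsilon>"
    \<comment> \<open>One unit of (1/2)^k pays for the distance to the subsequence, two for the
      distance of the subsequence to its limit.\<close>
    then obtain k where k: "3 * (1/2) ^ k < \<epsilon>"
      using real_arch_pow_inv[of "\<epsilon> / 3" "1/2"] by (auto simp: mult.commute)
    have "norm (L2_norm M (\<lambda>x. X m x - Z x) - 0) < \<epsilon>" if "m \<ge> N k" for m
    proof -
      have "L2_norm M (\<lambda>x. X m x - Z x) \<le> L2_norm M (\<lambda>x. X m x - Y k x) + L2_norm M (\<lambda>x. Y k x - Z x)"
        by (rule L2_norm_dist_triangle[OF X Y L(1)])
      also have "\<dots> \<le> (1/2)^k + 2 * (1/2)^k"
        using L(2)[of k] N0[of k m "N k"] N(1)[of k] that unfolding Y_def by (intro add_mono) auto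
      finally show ?thesis using k by simp
    qed
    then show "\<exists>no. \<forall>n\<ge>no. norm (L2_norm M (\<lambda>x. X n x - Z x) - 0) < \<epsilon>" by blast
  qed
  then show ?thesis using that L(1) by blast
qed

section \<open>Mean-square continuous processes\<close>

text \<open>The limit in the definition excludes \<open>t = s\<close>, but the difference vanishes
  there, so the condition may be written without that exception.\<close>

lemma C_L2_iff:
  "x \<in> C_L2 M S \<longleftrightarrow> (\<forall>t\<in>S. x t \<in> L2 M) \<and>
     (\<forall>s\<in>S. \<forall>\<epsilon>>0. \<exists>\<delta>>0. \<forall>t\<in>S. \<bar>t - s\<bar> < \<delta> \<longrightarrow> L2_norm M (\<lambda>\<omega>. x t \<omega> - x s \<omega>) < \<epsilon>)"
proof -
  have "((\<lambda>t. \<integral>\<omega>. (norm (x t \<omega> - x s \<omega>))\<^sup>2 \<partial>M) \<longlongrightarrow> 0) (at s within S) \<longleftrightarrow>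
     (\<forall>\<epsilon>>0. \<exists>\<delta>>0. \<forall>t\<in>S. \<bar>t - s\<bar> < \<delta> \<longrightarrow> L2_norm M (\<lambda>\<omega>. x t \<omega> - x s \<omega>) < \<epsilon>)" (is "?l \<longleftrightarrow> ?r") for s
  proof -
    let ?g = "\<lambda>t. L2_norm M (\<lambda>\<omega>. x t \<omega> - x s \<omega>)"
    have "?l \<longleftrightarrow> ((\<lambda>t. (?g t)\<^sup>2) \<longlongrightarrow> 0) (at s within S)"
      by (simp only: L2_norm_power2)
    also have "\<dots> \<longleftrightarrow> (?g \<longlongrightarrow> 0) (at s within S)"
    proof
      assume "((\<lambda>t. (?g t)\<^sup>2) \<longlongrightarrow> 0) (at s within S)"
      then have "((\<lambda>t. sqrt ((?g t)\<^sup>2)) \<longlongrightarrow> sqrt 0) (at s within S)" by (rule tendsto_real_sqrt)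
      then show "(?g \<longlongrightarrow> 0) (at s within S)" by simp
    next
      assume "(?g \<longlongrightarrow> 0) (at s within S)"
      then have "((\<lambda>t. (?g t)\<^sup>2) \<longlongrightarrow> 0\<^sup>2) (at s within S)" by (rule tendsto_power)
      then show "((\<lambda>t. (?g t)\<^sup>2) \<longlongrightarrow> 0) (at s within S)" by simp
    qed
    also have "\<dots> \<longleftrightarrow> ?r"
    proof -
      have "?g s = 0" by simp
      then have "(0 < dist t s \<and> dist t s < \<delta> \<longrightarrow> dist (?g t) 0 < \<epsilon>) \<longleftrightarrow> (\<bar>t - s\<bar> < \<delta> \<longrightarrow> ?g t < \<epsilon>)"
        if "0 < \<epsilon>" for t \<delta> \<epsilon>
        using that by (cases "t = s") (auto simp: dist_real_def)
      then have "(\<forall>\<epsilon>>0. \<exists>\<delta>>0. \<forall>t\<in>S. 0 < dist t s \<and> dist t s < \<delta> \<longrightarrow> dist (?g t) 0 < \<epsilon>) \<longleftrightarrow> ?r"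
        by simp
      then show ?thesis by (simp only: Lim_within)
    qed
    finally show ?thesis .
  qed
  then show ?thesis unfolding C_L2_def by simp
qed

lemma C_L2_cont:
  assumes "x \<in> C_L2 M S" "s \<in> S" "0 < \<epsilon>"
  obtains \<delta> where "0 < \<delta>" "\<And>t. t \<in> S \<Longrightarrow> \<bar>t - s\<bar> < \<delta> \<Longrightarrow> L2_norm M (\<lambda>\<omega>. x t \<omega> - x s \<omega>) < \<epsilon>"
  using assms unfolding C_L2_iff by blast

lemma C_L2_D: "x \<in> C_L2 M S \<Longrightarrow> t \<in> S \<Longrightarrow> x t \<in> L2 M"
  by (simp add: C_L2_def)

lemma C_L2_compose:
  assumes x: "x \<in> C_L2 M S" and h: "continuous_on S' h" "h ` S' \<subseteq> S"
  shows "(\<lambda>t. x (h t)) \<in> C_L2 M S'"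
  unfolding C_L2_iff
proof (intro conjI ballI allI impI)
  fix t assume "t \<in> S'" then show "x (h t) \<in> L2 M" using C_L2_D[OF x] h(2) by auto
next
  fix s and \<epsilon> :: real assume s: "s \<in> S'" "0 < \<epsilon>"
  then obtain \<delta> where d: "0 < \<delta>" "\<And>t. t \<in> S \<Longrightarrow> \<bar>t - h s\<bar> < \<delta> \<Longrightarrow> L2_norm M (\<lambda>\<omega>. x t \<omega> - x (h s) \<omega>) < \<epsilon>"
    using C_L2_cont[OF x _ s(2), of "h s"] h(2) by blast
  obtain \<eta> where "0 < \<eta>" "\<And>t. t \<in> S' \<Longrightarrow> \<bar>t - s\<bar> < \<eta> \<Longrightarrow> \<bar>h t - h s\<bar> < \<delta>"
    using h(1) s(1) d(1) unfolding continuous_on_iff dist_real_def by blast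
  then show "\<exists>\<delta>>0. \<forall>t\<in>S'. \<bar>t - s\<bar> < \<delta> \<longrightarrow> L2_norm M (\<lambda>\<omega>. x (h t) \<omega> - x (h s) \<omega>) < \<epsilon>"
    using d(2) h(2) by (intro exI[of _ \<eta>]) auto
qed

lemma C_L2_modulus:
  assumes x: "x \<in> C_L2 M S" and y: "\<And>t. t \<in> S \<Longrightarrow> y t \<in> L2 M" and C: "0 \<le> C"
    and le: "\<And>t s. t \<in> S \<Longrightarrow> s \<in> S \<Longrightarrow>
      L2_norm M (\<lambda>\<omega>. y t \<omega> - y s \<omega>) \<le> C * L2_norm M (\<lambda>\<omega>. x t \<omega> - x s \<omega>)"
  shows "y \<in> C_L2 M S"
  unfolding C_L2_iff
proof (intro conjI ballI allI impI)
  fix s and \<epsilon> :: real assume s: "s \<in> S" "0 < \<epsilon>"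
  then have "0 < \<epsilon> / (C + 1)" using C by auto
  then obtain \<delta> where d: "0 < \<delta>" "\<And>t. t \<in> S \<Longrightarrow> \<bar>t - s\<bar> < \<delta> \<Longrightarrow> L2_norm M (\<lambda>\<omega>. x t \<omega> - x s \<omega>) < \<epsilon> / (C + 1)"
    by (rule C_L2_cont[OF x s(1)]) blast
  have "L2_norm M (\<lambda>\<omega>. y t \<omega> - y s \<omega>) < \<epsilon>" if t: "t \<in> S" "\<bar>t - s\<bar> < \<delta>" for t
  proof -
    have "L2_norm M (\<lambda>\<omega>. y t \<omega> - y s \<omega>) \<le> (C + 1) * L2_norm M (\<lambda>\<omega>. x t \<omega> - x s \<omega>)"
      using le[OF t(1) s(1)] L2_norm_nonneg[of M "\<lambda>\<omega>. x t \<omega> - x s \<omega>"]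
      unfolding distrib_right by linarith
    also have "\<dots> < \<epsilon>" using d(2)[OF t] C by (simp add: field_simps)
    finally show ?thesis .
  qed
  with d(1) show "\<exists>\<delta>>0. \<forall>t\<in>S. \<bar>t - s\<bar> < \<delta> \<longrightarrow> L2_norm M (\<lambda>\<omega>. y t \<omega> - y s \<omega>) < \<epsilon>" by blast
qed (rule y)

lemma C_L2_add:
  assumes "x \<in> C_L2 M S" "y \<in> C_L2 M S"
  shows "(\<lambda>t \<omega>. x t \<omega> + y t \<omega>) \<in> C_L2 M S"
  unfolding C_L2_iff
proof (intro conjI ballI allI impI)
  fix t assume "t \<in> S" then show "(\<lambda>\<omega>. x t \<omega> + y t \<omega>) \<in> L2 M"
    by (intro L2_add C_L2_D[OF assms(1)] C_L2_D[OF assms(2)])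
next
  fix s and \<epsilon> :: real assume s: "s \<in> S" "0 < \<epsilon>"
  then have "0 < \<epsilon> / 2" by auto
  then obtain \<delta>1 where d1: "0 < \<delta>1" "\<And>t. t \<in> S \<Longrightarrow> \<bar>t - s\<bar> < \<delta>1 \<Longrightarrow> L2_norm M (\<lambda>\<omega>. x t \<omega> - x s \<omega>) < \<epsilon> / 2"
    by (rule C_L2_cont[OF assms(1) s(1)]) blast
  obtain \<delta>2 where d2: "0 < \<delta>2" "\<And>t. t \<in> S \<Longrightarrow> \<bar>t - s\<bar> < \<delta>2 \<Longrightarrow> L2_norm M (\<lambda>\<omega>. y t \<omega> - y s \<omega>) < \<epsilon> / 2"
    by (rule C_L2_cont[OF assms(2) s(1) \<open>0 < \<epsilon> / 2\<close>]) blast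
  have "L2_norm M (\<lambda>\<omega>. x t \<omega> + y t \<omega> - (x s \<omega> + y s \<omega>)) < \<epsilon>" if t: "t \<in> S" "\<bar>t - s\<bar> < min \<delta>1 \<delta>2" for t
  proof -
    have "L2_norm M (\<lambda>\<omega>. (x t \<omega> - x s \<omega>) + (y t \<omega> - y s \<omega>))
       \<le> L2_norm M (\<lambda>\<omega>. x t \<omega> - x s \<omega>) + L2_norm M (\<lambda>\<omega>. y t \<omega> - y s \<omega>)"
      by (intro L2_norm_triangle L2_diff C_L2_D[OF assms(1)] C_L2_D[OF assms(2)] t s)
    then show ?thesis using d1(2)[of t] d2(2)[of t] t by (simp add: algebra_simps)
  qed
  then show "\<exists>\<delta>>0. \<forall>t\<in>S. \<bar>t - s\<bar> < \<delta> \<longrightarrow> L2_norm M (\<lambda>\<omega>. x t \<omega> + y t \<omega> - (x s \<omega> + y s \<omega>)) < \<epsilon>"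
    using d1(1) d2(1) by (intro exI[of _ "min \<delta>1 \<delta>2"]) auto
qed

lemma C_L2_minus: "x \<in> C_L2 M S \<Longrightarrow> (\<lambda>t \<omega>. - x t \<omega>) \<in> C_L2 M S"
  by (rule C_L2_modulus[of x M S _ 1])
    (auto intro!: L2_minus C_L2_D eq_refl L2_norm_cong simp: norm_minus_commute)

lemma C_L2_diff:
  assumes "x \<in> C_L2 M S" "y \<in> C_L2 M S"
  shows "(\<lambda>t \<omega>. x t \<omega> - y t \<omega>) \<in> C_L2 M S"
  using C_L2_add[OF assms(1) C_L2_minus[OF assms(2)]] by simp

lemma C_L2_cong_AE:
  assumes x: "x \<in> C_L2 M S" and y: "\<And>t. t \<in> S \<Longrightarrow> y t \<in> borel_measurable M"
    "\<And>t. t \<in> S \<Longrightarrow> AE \<omega> in M. y t \<omega> = x t \<omega>"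
  shows "y \<in> C_L2 M S"
proof (rule C_L2_modulus[OF x, of _ 1])
  fix t s assume ts: "t \<in> S" "s \<in> S"
  have "L2_norm M (\<lambda>\<omega>. y t \<omega> - y s \<omega>) = L2_norm M (\<lambda>\<omega>. x t \<omega> - x s \<omega>)"
  proof (rule L2_cong_AE(2)[OF L2_diff[OF C_L2_D[OF x ts(1)] C_L2_D[OF x ts(2)]]])
    show "AE \<omega> in M. y t \<omega> - y s \<omega> = x t \<omega> - x s \<omega>"
      using y(2)[OF ts(1)] y(2)[OF ts(2)] by eventually_elim simp
  qed (intro borel_measurable_diff y ts)
  then show "L2_norm M (\<lambda>\<omega>. y t \<omega> - y s \<omega>) \<le> 1 * L2_norm M (\<lambda>\<omega>. x t \<omega> - x s \<omega>)" by simp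
qed (use L2_cong_AE(1)[OF C_L2_D[OF x] y] in auto)

text \<open>All distances are blind to null sets, so agreement almost surely at \<open>b\<close>
  suffices. This attaches the image of a process under the mild equation on \<open>{0..T}\<close> to
  the prescribed past.\<close>

lemma C_L2_glue:
  fixes a b c :: real
  assumes x: "x \<in> C_L2 M {a..b}" and y: "y \<in> C_L2 M {b..c}" and eq: "AE \<omega> in M. y b \<omega> = x b \<omega>"
    and ab: "a \<le> b" "b \<le> c"
  shows "(\<lambda>t. if t \<le> b then x t else y t) \<in> C_L2 M {a..c}"
proof -
  define z where "z t = (if t \<le> b then x t else y t)" for t
  have z: "z t = x t" if "t \<le> b" for t using that by (simp add: z_def)
  have z': "z t = y t" if "b < t" for t using that by (simp add: z_def)
  have zL: "z t \<in> L2 M" if "t \<in> {a..c}" for t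
    using C_L2_D[OF x, of t] C_L2_D[OF y, of t] that z[of t] z'[of t] by (cases "t \<le> b") auto
  have zy: "L2_norm M (\<lambda>\<omega>. z t \<omega> - z u \<omega>) = L2_norm M (\<lambda>\<omega>. y t \<omega> - y u \<omega>)"
    if "t \<in> {b..c}" "u \<in> {b..c}" for t u
  proof (rule L2_cong_AE(2)[OF L2_diff[OF C_L2_D[OF y] C_L2_D[OF y]]])
    show "(\<lambda>\<omega>. z t \<omega> - z u \<omega>) \<in> borel_measurable M"
      using zL[of t] zL[of u] that ab by (intro borel_measurable_diff L2_measurable) auto
    show "AE \<omega> in M. z t \<omega> - z u \<omega> = y t \<omega> - y u \<omega>"
      using eq by eventually_elim (use that ab in \<open>auto simp: z_def not_le dest: antisym\<close>)
  qed (use that in auto)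
  have zx: "L2_norm M (\<lambda>\<omega>. z t \<omega> - z u \<omega>) = L2_norm M (\<lambda>\<omega>. x t \<omega> - x u \<omega>)"
    if "t \<in> {a..b}" "u \<in> {a..b}" for t u
    using that by (simp add: z)
  have cont: "\<exists>\<delta>>0. \<forall>t\<in>{a..c}. \<bar>t - s\<bar> < \<delta> \<longrightarrow> L2_norm M (\<lambda>\<omega>. z t \<omega> - z s \<omega>) < \<epsilon>"
    if s: "s \<in> {a..c}" "0 < \<epsilon>" for s \<epsilon>
  proof -
  have 1: "\<exists>\<delta>>0. \<forall>t\<in>{a..b}. \<bar>t - s\<bar> < \<delta> \<longrightarrow> L2_norm M (\<lambda>\<omega>. z t \<omega> - z s \<omega>) < \<epsilon>"
  proof (cases "s \<in> {a..b}")
    case True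
    obtain \<delta> where "\<delta> > 0" "\<And>t. t \<in> {a..b} \<Longrightarrow> \<bar>t - s\<bar> < \<delta> \<Longrightarrow> L2_norm M (\<lambda>\<omega>. x t \<omega> - x s \<omega>) < \<epsilon>"
      by (rule C_L2_cont[OF x True s(2)]) blast
    then show ?thesis by (intro exI[of _ \<delta>]) (simp add: zx[OF _ True])
  next
    case False
    then show ?thesis using s ab by (intro exI[of _ "s - b"]) auto
  qed
  have 2: "\<exists>\<delta>>0. \<forall>t\<in>{b..c}. \<bar>t - s\<bar> < \<delta> \<longrightarrow> L2_norm M (\<lambda>\<omega>. z t \<omega> - z s \<omega>) < \<epsilon>"
  proof (cases "s \<in> {b..c}")
    case True
    obtain \<delta> where "\<delta> > 0" "\<And>t. t \<in> {b..c} \<Longrightarrow> \<bar>t - s\<bar> < \<delta> \<Longrightarrow> L2_norm M (\<lambda>\<omega>. y t \<omega> - y s \<omega>) < \<epsilon>"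
      by (rule C_L2_cont[OF y True s(2)]) blast
    then show ?thesis by (intro exI[of _ \<delta>]) (simp add: zy[OF _ True])
  next
    case False
    then show ?thesis using s ab by (intro exI[of _ "b - s"]) auto
  qed
  from 1 2 obtain \<delta>1 \<delta>2 where d1: "\<delta>1 > 0" "\<And>t. t \<in> {a..b} \<Longrightarrow> \<bar>t - s\<bar> < \<delta>1 \<Longrightarrow> L2_norm M (\<lambda>\<omega>. z t \<omega> - z s \<omega>) < \<epsilon>"
    and d2: "\<delta>2 > 0" "\<And>t. t \<in> {b..c} \<Longrightarrow> \<bar>t - s\<bar> < \<delta>2 \<Longrightarrow> L2_norm M (\<lambda>\<omega>. z t \<omega> - z s \<omega>) < \<epsilon>"
    by metis
  have "L2_norm M (\<lambda>\<omega>. z t \<omega> - z s \<omega>) < \<epsilon>" if "t \<in> {a..c}" "\<bar>t - s\<bar> < min \<delta>1 \<delta>2" for t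
    using d1(2)[of t] d2(2)[of t] that by (cases "t \<le> b") auto
  then show "\<exists>\<delta>>0. \<forall>t\<in>{a..c}. \<bar>t - s\<bar> < \<delta> \<longrightarrow> L2_norm M (\<lambda>\<omega>. z t \<omega> - z s \<omega>) < \<epsilon>"
    using d1(1) d2(1) by (intro exI[of _ "min \<delta>1 \<delta>2"]) auto
  qed
  have "z \<in> C_L2 M {a..c}" unfolding C_L2_iff using zL cont by blast
  then show ?thesis by (simp add: z_def[abs_def])
qed

lemma C_L2_bounded:
  fixes a b :: real
  assumes x: "x \<in> C_L2 M {a..b}"
  obtains B where "0 \<le> B" "\<And>t. t \<in> {a..b} \<Longrightarrow> L2_norm M (x t) \<le> B"
proof -
  have "continuous_on {a..b} (\<lambda>t. L2_norm M (x t))"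
    unfolding continuous_on_iff dist_real_def
  proof (intro ballI allI impI)
    fix s and \<epsilon> :: real assume s: "s \<in> {a..b}" "0 < \<epsilon>"
    obtain \<delta> where d: "\<delta> > 0" "\<And>t. t \<in> {a..b} \<Longrightarrow> \<bar>t - s\<bar> < \<delta> \<Longrightarrow> L2_norm M (\<lambda>\<omega>. x t \<omega> - x s \<omega>) < \<epsilon>"
      by (rule C_L2_cont[OF x s]) blast
    then show "\<exists>\<delta>>0. \<forall>t\<in>{a..b}. \<bar>t - s\<bar> < \<delta> \<longrightarrow> \<bar>L2_norm M (x t) - L2_norm M (x s)\<bar> < \<epsilon>"
      using L2_norm_diff_abs[OF C_L2_D[OF x] C_L2_D[OF x]] s by (blast intro: le_less_trans)
  qed
  then have "compact ((\<lambda>t. L2_norm M (x t)) ` {a..b})" by (intro compact_continuous_image) auto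
  then obtain B where B: "\<forall>c\<in>(\<lambda>t. L2_norm M (x t)) ` {a..b}. norm c \<le> B"
    using compact_imp_bounded bounded_iff by metis
  show ?thesis
  proof (rule that)
    show "0 \<le> max B 0" by simp
    fix t assume "t \<in> {a..b}"
    then have "norm (L2_norm M (x t)) \<le> B" by (intro bspec[OF B] imageI)
    then show "L2_norm M (x t) \<le> max B 0" by simp
  qed
qed

text \<open>Heine-Cantor: pairs of ever closer points that violate a uniform modulus have a common
  limit along a subsequence, and continuity at this limit contradicts the violation.\<close>

lemma C_L2_uniform:
  fixes a b :: real
  assumes x: "x \<in> C_L2 M {a..b}" and "0 < \<epsilon>"
  obtains \<delta> where "0 < \<delta>" "\<And>s t. s \<in> {a..b} \<Longrightarrow> t \<in> {a..b} \<Longrightarrow> \<bar>t - s\<bar> < \<delta> \<Longrightarrow> L2_norm M (\<lambda>\<omega>. x t \<omega> - x s \<omega>) < \<epsilon>"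
proof (rule ccontr)
  assume *: "\<not> thesis"
  have "\<forall>n. \<exists>s t. s \<in> {a..b} \<and> t \<in> {a..b} \<and> \<bar>t - s\<bar> < inverse (real (Suc n)) \<and> \<not> L2_norm M (\<lambda>\<omega>. x t \<omega> - x s \<omega>) < \<epsilon>"
  proof
    fix n show "\<exists>s t. s \<in> {a..b} \<and> t \<in> {a..b} \<and> \<bar>t - s\<bar> < inverse (real (Suc n)) \<and> \<not> L2_norm M (\<lambda>\<omega>. x t \<omega> - x s \<omega>) < \<epsilon>"
      using * that[of "inverse (real (Suc n))"] by force
  qed
  then obtain s t where st: "\<And>n. s n \<in> {a..b}" "\<And>n. t n \<in> {a..b}"
    "\<And>n. \<bar>t n - s n\<bar> < inverse (real (Suc n))" "\<And>n. \<not> L2_norm M (\<lambda>\<omega>. x (t n) \<omega> - x (s n) \<omega>) < \<epsilon>"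
    by metis
  obtain l q where l: "l \<in> {a..b}" "strict_mono q" "(s \<circ> q) \<longlonglongrightarrow> l"
    using compact_Icc[of a b] st(1) unfolding compact_eq_seq_compact_metric seq_compact_def by metis
  have "(\<lambda>n. t (q n) - s (q n)) \<longlonglongrightarrow> 0"
  proof (rule Lim_null_comparison)
    show "\<forall>\<^sub>F n in sequentially. norm (t (q n) - s (q n)) \<le> inverse (real (Suc n))"
    proof (intro always_eventually allI)
      fix n
      have "inverse (real (Suc (q n))) \<le> inverse (real (Suc n))"
        using seq_suble[OF l(2), of n] by (intro le_imp_inverse_le) auto
      then show "norm (t (q n) - s (q n)) \<le> inverse (real (Suc n))"
        using st(3)[of "q n"] unfolding real_norm_def by linarith
    qed
  qed (rule LIMSEQ_inverse_real_of_nat)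
  from tendsto_add[OF this l(3)] have tl: "(\<lambda>n. t (q n)) \<longlonglongrightarrow> l" by (simp add: o_def)
  have "0 < \<epsilon> / 2" using assms(2) by simp
  then obtain \<delta> where d: "\<delta> > 0" "\<And>t. t \<in> {a..b} \<Longrightarrow> \<bar>t - l\<bar> < \<delta> \<Longrightarrow> L2_norm M (\<lambda>\<omega>. x t \<omega> - x l \<omega>) < \<epsilon> / 2"
    by (rule C_L2_cont[OF x l(1)]) blast
  have "\<forall>\<^sub>F n in sequentially. \<bar>s (q n) - l\<bar> < \<delta> \<and> \<bar>t (q n) - l\<bar> < \<delta>"
    using tendstoD[OF l(3) d(1)] tendstoD[OF tl d(1)] by eventually_elim (simp add: dist_real_def)
  then obtain n where n: "\<bar>s (q n) - l\<bar> < \<delta>" "\<bar>t (q n) - l\<bar> < \<delta>"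
    by (auto simp: eventually_sequentially)
  have "L2_norm M (\<lambda>\<omega>. x (t (q n)) \<omega> - x (s (q n)) \<omega>)
      \<le> L2_norm M (\<lambda>\<omega>. x (t (q n)) \<omega> - x l \<omega>) + L2_norm M (\<lambda>\<omega>. x l \<omega> - x (s (q n)) \<omega>)"
    using st(1,2) l(1) by (intro L2_norm_dist_triangle C_L2_D[OF x])
  also have "\<dots> < \<epsilon>"
    using d(2)[OF st(2) n(2)] d(2)[OF st(1) n(1)] by (subst (2) L2_norm_minus_commute) simp
  finally show False using st(4) by blast
qed

lemma measurable_processD:
  assumes "measurable_process M S x" "t \<in> S"
  shows "x t \<in> borel_measurable M"
proof -
  have "(\<lambda>\<omega>. (t, \<omega>)) \<in> measurable M (restrict_space borel S \<Otimes>\<^sub>M M)"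
    using assms(2) by (intro measurable_Pair) (auto simp: space_restrict_space)
  from measurable_compose[OF this assms(1)[unfolded measurable_process_def]]
  show ?thesis by simp
qed

text \<open>The version is the limit of the process frozen along refining grids.\<close>

lemma C_L2_measurable_version:
  fixes a b :: real and x :: "real \<Rightarrow> 'w \<Rightarrow> 'x::{banach, second_countable_topology}"
  assumes fin: "finite_measure M" and x: "x \<in> C_L2 M {a..b}"
  obtains y where "y \<in> C_L2 M {a..b}" "measurable_process M {a..b} y"
    "\<And>t. t \<in> {a..b} \<Longrightarrow> AE \<omega> in M. y t \<omega> = x t \<omega>"
proof -
  have "\<forall>k. \<exists>\<delta>>0. \<forall>s\<in>{a..b}. \<forall>t\<in>{a..b}. \<bar>t - s\<bar> < \<delta> \<longrightarrow> L2_norm M (\<lambda>\<omega>. x t \<omega> - x s \<omega>) < (1/2) ^ Suc k"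
  proof
    fix k :: nat
    have "0 < (1/2 :: real) ^ Suc k" by simp
    from C_L2_uniform[OF x this]
    show "\<exists>\<delta>>0. \<forall>s\<in>{a..b}. \<forall>t\<in>{a..b}. \<bar>t - s\<bar> < \<delta> \<longrightarrow> L2_norm M (\<lambda>\<omega>. x t \<omega> - x s \<omega>) < (1/2) ^ Suc k"
      by metis
  qed
  then obtain d where d: "\<And>k. 0 < d k"
    "\<And>k s t. s \<in> {a..b} \<Longrightarrow> t \<in> {a..b} \<Longrightarrow> \<bar>t - s\<bar> < d k \<Longrightarrow> L2_norm M (\<lambda>\<omega>. x t \<omega> - x s \<omega>) < (1/2) ^ Suc k"
    by metis
  define p where "p k i = a + d k * real_of_int i" for k i
  define j where "j k t = \<lfloor>(t - a) / d k\<rfloor>" for k t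
  \<comment> \<open>The process is frozen at the grid point to the left of \<open>t\<close>. For
    \<open>t\<close> in the interval this point lies in the interval, so the value 0 is never taken
    there; it makes the expression meaningful for every integer index in the measurability
    argument.\<close>
  define X where "X k t \<omega> = (if p k (j k t) \<in> {a..b} then x (p k (j k t)) \<omega> else 0)" for k t \<omega>
  have p: "p k (j k t) \<in> {a..b}" "\<bar>t - p k (j k t)\<bar> < d k" if "t \<in> {a..b}" for k t
  proof -
    have "real_of_int (j k t) \<le> (t - a) / d k" "(t - a) / d k < real_of_int (j k t) + 1"
      unfolding j_def by linarith+
    then have "d k * real_of_int (j k t) \<le> t - a" "t - a < d k * real_of_int (j k t) + d k"
      using d(1)[of k] by (auto simp: field_simps)
    moreover have "0 \<le> d k * real_of_int (j k t)"
      using d(1)[of k] that by (auto simp: j_def)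
    ultimately show "p k (j k t) \<in> {a..b}" "\<bar>t - p k (j k t)\<bar> < d k"
      using that by (auto simp: p_def)
  qed
  have XL: "X k t \<in> L2 M" if "t \<in> {a..b}" for k t
    using C_L2_D[OF x p(1)[OF that]] p(1)[OF that] unfolding X_def by simp
  have Xx: "L2_norm M (\<lambda>\<omega>. X k t \<omega> - x t \<omega>) < (1/2) ^ Suc k" if "t \<in> {a..b}" for k t
    using d(2)[OF p(1)[OF that] that p(2)[OF that], of k] p(1)[OF that]
    unfolding X_def by (subst L2_norm_minus_commute) simp
  have st: "L2_norm M (\<lambda>\<omega>. X (Suc k) t \<omega> - X k t \<omega>) \<le> (1/2) ^ k" if "t \<in> {a..b}" for k t
  proof -
    have "L2_norm M (\<lambda>\<omega>. X (Suc k) t \<omega> - X k t \<omega>)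
      \<le> L2_norm M (\<lambda>\<omega>. X (Suc k) t \<omega> - x t \<omega>) + L2_norm M (\<lambda>\<omega>. x t \<omega> - X k t \<omega>)"
      by (rule L2_norm_dist_triangle[OF XL[OF that] C_L2_D[OF x that] XL[OF that]])
    \<comment> \<open>The grids were chosen with accuracy (1/2)^(k+1) so that two consecutive errors
      still add up to less than (1/2)^k.\<close>
    also have "\<dots> \<le> (1/2) ^ Suc (Suc k) + (1/2) ^ Suc k"
      using Xx[OF that, of "Suc k"] Xx[OF that, of k] by (subst (2) L2_norm_minus_commute) simp
    also have "\<dots> \<le> (1/2) ^ k" by simp
    finally show ?thesis .
  qed
  have Xm [measurable]: "(\<lambda>(t, \<omega>). X k t \<omega>) \<in> borel_measurable (restrict_space borel {a..b} \<Otimes>\<^sub>M M)" for k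
  proof -
    \<comment> \<open>The grid index takes countably many values; for a fixed index the process
      depends on the path alone.\<close>
    have "(\<lambda>q. (\<lambda>i q. if p k i \<in> {a..b} then x (p k i) (snd q) else 0) (j k (fst q)) q)
       \<in> borel_measurable (restrict_space borel {a..b} \<Otimes>\<^sub>M M)"
    proof (rule measurable_compose_countable)
      fix i
      have "(\<lambda>q. x (p k i) (snd q)) \<in> borel_measurable (restrict_space borel {a..b} \<Otimes>\<^sub>M M)" if "p k i \<in> {a..b}"
        using L2_measurable[OF C_L2_D[OF x that]] by measurable
      then show "(\<lambda>q. if p k i \<in> {a..b} then x (p k i) (snd q) else 0) \<in> borel_measurable (restrict_space borel {a..b} \<Otimes>\<^sub>M M)"
        by (cases "p k i \<in> {a..b}") auto
    next
      have [measurable]: "(\<lambda>t. t) \<in> borel_measurable (restrict_space borel {a..b})"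
        by (rule measurable_restrict_space1) simp
      have "(\<lambda>t. (t - a) / d k) \<in> borel_measurable (restrict_space borel {a..b})" by measurable
      then have "(\<lambda>t. j k t) \<in> measurable (restrict_space borel {a..b}) (count_space UNIV)"
        unfolding j_def by (rule measurable_compose) (rule measurable_real_floor)
      then show "(\<lambda>q. j k (fst q)) \<in> measurable (restrict_space borel {a..b} \<Otimes>\<^sub>M M) (count_space UNIV)"
        by (rule measurable_compose[OF measurable_fst])
    qed
    then show ?thesis by (simp add: X_def case_prod_beta')
  qed
  define y where "y t \<omega> = lim (\<lambda>k. X k t \<omega>)" for t \<omega>
  have ym: "measurable_process M {a..b} y"
    unfolding measurable_process_def y_def case_prod_beta'
    by (rule borel_measurable_lim_metric) (use Xm in \<open>simp add: case_prod_beta'\<close>)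
  have yx: "AE \<omega> in M. y t \<omega> = x t \<omega>" if t: "t \<in> {a..b}" for t
  proof -
    have yL: "y t \<in> borel_measurable M" by (rule measurable_processD[OF ym t])
    have lim: "AE \<omega> in M. (\<lambda>k. X k t \<omega>) \<longlonglongrightarrow> y t \<omega>"
      using L2_geometric_convergent[OF fin XL[OF t] st[OF t]] unfolding y_def
      by eventually_elim (simp add: convergent_LIMSEQ_iff)
    note L = L2_geometric_limit[OF fin XL[OF t] st[OF t] lim yL]
    have "L2_norm M (\<lambda>\<omega>. y t \<omega> - x t \<omega>) \<le> 3 * (1/2) ^ k" for k
    proof -
      have "L2_norm M (\<lambda>\<omega>. y t \<omega> - x t \<omega>)
        \<le> L2_norm M (\<lambda>\<omega>. y t \<omega> - X k t \<omega>) + L2_norm M (\<lambda>\<omega>. X k t \<omega> - x t \<omega>)"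
        by (rule L2_norm_dist_triangle[OF L(1) XL[OF t] C_L2_D[OF x t]])
      also have "\<dots> \<le> 2 * (1/2) ^ k + (1/2) ^ Suc k"
        using L(2)[of k] Xx[OF t, of k] by (subst L2_norm_minus_commute) simp
      also have "\<dots> \<le> 3 * (1/2) ^ k" by simp
      finally show ?thesis .
    qed
    moreover have "(\<lambda>k. 3 * (1/2 :: real) ^ k) \<longlonglongrightarrow> 3 * 0"
      by (intro tendsto_mult tendsto_const LIMSEQ_power_zero) simp
    ultimately have "L2_norm M (\<lambda>\<omega>. y t \<omega> - x t \<omega>) \<le> 3 * 0"
      by (intro tendsto_lowerbound[of "\<lambda>k. 3 * (1/2 :: real) ^ k" _ sequentially]) auto
    then have "L2_norm M (\<lambda>\<omega>. y t \<omega> - x t \<omega>) = 0" using L2_norm_nonneg[of M "\<lambda>\<omega>. y t \<omega> - x t \<omega>"] by linarith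
    from L2_norm_eq_0_AE[OF L2_diff[OF L(1) C_L2_D[OF x t]] this] show ?thesis by simp
  qed
  show ?thesis
    by (rule that[of y]) (use ym yx in \<open>auto intro!: C_L2_cong_AE[OF x] measurable_processD[OF ym]\<close>)
qed

text \<open>The limit is chosen separately for each time; uniformity is recovered by keeping one
  index of the Cauchy condition fixed and letting the other tend to infinity.\<close>

lemma C_L2_complete:
  fixes X :: "nat \<Rightarrow> real \<Rightarrow> 'w \<Rightarrow> 'x::{banach, second_countable_topology}"
  assumes fin: "finite_measure M" and X: "\<And>k. X k \<in> C_L2 M S"
    and cauchy: "\<And>\<epsilon>. 0 < \<epsilon> \<Longrightarrow> \<exists>N. \<forall>m\<ge>N. \<forall>n\<ge>N. \<forall>t\<in>S. L2_norm M (\<lambda>\<omega>. X m t \<omega> - X n t \<omega>) < \<epsilon>"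
  obtains y where "y \<in> C_L2 M S"
    "\<And>\<epsilon>. 0 < \<epsilon> \<Longrightarrow> \<exists>N. \<forall>n\<ge>N. \<forall>t\<in>S. L2_norm M (\<lambda>\<omega>. X n t \<omega> - y t \<omega>) \<le> \<epsilon>"
proof -
  have "\<forall>t\<in>S. \<exists>Z. Z \<in> L2 M \<and> (\<lambda>k. L2_norm M (\<lambda>\<omega>. X k t \<omega> - Z \<omega>)) \<longlonglongrightarrow> 0"
  proof
    fix t assume t: "t \<in> S"
    have "\<exists>N. \<forall>m\<ge>N. \<forall>n\<ge>N. L2_norm M (\<lambda>x. X m t x - X n t x) < \<epsilon>" if "0 < \<epsilon>" for \<epsilon>
      using cauchy[OF that] t by blast
    from L2_complete[OF fin C_L2_D[OF X t] this]
    show "\<exists>Z. Z \<in> L2 M \<and> (\<lambda>k. L2_norm M (\<lambda>\<omega>. X k t \<omega> - Z \<omega>)) \<longlonglongrightarrow> 0" by metis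
  qed
  then obtain y where y: "\<And>t. t \<in> S \<Longrightarrow> y t \<in> L2 M"
    "\<And>t. t \<in> S \<Longrightarrow> (\<lambda>k. L2_norm M (\<lambda>\<omega>. X k t \<omega> - y t \<omega>)) \<longlonglongrightarrow> 0" by metis
  have unif: "\<exists>N. \<forall>n\<ge>N. \<forall>t\<in>S. L2_norm M (\<lambda>\<omega>. X n t \<omega> - y t \<omega>) \<le> \<epsilon>" if e: "0 < \<epsilon>" for \<epsilon>
  proof -
    obtain N where N: "\<And>m n t. m \<ge> N \<Longrightarrow> n \<ge> N \<Longrightarrow> t \<in> S \<Longrightarrow> L2_norm M (\<lambda>\<omega>. X m t \<omega> - X n t \<omega>) < \<epsilon>"
      using cauchy[OF e] by blast
    have "L2_norm M (\<lambda>\<omega>. X n t \<omega> - y t \<omega>) \<le> \<epsilon>" if n: "n \<ge> N" "t \<in> S" for n t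
    proof -
      have "(\<lambda>m. \<epsilon> + L2_norm M (\<lambda>\<omega>. X m t \<omega> - y t \<omega>)) \<longlonglongrightarrow> \<epsilon> + 0"
        by (intro tendsto_intros y n)
      moreover have "L2_norm M (\<lambda>\<omega>. X n t \<omega> - y t \<omega>) \<le> \<epsilon> + L2_norm M (\<lambda>\<omega>. X m t \<omega> - y t \<omega>)" if "m \<ge> N" for m
        using L2_norm_dist_triangle[OF C_L2_D[OF X n(2), of n] C_L2_D[OF X n(2), of m] y(1)[OF n(2)]]
          N[OF n(1) that n(2)] by linarith
      ultimately have "L2_norm M (\<lambda>\<omega>. X n t \<omega> - y t \<omega>) \<le> \<epsilon> + 0"
        by (intro tendsto_lowerbound[of "\<lambda>m. \<epsilon> + L2_norm M (\<lambda>\<omega>. X m t \<omega> - y t \<omega>)" _ sequentially])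
          (auto simp: eventually_sequentially)
      then show ?thesis by simp
    qed
    then show ?thesis by blast
  qed
  have "y \<in> C_L2 M S"
    unfolding C_L2_iff
  proof (intro conjI ballI allI impI)
    fix s and \<epsilon> :: real assume s: "s \<in> S" "0 < \<epsilon>"
    then have e: "0 < \<epsilon> / 3" by simp
    obtain n where n: "\<And>t. t \<in> S \<Longrightarrow> L2_norm M (\<lambda>\<omega>. X n t \<omega> - y t \<omega>) \<le> \<epsilon> / 3"
      using unif[OF e] by blast
    obtain \<delta> where d: "\<delta> > 0" "\<And>t. t \<in> S \<Longrightarrow> \<bar>t - s\<bar> < \<delta> \<Longrightarrow> L2_norm M (\<lambda>\<omega>. X n t \<omega> - X n s \<omega>) < \<epsilon> / 3"
      by (rule C_L2_cont[OF X[of n] s(1) e]) blast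
    have "L2_norm M (\<lambda>\<omega>. y t \<omega> - y s \<omega>) < \<epsilon>" if t: "t \<in> S" "\<bar>t - s\<bar> < \<delta>" for t
    proof -
      note L = C_L2_D[OF X t(1), of n] C_L2_D[OF X s(1), of n] y(1)[OF t(1)] y(1)[OF s(1)]
      show ?thesis
        using L2_norm_dist_triangle[OF L(3,1,4)] L2_norm_dist_triangle[OF L(1,2,4)]
          n[OF t(1)] n[OF s(1)] d(2)[OF t] L2_norm_minus_commute[of M "y t" "X n t"] by linarith
    qed
    with d(1) show "\<exists>\<delta>>0. \<forall>t\<in>S. \<bar>t - s\<bar> < \<delta> \<longrightarrow> L2_norm M (\<lambda>\<omega>. y t \<omega> - y s \<omega>) < \<epsilon>" by blast
  qed (rule y)
  then show ?thesis using that unif by blast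
qed

text \<open>Banach's fixed point theorem for processes modulo null sets: \<open>P x y\<close> says that \<open>y\<close> is an
  image of \<open>x\<close>, and \<open>Q\<close> selects the admissible processes.\<close>

lemma C_L2_fixed_point:
  fixes P :: "(real \<Rightarrow> 'w \<Rightarrow> 'x::{banach, second_countable_topology}) \<Rightarrow> (real \<Rightarrow> 'w \<Rightarrow> 'x) \<Rightarrow> bool"
    and a b l :: real
  assumes fin: "finite_measure M" and l: "0 \<le> l" "l < 1"
    and QC: "\<And>x. Q x \<Longrightarrow> x \<in> C_L2 M {a..b}"
    and Q0: "Q x0"
    and step: "\<And>x. Q x \<Longrightarrow> \<exists>y. Q y \<and> P x y"
    and contr: "\<And>x x' y y' B. Q x \<Longrightarrow> Q x' \<Longrightarrow> Q y \<Longrightarrow> Q y' \<Longrightarrow> P x y \<Longrightarrow> P x' y' \<Longrightarrow> 0 \<le> B \<Longrightarrow>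
       (\<And>t. t \<in> {a..b} \<Longrightarrow> L2_norm M (\<lambda>\<omega>. x t \<omega> - x' t \<omega>) \<le> B) \<Longrightarrow>
       (\<And>t. t \<in> {a..b} \<Longrightarrow> L2_norm M (\<lambda>\<omega>. y t \<omega> - y' t \<omega>) \<le> l * B)"
    and closed: "\<And>X y. (\<And>k. Q (X k)) \<Longrightarrow> y \<in> C_L2 M {a..b} \<Longrightarrow>
       (\<And>t. t \<in> {a..b} \<Longrightarrow> (\<lambda>k. L2_norm M (\<lambda>\<omega>. X k t \<omega> - y t \<omega>)) \<longlonglongrightarrow> 0) \<Longrightarrow>
       \<exists>z. Q z \<and> (\<forall>t\<in>{a..b}. AE \<omega> in M. z t \<omega> = y t \<omega>)"
    and cong: "\<And>x y y'. Q x \<Longrightarrow> Q y \<Longrightarrow> P x y \<Longrightarrow> Q y' \<Longrightarrow>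
       (\<And>t. t \<in> {a..b} \<Longrightarrow> AE \<omega> in M. y' t \<omega> = y t \<omega>) \<Longrightarrow> P x y'"
  shows "\<exists>x. Q x \<and> P x x"
proof -
  obtain F where F: "\<And>x. Q x \<Longrightarrow> Q (F x)" "\<And>x. Q x \<Longrightarrow> P x (F x)" using step by metis
  define X where "X k = (F ^^ k) x0" for k
  have XQ: "Q (X k)" for k by (induction k) (auto simp: X_def Q0 F)
  have XP: "P (X k) (X (Suc k))" for k using F(2)[OF XQ[of k]] by (simp add: X_def)
  note XL = C_L2_D[OF QC[OF XQ]]
  obtain B where B: "0 \<le> B" "\<And>t. t \<in> {a..b} \<Longrightarrow> L2_norm M (\<lambda>\<omega>. X 1 t \<omega> - X 0 t \<omega>) \<le> B"
    using C_L2_bounded[OF C_L2_diff[OF QC[OF XQ[of 1]] QC[OF XQ[of 0]]]] by metis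
  have one: "L2_norm M (\<lambda>\<omega>. X (Suc k) t \<omega> - X k t \<omega>) \<le> l ^ k * B" if "t \<in> {a..b}" for k t
    using that
  proof (induction k arbitrary: t)
    case 0 then show ?case using B(2) by simp
  next
    case (Suc k)
    have "L2_norm M (\<lambda>\<omega>. X (Suc (Suc k)) t \<omega> - X (Suc k) t \<omega>) \<le> l * (l ^ k * B)"
      using B(1) l(1) Suc by (intro contr[OF XQ[of "Suc k"] XQ[of k] XQ XQ XP XP]) auto
    then show ?case by (simp add: mult.assoc)
  qed
  \<comment> \<open>\<open>K\<close> solves \<open>K = B + l * K\<close>; it is the sum of the
    geometric series of steps, and with it the tail bounds telescope.\<close>
  define K where "K = B / (1 - l)"
  have K: "0 \<le> K" "l ^ k * K = l ^ k * B + l ^ Suc k * K" for k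
    using B l by (auto simp: K_def field_simps)
  have tail: "L2_norm M (\<lambda>\<omega>. X (k + i) t \<omega> - X k t \<omega>) \<le> l ^ k * K - l ^ (k + i) * K" if t: "t \<in> {a..b}" for k i t
  proof (induction i)
    case (Suc i)
    have "L2_norm M (\<lambda>\<omega>. X (k + Suc i) t \<omega> - X k t \<omega>)
      \<le> L2_norm M (\<lambda>\<omega>. X (Suc (k + i)) t \<omega> - X (k + i) t \<omega>) + L2_norm M (\<lambda>\<omega>. X (k + i) t \<omega> - X k t \<omega>)"
      using L2_norm_dist_triangle[OF XL[OF t] XL[OF t] XL[OF t], of "Suc (k + i)" k "k + i"]
      by simp
    then show ?case using one[OF t, of "k + i"] Suc K(2)[of "k + i"] by simp
  qed simp
  have tail': "L2_norm M (\<lambda>\<omega>. X m t \<omega> - X n t \<omega>) \<le> 2 * (l ^ N * K)" if "m \<ge> N" "n \<ge> N" and t: "t \<in> {a..b}" for m n N t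
  proof -
    have "L2_norm M (\<lambda>\<omega>. X m t \<omega> - X N t \<omega>) \<le> l ^ N * K" "L2_norm M (\<lambda>\<omega>. X n t \<omega> - X N t \<omega>) \<le> l ^ N * K"
      using tail[OF t, of N "m - N"] tail[OF t, of N "n - N"] that(1,2) K(1) l(1)
      by (auto intro: order_trans)
    then show ?thesis
      using L2_norm_dist_triangle[OF XL[OF t] XL[OF t] XL[OF t], of m n N]
        L2_norm_minus_commute[of M "X N t" "X n t"] by linarith
  qed
  have l0: "(\<lambda>N. 2 * (l ^ N * K)) \<longlonglongrightarrow> 2 * (0 * K)"
    using l by (intro tendsto_intros LIMSEQ_power_zero) auto
  have cauchy: "\<exists>N. \<forall>m\<ge>N. \<forall>n\<ge>N. \<forall>t\<in>{a..b}. L2_norm M (\<lambda>\<omega>. X m t \<omega> - X n t \<omega>) < \<epsilon>" if "0 < \<epsilon>" for \<epsilon>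
  proof -
    have "\<forall>\<^sub>F N in sequentially. 2 * (l ^ N * K) < \<epsilon>" using order_tendstoD(2)[OF l0, of \<epsilon>] that by simp
    then obtain N where "2 * (l ^ N * K) < \<epsilon>" by (auto simp: eventually_sequentially)
    then show ?thesis using tail'[of N] by (blast intro: le_less_trans)
  qed
  obtain y0 where y0: "y0 \<in> C_L2 M {a..b}"
    and y0c: "\<And>\<epsilon>. 0 < \<epsilon> \<Longrightarrow> \<exists>N. \<forall>n\<ge>N. \<forall>t\<in>{a..b}. L2_norm M (\<lambda>\<omega>. X n t \<omega> - y0 t \<omega>) \<le> \<epsilon>"
    using C_L2_complete[OF fin QC[OF XQ] cauchy] by metis
  have "(\<lambda>k. L2_norm M (\<lambda>\<omega>. X k t \<omega> - y0 t \<omega>)) \<longlonglongrightarrow> 0" if t: "t \<in> {a..b}" for t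
  proof (rule LIMSEQ_I)
    fix \<epsilon> :: real assume "0 < \<epsilon>"
    then have "0 < \<epsilon> / 2" by simp
    from y0c[OF this] obtain N where "\<forall>n\<ge>N. \<forall>t\<in>{a..b}. L2_norm M (\<lambda>\<omega>. X n t \<omega> - y0 t \<omega>) \<le> \<epsilon> / 2" by blast
    then have "\<forall>n\<ge>N. norm (L2_norm M (\<lambda>\<omega>. X n t \<omega> - y0 t \<omega>) - 0) < \<epsilon>" using t \<open>0 < \<epsilon>\<close> by fastforce
    then show "\<exists>N. \<forall>n\<ge>N. norm (L2_norm M (\<lambda>\<omega>. X n t \<omega> - y0 t \<omega>) - 0) < \<epsilon>" by blast
  qed
  \<comment> \<open>The limit itself need not be admissible, so it is exchanged for an admissible
    version, which has the same distances to the iterates.\<close>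
  from closed[OF XQ y0 this] obtain z where z: "Q z" "\<And>t. t \<in> {a..b} \<Longrightarrow> AE \<omega> in M. z t \<omega> = y0 t \<omega>"
    by blast
  have Xz: "L2_norm M (\<lambda>\<omega>. X n t \<omega> - z t \<omega>) = L2_norm M (\<lambda>\<omega>. X n t \<omega> - y0 t \<omega>)" if t: "t \<in> {a..b}" for n t
  proof (rule L2_cong_AE(2)[OF L2_diff[OF XL[OF t] C_L2_D[OF y0 t]]])
    show "AE \<omega> in M. X n t \<omega> - z t \<omega> = X n t \<omega> - y0 t \<omega>" using z(2)[OF t] by eventually_elim simp
  qed (intro L2_measurable L2_diff XL[OF t] C_L2_D[OF QC[OF z(1)] t])
  obtain y where y: "Q y" "P z y" using step[OF z(1)] by blast
  have "AE \<omega> in M. z t \<omega> = y t \<omega>" if t: "t \<in> {a..b}" for t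
  proof -
    note yL = C_L2_D[OF QC[OF y(1)] t] and zL = C_L2_D[OF QC[OF z(1)] t]
    have "L2_norm M (\<lambda>\<omega>. z t \<omega> - y t \<omega>) \<le> \<epsilon> + l * \<epsilon>" if e: "0 < \<epsilon>" for \<epsilon>
    proof -
      obtain N where N: "\<And>n t. n \<ge> N \<Longrightarrow> t \<in> {a..b} \<Longrightarrow> L2_norm M (\<lambda>\<omega>. X n t \<omega> - z t \<omega>) \<le> \<epsilon>"
        using y0c[OF e] Xz by metis
      have "L2_norm M (\<lambda>\<omega>. X (Suc N) t \<omega> - y t \<omega>) \<le> l * \<epsilon>"
        using e by (intro contr[OF XQ[of N] z(1) XQ y(1) XP y(2) _ N t]) auto
      then show ?thesis
        using L2_norm_dist_triangle[OF zL XL[OF t, of "Suc N"] yL] N[of "Suc N", OF _ t]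
          L2_norm_minus_commute[of M "z t" "X (Suc N) t"] by simp
    qed
    note * = this
    have "L2_norm M (\<lambda>\<omega>. z t \<omega> - y t \<omega>) = 0"
    proof (rule ccontr)
      let ?d = "L2_norm M (\<lambda>\<omega>. z t \<omega> - y t \<omega>)"
      assume "?d \<noteq> 0"
      then have d: "0 < ?d" using L2_norm_nonneg[of M "\<lambda>\<omega>. z t \<omega> - y t \<omega>"] by linarith
      \<comment> \<open>Taking a third of the distance for \<epsilon> bounds the distance by two
        thirds of itself.\<close>
      then have "?d \<le> ?d / 3 + l * (?d / 3)" by (intro *) simp
      also have "\<dots> \<le> ?d / 3 + 1 * (?d / 3)" using l d by (intro add_left_mono mult_right_mono) auto
      finally show False using d by simp
    qed
    from L2_norm_eq_0_AE[OF L2_diff[OF zL yL] this] show ?thesis by simp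
  qed
  from cong[OF z(1) y z(1) this] show ?thesis using z(1) by blast
qed

section \<open>Lebesgue measure on an interval and limits in \<open>L2\<close>\<close>

lemma borel_measurable_lebesgue_onI:
  "f \<in> borel_measurable borel \<Longrightarrow> f \<in> borel_measurable (lebesgue_on S)"
  by (intro measurable_restrict_space1 measurable_completion) simp

lemma finite_measure_lebesgue_on: "finite_measure (lebesgue_on {a..b::real})"
  by (rule finite_measureI)
    (simp add: emeasure_restrict_space space_restrict_space emeasure_lborel_Icc_eq)

lemma L2_inner_tendsto:
  fixes f g :: "'a \<Rightarrow> 'b::{real_inner, second_countable_topology}"
  assumes L: "\<And>k. F k \<in> L2 M" "f \<in> L2 M" "\<And>k. G k \<in> L2 M" "g \<in> L2 M"
    and F: "(\<lambda>k. L2_norm M (\<lambda>x. F k x - f x)) \<longlonglongrightarrow> 0"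
    and G: "(\<lambda>k. L2_norm M (\<lambda>x. G k x - g x)) \<longlonglongrightarrow> 0"
  shows "(\<lambda>k. L2_inner M (F k) (G k)) \<longlonglongrightarrow> L2_inner M f g"
proof -
  have "(\<lambda>k. L2_norm M (\<lambda>x. F k x - f x) * L2_norm M (G k) + L2_norm M f * L2_norm M (\<lambda>x. G k x - g x))
     \<longlonglongrightarrow> 0 * L2_norm M g + L2_norm M f * 0"
  proof (intro tendsto_intros F G)
    show "(\<lambda>k. L2_norm M (G k)) \<longlonglongrightarrow> L2_norm M g"
    proof (rule Lim_transform2[OF tendsto_const])
      show "(\<lambda>k. L2_norm M g - L2_norm M (G k)) \<longlonglongrightarrow> 0"
        by (rule Lim_null_comparison[OF _ G])
          (use L2_norm_diff_abs[OF L(3,4)] in \<open>auto simp: abs_minus_commute intro!: always_eventually\<close>)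
    qed
  qed
  then have "(\<lambda>k. L2_norm M (\<lambda>x. F k x - f x) * L2_norm M (G k) + L2_norm M f * L2_norm M (\<lambda>x. G k x - g x)) \<longlonglongrightarrow> 0"
    by simp
  then have "(\<lambda>k. L2_inner M (F k) (G k) - L2_inner M f g) \<longlonglongrightarrow> 0"
  proof (rule Lim_null_comparison[rotated], intro always_eventually allI)
    fix k
    have "L2_inner M (F k) (G k) - L2_inner M f g
      = L2_inner M (\<lambda>x. F k x - f x) (G k) + L2_inner M f (\<lambda>x. G k x - g x)"
      by (simp add: L2_inner_diff_left L2_inner_diff_right L)
    then show "norm (L2_inner M (F k) (G k) - L2_inner M f g)
      \<le> L2_norm M (\<lambda>x. F k x - f x) * L2_norm M (G k) + L2_norm M f * L2_norm M (\<lambda>x. G k x - g x)"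
      using L2_inner_bound[OF L2_diff[OF L(1,2)] L(3), of k k] L2_inner_bound[OF L(2) L2_diff[OF L(3,4)], of k]
      by simp
  qed
  then show ?thesis by (simp add: LIM_zero_cancel)
qed

lemma L2_norm_tendsto_diff:
  assumes L: "\<And>k. F k \<in> L2 M" "f \<in> L2 M" "\<And>k. G k \<in> L2 M" "g \<in> L2 M"
    and F: "(\<lambda>k. L2_norm M (\<lambda>x. F k x - f x)) \<longlonglongrightarrow> 0"
    and G: "(\<lambda>k. L2_norm M (\<lambda>x. G k x - g x)) \<longlonglongrightarrow> 0"
  shows "(\<lambda>k. L2_norm M (\<lambda>x. (F k x - G k x) - (f x - g x))) \<longlonglongrightarrow> 0"
proof (rule Lim_null_comparison)
  show "(\<lambda>k. L2_norm M (\<lambda>x. F k x - f x) + L2_norm M (\<lambda>x. G k x - g x)) \<longlonglongrightarrow> 0"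
    using tendsto_add[OF F G] by simp
  show "\<forall>\<^sub>F k in sequentially. norm (L2_norm M (\<lambda>x. (F k x - G k x) - (f x - g x)))
     \<le> L2_norm M (\<lambda>x. F k x - f x) + L2_norm M (\<lambda>x. G k x - g x)"
  proof (intro always_eventually allI)
    fix k
    have "L2_norm M (\<lambda>x. (F k x - f x) - (G k x - g x)) \<le> L2_norm M (\<lambda>x. F k x - f x) + L2_norm M (\<lambda>x. G k x - g x)"
      by (intro L2_norm_triangle_diff L2_diff L)
    then show "norm (L2_norm M (\<lambda>x. (F k x - G k x) - (f x - g x)))
     \<le> L2_norm M (\<lambda>x. F k x - f x) + L2_norm M (\<lambda>x. G k x - g x)" by (simp add: algebra_simps)
  qed
qed

lemma L2_dominated:
  fixes F :: "nat \<Rightarrow> 'a \<Rightarrow> 'b::{real_normed_vector, second_countable_topology}"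
  assumes [measurable]: "\<And>k. F k \<in> borel_measurable M" "f \<in> borel_measurable M"
    and G: "G \<in> L2 M" "\<And>k. AE x in M. norm (F k x - f x) \<le> norm (G x)"
    and lim: "AE x in M. (\<lambda>k. F k x) \<longlonglongrightarrow> f x"
  shows "(\<lambda>k. L2_norm M (\<lambda>x. F k x - f x)) \<longlonglongrightarrow> 0"
proof -
  have "(\<lambda>k. \<integral>x. (norm (F k x - f x))\<^sup>2 \<partial>M) \<longlonglongrightarrow> (\<integral>x. 0 \<partial>M)"
  proof (rule integral_dominated_convergence[where w = "\<lambda>x. (norm (G x))\<^sup>2"])
    show "integrable M (\<lambda>x. (norm (G x))\<^sup>2)" by (rule L2_integrable_sq[OF G(1)])
    show "AE x in M. (\<lambda>k. (norm (F k x - f x))\<^sup>2) \<longlonglongrightarrow> 0" using lim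
    proof eventually_elim
      case (elim x)
      have "(\<lambda>k. (norm (F k x - f x))\<^sup>2) \<longlonglongrightarrow> (norm (f x - f x))\<^sup>2"
        by (intro tendsto_intros elim)
      then show ?case by simp
    qed
    fix k show "AE x in M. norm ((norm (F k x - f x))\<^sup>2) \<le> (norm (G x))\<^sup>2"
      using G(2)[of k] by eventually_elim (simp add: power_mono)
  qed auto
  then have "(\<lambda>k. sqrt (\<integral>x. (norm (F k x - f x))\<^sup>2 \<partial>M)) \<longlonglongrightarrow> sqrt 0"
    by (intro tendsto_real_sqrt) simp
  then show ?thesis by (simp add: L2_norm_def)
qed

section \<open>Wiener integrals\<close>

text \<open>Pairs of a step function on \<open>[0,T]\<close> and its stochastic integral, built from the functions
  \<open>1\<^bsub>(0,t]\<^esub> c\<close>; in this form differences of step functions on different partitions need no common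
  refinement.\<close>

inductive elementary_integral ::
  "(real \<Rightarrow> 'w \<Rightarrow> real) \<Rightarrow> real \<Rightarrow> (real \<Rightarrow> 'x::real_vector) \<Rightarrow> ('w \<Rightarrow> 'x) \<Rightarrow> bool" for b T where
  zero: "elementary_integral b T (\<lambda>_. 0) (\<lambda>_. 0)"
| step: "elementary_integral b T h Z \<Longrightarrow> 0 \<le> t \<Longrightarrow> t \<le> T \<Longrightarrow>
    elementary_integral b T (\<lambda>s. h s + indicat_real {0<..t} s *\<^sub>R c) (\<lambda>\<omega>. Z \<omega> + b t \<omega> *\<^sub>R c)"

lemma elementary_integral_single:
  "0 \<le> t \<Longrightarrow> t \<le> T \<Longrightarrow> elementary_integral b T (\<lambda>s. indicat_real {0<..t} s *\<^sub>R c) (\<lambda>\<omega>. b t \<omega> *\<^sub>R c)"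
  using elementary_integral.step[OF elementary_integral.zero, of t T b c] by simp

lemma elementary_integral_add:
  assumes "elementary_integral b T h' Z'" "elementary_integral b T h Z"
  shows "elementary_integral b T (\<lambda>s. h s + h' s) (\<lambda>\<omega>. Z \<omega> + Z' \<omega>)"
  using assms
proof (induction rule: elementary_integral.induct)
  case (step h' Z' t c)
  from elementary_integral.step[OF step.IH[OF step.prems] step.hyps(2,3), of c]
  show ?case by (simp add: add.assoc)
qed simp

lemma elementary_integral_minus:
  "elementary_integral b T h Z \<Longrightarrow> elementary_integral b T (\<lambda>s. - h s) (\<lambda>\<omega>. - Z \<omega>)"
proof (induction rule: elementary_integral.induct)
  case zero show ?case using elementary_integral.zero by simp
next
  case (step h Z t c)
  from elementary_integral.step[OF step.IH step.hyps(2,3), of "-c"] show ?case by simp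
qed

lemma elementary_integral_diff:
  assumes "elementary_integral b T h Z" "elementary_integral b T h' Z'"
  shows "elementary_integral b T (\<lambda>s. h s - h' s) (\<lambda>\<omega>. Z \<omega> - Z' \<omega>)"
  using elementary_integral_add[OF elementary_integral_minus[OF assms(2)] assms(1)] by simp

text \<open>The indicator of a cell of the partition is the difference of two indicators of
  intervals starting at 0; correspondingly the increment of \<open>b\<close> is the difference of
  its values at the two ends.\<close>

lemma elementary_integral_step_function:
  assumes a: "0 \<le> a 0" "\<And>i. i < m \<Longrightarrow> a i \<le> a (Suc i)" "a m \<le> T"
  shows "elementary_integral b T (step_function m a c) (\<lambda>\<omega>. \<Sum>i<m. (b (a (Suc i)) \<omega> - b (a i) \<omega>) *\<^sub>R c i)"
  using assms
proof (induction m arbitrary: T)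
  case 0
  show ?case using elementary_integral.zero by (simp add: step_function_def[abs_def])
next
  case (Suc m)
  have mono: "0 \<le> a i" if "i \<le> Suc m" for i
    using that Suc.prems(1,2) by (induction i) (auto intro: order_trans)
  have am: "0 \<le> a m" "a m \<le> a (Suc m)" "a m \<le> T" using mono[of m] Suc.prems(2)[of m] Suc.prems(3) by auto
  have IH: "elementary_integral b T (step_function m a c) (\<lambda>\<omega>. \<Sum>i<m. (b (a (Suc i)) \<omega> - b (a i) \<omega>) *\<^sub>R c i)"
    using Suc am by auto
  have "elementary_integral b T (\<lambda>s. indicat_real {0<..a (Suc m)} s *\<^sub>R c m - indicat_real {0<..a m} s *\<^sub>R c m)
     (\<lambda>\<omega>. b (a (Suc m)) \<omega> *\<^sub>R c m - b (a m) \<omega> *\<^sub>R c m)"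
    using am Suc.prems(3) by (intro elementary_integral_diff elementary_integral_single) auto
  from elementary_integral_add[OF this IH]
  have "elementary_integral b T (\<lambda>s. step_function m a c s + (indicat_real {0<..a (Suc m)} s *\<^sub>R c m - indicat_real {0<..a m} s *\<^sub>R c m))
     (\<lambda>\<omega>. (\<Sum>i<m. (b (a (Suc i)) \<omega> - b (a i) \<omega>) *\<^sub>R c i) + (b (a (Suc m)) \<omega> *\<^sub>R c m - b (a m) \<omega> *\<^sub>R c m))" .
  note E = this
  have I: "indicat_real {0<..a (Suc m)} s *\<^sub>R c m - indicat_real {0<..a m} s *\<^sub>R c m
      = indicat_real {a m<..a (Suc m)} s *\<^sub>R c m" for s
    using am by (auto simp: indicator_def)
  from E have "elementary_integral b T (\<lambda>s. step_function m a c s + indicat_real {a m<..a (Suc m)} s *\<^sub>R c m)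
     (\<lambda>\<omega>. (\<Sum>i<m. (b (a (Suc i)) \<omega> - b (a i) \<omega>) *\<^sub>R c i) + (b (a (Suc m)) \<omega> *\<^sub>R c m - b (a m) \<omega> *\<^sub>R c m))"
    by (simp only: I)
  moreover have "(\<lambda>s. step_function m a c s + indicat_real {a m<..a (Suc m)} s *\<^sub>R c m) = step_function (Suc m) a c"
    unfolding step_function_def by (intro ext) (simp only: sum.lessThan_Suc)
  ultimately show ?case by (simp only: sum.lessThan_Suc scaleR_left_diff_distrib)
qed

lemma indicator_scaleR_L2: "A \<in> sets borel \<Longrightarrow> (\<lambda>s. indicat_real A s *\<^sub>R c) \<in> L2 (lebesgue_on {a..b::real})"
proof (rule L2_bound(1)[of "\<lambda>s. c" _ _ 1])
  interpret finite_measure "lebesgue_on {a..b}" by (rule finite_measure_lebesgue_on)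
  show "(\<lambda>s. c) \<in> L2 (lebesgue_on {a..b})" by (simp add: L2_def)
  assume "A \<in> sets borel" then show "(\<lambda>s. indicat_real A s *\<^sub>R c) \<in> borel_measurable (lebesgue_on {a..b})"
    by (intro borel_measurable_lebesgue_onI) auto
qed (auto simp: indicator_def)

lemma elementary_integral_L2:
  fixes h :: "real \<Rightarrow> 'x::{real_normed_vector, second_countable_topology}"
  assumes "elementary_integral b T h Z" "\<And>t. t \<in> {0..T} \<Longrightarrow> b t \<in> L2 M"
  shows "h \<in> L2 (lebesgue_on {0..T'})" "Z \<in> L2 M"
proof -
  have "h \<in> L2 (lebesgue_on {0..T'}) \<and> Z \<in> L2 M"
    using assms(1)
  proof (induction rule: elementary_integral.induct)
    case (step h Z t c)
    have "(\<lambda>\<omega>. b t \<omega> *\<^sub>R c) \<in> L2 M"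
    proof (rule L2_bound(1)[of "b t" _ _ "norm c"])
      show b: "b t \<in> L2 M" using assms(2) step by auto
      show "(\<lambda>\<omega>. b t \<omega> *\<^sub>R c) \<in> borel_measurable M" using L2_measurable[OF b] by measurable
    qed auto
    then show ?case using step by (auto intro!: L2_add indicator_scaleR_L2)
  qed auto
  then show "h \<in> L2 (lebesgue_on {0..T'})" "Z \<in> L2 M" by auto
qed

lemma integral_indicator_Ioc:
  assumes "0 \<le> t" "t \<le> T"
  shows "(\<integral>s. indicat_real {0<..t} s \<partial>lebesgue_on {0..T}) = t"
proof -
  have "{0<..t} \<inter> {0..T} = {0<..t}" using assms by auto
  moreover have "Sigma_Algebra.measure (lebesgue_on {0..T}) {0<..t} = t"
    using assms by (subst measure_restrict_space) auto
  ultimately show ?thesis by (simp add: space_restrict_space)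
qed

text \<open>With \<open>\<kappa> = 1\<close> this is the isometry for one Brownian motion, with \<open>\<kappa> = 0\<close> the orthogonality of
  integrals with respect to independent ones.\<close>

lemma elementary_integral_inner:
  fixes h h' :: "real \<Rightarrow> 'x::{real_inner, second_countable_topology}"
  assumes b: "\<And>t. t \<in> {0..T} \<Longrightarrow> b t \<in> L2 M" "\<And>t. t \<in> {0..T} \<Longrightarrow> b' t \<in> L2 M"
    and cov: "\<And>s t. s \<in> {0..T} \<Longrightarrow> t \<in> {0..T} \<Longrightarrow> (\<integral>\<omega>. b s \<omega> * b' t \<omega> \<partial>M) = \<kappa> * min s t"
    and el: "elementary_integral b T h Z" "elementary_integral b' T h' Z'"
  shows "L2_inner M Z Z' = \<kappa> * L2_inner (lebesgue_on {0..T}) h h'"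
proof -
  let ?L = "lebesgue_on {0..T}"
  have add_left: "L2_inner N (\<lambda>x. f x + g x) k = L2_inner N f k + L2_inner N g k"
    if "f \<in> L2 N" "g \<in> L2 N" "k \<in> L2 N" for f g k :: "'q \<Rightarrow> 'x" and N
    unfolding L2_inner_def using that by (simp add: inner_add_left L2_inner_integrable)
  have add_right: "L2_inner N k (\<lambda>x. f x + g x) = L2_inner N k f + L2_inner N k g"
    if "f \<in> L2 N" "g \<in> L2 N" "k \<in> L2 N" for f g k :: "'q \<Rightarrow> 'x" and N
    unfolding L2_inner_def using that by (simp add: inner_add_right L2_inner_integrable)
  have bc: "(\<lambda>\<omega>. b t \<omega> *\<^sub>R c) \<in> L2 M" "(\<lambda>\<omega>. b' t \<omega> *\<^sub>R c) \<in> L2 M" if "0 \<le> t" "t \<le> T" for t and c :: 'x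
    using elementary_integral_L2(2)[OF elementary_integral_single[OF that, of b c] b(1)]
      elementary_integral_L2(2)[OF elementary_integral_single[OF that, of b' c] b(2)] by auto
  have ic: "(\<lambda>s. indicat_real {0<..t} s *\<^sub>R c) \<in> L2 ?L" for t and c :: 'x
    by (rule indicator_scaleR_L2) simp
  \<comment> \<open>The intervals \<open>{0<..s}\<close> and \<open>{0<..t}\<close> overlap in
    length \<open>min s t\<close>, which is the covariance divided by \<kappa>. The rest is
    bilinearity, by induction first on the second and then on the first pair.\<close>
  have base: "L2_inner M (\<lambda>\<omega>. b s \<omega> *\<^sub>R c) (\<lambda>\<omega>. b' t \<omega> *\<^sub>R d)
     = \<kappa> * L2_inner ?L (\<lambda>r. indicat_real {0<..s} r *\<^sub>R c) (\<lambda>r. indicat_real {0<..t} r *\<^sub>R d)"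
    if "0 \<le> s" "s \<le> T" "0 \<le> t" "t \<le> T" for s t and c d :: 'x
  proof -
    have "L2_inner M (\<lambda>\<omega>. b s \<omega> *\<^sub>R c) (\<lambda>\<omega>. b' t \<omega> *\<^sub>R d) = (\<integral>\<omega>. (b s \<omega> * b' t \<omega>) * (c \<bullet> d) \<partial>M)"
      unfolding L2_inner_def by (simp add: mult_ac)
    also have "\<dots> = \<kappa> * (min s t * (c \<bullet> d))" using cov[of s t] that by simp
    also have "min s t * (c \<bullet> d) = (\<integral>r. indicat_real {0<..min s t} r * (c \<bullet> d) \<partial>?L)"
      using integral_indicator_Ioc[of "min s t" T] that by simp
    also have "\<dots> = L2_inner ?L (\<lambda>r. indicat_real {0<..s} r *\<^sub>R c) (\<lambda>r. indicat_real {0<..t} r *\<^sub>R d)"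
      unfolding L2_inner_def by (intro Bochner_Integration.integral_cong) (auto simp: indicator_def)
    finally show ?thesis by (simp add: mult.assoc)
  qed
  have single: "L2_inner M (\<lambda>\<omega>. b s \<omega> *\<^sub>R c) Z' = \<kappa> * L2_inner ?L (\<lambda>r. indicat_real {0<..s} r *\<^sub>R c) h'"
    if s: "0 \<le> s" "s \<le> T" for s and c :: 'x
    using el(2)
  proof (induction rule: elementary_integral.induct)
    case zero show ?case by (simp add: L2_inner_def)
  next
    case (step h Z t d)
    have "h \<in> L2 ?L" "Z \<in> L2 M" using elementary_integral_L2[OF step.hyps(1) b(2)] by auto
    then show ?case using step s by (simp add: add_right bc ic base distrib_left)
  qed
  note L' = elementary_integral_L2[OF el(2) b(2)]
  show ?thesis using el(1)
  proof (induction rule: elementary_integral.induct)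
    case zero show ?case by (simp add: L2_inner_def)
  next
    case (step h Z t d)
    have "h \<in> L2 ?L" "Z \<in> L2 M" using elementary_integral_L2[OF step.hyps(1) b(1)] by auto
    then show ?case using step L' by (simp add: add_left bc ic single distrib_left)
  qed
qed

text \<open>The sequential form of the Wiener integral, always over the whole of
  \<open>{0..T}\<close>. Integrals up to different times are represented by cutting off the
  integrand, so that they can be subtracted from one another.\<close>

definition wiener_pair ::
  "'w measure \<Rightarrow> (real \<Rightarrow> 'w \<Rightarrow> real) \<Rightarrow> real \<Rightarrow>
   (real \<Rightarrow> 'x::{real_normed_vector,second_countable_topology}) \<Rightarrow> ('w \<Rightarrow> 'x) \<Rightarrow> bool" where
  "wiener_pair M b T h Z \<longleftrightarrow> h \<in> L2 (lebesgue_on {0..T}) \<and> Z \<in> L2 M \<and>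
     (\<exists>hs Zs. (\<forall>k::nat. elementary_integral b T (hs k) (Zs k)) \<and>
        (\<lambda>k. L2_norm (lebesgue_on {0..T}) (\<lambda>s. hs k s - h s)) \<longlonglongrightarrow> 0 \<and>
        (\<lambda>k. L2_norm M (\<lambda>\<omega>. Zs k \<omega> - Z \<omega>)) \<longlonglongrightarrow> 0)"

lemma wiener_pair_inner:
  fixes h h' :: "real \<Rightarrow> 'x::{real_inner, second_countable_topology}"
  assumes b: "\<And>t. t \<in> {0..T} \<Longrightarrow> b t \<in> L2 M" "\<And>t. t \<in> {0..T} \<Longrightarrow> b' t \<in> L2 M"
    and cov: "\<And>s t. s \<in> {0..T} \<Longrightarrow> t \<in> {0..T} \<Longrightarrow> (\<integral>\<omega>. b s \<omega> * b' t \<omega> \<partial>M) = \<kappa> * min s t"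
    and w: "wiener_pair M b T h Z" "wiener_pair M b' T h' Z'"
  shows "L2_inner M Z Z' = \<kappa> * L2_inner (lebesgue_on {0..T}) h h'"
proof -
  let ?L = "lebesgue_on {0..T}"
  obtain hs Zs where 1: "\<And>k. elementary_integral b T (hs k) (Zs k)"
    "(\<lambda>k. L2_norm ?L (\<lambda>s. hs k s - h s)) \<longlonglongrightarrow> 0" "(\<lambda>k. L2_norm M (\<lambda>\<omega>. Zs k \<omega> - Z \<omega>)) \<longlonglongrightarrow> 0"
    using w(1) unfolding wiener_pair_def by blast
  obtain hs' Zs' where 2: "\<And>k. elementary_integral b' T (hs' k) (Zs' k)"
    "(\<lambda>k. L2_norm ?L (\<lambda>s. hs' k s - h' s)) \<longlonglongrightarrow> 0" "(\<lambda>k. L2_norm M (\<lambda>\<omega>. Zs' k \<omega> - Z' \<omega>)) \<longlonglongrightarrow> 0"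
    using w(2) unfolding wiener_pair_def by blast
  have L: "h \<in> L2 ?L" "Z \<in> L2 M" "h' \<in> L2 ?L" "Z' \<in> L2 M" using w by (auto simp: wiener_pair_def)
  have "(\<lambda>k. L2_inner M (Zs k) (Zs' k)) \<longlonglongrightarrow> L2_inner M Z Z'"
    by (rule L2_inner_tendsto[OF elementary_integral_L2(2)[OF 1(1) b(1)] L(2)
        elementary_integral_L2(2)[OF 2(1) b(2)] L(4) 1(3) 2(3)])
  moreover have "(\<lambda>k. L2_inner ?L (hs k) (hs' k)) \<longlonglongrightarrow> L2_inner ?L h h'"
    by (rule L2_inner_tendsto[OF elementary_integral_L2(1)[OF 1(1) b(1)] L(1)
        elementary_integral_L2(1)[OF 2(1) b(2)] L(3) 1(2) 2(2)])
  then have "(\<lambda>k. \<kappa> * L2_inner ?L (hs k) (hs' k)) \<longlonglongrightarrow> \<kappa> * L2_inner ?L h h'" by (intro tendsto_intros)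
  ultimately show ?thesis
    using elementary_integral_inner[OF b cov 1(1) 2(1)] by (auto intro: LIMSEQ_unique)
qed

lemma wiener_pair_diff:
  fixes h h' :: "real \<Rightarrow> 'x::{real_normed_vector, second_countable_topology}"
  assumes b: "\<And>t. t \<in> {0..T} \<Longrightarrow> b t \<in> L2 M"
    and w: "wiener_pair M b T h Z" "wiener_pair M b T h' Z'"
  shows "wiener_pair M b T (\<lambda>s. h s - h' s) (\<lambda>\<omega>. Z \<omega> - Z' \<omega>)"
proof -
  let ?L = "lebesgue_on {0..T}"
  obtain hs Zs where 1: "\<And>k. elementary_integral b T (hs k) (Zs k)"
    "(\<lambda>k. L2_norm ?L (\<lambda>s. hs k s - h s)) \<longlonglongrightarrow> 0" "(\<lambda>k. L2_norm M (\<lambda>\<omega>. Zs k \<omega> - Z \<omega>)) \<longlonglongrightarrow> 0"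
    using w(1) unfolding wiener_pair_def by blast
  obtain hs' Zs' where 2: "\<And>k. elementary_integral b T (hs' k) (Zs' k)"
    "(\<lambda>k. L2_norm ?L (\<lambda>s. hs' k s - h' s)) \<longlonglongrightarrow> 0" "(\<lambda>k. L2_norm M (\<lambda>\<omega>. Zs' k \<omega> - Z' \<omega>)) \<longlonglongrightarrow> 0"
    using w(2) unfolding wiener_pair_def by blast
  have L: "h \<in> L2 ?L" "Z \<in> L2 M" "h' \<in> L2 ?L" "Z' \<in> L2 M" using w by (auto simp: wiener_pair_def)
  note A = L2_norm_tendsto_diff[OF elementary_integral_L2(1)[OF 1(1) b] L(1) elementary_integral_L2(1)[OF 2(1) b] L(3) 1(2) 2(2)]
  note B = L2_norm_tendsto_diff[OF elementary_integral_L2(2)[OF 1(1) b] L(2) elementary_integral_L2(2)[OF 2(1) b] L(4) 1(3) 2(3)]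
  have "\<exists>hs Zs. (\<forall>k::nat. elementary_integral b T (hs k) (Zs k)) \<and>
        (\<lambda>k. L2_norm ?L (\<lambda>s. hs k s - (h s - h' s))) \<longlonglongrightarrow> 0 \<and>
        (\<lambda>k. L2_norm M (\<lambda>\<omega>. Zs k \<omega> - (Z \<omega> - Z' \<omega>))) \<longlonglongrightarrow> 0"
    by (rule exI[of _ "\<lambda>k s. hs k s - hs' k s"], rule exI[of _ "\<lambda>k \<omega>. Zs k \<omega> - Zs' k \<omega>"])
      (use A B elementary_integral_diff[OF 1(1) 2(1)] in auto)
  then show ?thesis using L by (auto simp: wiener_pair_def intro: L2_diff)
qed

lemma wiener_pair_isometry:
  fixes h :: "real \<Rightarrow> 'x::{real_inner, second_countable_topology}"
  assumes b: "\<And>t. t \<in> {0..T} \<Longrightarrow> b t \<in> L2 M"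
    and cov: "\<And>s t. s \<in> {0..T} \<Longrightarrow> t \<in> {0..T} \<Longrightarrow> (\<integral>\<omega>. b s \<omega> * b t \<omega> \<partial>M) = min s t"
    and w: "wiener_pair M b T h Z"
  shows "L2_norm M Z = L2_norm (lebesgue_on {0..T}) h"
proof -
  have "L2_inner M Z Z = 1 * L2_inner (lebesgue_on {0..T}) h h"
    by (rule wiener_pair_inner[OF b b _ w w]) (use cov in auto)
  then have "(L2_norm M Z)\<^sup>2 = (L2_norm (lebesgue_on {0..T}) h)\<^sup>2" by (simp add: L2_inner_self)
  then show ?thesis by (simp add: power2_eq_iff_nonneg)
qed

text \<open>Both sides reduce to the same integral over the line. Extension by zero thus places the
  spaces over all \<open>{0..t}\<close> isometrically inside the one over
  \<open>{0..T}\<close>.\<close>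

lemma indicator_cut:
  fixes t T :: real
  assumes "0 \<le> t" "t \<le> T"
  shows "(h \<in> borel_measurable (lebesgue_on {0..t})) \<longleftrightarrow>
      (\<lambda>s. indicat_real {0..t} s *\<^sub>R h s) \<in> borel_measurable (lebesgue_on {0..T})" (is ?A)
    and "h \<in> borel_measurable (lebesgue_on {0..t}) \<Longrightarrow>
      (\<integral>\<^sup>+s. ennreal ((norm (h s))\<^sup>2) \<partial>lebesgue_on {0..t}) =
      (\<integral>\<^sup>+s. ennreal ((norm (indicat_real {0..t} s *\<^sub>R h s))\<^sup>2) \<partial>lebesgue_on {0..T})"
    and "h \<in> L2 (lebesgue_on {0..t}) \<longleftrightarrow> (\<lambda>s. indicat_real {0..t} s *\<^sub>R h s) \<in> L2 (lebesgue_on {0..T})"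
    and "L2_norm (lebesgue_on {0..t}) h = L2_norm (lebesgue_on {0..T}) (\<lambda>s. indicat_real {0..t} s *\<^sub>R h s)"
proof -
  have eq: "indicat_real {0..T} s *\<^sub>R indicat_real {0..t} s *\<^sub>R h s = indicat_real {0..t} s *\<^sub>R h s" for s
    using assms by (auto simp: indicator_def)
  show A: ?A
  proof -
    have iff: "g \<in> borel_measurable (lebesgue_on {0..u}) \<longleftrightarrow> (\<lambda>s. indicat_real {0..u} s *\<^sub>R g s) \<in> borel_measurable lebesgue"
      for u and g :: "real \<Rightarrow> 'a"
      by (rule borel_measurable_restrict_space_iff) simp
    show ?thesis by (simp only: iff eq)
  qed
  have e2: "ennreal ((norm (indicat_real {0..t} s *\<^sub>R h s))\<^sup>2) * indicator {0..T} s
      = ennreal ((norm (h s))\<^sup>2) * indicator {0..t} s" for s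
    using assms by (auto simp: indicator_def)
  show B: "(\<integral>\<^sup>+s. ennreal ((norm (h s))\<^sup>2) \<partial>lebesgue_on {0..t}) =
      (\<integral>\<^sup>+s. ennreal ((norm (indicat_real {0..t} s *\<^sub>R h s))\<^sup>2) \<partial>lebesgue_on {0..T})"
  proof -
    have R: "(\<integral>\<^sup>+s. F s \<partial>lebesgue_on {0..u}) = (\<integral>\<^sup>+s. F s * indicator {0..u} s \<partial>lebesgue)"
      for F :: "real \<Rightarrow> ennreal" and u
      by (rule nn_integral_restrict_space) simp
    show ?thesis by (simp only: R e2)
  qed
  show "h \<in> L2 (lebesgue_on {0..t}) \<longleftrightarrow> (\<lambda>s. indicat_real {0..t} s *\<^sub>R h s) \<in> L2 (lebesgue_on {0..T})"
    unfolding L2_iff A B ..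
  have e3: "indicat_real {0..T} s *\<^sub>R (norm (indicat_real {0..t} s *\<^sub>R h s))\<^sup>2 = indicat_real {0..t} s *\<^sub>R (norm (h s))\<^sup>2" for s
    using assms by (auto simp: indicator_def)
  show "L2_norm (lebesgue_on {0..t}) h = L2_norm (lebesgue_on {0..T}) (\<lambda>s. indicat_real {0..t} s *\<^sub>R h s)"
  proof -
    have R: "(\<integral>s. F s \<partial>lebesgue_on {0..u}) = (\<integral>s. indicat_real {0..u} s *\<^sub>R F s \<partial>lebesgue)"
      for F :: "real \<Rightarrow> real" and u
      by (rule integral_restrict_space) simp
    show ?thesis by (simp only: L2_norm_def R e3)
  qed
qed

lemma step_function_outside:
  assumes "0 \<le> a 0" "\<And>i. i < m \<Longrightarrow> a i \<le> a (Suc i)" "a m = t"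
  shows "indicat_real {0..t} s *\<^sub>R step_function m a c s = step_function m a c s"
proof (cases "s \<in> {0..t}")
  case False
  have mono: "0 \<le> a i" if "i \<le> m" for i
    using that assms(1,2) by (induction i) (auto intro: order_trans)
  have up: "a i \<le> t" if "i \<le> m" for i
    using that
  proof (induction rule: inc_induct)
    case base show ?case using assms(3) by simp
  next
    case (step n) then show ?case using assms(2)[of n] by linarith
  qed
  have "s \<notin> {a i<..a (Suc i)}" if "i < m" for i
    using mono[of i] up[of "Suc i"] that False by auto
  then show ?thesis by (simp add: step_function_def)
qed simp

text \<open>Step functions of accuracy (1/2)^k are picked from the definition. They vanish outside
  the interval of their partition, so cutting off at \<open>t\<close> changes only the integrand,
  not its approximations.\<close>

lemma has_wiener_integral_pair:
  fixes h :: "real \<Rightarrow> 'x::{real_normed_vector, second_countable_topology}"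
  assumes b: "\<And>t. t \<in> {0..T} \<Longrightarrow> b t \<in> L2 M"
    and t: "0 \<le> t" "t \<le> T" and w: "has_wiener_integral M b t h Z"
  shows "wiener_pair M b T (\<lambda>s. indicat_real {0..t} s *\<^sub>R h s) Z"
proof -
  let ?L = "lebesgue_on {0..T}" and ?h = "\<lambda>s. indicat_real {0..t} s *\<^sub>R h s"
  have L: "?h \<in> L2 ?L" "Z \<in> L2 M" "h \<in> L2 (lebesgue_on {0..t})"
    using w indicator_cut(3)[OF t, of h] by (auto simp: has_wiener_integral_def)
  have "\<exists>h' Z'. elementary_integral b T h' Z' \<and> L2_norm ?L (\<lambda>s. h' s - ?h s) \<le> (1/2) ^ k \<and>
     L2_norm M (\<lambda>\<omega>. Z' \<omega> - Z \<omega>) \<le> (1/2) ^ k" for k :: nat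
  proof -
    have "0 < ((1/2 :: real) ^ k)\<^sup>2" by simp
    then obtain m a c where mac: "a 0 = 0" "a m = t" "\<forall>i<m. a i \<le> a (Suc i)"
      "(\<integral>\<^sup>+s. ennreal ((norm (h s - step_function m a c s))\<^sup>2) \<partial>lebesgue_on {0..t}) < ennreal (((1/2) ^ k)\<^sup>2)"
      "(\<integral>\<^sup>+\<omega>. ennreal ((norm (Z \<omega> - (\<Sum>i<m. (b (a (Suc i)) \<omega> - b (a i) \<omega>) *\<^sub>R c i)))\<^sup>2) \<partial>M) < ennreal (((1/2) ^ k)\<^sup>2)"
      using w unfolding has_wiener_integral_def by blast
    let ?Z = "\<lambda>\<omega>. \<Sum>i<m. (b (a (Suc i)) \<omega> - b (a i) \<omega>) *\<^sub>R c i"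
    have el: "elementary_integral b T (step_function m a c) ?Z"
      using mac t by (intro elementary_integral_step_function) auto
    have 1: "L2_norm M (\<lambda>\<omega>. Z \<omega> - ?Z \<omega>) \<le> (1/2) ^ k"
      using mac(5) by (intro L2_norm_leI) auto
    have "L2_norm (lebesgue_on {0..t}) (\<lambda>s. h s - step_function m a c s) \<le> (1/2) ^ k"
      using mac(4) by (intro L2_norm_leI) auto
    then have "L2_norm ?L (\<lambda>s. indicat_real {0..t} s *\<^sub>R (h s - step_function m a c s)) \<le> (1/2) ^ k"
      by (simp add: indicator_cut(4)[OF t])
    moreover have "indicat_real {0..t} s *\<^sub>R step_function m a c s = step_function m a c s" for s
      using mac by (intro step_function_outside) auto
    ultimately have 2: "L2_norm ?L (\<lambda>s. ?h s - step_function m a c s) \<le> (1/2) ^ k"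
      by (simp add: scaleR_diff_right)
    show ?thesis
      using el 1 2 by (intro exI[of _ "step_function m a c"] exI[of _ ?Z])
        (simp add: L2_norm_minus_commute[of _ "step_function m a c"] L2_norm_minus_commute[of M ?Z])
  qed
  then have "\<forall>k. \<exists>p. elementary_integral b T (fst p) (snd p) \<and> L2_norm ?L (\<lambda>s. fst p s - ?h s) \<le> (1/2) ^ k \<and>
     L2_norm M (\<lambda>\<omega>. snd p \<omega> - Z \<omega>) \<le> (1/2) ^ k"
    by simp
  from choice[OF this] obtain p where p: "\<And>k. elementary_integral b T (fst (p k)) (snd (p k)) \<and>
     L2_norm ?L (\<lambda>s. fst (p k) s - ?h s) \<le> (1/2) ^ k \<and> L2_norm M (\<lambda>\<omega>. snd (p k) \<omega> - Z \<omega>) \<le> (1/2) ^ k"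
    by blast
  define hs Zs where "hs k = fst (p k)" and "Zs k = snd (p k)" for k
  have hz: "\<And>k. elementary_integral b T (hs k) (Zs k)"
    "\<And>k. L2_norm ?L (\<lambda>s. hs k s - ?h s) \<le> (1/2) ^ k" "\<And>k. L2_norm M (\<lambda>\<omega>. Zs k \<omega> - Z \<omega>) \<le> (1/2) ^ k"
    using p by (simp_all add: hs_def Zs_def)
  have z: "(\<lambda>k. (1/2 :: real) ^ k) \<longlonglongrightarrow> 0" by (rule LIMSEQ_power_zero) simp
  have "(\<lambda>k. L2_norm ?L (\<lambda>s. hs k s - ?h s)) \<longlonglongrightarrow> 0" "(\<lambda>k. L2_norm M (\<lambda>\<omega>. Zs k \<omega> - Z \<omega>)) \<longlonglongrightarrow> 0"
    by (rule Lim_null_comparison[OF _ z]; use hz in \<open>auto intro!: always_eventually\<close>)+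
  then show ?thesis using L hz(1) unfolding wiener_pair_def by blast
qed

subsection \<open>Density of step functions\<close>

text \<open>Approximability on all fine enough uniform grids is stable under sums, since the grids agree.\<close>

definition grid_approximable :: "real \<Rightarrow> (real \<Rightarrow> 'x::{real_normed_vector,second_countable_topology}) \<Rightarrow> bool" where
  "grid_approximable t h \<longleftrightarrow> h \<in> L2 (lebesgue_on {0..t}) \<and>
     (\<forall>\<epsilon>>0. \<exists>N>0. \<forall>m\<ge>N. \<exists>c. L2_norm (lebesgue_on {0..t})
        (\<lambda>s. h s - step_function m (\<lambda>i. t * real i / real m) c s) < \<epsilon>)"

lemma step_function_L2: "step_function m a c \<in> L2 (lebesgue_on {u..v})"
  unfolding step_function_def[abs_def] by (intro L2_sum indicator_scaleR_L2) auto

lemma step_function_add: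
  "step_function m a c s + step_function m a d s = step_function m a (\<lambda>i. c i + d i) s"
  by (simp add: step_function_def scaleR_add_right sum.distrib)

lemma step_function_scaleR:
  "step_function m a (\<lambda>i. x *\<^sub>R c i) s = x *\<^sub>R step_function m a c s"
  unfolding step_function_def scaleR_sum_right by (intro sum.cong refl) simp

lemma grid_approximable_add:
  assumes "grid_approximable t h" "grid_approximable t k"
  shows "grid_approximable t (\<lambda>s. h s + k s)"
  unfolding grid_approximable_def
proof (intro conjI allI impI)
  let ?L = "lebesgue_on {0..t}"
  have L: "h \<in> L2 ?L" "k \<in> L2 ?L" using assms by (auto simp: grid_approximable_def)
  then show "(\<lambda>s. h s + k s) \<in> L2 ?L" by (rule L2_add)
  fix \<epsilon> :: real assume "0 < \<epsilon>"
  then have e: "0 < \<epsilon> / 2" by simp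
  obtain N where N: "N > 0" "\<And>m. m \<ge> N \<Longrightarrow> \<exists>c. L2_norm ?L (\<lambda>s. h s - step_function m (\<lambda>i. t * real i / real m) c s) < \<epsilon> / 2"
    using assms(1) e unfolding grid_approximable_def by meson
  obtain N' where N': "\<And>m. m \<ge> N' \<Longrightarrow> \<exists>c. L2_norm ?L (\<lambda>s. k s - step_function m (\<lambda>i. t * real i / real m) c s) < \<epsilon> / 2"
    using assms(2) e unfolding grid_approximable_def by meson
  have "\<exists>c. L2_norm ?L (\<lambda>s. h s + k s - step_function m (\<lambda>i. t * real i / real m) c s) < \<epsilon>" if "m \<ge> max N N'" for m
  proof -
    let ?a = "\<lambda>i. t * real i / real m"
    obtain c d where cd: "L2_norm ?L (\<lambda>s. h s - step_function m ?a c s) < \<epsilon> / 2"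
      "L2_norm ?L (\<lambda>s. k s - step_function m ?a d s) < \<epsilon> / 2"
      using N(2)[of m] N'[of m] \<open>m \<ge> max N N'\<close> by auto
    have "L2_norm ?L (\<lambda>s. (h s - step_function m ?a c s) + (k s - step_function m ?a d s)) < \<epsilon>"
      using L2_norm_triangle[OF L2_diff[OF L(1) step_function_L2] L2_diff[OF L(2) step_function_L2], of m ?a c m ?a d] cd
      by linarith
    then have "L2_norm ?L (\<lambda>s. h s + k s - step_function m ?a (\<lambda>i. c i + d i) s) < \<epsilon>"
      by (simp add: step_function_add[symmetric] algebra_simps)
    then show ?thesis by blast
  qed
  then show "\<exists>N>0. \<forall>m\<ge>N. \<exists>c. L2_norm ?L (\<lambda>s. h s + k s - step_function m (\<lambda>i. t * real i / real m) c s) < \<epsilon>"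
    using N(1) by (intro exI[of _ "max N N'"]) auto
qed

lemma grid_approximable_scaleR:
  assumes "grid_approximable t h"
  shows "grid_approximable t (\<lambda>s. x *\<^sub>R h s)"
  unfolding grid_approximable_def
proof (intro conjI allI impI)
  let ?L = "lebesgue_on {0..t}"
  show "(\<lambda>s. x *\<^sub>R h s) \<in> L2 ?L" using assms by (auto simp: grid_approximable_def intro: L2_scaleR)
  fix \<epsilon> :: real assume "0 < \<epsilon>"
  then have e: "0 < \<epsilon> / (\<bar>x\<bar> + 1)" by simp
  obtain N where N: "N > 0" "\<And>m. m \<ge> N \<Longrightarrow> \<exists>c. L2_norm ?L (\<lambda>s. h s - step_function m (\<lambda>i. t * real i / real m) c s) < \<epsilon> / (\<bar>x\<bar> + 1)"
    using assms e unfolding grid_approximable_def by meson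
  have "\<exists>c. L2_norm ?L (\<lambda>s. x *\<^sub>R h s - step_function m (\<lambda>i. t * real i / real m) c s) < \<epsilon>" if m: "m \<ge> N" for m
  proof -
    let ?a = "\<lambda>i. t * real i / real m"
    obtain c where c: "L2_norm ?L (\<lambda>s. h s - step_function m ?a c s) < \<epsilon> / (\<bar>x\<bar> + 1)"
      using N(2)[OF m] by auto
    have "L2_norm ?L (\<lambda>s. x *\<^sub>R h s - step_function m ?a (\<lambda>i. x *\<^sub>R c i) s) = \<bar>x\<bar> * L2_norm ?L (\<lambda>s. h s - step_function m ?a c s)"
      by (simp add: step_function_scaleR L2_norm_scaleR[symmetric] scaleR_diff_right)
    also have "\<dots> \<le> (\<bar>x\<bar> + 1) * L2_norm ?L (\<lambda>s. h s - step_function m ?a c s)"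
      by (intro mult_right_mono) auto
    also have "\<dots> < \<epsilon>" using c by (simp add: field_simps)
    finally show ?thesis by blast
  qed
  then show "\<exists>N>0. \<forall>m\<ge>N. \<exists>c. L2_norm ?L (\<lambda>s. x *\<^sub>R h s - step_function m (\<lambda>i. t * real i / real m) c s) < \<epsilon>"
    using N(1) by blast
qed

lemma grid_approximable_closed:
  assumes h: "h \<in> L2 (lebesgue_on {0..t})"
    and k: "\<And>n. grid_approximable t (k n)"
    and lim: "(\<lambda>n::nat. L2_norm (lebesgue_on {0..t}) (\<lambda>s. k n s - h s)) \<longlonglongrightarrow> 0"
  shows "grid_approximable t h"
  unfolding grid_approximable_def
proof (intro conjI allI impI h)
  let ?L = "lebesgue_on {0..t}"
  have L: "k n \<in> L2 ?L" for n using k by (auto simp: grid_approximable_def)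
  fix \<epsilon> :: real assume "0 < \<epsilon>"
  then have e: "0 < \<epsilon> / 2" by simp
  obtain n where n: "L2_norm ?L (\<lambda>s. k n s - h s) < \<epsilon> / 2"
    using order_tendstoD(2)[OF lim e] by (auto simp: eventually_sequentially)
  obtain N where N: "N > 0" "\<And>m. m \<ge> N \<Longrightarrow> \<exists>c. L2_norm ?L (\<lambda>s. k n s - step_function m (\<lambda>i. t * real i / real m) c s) < \<epsilon> / 2"
    using k[of n] e unfolding grid_approximable_def by meson
  have "\<exists>c. L2_norm ?L (\<lambda>s. h s - step_function m (\<lambda>i. t * real i / real m) c s) < \<epsilon>" if m: "m \<ge> N" for m
  proof -
    let ?a = "\<lambda>i. t * real i / real m"
    obtain c where c: "L2_norm ?L (\<lambda>s. k n s - step_function m ?a c s) < \<epsilon> / 2"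
      using N(2)[OF m] by auto
    then show ?thesis
      using L2_norm_dist_triangle[OF h L[of n] step_function_L2[of m ?a c]] n L2_norm_minus_commute[of ?L h "k n"]
      by (intro exI[of _ c]) linarith
  qed
  then show "\<exists>N>0. \<forall>m\<ge>N. \<exists>c. L2_norm ?L (\<lambda>s. h s - step_function m (\<lambda>i. t * real i / real m) c s) < \<epsilon>"
    using N(1) by blast
qed

lemma grid_approximable_cong_AE:
  assumes "grid_approximable t k" "h \<in> borel_measurable (lebesgue_on {0..t})" "AE s in lebesgue_on {0..t}. h s = k s"
  shows "grid_approximable t h"
proof (rule grid_approximable_closed[where k = "\<lambda>_. k"])
  have k: "k \<in> L2 (lebesgue_on {0..t})" using assms(1) by (simp add: grid_approximable_def)
  show h: "h \<in> L2 (lebesgue_on {0..t})" by (rule L2_cong_AE(1)[OF k assms(2,3)])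
  have "L2_norm (lebesgue_on {0..t}) (\<lambda>s. k s - h s) = L2_norm (lebesgue_on {0..t}) (\<lambda>s. 0)"
    using assms(3) L2_measurable[OF k] assms(2) by (intro L2_norm_cong_AE) (auto elim: eventually_mono)
  then show "(\<lambda>n::nat. L2_norm (lebesgue_on {0..t}) (\<lambda>s. k s - h s)) \<longlonglongrightarrow> 0" by simp
qed (use assms in auto)

text \<open>A step function that is constant on the first \<open>j\<close> cells telescopes to a
  single indicator ending at the \<open>j\<close>-th grid point.\<close>

lemma step_function_initial:
  assumes "j \<le> m" "0 \<le> (t::real)" "0 < m"
  shows "step_function m (\<lambda>i. t * real i / real m) (\<lambda>i. if i < j then c else 0) s
    = indicat_real {0<..t * real j / real m} s *\<^sub>R c"
proof -
  let ?a = "\<lambda>i. t * real i / real m"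
  have "step_function m ?a (\<lambda>i. if i < j then c else 0) s = (\<Sum>i<j. indicat_real {?a i<..?a (Suc i)} s *\<^sub>R c)"
    unfolding step_function_def using assms by (intro sum.mono_neutral_cong_right) auto
  also have "\<dots> = (\<Sum>i<j. indicat_real {0<..?a (Suc i)} s *\<^sub>R c - indicat_real {0<..?a i} s *\<^sub>R c)"
  proof (intro sum.cong refl)
    fix i
    have "0 \<le> ?a i" "?a i \<le> ?a (Suc i)" using assms by (auto simp: divide_simps intro!: mult_left_mono)
    then show "indicat_real {?a i<..?a (Suc i)} s *\<^sub>R c = indicat_real {0<..?a (Suc i)} s *\<^sub>R c - indicat_real {0<..?a i} s *\<^sub>R c"
      by (auto simp: indicator_def)
  qed
  also have "\<dots> = indicat_real {0<..?a j} s *\<^sub>R c - indicat_real {0<..?a 0} s *\<^sub>R c"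
    by (rule sum_lessThan_telescope)
  finally show ?thesis by simp
qed

text \<open>The endpoint \<open>q\<close> is replaced by the last grid point \<open>p\<close> not
  beyond it. The two functions differ only on \<open>{p<..q}\<close>, which is shorter than one
  cell.\<close>

lemma grid_approximable_initial:
  fixes c :: "'x::{real_normed_vector, second_countable_topology}"
  assumes t: "0 \<le> t" "0 < q" "q \<le> t"
  shows "grid_approximable t (\<lambda>s. indicat_real {0<..q} s *\<^sub>R c)"
  unfolding grid_approximable_def
proof (intro conjI allI impI)
  let ?L = "lebesgue_on {0..t}"
  show "(\<lambda>s. indicat_real {0<..q} s *\<^sub>R c) \<in> L2 ?L" by (rule indicator_scaleR_L2) simp
  fix \<epsilon> :: real assume e: "0 < \<epsilon>"
  have tp: "0 < t" using t by simp
  \<comment> \<open>Chosen so that a single cell, of length \<open>t / m\<close>, contributes less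
    than the square of \<epsilon> to the squared error.\<close>
  obtain N0 where N0: "t * (norm c)\<^sup>2 / \<epsilon>\<^sup>2 < real N0" using reals_Archimedean2 by blast
  have "L2_norm ?L (\<lambda>s. indicat_real {0<..q} s *\<^sub>R c -
       step_function m (\<lambda>i. t * real i / real m) (\<lambda>i. if i < nat \<lfloor>q * real m / t\<rfloor> then c else 0) s) < \<epsilon>"
    if m: "m \<ge> N0 + 1" for m
  proof -
    define j where "j = nat \<lfloor>q * real m / t\<rfloor>"
    have q0: "0 \<le> q * real m / t" "q * real m / t \<le> real m"
      using t tp by (auto simp: pos_divide_le_eq mult.commute[of "real m"] intro!: mult_right_mono)
    then have j: "real j \<le> q * real m / t" "q * real m / t < real j + 1" by (auto simp: j_def)
    have jm: "j \<le> m" using j(1) q0(2) by linarith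
    define p where "p = t * real j / real m"
    have p: "0 \<le> p" "p \<le> q" "q < p + t / real m"
      using j t tp m by (auto simp: p_def field_simps)
    have "L2_norm ?L (\<lambda>s. indicat_real {0<..q} s *\<^sub>R c - indicat_real {0<..p} s *\<^sub>R c)
      = L2_norm ?L (\<lambda>s. indicat_real {p<..q} s *\<^sub>R c)"
      using p by (intro L2_norm_cong) (auto simp: indicator_def)
    also have "\<dots> = sqrt (\<integral>s. indicat_real {p<..q} s * (norm c)\<^sup>2 \<partial>?L)"
      unfolding L2_norm_def by (intro arg_cong[where f = sqrt] Bochner_Integration.integral_cong) (auto simp: indicator_def)
    also have "\<dots> = sqrt ((q - p) * (norm c)\<^sup>2)"
    proof -
      have "{p<..q} \<inter> {0..t} = {p<..q}" using p t by auto
      moreover have "Sigma_Algebra.measure (lebesgue_on {0..t}) {p<..q} = q - p"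
        using p t by (subst measure_restrict_space) auto
      ultimately show ?thesis by (simp add: space_restrict_space)
    qed
    also have "\<dots> < sqrt (\<epsilon>\<^sup>2)"
    proof (rule real_sqrt_less_mono)
      have "(q - p) * (norm c)\<^sup>2 \<le> t / real m * (norm c)\<^sup>2" using p by (intro mult_right_mono) auto
      also have "\<dots> < \<epsilon>\<^sup>2"
      proof -
        have "t * (norm c)\<^sup>2 / \<epsilon>\<^sup>2 < real m" using N0 m by simp
        then show ?thesis using e m by (simp add: field_simps)
      qed
      finally show "(q - p) * (norm c)\<^sup>2 < \<epsilon>\<^sup>2" .
    qed
    finally show ?thesis
      using e m step_function_initial[OF jm t(1), of c] by (simp add: j_def[symmetric] p_def)
  qed
  then show "\<exists>N>0. \<forall>m\<ge>N. \<exists>d. L2_norm ?L (\<lambda>s. indicat_real {0<..q} s *\<^sub>R c - step_function m (\<lambda>i. t * real i / real m) d s) < \<epsilon>"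
    by (intro exI[of _ "N0 + 1"]) auto
qed

lemma grid_approximable_zero: "0 \<le> t \<Longrightarrow> grid_approximable t (\<lambda>s. 0)"
  unfolding grid_approximable_def by (auto intro!: exI[of _ "\<lambda>_. 0"] exI[of _ 1] simp: step_function_def)

lemma grid_approximable_sum:
  assumes "0 \<le> t" "\<And>i. i \<in> F \<Longrightarrow> grid_approximable t (h i)"
  shows "grid_approximable t (\<lambda>s. \<Sum>i\<in>F. h i s)"
  using assms(2)
  by (induction F rule: infinite_finite_induct) (auto intro: grid_approximable_add grid_approximable_zero[OF assms(1)])

lemma AE_lebesgue_onI:
  "S \<in> sets lebesgue \<Longrightarrow> AE s in lebesgue. P s \<Longrightarrow> AE s in lebesgue_on S. P s"
  by (subst AE_restrict_space_iff) (auto elim: eventually_mono)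

lemma AE_lebesgue_on_neq: "S \<in> sets lebesgue \<Longrightarrow> AE s in lebesgue_on S. s \<noteq> (u :: real)"
  using AE_lborel_singleton[of u] by (intro AE_lebesgue_onI AE_completion)

text \<open>Dynkin's argument: the half-lines are stable under intersection and generate the Borel
  sets, and the approximable sets are stable under complements and countable disjoint
  unions.\<close>

lemma grid_approximable_borel_indicator:
  fixes c :: "'x::{real_normed_vector, second_countable_topology}"
  assumes t: "0 < t" and A: "A \<in> sets borel"
  shows "grid_approximable t (\<lambda>s. indicat_real A s *\<^sub>R c)"
proof -
  let ?L = "lebesgue_on {0..t}"
  interpret finite_measure ?L by (rule finite_measure_lebesgue_on)
  have t0: "0 \<le> t" using t by simp
  \<comment> \<open>On \<open>{0..t}\<close> a half-line agrees, apart from the point 0, with an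
    initial interval or with the empty set.\<close>
  have atMost: "grid_approximable t (\<lambda>s. indicat_real {..q} s *\<^sub>R c)" for q
  proof -
    have m: "(\<lambda>s. indicat_real {..q} s *\<^sub>R c) \<in> borel_measurable ?L"
      by (intro borel_measurable_lebesgue_onI) simp
    show ?thesis
    proof (cases "0 < q")
      case True
      have "grid_approximable t (\<lambda>s. indicat_real {0<..min q t} s *\<^sub>R c)"
        using t True by (intro grid_approximable_initial) auto
      then show ?thesis
      proof (rule grid_approximable_cong_AE[OF _ m])
        have "AE s in ?L. s \<noteq> 0" by (rule AE_lebesgue_on_neq) simp
        moreover have "AE s in ?L. s \<in> {0..t}" by (rule AE_I2) (simp add: space_restrict_space)
        ultimately show "AE s in ?L. indicat_real {..q} s *\<^sub>R c = indicat_real {0<..min q t} s *\<^sub>R c"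
          by eventually_elim (auto simp: indicator_def)
      qed
    next
      case False
      show ?thesis
      proof (rule grid_approximable_cong_AE[OF grid_approximable_zero[OF t0] m])
        have "AE s in ?L. s \<noteq> 0" by (rule AE_lebesgue_on_neq) simp
        moreover have "AE s in ?L. s \<in> {0..t}" by (rule AE_I2) (simp add: space_restrict_space)
        ultimately show "AE s in ?L. indicat_real {..q} s *\<^sub>R c = 0"
          by eventually_elim (use False in \<open>auto simp: indicator_def\<close>)
      qed
    qed
  qed
  have stable: "Int_stable (range (\<lambda>a::real. {..a}))"
    by (auto simp: Int_stable_def)
  have pow: "range (\<lambda>a::real. {..a}) \<subseteq> Pow UNIV" by simp
  have "A \<in> sigma_sets UNIV (range (\<lambda>a::real. {..a}))"
    using A by (simp add: borel_eq_atMost)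
  then show ?thesis
  proof (induction rule: sigma_sets_induct_disjoint[OF stable pow, consumes 1, case_names basic empty compl union])
    case (basic A) then show ?case using atMost by auto
  next
    case empty show ?case using grid_approximable_zero[OF t0] by simp
  next
    case (compl A)
    have Ab: "A \<in> sets borel" using compl(1) by (simp add: borel_eq_atMost)
    \<comment> \<open>Only points of \<open>{0..t}\<close> count, and there \<open>{..t}\<close>
      plays the role of the whole line.\<close>
    have "grid_approximable t (\<lambda>s. indicat_real {..t} s *\<^sub>R c + (-1) *\<^sub>R (indicat_real A s *\<^sub>R c))"
      by (intro grid_approximable_add grid_approximable_scaleR atMost compl)
    then show ?case
    proof (rule grid_approximable_cong_AE)
      show "(\<lambda>s. indicat_real (UNIV - A) s *\<^sub>R c) \<in> borel_measurable ?L"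
        using Ab by (intro borel_measurable_lebesgue_onI) auto
      show "AE s in ?L. indicat_real (UNIV - A) s *\<^sub>R c = indicat_real {..t} s *\<^sub>R c + (-1) *\<^sub>R (indicat_real A s *\<^sub>R c)"
        by (rule AE_I2) (auto simp: indicator_def space_restrict_space)
    qed
  next
    case (union A)
    have Ab [measurable]: "A i \<in> sets borel" for i using union(2) by (auto simp: borel_eq_atMost)
    have U: "(\<Union>i. A i) \<in> sets borel" by measurable
    show ?case
    proof (rule grid_approximable_closed)
      show "(\<lambda>s. indicat_real (\<Union>i. A i) s *\<^sub>R c) \<in> L2 ?L" by (rule indicator_scaleR_L2[OF U])
      show "grid_approximable t (\<lambda>s. \<Sum>i<n. indicat_real (A i) s *\<^sub>R c)" for n
        by (intro grid_approximable_sum t0 union)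
      have eq: "(\<Sum>i<n. indicat_real (A i) s *\<^sub>R c) = indicat_real (\<Union>i<n. A i) s *\<^sub>R c" for n s
      proof -
        have "(\<Sum>i<n. indicat_real (A i) s) = indicat_real (\<Union>i<n. A i) s"
          using union(1) by (intro indicator_UN_disjoint[symmetric]) (auto simp: disjoint_family_on_def)
        then show ?thesis by (simp add: scaleR_sum_left[symmetric])
      qed
      show "(\<lambda>n. L2_norm ?L (\<lambda>s. (\<Sum>i<n. indicat_real (A i) s *\<^sub>R c) - indicat_real (\<Union>i. A i) s *\<^sub>R c)) \<longlonglongrightarrow> 0"
        unfolding eq
      proof (rule L2_dominated[where G = "\<lambda>_. c"])
        show "(\<lambda>s. indicat_real (\<Union>i<n. A i) s *\<^sub>R c) \<in> borel_measurable ?L" for n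
          by (intro borel_measurable_lebesgue_onI) measurable
        show "(\<lambda>s. indicat_real (\<Union>i. A i) s *\<^sub>R c) \<in> borel_measurable ?L"
          by (intro borel_measurable_lebesgue_onI) measurable
        show "(\<lambda>_. c) \<in> L2 ?L" by (simp add: L2_def)
        show "AE s in ?L. norm (indicat_real (\<Union>i<n. A i) s *\<^sub>R c - indicat_real (\<Union>i. A i) s *\<^sub>R c) \<le> norm c" for n
          by (rule AE_I2) (auto simp: indicator_def)
        show "AE s in ?L. (\<lambda>n. indicat_real (\<Union>i<n. A i) s *\<^sub>R c) \<longlonglongrightarrow> indicat_real (\<Union>i. A i) s *\<^sub>R c"
          by (intro AE_I2 tendsto_intros LIMSEQ_indicator_UN)
      qed
    qed
  qed
qed

text \<open>A Lebesgue set is a Borel set up to a null set, simple functions are sums of indicators,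
  and dominated convergence reaches every square-integrable function.\<close>

lemma grid_approximable_L2:
  fixes h :: "real \<Rightarrow> 'x::{real_normed_vector, second_countable_topology}"
  assumes t: "0 < t" and h: "h \<in> L2 (lebesgue_on {0..t})"
  shows "grid_approximable t h"
proof -
  let ?L = "lebesgue_on {0..t}"
  have t0: "0 \<le> t" using t by simp
  interpret finite_measure ?L by (rule finite_measure_lebesgue_on)
  have ind: "grid_approximable t (\<lambda>s. indicat_real A s *\<^sub>R c)" if A: "A \<in> sets ?L" for A and c :: 'x
  proof -
    have Al: "A \<in> sets lebesgue" using A by (auto simp: sets_restrict_space)
    then obtain S N N' where S: "A = S \<union> N" "N \<subseteq> N'" "N' \<in> null_sets lborel" "S \<in> sets lborel"
      by (rule sets_completionE)
    have "grid_approximable t (\<lambda>s. indicat_real S s *\<^sub>R c)"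
      using S(4) by (intro grid_approximable_borel_indicator t) simp
    then show ?thesis
    proof (rule grid_approximable_cong_AE)
      show "(\<lambda>s. indicat_real A s *\<^sub>R c) \<in> borel_measurable ?L" using A by measurable
      have "AE s in lebesgue. s \<notin> N'" using S(3) by (intro AE_completion AE_not_in)
      then have "AE s in ?L. s \<notin> N'" by (intro AE_lebesgue_onI) auto
      then show "AE s in ?L. indicat_real A s *\<^sub>R c = indicat_real S s *\<^sub>R c"
        by eventually_elim (use S in \<open>auto simp: indicator_def\<close>)
    qed
  qed
  obtain F where F: "\<And>i. simple_function ?L (F i)" "\<And>s. s \<in> space ?L \<Longrightarrow> (\<lambda>i. F i s) \<longlonglongrightarrow> h s"
    "\<And>i s. s \<in> space ?L \<Longrightarrow> dist (F i s) 0 \<le> 2 * dist (h s) 0"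
    using borel_measurable_implies_sequence_metric[OF L2_measurable[OF h], of 0] by blast
  have Fm: "F i \<in> borel_measurable ?L" for i by (intro borel_measurable_simple_function F)
  show ?thesis
  proof (rule grid_approximable_closed[OF h])
    fix i
    have "grid_approximable t (\<lambda>s. \<Sum>y\<in>F i ` space ?L. indicat_real (F i -` {y} \<inter> space ?L) s *\<^sub>R y)"
      by (intro grid_approximable_sum t0 ind simple_functionD(2)[OF F(1)])
    then show "grid_approximable t (F i)"
    proof (rule grid_approximable_cong_AE[OF _ Fm], intro AE_I2)
      fix s assume s: "s \<in> space ?L"
      have "(\<Sum>y\<in>F i ` space ?L. indicat_real (F i -` {y} \<inter> space ?L) s *\<^sub>R y)
         = (\<Sum>y\<in>F i ` space ?L. if y = F i s then y else 0)"
        using s by (intro sum.cong refl) (auto simp: indicator_def)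
      then show "F i s = (\<Sum>y\<in>F i ` space ?L. indicat_real (F i -` {y} \<inter> space ?L) s *\<^sub>R y)"
        using s simple_functionD(1)[OF F(1)[of i]] by simp
    qed
  next
    show "(\<lambda>i. L2_norm ?L (\<lambda>s. F i s - h s)) \<longlonglongrightarrow> 0"
    \<comment> \<open>The approximating simple functions are bounded by twice
      \<open>norm (h s)\<close>; subtracting \<open>h\<close> gives the factor 3.\<close>
    proof (rule L2_dominated[OF Fm L2_measurable[OF h], where G = "\<lambda>s. 3 *\<^sub>R h s"])
      show "(\<lambda>s. 3 *\<^sub>R h s) \<in> L2 ?L" by (rule L2_scaleR[OF h])
      show "AE s in ?L. norm (F i s - h s) \<le> norm (3 *\<^sub>R h s)" for i
      proof (rule AE_I2)
        fix s assume "s \<in> space ?L"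
        from F(3)[OF this, of i] show "norm (F i s - h s) \<le> norm (3 *\<^sub>R h s)"
          using norm_triangle_ineq4[of "F i s" "h s"] by simp
      qed
    qed (use F(2) in auto)
  qed
qed

text \<open>Step functions converging to \<open>h\<close> are Cauchy; the isometry for elementary
  integrals transports this to \<open>L2 M\<close>, where completeness yields the integral.\<close>

lemma has_wiener_integral_exists:
  fixes h :: "real \<Rightarrow> 'x::{real_inner, banach, second_countable_topology}"
  assumes M: "finite_measure M"
    and b: "\<And>t. t \<in> {0..T} \<Longrightarrow> b t \<in> L2 M"
    and cov: "\<And>s t. s \<in> {0..T} \<Longrightarrow> t \<in> {0..T} \<Longrightarrow> (\<integral>\<omega>. b s \<omega> * b t \<omega> \<partial>M) = min s t"
    and t: "0 \<le> t" "t \<le> T" and h: "h \<in> L2 (lebesgue_on {0..t})"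
  shows "\<exists>Z. has_wiener_integral M b t h Z"
proof (cases "t = 0")
  case True
  \<comment> \<open>Uniform grids need a positive length. At \<open>t = 0\<close> the interval is a
    null set, and the partition with \<open>m = 0\<close> consists of a single point.\<close>
  have "has_wiener_integral M b t h (\<lambda>_. 0)"
    unfolding has_wiener_integral_def
  proof (intro conjI allI impI h)
    fix \<epsilon> :: real assume "0 < \<epsilon>"
    have "AE s in lebesgue_on {0..t}. s \<noteq> 0" by (rule AE_lebesgue_on_neq) simp
    moreover have "AE s in lebesgue_on {0..t}. s \<in> {0..t}" by (rule AE_I2) (simp add: space_restrict_space)
    ultimately have "AE s in lebesgue_on {0..t}. ennreal ((norm (h s - step_function 0 (\<lambda>_. 0) (\<lambda>_. 0) s))\<^sup>2) = 0"
      by eventually_elim (use True in auto)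
    then have "(\<integral>\<^sup>+s. ennreal ((norm (h s - step_function 0 (\<lambda>_. 0) (\<lambda>_. 0) s))\<^sup>2) \<partial>lebesgue_on {0..t}) = (\<integral>\<^sup>+s. 0 \<partial>lebesgue_on {0..t})"
      by (rule nn_integral_cong_AE)
    then show "\<exists>m a c. a 0 = 0 \<and> a m = t \<and> (\<forall>i<m. a i \<le> a (Suc i)) \<and>
        (\<integral>\<^sup>+s. ennreal ((norm (h s - step_function m a c s))\<^sup>2) \<partial>lebesgue_on {0..t}) < ennreal \<epsilon> \<and>
        (\<integral>\<^sup>+\<omega>. ennreal ((norm (0 - (\<Sum>i<m. (b (a (Suc i)) \<omega> - b (a i) \<omega>) *\<^sub>R c i)))\<^sup>2) \<partial>M) < ennreal \<epsilon>"
      using True \<open>0 < \<epsilon>\<close> by (intro exI[of _ 0] exI[of _ "\<lambda>_. 0"]) simp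
  qed simp
  then show ?thesis by blast
next
  case False
  let ?L = "lebesgue_on {0..t}"
  have t0: "0 < t" using t False by simp
  have "\<exists>m a c. a 0 = 0 \<and> a m = t \<and> (\<forall>i<m. a i \<le> a (Suc i)) \<and> L2_norm ?L (\<lambda>s. h s - step_function m a c s) < (1/2) ^ k" for k :: nat
  proof -
    have "0 < (1/2 :: real) ^ k" by simp
    moreover have "\<forall>\<epsilon>>0. \<exists>N>0. \<forall>m\<ge>N. \<exists>c. L2_norm ?L (\<lambda>s. h s - step_function m (\<lambda>i. t * real i / real m) c s) < \<epsilon>"
      using grid_approximable_L2[OF t0 h] by (simp add: grid_approximable_def)
    ultimately have "\<exists>N>0. \<forall>m\<ge>N. \<exists>c. L2_norm ?L (\<lambda>s. h s - step_function m (\<lambda>i. t * real i / real m) c s) < (1/2) ^ k"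
      by simp
    then obtain N c where N: "N > 0" "L2_norm ?L (\<lambda>s. h s - step_function N (\<lambda>i. t * real i / real N) c s) < (1/2) ^ k"
      by auto
    have "t * real i / real N \<le> t * real (Suc i) / real N" for i
      using t0 by (intro divide_right_mono mult_left_mono) auto
    then show ?thesis using t0 N
      by (intro exI[of _ N] exI[of _ "\<lambda>i. t * real i / real N"] exI[of _ c]) simp
  qed
  then have "\<forall>k. \<exists>p. fst (snd p) 0 = 0 \<and> fst (snd p) (fst p) = t \<and> (\<forall>i<fst p. fst (snd p) i \<le> fst (snd p) (Suc i)) \<and>
     L2_norm ?L (\<lambda>s. h s - step_function (fst p) (fst (snd p)) (snd (snd p)) s) < (1/2) ^ k"
    by simp
  from choice[OF this] obtain p where p: "\<And>k. fst (snd (p k)) 0 = 0 \<and> fst (snd (p k)) (fst (p k)) = t \<and>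
     (\<forall>i<fst (p k). fst (snd (p k)) i \<le> fst (snd (p k)) (Suc i)) \<and>
     L2_norm ?L (\<lambda>s. h s - step_function (fst (p k)) (fst (snd (p k))) (snd (snd (p k))) s) < (1/2) ^ k"
    by blast
  define m a c where "m k = fst (p k)" and "a k = fst (snd (p k))" and "c k = snd (snd (p k))" for k
  have mac: "\<And>k. a k 0 = 0" "\<And>k. a k (m k) = t" "\<And>k. \<forall>i<m k. a k i \<le> a k (Suc i)"
    "\<And>k. L2_norm ?L (\<lambda>s. h s - step_function (m k) (a k) (c k) s) < (1/2 :: real) ^ k"
    using p by (simp_all add: m_def a_def c_def)
  define S where "S k = step_function (m k) (a k) (c k)" for k
  define Z where "Z k \<omega> = (\<Sum>i<m k. (b (a k (Suc i)) \<omega> - b (a k i) \<omega>) *\<^sub>R c k i)" for k \<omega>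
  have el: "elementary_integral b T (S k) (Z k)" for k
    unfolding S_def Z_def[abs_def] using mac t by (intro elementary_integral_step_function) auto
  have SL: "S k \<in> L2 (lebesgue_on {0..u})" for k u unfolding S_def by (rule step_function_L2)
  have ZL: "Z k \<in> L2 M" for k by (rule elementary_integral_L2(2)[OF el b])
  have S_out: "indicat_real {0..t} s *\<^sub>R S k s = S k s" for k s
    unfolding S_def using mac by (intro step_function_outside) auto
  have Sh: "L2_norm ?L (\<lambda>s. h s - S k s) < (1/2) ^ k" for k using mac(4) by (simp add: S_def)
  \<comment> \<open>The elementary isometry lives over \<open>{0..T}\<close>; as the step functions
    vanish beyond \<open>t\<close>, the norm over \<open>{0..t}\<close> is the same.\<close>
  have ZS: "L2_norm M (\<lambda>\<omega>. Z k \<omega> - Z l \<omega>) = L2_norm ?L (\<lambda>s. S k s - S l s)" for k l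
  proof -
    have D: "elementary_integral b T (\<lambda>s. S k s - S l s) (\<lambda>\<omega>. Z k \<omega> - Z l \<omega>)"
      by (rule elementary_integral_diff[OF el el])
    have "L2_inner M (\<lambda>\<omega>. Z k \<omega> - Z l \<omega>) (\<lambda>\<omega>. Z k \<omega> - Z l \<omega>)
        = 1 * L2_inner (lebesgue_on {0..T}) (\<lambda>s. S k s - S l s) (\<lambda>s. S k s - S l s)"
      by (rule elementary_integral_inner[OF b b _ D D]) (use cov in auto)
    then have "L2_norm M (\<lambda>\<omega>. Z k \<omega> - Z l \<omega>) = L2_norm (lebesgue_on {0..T}) (\<lambda>s. S k s - S l s)"
      by (simp add: L2_inner_self power2_eq_iff_nonneg)
    also have "\<dots> = L2_norm ?L (\<lambda>s. S k s - S l s)"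
      by (simp add: indicator_cut(4)[OF t, of "\<lambda>s. S k s - S l s"] scaleR_diff_right S_out)
    finally show ?thesis .
  qed
  have Z2: "L2_norm M (\<lambda>\<omega>. Z k \<omega> - Z l \<omega>) < (1/2) ^ k + (1/2) ^ l" for k l
    using L2_norm_dist_triangle[OF SL h SL, of k l] Sh[of k] Sh[of l] L2_norm_minus_commute[of ?L h "S k"]
    by (simp add: ZS)
  have "\<exists>N. \<forall>k\<ge>N. \<forall>l\<ge>N. L2_norm M (\<lambda>\<omega>. Z k \<omega> - Z l \<omega>) < \<epsilon>" if e: "0 < \<epsilon>" for \<epsilon>
  proof -
    obtain N where N: "(1/2 :: real) ^ N < \<epsilon> / 2" using real_arch_pow_inv[of "\<epsilon> / 2" "1/2"] e by auto
    have "L2_norm M (\<lambda>\<omega>. Z k \<omega> - Z l \<omega>) < \<epsilon>" if "k \<ge> N" "l \<ge> N" for k l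
    proof -
      have "(1/2 :: real) ^ k \<le> (1/2) ^ N" "(1/2 :: real) ^ l \<le> (1/2) ^ N"
        using that by (auto intro!: power_decreasing)
      then show ?thesis using Z2[of k l] N by linarith
    qed
    then show ?thesis by blast
  qed
  from L2_complete[OF M ZL this] obtain Z0 where Z0: "Z0 \<in> L2 M" "(\<lambda>k. L2_norm M (\<lambda>\<omega>. Z k \<omega> - Z0 \<omega>)) \<longlonglongrightarrow> 0"
    by metis
  have "has_wiener_integral M b t h Z0"
    unfolding has_wiener_integral_def
  proof (intro conjI allI impI h Z0)
    fix \<epsilon> :: real assume e: "0 < \<epsilon>"
    then have se: "0 < sqrt \<epsilon>" by simp
    have "\<forall>\<^sub>F k in sequentially. L2_norm M (\<lambda>\<omega>. Z k \<omega> - Z0 \<omega>) < sqrt \<epsilon>"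
      by (rule order_tendstoD(2)[OF Z0(2) se])
    moreover have "\<forall>\<^sub>F k in sequentially. (1/2 :: real) ^ k < sqrt \<epsilon>"
      by (rule order_tendstoD(2)[OF LIMSEQ_power_zero se]) simp
    ultimately have "\<forall>\<^sub>F k in sequentially. L2_norm M (\<lambda>\<omega>. Z k \<omega> - Z0 \<omega>) < sqrt \<epsilon> \<and> (1/2 :: real) ^ k < sqrt \<epsilon>"
      by eventually_elim simp
    then obtain k where k: "L2_norm M (\<lambda>\<omega>. Z k \<omega> - Z0 \<omega>) < sqrt \<epsilon>" "(1/2 :: real) ^ k < sqrt \<epsilon>"
      by (auto simp: eventually_sequentially)
    have sq: "x\<^sup>2 < \<epsilon>" if "0 \<le> x" "x < sqrt \<epsilon>" for x
      using power_strict_mono[OF that(2,1), of 2] e by simp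
    have 1: "(\<integral>\<^sup>+s. ennreal ((norm (h s - S k s))\<^sup>2) \<partial>?L) < ennreal \<epsilon>"
      using sq[OF L2_norm_nonneg, of ?L "\<lambda>s. h s - S k s"] Sh[of k] k(2) e
      by (subst nn_integral_L2_norm[OF L2_diff[OF h SL]]) (auto simp: ennreal_less_iff)
    have 2: "(\<integral>\<^sup>+\<omega>. ennreal ((norm (Z0 \<omega> - Z k \<omega>))\<^sup>2) \<partial>M) < ennreal \<epsilon>"
      using sq[OF L2_norm_nonneg k(1)] e L2_norm_minus_commute[of M Z0 "Z k"]
      by (subst nn_integral_L2_norm[OF L2_diff[OF Z0(1) ZL]]) (auto simp: ennreal_less_iff)
    show "\<exists>m a c. a 0 = 0 \<and> a m = t \<and> (\<forall>i<m. a i \<le> a (Suc i)) \<and>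
        (\<integral>\<^sup>+s. ennreal ((norm (h s - step_function m a c s))\<^sup>2) \<partial>?L) < ennreal \<epsilon> \<and>
        (\<integral>\<^sup>+\<omega>. ennreal ((norm (Z0 \<omega> - (\<Sum>i<m. (b (a (Suc i)) \<omega> - b (a i) \<omega>) *\<^sub>R c i)))\<^sup>2) \<partial>M) < ennreal \<epsilon>"
      using mac(1-3)[of k] 1 2 unfolding S_def Z_def by blast
  qed
  then show ?thesis by blast
qed

subsection \<open>Covariances of Brownian motions\<close>

context prob_space
begin

lemma brownian_motion_increment:
  assumes bm: "standard_brownian_motion M T b" and st: "0 \<le> s" "s \<le> t" "t \<le> T"
  shows "(\<lambda>\<omega>. b t \<omega> - b s \<omega>) \<in> L2 M" "(\<integral>\<omega>. b t \<omega> - b s \<omega> \<partial>M) = 0"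
    "(\<integral>\<omega>. (b t \<omega> - b s \<omega>) * (b t \<omega> - b s \<omega>) \<partial>M) = t - s"
proof -
  have *: "(\<lambda>\<omega>. b t \<omega> - b s \<omega>) \<in> L2 M \<and> (\<integral>\<omega>. b t \<omega> - b s \<omega> \<partial>M) = 0 \<and>
    (\<integral>\<omega>. (b t \<omega> - b s \<omega>) * (b t \<omega> - b s \<omega>) \<partial>M) = t - s"
  \<comment> \<open>Coinciding times are separated because a normal density needs a positive
    variance; the increment is then identically 0.\<close>
  proof (cases "s = t")
    case False
    then have D: "distributed M lborel (\<lambda>\<omega>. b t \<omega> - b s \<omega>) (normal_density 0 (sqrt (t - s)))"
      using bm st unfolding standard_brownian_motion_def by auto
    have pos: "0 < sqrt (t - s)" using False st by simp
    have m: "(\<lambda>\<omega>. b t \<omega> - b s \<omega>) \<in> borel_measurable M"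
      using distributed_measurable[OF D] by simp
    have E: "(\<integral>\<omega>. b t \<omega> - b s \<omega> \<partial>M) = 0" by (rule normal_distributed_expectation[OF pos D])
    have V: "(\<integral>\<omega>. (b t \<omega> - b s \<omega>)\<^sup>2 \<partial>M) = t - s"
      using normal_distributed_variance[OF pos D] E st by simp
    have "integrable lborel (\<lambda>x. normal_density 0 (sqrt (t - s)) x * x\<^sup>2)"
      using integrable_normal_moment[OF pos, of 0 2] by simp
    then have "integrable M (\<lambda>\<omega>. (b t \<omega> - b s \<omega>)\<^sup>2)"
      using distributed_integrable[OF D, of "\<lambda>x. x\<^sup>2"] by simp
    then show ?thesis using m E V by (auto simp: L2_def power2_eq_square)
  qed auto
  then show "(\<lambda>\<omega>. b t \<omega> - b s \<omega>) \<in> L2 M" "(\<integral>\<omega>. b t \<omega> - b s \<omega> \<partial>M) = 0"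
    "(\<integral>\<omega>. (b t \<omega> - b s \<omega>) * (b t \<omega> - b s \<omega>) \<partial>M) = t - s" by auto
qed

lemma brownian_motion_L2:
  assumes bm: "standard_brownian_motion M T b" and t: "t \<in> {0..T}"
  shows "b t \<in> L2 M" "(\<integral>\<omega>. b t \<omega> \<partial>M) = 0"
proof -
  have z: "AE \<omega> in M. b 0 \<omega> = 0" and m: "b t \<in> borel_measurable M"
    using bm t unfolding standard_brownian_motion_def by auto
  have eq: "AE \<omega> in M. b t \<omega> = b t \<omega> - b 0 \<omega>" using z by eventually_elim simp
  have t': "0 \<le> t" "t \<le> T" using t by auto
  note I = brownian_motion_increment[OF bm order_refl t']
  show "b t \<in> L2 M" by (rule L2_cong_AE(1)[OF I(1) m eq])
  have "(\<integral>\<omega>. b t \<omega> \<partial>M) = (\<integral>\<omega>. b t \<omega> - b 0 \<omega> \<partial>M)"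
    by (rule integral_cong_AE[OF m L2_measurable[OF I(1)] eq])
  then show "(\<integral>\<omega>. b t \<omega> \<partial>M) = 0" using I(2) by simp
qed

lemma L2_integrable: "(f :: 'a \<Rightarrow> real) \<in> L2 M \<Longrightarrow> integrable M f"
  using L2_inner_integrable[of f M "\<lambda>_. 1"] by (simp add: L2_def)

lemma indep_vars_pair_expectation:
  fixes X :: "'i \<Rightarrow> 'a \<Rightarrow> real"
  assumes "indep_vars (\<lambda>_. borel) X I" "i \<in> I" "j \<in> I" "i \<noteq> j" "integrable M (X i)" "integrable M (X j)"
  shows "(\<integral>\<omega>. X i \<omega> * X j \<omega> \<partial>M) = (\<integral>\<omega>. X i \<omega> \<partial>M) * (\<integral>\<omega>. X j \<omega> \<partial>M)"
proof -
  have "indep_vars (\<lambda>_. borel) X {i, j}" by (rule indep_vars_subset[OF assms(1)]) (use assms in auto)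
  then have "(\<integral>\<omega>. (\<Prod>k\<in>{i, j}. X k \<omega>) \<partial>M) = (\<Prod>k\<in>{i, j}. \<integral>\<omega>. X k \<omega> \<partial>M)"
    using assms by (intro indep_vars_lebesgue_integral) auto
  then show ?thesis using assms(4) by simp
qed

text \<open>For \<open>s <= t\<close> the product is the square of the increment up to
  \<open>s\<close> plus the product of that increment with the next one. By independence the latter
  has mean zero.\<close>

lemma brownian_motion_covariance:
  assumes bm: "standard_brownian_motion M T b" and s: "s \<in> {0..T}" and t: "t \<in> {0..T}"
  shows "(\<integral>\<omega>. b s \<omega> * b t \<omega> \<partial>M) = min s t"
proof -
  have le: "(\<integral>\<omega>. b s \<omega> * b t \<omega> \<partial>M) = s" if st: "0 \<le> s" "s \<le> t" "t \<le> T" for s t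
  proof -
    have z: "AE \<omega> in M. b 0 \<omega> = 0" using bm unfolding standard_brownian_motion_def by auto
    let ?X = "\<lambda>\<omega>. b s \<omega> - b 0 \<omega>" and ?Y = "\<lambda>\<omega>. b t \<omega> - b s \<omega>"
    have X: "?X \<in> L2 M" "(\<integral>\<omega>. ?X \<omega> \<partial>M) = 0" "(\<integral>\<omega>. ?X \<omega> * ?X \<omega> \<partial>M) = s"
      using brownian_motion_increment[OF bm, of 0 s] st by auto
    have Y: "?Y \<in> L2 M" "(\<integral>\<omega>. ?Y \<omega> \<partial>M) = 0" using brownian_motion_increment[OF bm, of s t] st by auto
    \<comment> \<open>The partition 0, \<open>s\<close>, \<open>t\<close>, whose two increments are
      the ones just named.\<close>
    define a where "a = (\<lambda>i::nat. if i = 0 then 0 else if i = 1 then s else t)"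
    have "indep_vars (\<lambda>_. borel) (\<lambda>i \<omega>. b (a (Suc i)) \<omega> - b (a i) \<omega>) {..<2}"
    proof -
      have "0 \<le> a 0" "\<forall>i<2. a i \<le> a (Suc i)" "a 2 \<le> T" using st by (auto simp: a_def less_2_cases_iff)
      then show ?thesis using bm unfolding standard_brownian_motion_def by blast
    qed
    from indep_vars_pair_expectation[OF this, of 0 1]
    have XY: "(\<integral>\<omega>. ?X \<omega> * ?Y \<omega> \<partial>M) = 0"
      using L2_integrable[OF X(1)] L2_integrable[OF Y(1)] X(2) by (simp add: a_def)
    have iXX: "integrable M (\<lambda>\<omega>. ?X \<omega> * ?X \<omega>)" "integrable M (\<lambda>\<omega>. ?X \<omega> * ?Y \<omega>)"
      using L2_inner_integrable[OF X(1) X(1)] L2_inner_integrable[OF X(1) Y(1)] by simp_all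
    have "(\<integral>\<omega>. b s \<omega> * b t \<omega> \<partial>M) = (\<integral>\<omega>. ?X \<omega> * ?X \<omega> + ?X \<omega> * ?Y \<omega> \<partial>M)"
    proof (rule integral_cong_AE)
      show "AE \<omega> in M. b s \<omega> * b t \<omega> = ?X \<omega> * ?X \<omega> + ?X \<omega> * ?Y \<omega>"
        using z by eventually_elim (simp add: algebra_simps)
      have "b s \<in> borel_measurable M" "b t \<in> borel_measurable M"
        using brownian_motion_L2[OF bm] st by (auto intro!: L2_measurable)
      then show "(\<lambda>\<omega>. b s \<omega> * b t \<omega>) \<in> borel_measurable M" by measurable
    qed (use iXX in auto)
    also have "\<dots> = s" using iXX X XY by simp
    finally show ?thesis .
  qed
  show ?thesis using le[of s t] le[of t s] s t by (cases "s \<le> t") (auto simp: mult.commute)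
qed

lemma independent_brownian_motions_covariance:
  assumes ind: "independent_processes M T \<beta> I" and n: "n \<in> I" "m \<in> I" "n \<noteq> m"
    and bm: "standard_brownian_motion M T (\<beta> n)" "standard_brownian_motion M T (\<beta> m)"
    and s: "s \<in> {0..T}" and t: "t \<in> {0..T}"
  shows "(\<integral>\<omega>. \<beta> n s \<omega> * \<beta> m t \<omega> \<partial>M) = 0"
proof -
  \<comment> \<open>Independence is given for whole paths. Evaluating each path at a time of its
    own, \<open>s\<close> for index \<open>n\<close> and \<open>t\<close> for the others, keeps it
    and yields real variables.\<close>
  define u where "u k = (if k = n then s else t)" for k
  have ut: "u k \<in> {0..T}" for k using s t by (simp add: u_def)
  have "indep_vars (\<lambda>_. Pi\<^sub>M {0..T} (\<lambda>_. borel)) (\<lambda>n \<omega>. \<lambda>t\<in>{0..T}. \<beta> n t \<omega>) I"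
    using ind unfolding independent_processes_def .
  from indep_vars_compose2[OF this, of "\<lambda>k f. f (u k)" "\<lambda>_. borel"]
  have "indep_vars (\<lambda>_. borel) (\<lambda>k \<omega>. \<beta> k (u k) \<omega>) I"
    using ut by (simp add: measurable_component_singleton)
  from indep_vars_pair_expectation[OF this n]
  have "(\<integral>\<omega>. \<beta> n (u n) \<omega> * \<beta> m (u m) \<omega> \<partial>M) = (\<integral>\<omega>. \<beta> n (u n) \<omega> \<partial>M) * (\<integral>\<omega>. \<beta> m (u m) \<omega> \<partial>M)"
    using L2_integrable brownian_motion_L2(1)[OF bm(1) ut] brownian_motion_L2(1)[OF bm(2) ut] by blast
  then show ?thesis using brownian_motion_L2(2)[OF bm(1) s] n(3) by (simp add: u_def)
qed

end

section \<open>The kernel of fractional Brownian motion\<close>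

lemma nn_integral_lebesgue_on_borel:
  assumes "F \<in> borel_measurable borel" "S \<in> sets borel"
  shows "(\<integral>\<^sup>+s. F s \<partial>lebesgue_on S) = (\<integral>\<^sup>+s. F s * indicator S s \<partial>lborel)"
  using assms by (subst nn_integral_restrict_space) (auto intro!: nn_integral_completion)

lemma nn_integral_powr_shift:
  fixes s t p :: real
  assumes p: "-1 < p" and st: "s \<le> t"
  shows "(\<integral>\<^sup>+r. ennreal ((r - s) powr p) * indicator {s..t} r \<partial>lborel) = ennreal ((t - s) powr (p + 1) / (p + 1))"
proof -
  have "(\<integral>\<^sup>+r. ennreal ((r - s) powr p) * indicator {s..t} r \<partial>lborel)
    = ennreal \<bar>1\<bar> * (\<integral>\<^sup>+x. ennreal ((s + 1 * x - s) powr p) * indicator {s..t} (s + 1 * x) \<partial>lborel)"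
    by (rule nn_integral_real_affine) auto
  also have "\<dots> = (\<integral>\<^sup>+x. ennreal (x powr p) * indicator {0..t - s} x \<partial>lborel)"
    by (auto intro!: nn_integral_cong simp: indicator_def)
  also have "\<dots> = ennreal ((t - s) powr (p + 1) / (p + 1))"
    using p st by (intro nn_integral_has_integral_lebesgue' has_integral_powr_from_0) auto
  finally show ?thesis .
qed

lemma lebesgue_on_integral_eq_integral:
  fixes f :: "real \<Rightarrow> real"
  assumes "integrable (lebesgue_on {a..b}) f"
  shows "integral\<^sup>L (lebesgue_on {a..b}) f = integral {a..b} f" "f integrable_on {a..b}"
proof -
  have si: "set_integrable lebesgue {a..b} f"
    using assms by (simp add: set_integrable_def integrable_restrict_space)
  show "f integrable_on {a..b}" by (rule set_lebesgue_integral_eq_integral(1)[OF si])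
  show "integral\<^sup>L (lebesgue_on {a..b}) f = integral {a..b} f"
    using set_lebesgue_integral_eq_integral(2)[OF si]
    by (simp add: set_lebesgue_integral_def integral_restrict_space)
qed

context
  fixes H s :: real assumes H: "0 < H" "H < 1/2" and s: "0 < s"
begin

text \<open>Since \<open>s\<close> is positive, the first power is bounded by its value at
  \<open>s\<close>; what remains is a singularity at \<open>s\<close> of order
  \<open>H - 1/2\<close>, which is above -1.\<close>

lemma K_H_integrand_integrable:
  "integrable (lebesgue_on {s..x}) (\<lambda>u. u powr (H - 3/2) * (u - s) powr (H - 1/2))"
proof (cases "s \<le> x")
  case False then show ?thesis by (simp add: integrable_restrict_space)
next
  case True
  let ?F = "\<lambda>u. u powr (H - 3/2) * (u - s) powr (H - 1/2)"
  have "(\<integral>\<^sup>+u. ennreal (norm (?F u)) \<partial>lebesgue_on {s..x}) = (\<integral>\<^sup>+u. ennreal (norm (?F u)) * indicator {s..x} u \<partial>lborel)"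
    by (rule nn_integral_lebesgue_on_borel) auto
  also have "\<dots> \<le> (\<integral>\<^sup>+u. ennreal (s powr (H - 3/2)) * (ennreal ((u - s) powr (H - 1/2)) * indicator {s..x} u) \<partial>lborel)"
  proof (rule nn_integral_mono)
    fix u
    have "u powr (H - 3/2) * (u - s) powr (H - 1/2) \<le> s powr (H - 3/2) * (u - s) powr (H - 1/2)" if "s \<le> u"
      using that s H by (intro mult_right_mono powr_mono2') auto
    then show "ennreal (norm (?F u)) * indicator {s..x} u \<le> ennreal (s powr (H - 3/2)) * (ennreal ((u - s) powr (H - 1/2)) * indicator {s..x} u)"
      by (auto simp: indicator_def ennreal_mult[symmetric] intro!: ennreal_leI)
  qed
  also have "\<dots> = ennreal (s powr (H - 3/2)) * ennreal ((x - s) powr (H - 1/2 + 1) / (H - 1/2 + 1))"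
    using H True by (subst nn_integral_cmult) (auto simp: nn_integral_powr_shift)
  also have "\<dots> < \<infinity>" by (simp add: ennreal_mult_less_top)
  finally show ?thesis
    by (intro integrableI_bounded borel_measurable_lebesgue_onI) auto
qed

lemma K_H_integral_deriv:
  assumes r: "s < r"
  shows "((\<lambda>x. \<integral>u. u powr (H - 3/2) * (u - s) powr (H - 1/2) \<partial>lebesgue_on {s..x})
    has_real_derivative r powr (H - 3/2) * (r - s) powr (H - 1/2)) (at r)"
proof -
  let ?F = "\<lambda>u. u powr (H - 3/2) * (u - s) powr (H - 1/2)"
  \<comment> \<open>The fundamental theorem of calculus is applied on an interval that keeps away
    from the singularity at \<open>s\<close>; the part from \<open>s\<close> to \<open>a\<close> is
    a constant.\<close>
  define a b where "a = (s + r) / 2" and "b = r + 1"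
  have ab: "s < a" "a < r" "r < b" using r by (auto simp: a_def b_def)
  have cont: "continuous_on {a..b} ?F"
    using ab s by (intro continuous_intros) auto
  have "((\<lambda>x. integral {a..x} ?F) has_real_derivative ?F r) (at r within {a..b})"
    using ab by (intro integral_has_real_derivative cont) auto
  then have "((\<lambda>x. integral {a..x} ?F) has_real_derivative ?F r) (at r)"
    using ab at_within_Icc_at[of a r b] by simp
  then have "((\<lambda>x. integral {s..a} ?F + integral {a..x} ?F) has_real_derivative 0 + ?F r) (at r)"
    by (intro DERIV_add DERIV_const)
  then have "((\<lambda>x. integral {s..a} ?F + integral {a..x} ?F) has_real_derivative ?F r) (at r)" by simp
  then show ?thesis
  proof (rule has_field_derivative_transform_within_open)
    show "open {a<..<b}" "r \<in> {a<..<b}" using ab by auto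
    fix x assume x: "x \<in> {a<..<b}"
    have "integral {s..a} ?F + integral {a..x} ?F = integral {s..x} ?F"
      using x ab lebesgue_on_integral_eq_integral(2)[OF K_H_integrand_integrable[of x]]
      by (intro Henstock_Kurzweil_Integration.integral_combine) auto
    then show "integral {s..a} ?F + integral {a..x} ?F = (\<integral>u. ?F u \<partial>lebesgue_on {s..x})"
      using lebesgue_on_integral_eq_integral(1)[OF K_H_integrand_integrable[of x]] by simp
  qed
qed

text \<open>Of the three terms of the product rule, the one from differentiating the power of
  \<open>r / s\<close> cancels against the integral term. A single singular power is left.\<close>

lemma deriv_K_H:
  assumes r: "s < r"
  shows "deriv (\<lambda>r. K_H H r s) r = c_H H * (H - 1/2) * (r / s) powr (H - 1/2) * (r - s) powr (H - 3/2)"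
proof (rule DERIV_imp_deriv)
  let ?J = "\<lambda>x. \<integral>u. u powr (H - 3/2) * (u - s) powr (H - 1/2) \<partial>lebesgue_on {s..x}"
  let ?E = "\<lambda>x. c_H H * ((x / s) powr (H - 1/2) * (x - s) powr (H - 1/2) - (H - 1/2) * s powr (1/2 - H) * ?J x)"
  have rs: "0 < r / s" "0 < r - s" using r s by auto
  have d1: "((\<lambda>x. (x / s) powr (H - 1/2)) has_real_derivative (H - 1/2) * (r / s) powr (H - 1/2 - 1) * (1 / s)) (at r)"
    using rs s by (intro has_real_derivative_powr[THEN DERIV_chain2]) (auto intro!: derivative_eq_intros)
  have d2: "((\<lambda>x. (x - s) powr (H - 1/2)) has_real_derivative (H - 1/2) * (r - s) powr (H - 1/2 - 1) * 1) (at r)"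
    using rs by (intro has_real_derivative_powr[THEN DERIV_chain2]) (auto intro!: derivative_eq_intros)
  have "(?E has_real_derivative c_H H *
      (((H - 1/2) * (r / s) powr (H - 1/2 - 1) * (1 / s)) * (r - s) powr (H - 1/2)
        + ((H - 1/2) * (r - s) powr (H - 1/2 - 1) * 1) * (r / s) powr (H - 1/2)
        - (H - 1/2) * s powr (1/2 - H) * (r powr (H - 3/2) * (r - s) powr (H - 1/2)))) (at r)"
    by (intro DERIV_cmult DERIV_diff DERIV_mult d1 d2 K_H_integral_deriv[OF r])
  moreover have "(r / s) powr (H - 1/2 - 1) * (1 / s) = s powr (1/2 - H) * r powr (H - 3/2)"
  proof -
    have "(r / s) powr (H - 3/2) = r powr (H - 3/2) / s powr (H - 3/2)"
      using s r by (simp add: powr_divide)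
    then have "(r / s) powr (H - 1/2 - 1) * (1 / s) = (1 / s powr (H - 3/2) * (1 / s)) * r powr (H - 3/2)"
      by simp
    also have "1 / s powr (H - 3/2) * (1 / s) = s powr (1/2 - H)"
    proof -
      have "s powr (1/2 - H) = s powr (- (H - 3/2) + - 1)" by simp
      also have "\<dots> = s powr (- (H - 3/2)) * s powr (- 1)" by (rule powr_add)
      also have "\<dots> = 1 / s powr (H - 3/2) * (1 / s)"
        using powr_minus[of s "H - 3/2"] powr_minus[of s 1] powr_one[of s] s
        by (simp only: divide_inverse mult_1_left)
      finally show ?thesis by (rule sym)
    qed
    finally show ?thesis .
  qed
  ultimately have "(?E has_real_derivative c_H H * (H - 1/2) * (r / s) powr (H - 1/2) * (r - s) powr (H - 3/2)) (at r)"
    by (elim DERIV_cong) (simp add: algebra_simps)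
  then show "((\<lambda>r. K_H H r s) has_real_derivative c_H H * (H - 1/2) * (r / s) powr (H - 1/2) * (r - s) powr (H - 3/2)) (at r)"
    by (rule has_field_derivative_transform_within_open[of _ _ _ "{s<..}"])
      (use r in \<open>auto simp: K_H_def\<close>)
qed

end

text \<open>A closed formula for the derivative of \<open>K_H\<close> in its first argument, valid
  for \<open>0 < s < r\<close>. Unlike \<open>deriv\<close> it is explicit at all points and jointly
  Borel measurable.\<close>

definition dK :: "real \<Rightarrow> real \<Rightarrow> real \<Rightarrow> real" where
  "dK H r s = c_H H * (H - 1/2) * (r / s) powr (H - 1/2) * (r - s) powr (H - 3/2)"

text \<open>The base \<open>r / s\<close> is at least 1 and the exponent \<open>H - 1/2\<close> is
  negative, so this factor is at most 1.\<close>

lemma dK_bound: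
  assumes "H < 1/2" "0 < s" "s < r"
  shows "\<bar>dK H r s\<bar> \<le> \<bar>c_H H * (H - 1/2)\<bar> * (r - s) powr (H - 3/2)"
proof -
  have "(r / s) powr (H - 1/2) \<le> (r / s) powr 0" using assms by (intro powr_mono) auto
  then have "(r / s) powr (H - 1/2) \<le> 1" using assms by simp
  then have "\<bar>c_H H * (H - 1/2)\<bar> * ((r / s) powr (H - 1/2) * (r - s) powr (H - 3/2))
     \<le> \<bar>c_H H * (H - 1/2)\<bar> * (1 * (r - s) powr (H - 3/2))"
    by (intro mult_left_mono mult_right_mono) auto
  then show ?thesis by (simp add: dK_def abs_mult mult.assoc)
qed

lemma K_star_scaleR: "K_star H t (\<lambda>r. c *\<^sub>R h r) s = c *\<^sub>R K_star H t h s"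
proof -
  have "(\<integral>r. deriv (\<lambda>r. K_H H r s) r *\<^sub>R (c *\<^sub>R h r - c *\<^sub>R h s) \<partial>lebesgue_on {s..t})
    = (\<integral>r. c *\<^sub>R (deriv (\<lambda>r. K_H H r s) r *\<^sub>R (h r - h s)) \<partial>lebesgue_on {s..t})"
    by (intro Bochner_Integration.integral_cong refl) (simp add: scaleR_diff_right mult.commute)
  also have "\<dots> = c *\<^sub>R (\<integral>r. deriv (\<lambda>r. K_H H r s) r *\<^sub>R (h r - h s) \<partial>lebesgue_on {s..t})"
    by (rule integral_scaleR_right)
  finally show ?thesis by (simp add: K_star_def scaleR_add_right mult.commute)
qed

text \<open>Passes from \<open>deriv\<close> on a closed interval with Lebesgue measure to
  \<open>dK\<close> on the open interval with \<open>lborel\<close>, where product measurability is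
  at hand.\<close>

lemma deriv_K_H_integral:
  fixes w :: "real \<Rightarrow> 'x::{banach, second_countable_topology}"
  assumes H: "0 < H" "H < 1/2" and s: "0 < s"
    and w: "(\<lambda>r. indicat_real {s<..<t} r *\<^sub>R (dK H r s *\<^sub>R w r)) \<in> borel_measurable borel"
  shows "integrable (lebesgue_on {s..t}) (\<lambda>r. deriv (\<lambda>r. K_H H r s) r *\<^sub>R w r) \<longleftrightarrow>
      integrable lborel (\<lambda>r. indicat_real {s<..<t} r *\<^sub>R (dK H r s *\<^sub>R w r))"
    and "(\<integral>r. deriv (\<lambda>r. K_H H r s) r *\<^sub>R w r \<partial>lebesgue_on {s..t}) =
      (\<integral>r. indicat_real {s<..<t} r *\<^sub>R (dK H r s *\<^sub>R w r) \<partial>lborel)"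
proof -
  let ?g = "\<lambda>r. indicat_real {s<..<t} r *\<^sub>R (dK H r s *\<^sub>R w r)"
  let ?f = "\<lambda>r. indicat_real {s..t} r *\<^sub>R (deriv (\<lambda>r. K_H H r s) r *\<^sub>R w r)"
  have gl: "?g \<in> borel_measurable lebesgue" using w by (intro measurable_completion) simp
  have "AE r in lebesgue. r \<noteq> s" "AE r in lebesgue. r \<noteq> t"
    by (intro AE_completion AE_lborel_singleton)+
  then have eq: "AE r in lebesgue. ?f r = ?g r"
    by eventually_elim (auto simp: indicator_def dK_def deriv_K_H[OF H s])
  \<comment> \<open>Nothing is known about \<open>deriv\<close> at the endpoint \<open>s\<close>.
    Measurability is therefore obtained by viewing the integrand as a Borel function altered at two
    points.\<close>
  have "?f = (\<lambda>r. if r = s then ?f s else if r = t then ?f t else ?g r)"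
    by (intro ext) (auto simp: indicator_def dK_def deriv_K_H[OF H s])
  moreover have "(\<lambda>r. if r = s then ?f s else if r = t then ?f t else ?g r) \<in> borel_measurable lebesgue"
    by (intro measurable_If gl measurable_const) simp_all
  ultimately have fl: "?f \<in> borel_measurable lebesgue" by simp
  have "integrable (lebesgue_on {s..t}) (\<lambda>r. deriv (\<lambda>r. K_H H r s) r *\<^sub>R w r) \<longleftrightarrow> integrable lebesgue ?f"
    by (simp add: integrable_restrict_space)
  also have "\<dots> \<longleftrightarrow> integrable lebesgue ?g" using fl gl eq by (rule integrable_cong_AE)
  also have "\<dots> \<longleftrightarrow> integrable lborel ?g" using w by (intro integrable_completion) simp
  finally show "integrable (lebesgue_on {s..t}) (\<lambda>r. deriv (\<lambda>r. K_H H r s) r *\<^sub>R w r) \<longleftrightarrow> integrable lborel ?g" .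
  have "(\<integral>r. deriv (\<lambda>r. K_H H r s) r *\<^sub>R w r \<partial>lebesgue_on {s..t}) = (\<integral>r. ?f r \<partial>lebesgue)"
    by (simp add: integral_restrict_space)
  also have "\<dots> = (\<integral>r. ?g r \<partial>lebesgue)" using fl gl eq by (rule integral_cong_AE)
  also have "\<dots> = (\<integral>r. ?g r \<partial>lborel)" using w by (intro integral_completion) simp
  finally show "(\<integral>r. deriv (\<lambda>r. K_H H r s) r *\<^sub>R w r \<partial>lebesgue_on {s..t}) = (\<integral>r. ?g r \<partial>lborel)" .
qed

section \<open>Resolvent operators and Hilbert--Schmidt norms\<close>

lemma resolvent_bounded:
  assumes R: "resolvent_operator DA A B R" and T: "0 \<le> T" and D: "D = (SUP t\<in>{0..T}. norm (R t))"
  shows "\<And>t. t \<in> {0..T} \<Longrightarrow> norm (R t) \<le> D" "0 \<le> D"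
proof -
  obtain N b where Nb: "\<And>t. t \<ge> 0 \<Longrightarrow> norm (R t) \<le> N * exp (b * t)"
    using R unfolding resolvent_operator_def by blast
  have N: "0 \<le> N" using order_trans[OF norm_ge_zero Nb[of 0]] by simp
  have "bdd_above ((\<lambda>t. norm (R t)) ` {0..T})"
  proof (rule bdd_aboveI2)
    fix t assume t: "t \<in> {0..T}"
    \<comment> \<open>The growth rate may be negative, hence the absolute value.\<close>
    have "b * t \<le> \<bar>b\<bar> * T" using t by (meson abs_ge_self abs_ge_zero atLeastAtMost_iff mult_mono order_trans)
    then have "N * exp (b * t) \<le> N * exp (\<bar>b\<bar> * T)" using N by (intro mult_left_mono) auto
    then show "norm (R t) \<le> N * exp (\<bar>b\<bar> * T)" using Nb[of t] t by simp
  qed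
  then show bd: "norm (R t) \<le> D" if "t \<in> {0..T}" for t
    unfolding D using that by (intro cSUP_upper)
  have "norm (R 0) \<le> D" using T by (intro bd) simp
  then show "0 \<le> D" using norm_ge_zero[of "R 0"] by linarith
qed

text \<open>For \<open>x\<close> in the domain the orbit is differentiable, so a bound on the
  derivative suffices. Of the two resolvent equations, the one containing \<open>R t (A x)\<close>
  is used, because this term is bounded by the graph norm of \<open>x\<close> at once.\<close>

lemma resolvent_Lipschitz:
  fixes R :: "real \<Rightarrow> 'x::{banach,second_countable_topology} \<Rightarrow>\<^sub>L 'x"
  assumes R: "resolvent_operator DA A B R" and T: "0 \<le> T" and D: "D = (SUP t\<in>{0..T}. norm (R t))"
    and B0: "\<exists>K. \<forall>y\<in>DA. norm (B 0 y) \<le> K * graph_norm A y"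
    and c: "\<forall>t\<ge>0. 0 \<le> c t" "integrable (lebesgue_on {0..T}) c"
    and W: "\<forall>y\<in>DA. \<exists>w. has_W11_derivative (\<lambda>t. B t y) w \<and>
           (AE t in lebesgue_on {0..}. norm (w t) \<le> c t * graph_norm A y)"
  obtains C where "0 \<le> C" "\<And>x u v. x \<in> DA \<Longrightarrow> u \<in> {0..T} \<Longrightarrow> v \<in> {0..T} \<Longrightarrow>
     norm (R u x - R v x) \<le> C * \<bar>u - v\<bar> * graph_norm A x"
proof -
  note RD = resolvent_bounded[OF R T D]
  obtain K where K: "\<And>y. y \<in> DA \<Longrightarrow> norm (B 0 y) \<le> K * graph_norm A y" using B0 by blast
  define c1 where "c1 = (\<integral>s. c s \<partial>lebesgue_on {0..T})"
  have c1: "0 \<le> c1" unfolding c1_def using c(1)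
    by (intro integral_nonneg_AE AE_I2) (auto simp: space_restrict_space)
  define K' where "K' = max K 0 + c1"
  have g0: "0 \<le> graph_norm A y" for y by (simp add: graph_norm_def)
  \<comment> \<open>The operators \<open>B t\<close> are bounded on the graph-norm space for each
    \<open>t\<close> separately. Integrating the derivative \<open>w\<close> from time 0 makes the
    bound uniform on \<open>{0..T}\<close>.\<close>
  have Bt: "norm (B t y) \<le> K' * graph_norm A y" if y: "y \<in> DA" and t: "t \<in> {0..T}" for y t
  proof -
    from bspec[OF W y] obtain w where w: "has_W11_derivative (\<lambda>t. B t y) w"
      "AE t in lebesgue_on {0..}. norm (w t) \<le> c t * graph_norm A y"
      by (elim exE conjE) (rule that)
    have Bw: "B t y = B 0 y + (\<integral>s. w s \<partial>lebesgue_on {0..t})"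
      using w(1)[unfolded has_W11_derivative_def, THEN conjunct2, THEN conjunct2, rule_format, of t] t by simp
    have int_c: "integrable (lebesgue_on {0..t}) c"
    proof -
      have "integrable lebesgue (\<lambda>s. indicat_real {0..T} s *\<^sub>R c s)" using c(2) by (simp add: integrable_restrict_space)
      from integrable_mult_indicator[OF _ this, of "{0..t}"]
      have "integrable lebesgue (\<lambda>s. indicat_real {0..t} s *\<^sub>R (indicat_real {0..T} s *\<^sub>R c s))" by simp
      moreover have "(\<lambda>s. indicat_real {0..t} s *\<^sub>R (indicat_real {0..T} s *\<^sub>R c s)) = (\<lambda>s. indicat_real {0..t} s *\<^sub>R c s)"
        using t by (auto simp: indicator_def)
      ultimately have "integrable lebesgue (\<lambda>s. indicat_real {0..t} s *\<^sub>R c s)" by (simp only:)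
      then show ?thesis by (simp add: integrable_restrict_space)
    qed
    have ct: "(\<integral>s. c s \<partial>lebesgue_on {0..t}) \<le> c1"
    proof -
      have 1: "integrable lebesgue (\<lambda>s. indicat_real {0..t} s * c s)" "integrable lebesgue (\<lambda>s. indicat_real {0..T} s * c s)"
        using int_c c(2) by (simp_all add: integrable_restrict_space)
      have "(\<integral>s. indicat_real {0..t} s * c s \<partial>lebesgue) \<le> (\<integral>s. indicat_real {0..T} s * c s \<partial>lebesgue)"
        using t c(1) by (intro integral_mono 1) (auto simp: indicator_def)
      then show ?thesis unfolding c1_def by (simp add: integral_restrict_space)
    qed
    have AEw: "AE s in lebesgue_on {0..t}. norm (w s) \<le> c s * graph_norm A y"
    proof -
      have "AE s in lebesgue. s \<in> {0..} \<longrightarrow> norm (w s) \<le> c s * graph_norm A y"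
        using w(2) by (subst (asm) AE_restrict_space_iff) auto
      then show ?thesis by (subst AE_restrict_space_iff) (auto elim: eventually_mono)
    qed
    have "norm (\<integral>s. w s \<partial>lebesgue_on {0..t}) \<le> (\<integral>s. c s * graph_norm A y \<partial>lebesgue_on {0..t})"
    proof (rule order_trans[OF integral_norm_bound])
      show "(\<integral>s. norm (w s) \<partial>lebesgue_on {0..t}) \<le> (\<integral>s. c s * graph_norm A y \<partial>lebesgue_on {0..t})"
      proof (rule integral_mono_AE')
        show "integrable (lebesgue_on {0..t}) (\<lambda>s. c s * graph_norm A y)" using int_c by simp
        show "AE s in lebesgue_on {0..t}. 0 \<le> c s * graph_norm A y"
          using AEw by eventually_elim (rule order_trans[OF norm_ge_zero])
      qed (rule AEw)
    qed
    also have "\<dots> \<le> c1 * graph_norm A y" using ct g0[of y] by (simp add: mult_right_mono)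
    finally have "norm (B t y) \<le> K * graph_norm A y + c1 * graph_norm A y"
      unfolding Bw using K[OF y] norm_triangle_ineq[of "B 0 y" "\<integral>s. w s \<partial>lebesgue_on {0..t}"] by linarith
    also have "\<dots> \<le> K' * graph_norm A y"
      using mult_right_mono[of K "max K 0" "graph_norm A y"] g0[of y] by (simp add: K'_def algebra_simps)
    finally show ?thesis .
  qed
  \<comment> \<open>\<open>D\<close> bounds \<open>R t (A x)\<close>, and
    \<open>T * (D * K')\<close> bounds the memory integral.\<close>
  define C where "C = D + T * (D * K')"
  have K0: "0 \<le> K'" using c1 by (simp add: K'_def)
  have C: "0 \<le> C" using RD(2) T K0 by (simp add: C_def)
  show ?thesis
  proof (rule that[OF C])
    fix x u v assume x: "x \<in> DA" and uv: "u \<in> {0..T}" "v \<in> {0..T}"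
    have "\<exists>R'. continuous_on {0..} R' \<and>
           (\<forall>t\<ge>0. ((\<lambda>s. R s x) has_vector_derivative R' t) (at t within {0..}) \<and>
              R' t = A (R t x) + (\<integral>s. B (t - s) (R s x) \<partial>lebesgue_on {0..t}) \<and>
              R' t = R t (A x) + (\<integral>s. R (t - s) (B s x) \<partial>lebesgue_on {0..t}))"
      using R[unfolded resolvent_operator_def, THEN conjunct2, THEN conjunct2, THEN conjunct2, rule_format, OF x]
      by (elim conjE)
    then obtain R' where R'0: "\<forall>t\<ge>0. ((\<lambda>s. R s x) has_vector_derivative R' t) (at t within {0..}) \<and>
              R' t = A (R t x) + (\<integral>s. B (t - s) (R s x) \<partial>lebesgue_on {0..t}) \<and>
              R' t = R t (A x) + (\<integral>s. R (t - s) (B s x) \<partial>lebesgue_on {0..t})"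
      by (elim exE conjE)
    have R': "\<And>t. t \<ge> 0 \<Longrightarrow> ((\<lambda>s. R s x) has_vector_derivative R' t) (at t within {0..})"
      "\<And>t. t \<ge> 0 \<Longrightarrow> R' t = R t (A x) + (\<integral>s. R (t - s) (B s x) \<partial>lebesgue_on {0..t})"
      by (rule R'0[rule_format, THEN conjunct1], assumption)
        (rule R'0[rule_format, THEN conjunct2, THEN conjunct2], assumption)
    have R'b: "norm (R' t) \<le> C * graph_norm A x" if t: "t \<in> {0..T}" for t
    proof -
      have 1: "norm (R t (A x)) \<le> D * graph_norm A x"
        using norm_blinfun[of "R t" "A x"] RD(1)[OF t] RD(2) mult_mono[of "norm (R t)" D "norm (A x)" "graph_norm A x"]
        by (simp add: graph_norm_def)
      have 2: "norm (\<integral>s. R (t - s) (B s x) \<partial>lebesgue_on {0..t}) \<le> T * (D * K' * graph_norm A x)"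
      proof (cases "integrable (lebesgue_on {0..t}) (\<lambda>s. R (t - s) (B s x))")
        case True
        interpret finite_measure "lebesgue_on {0..t}" by (rule finite_measure_lebesgue_on)
        have "norm (\<integral>s. R (t - s) (B s x) \<partial>lebesgue_on {0..t}) \<le> (\<integral>s. D * K' * graph_norm A x \<partial>lebesgue_on {0..t})"
        proof (rule Bochner_Integration.integral_norm_bound_integral[OF True])
          fix s assume "s \<in> space (lebesgue_on {0..t})"
          then have s: "s \<in> {0..T}" "t - s \<in> {0..T}" using t by (auto simp: space_restrict_space)
          have "norm (R (t - s) (B s x)) \<le> norm (R (t - s)) * norm (B s x)" by (rule norm_blinfun)
          also have "\<dots> \<le> D * (K' * graph_norm A x)"
            using RD(1)[OF s(2)] Bt[OF x s(1)] RD(2) by (intro mult_mono) auto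
          finally show "norm (R (t - s) (B s x)) \<le> D * K' * graph_norm A x" by (simp add: mult.assoc)
        qed simp
        also have "\<dots> = t * (D * K' * graph_norm A x)"
          using t by (simp add: measure_restrict_space space_restrict_space)
        also have "\<dots> \<le> T * (D * K' * graph_norm A x)"
          using t RD(2) K0 g0[of x] by (intro mult_right_mono) auto
        finally show ?thesis .
      next
        \<comment> \<open>A non-integrable integrand gives the integral 0, for which the bound is
          trivial.\<close>
        case False
        then show ?thesis using T RD(2) K0 g0[of x] by (simp add: not_integrable_integral_eq)
      qed
      show ?thesis
        using R'(2)[of t] t norm_triangle_ineq[of "R t (A x)" "\<integral>s. R (t - s) (B s x) \<partial>lebesgue_on {0..t}"] 1 2
        by (simp add: C_def algebra_simps)
    qed
    have "norm (R u x - R v x) \<le> C * graph_norm A x * norm (u - v)"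
    proof (rule differentiable_bound[where S = "{0..T}" and f' = "\<lambda>t h. h *\<^sub>R R' t"])
      show "((\<lambda>s. R s x) has_derivative (\<lambda>h. h *\<^sub>R R' t)) (at t within {0..T})" if "t \<in> {0..T}" for t
        using R'(1)[of t] that has_vector_derivative_within_subset[of "\<lambda>s. R s x" "R' t" t "{0..}" "{0..T}"]
        by (auto simp: has_vector_derivative_def)
      show "onorm (\<lambda>h. h *\<^sub>R R' t) \<le> C * graph_norm A x" if "t \<in> {0..T}" for t
        using R'b[OF that] C g0[of x] by (intro onorm_bound) (auto simp: mult.commute intro!: mult_left_mono)
    qed (use uv in auto)
    then show "norm (R u x - R v x) \<le> C * \<bar>u - v\<bar> * graph_norm A x" by (simp add: mult_ac)
  qed
qed

text \<open>\<open>A\<close> is unbounded, so \<open>A (v t)\<close> need not be continuous in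
  \<open>t\<close>. It is, however, the pointwise limit of difference quotients of the semigroup,
  and these are continuous in \<open>t\<close>.\<close>

lemma generator_measurable:
  fixes v :: "real \<Rightarrow> 'x::{banach,second_countable_topology}"
  assumes S: "infinitesimal_generator DA A S" and v: "continuous_on {0..T} v" "\<And>t. t \<in> {0..T} \<Longrightarrow> v t \<in> DA"
  shows "(\<lambda>t. indicat_real {0..T} t *\<^sub>R A (v t)) \<in> borel_measurable borel"
proof (rule borel_measurable_LIMSEQ_metric)
  let ?h = "\<lambda>k::nat. inverse (real (Suc k))"
  show "(\<lambda>t. indicat_real {0..T} t *\<^sub>R ((S (?h k) (v t) - v t) /\<^sub>R ?h k)) \<in> borel_measurable borel" for k
    by (intro borel_measurable_continuous_on_indicator continuous_intros v) auto
  fix t :: real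
  show "(\<lambda>k. indicat_real {0..T} t *\<^sub>R ((S (?h k) (v t) - v t) /\<^sub>R ?h k)) \<longlonglongrightarrow> indicat_real {0..T} t *\<^sub>R A (v t)"
  proof (cases "t \<in> {0..T}")
    case True
    then have "((\<lambda>h. (S h (v t) - v t) /\<^sub>R h) \<longlongrightarrow> A (v t)) (at_right 0)"
      using S v(2) unfolding infinitesimal_generator_def by blast
    moreover have "filterlim ?h (at_right 0) sequentially"
      unfolding filterlim_at using LIMSEQ_inverse_real_of_nat by (auto simp del: of_nat_Suc)
    ultimately have "(\<lambda>k. (S (?h k) (v t) - v t) /\<^sub>R ?h k) \<longlonglongrightarrow> A (v t)" by (rule filterlim_compose)
    then show ?thesis by (intro tendsto_intros)
  qed simp
qed

lemma infsum_ennreal_eq_suminf: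
  fixes f :: "nat \<Rightarrow> ennreal"
  shows "infsum f I = (\<Sum>n. if n \<in> I then f n else 0)"
proof -
  have "infsum f I = infsum (\<lambda>n. if n \<in> I then f n else 0) UNIV"
    by (rule infsum_cong_neutral) auto
  moreover have "((\<lambda>n. if n \<in> I then f n else 0) has_sum infsum (\<lambda>n. if n \<in> I then f n else 0) UNIV) UNIV"
    by (rule has_sum_infsum) (rule nonneg_summable_on_complete, simp)
  ultimately show ?thesis using has_sum_imp_sums sums_unique by metis
qed

text \<open>Extending the eigenvalues by zero turns sums over \<open>I\<close> into series over all
  naturals, to which the usual comparison arguments apply.\<close>

definition weight :: "nat set \<Rightarrow> (nat \<Rightarrow> real) \<Rightarrow> nat \<Rightarrow> real" where
  "weight I lam n = (if n \<in> I then lam n else 0)"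

lemma infsum_weight: "(\<Sum>\<^sub>\<infinity>n\<in>I. ennreal (lam n * X n)) = (\<Sum>n. ennreal (weight I lam n * X n))"
  unfolding infsum_ennreal_eq_suminf weight_def by (intro arg_cong[where f = suminf] ext) auto

lemma L20_sq_eq: "L20_sq I lam e \<psi> = (\<Sum>n. ennreal (weight I lam n * (norm (\<psi> (e n)))\<^sup>2))"
  unfolding L20_sq_def by (rule infsum_weight)

lemma weight_nonneg: "\<forall>n\<in>I. 0 \<le> lam n \<Longrightarrow> 0 \<le> weight I lam n"
  by (simp add: weight_def)

lemma L20_sq_add_le:
  assumes "\<forall>n\<in>I. 0 \<le> lam n"
  shows "L20_sq I lam e (\<lambda>y. \<phi> y + \<psi> y) \<le> 2 * L20_sq I lam e \<phi> + 2 * L20_sq I lam e \<psi>"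
proof -
  have "L20_sq I lam e (\<lambda>y. \<phi> y + \<psi> y)
    \<le> (\<Sum>n. 2 * ennreal (weight I lam n * (norm (\<phi> (e n)))\<^sup>2) + 2 * ennreal (weight I lam n * (norm (\<psi> (e n)))\<^sup>2))"
    unfolding L20_sq_eq
  proof (rule suminf_le)
    fix n
    have "weight I lam n * (norm (\<phi> (e n) + \<psi> (e n)))\<^sup>2
      \<le> weight I lam n * (2 * (norm (\<phi> (e n)))\<^sup>2 + 2 * (norm (\<psi> (e n)))\<^sup>2)"
      by (intro mult_left_mono norm_add_sq_le weight_nonneg assms)
    also have "ennreal \<dots> = 2 * ennreal (weight I lam n * (norm (\<phi> (e n)))\<^sup>2) + 2 * ennreal (weight I lam n * (norm (\<psi> (e n)))\<^sup>2)"
      using weight_nonneg[OF assms, of n]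
      by (simp add: distrib_left mult.left_commute[of _ 2] ennreal_mult ennreal_plus)
    finally show "ennreal (weight I lam n * (norm (\<phi> (e n) + \<psi> (e n)))\<^sup>2)
      \<le> 2 * ennreal (weight I lam n * (norm (\<phi> (e n)))\<^sup>2) + 2 * ennreal (weight I lam n * (norm (\<psi> (e n)))\<^sup>2)"
      by (simp add: ennreal_leI)
  qed auto
  also have "\<dots> = 2 * L20_sq I lam e \<phi> + 2 * L20_sq I lam e \<psi>"
    unfolding L20_sq_eq by (subst suminf_add[symmetric]) (auto simp: ennreal_suminf_cmult)
  finally show ?thesis .
qed

text \<open>\<open>R\<close> is continuous only strongly. Writing the argument as its limit plus a
  small error, the error is controlled by the uniform bound on the operators.\<close>

lemma blinfun_tendsto_strong:
  fixes R :: "'c \<Rightarrow> 'x::real_normed_vector \<Rightarrow>\<^sub>L 'y::real_normed_vector"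
  assumes b: "eventually (\<lambda>z. norm (R z) \<le> D) F"
    and y: "(y \<longlongrightarrow> y0) F" and R: "((\<lambda>z. R z y0) \<longlongrightarrow> l) F"
  shows "((\<lambda>z. R z (y z)) \<longlongrightarrow> l) F"
proof -
  have n0: "((\<lambda>z. D * norm (y z - y0)) \<longlongrightarrow> 0) F"
    by (intro tendsto_mult_right_zero tendsto_norm_zero LIM_zero y)
  have "((\<lambda>z. R z (y z - y0)) \<longlongrightarrow> 0) F"
  proof (rule Lim_null_comparison[OF _ n0])
    show "\<forall>\<^sub>F z in F. norm (R z (y z - y0)) \<le> D * norm (y z - y0)" using b
    proof eventually_elim
      case (elim z)
      have "norm (R z (y z - y0)) \<le> norm (R z) * norm (y z - y0)" by (rule norm_blinfun)
      also have "\<dots> \<le> D * norm (y z - y0)" using elim by (intro mult_right_mono) auto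
      finally show ?case .
    qed
  qed
  from tendsto_add[OF this R] show ?thesis by (simp add: blinfun.diff_right)
qed

lemma continuous_on_strong:
  fixes R :: "real \<Rightarrow> 'x::real_normed_vector \<Rightarrow>\<^sub>L 'y::real_normed_vector"
  assumes RD: "\<And>t. t \<in> {0..T} \<Longrightarrow> norm (R t) \<le> D"
    and Rc: "\<And>x. continuous_on {0..} (\<lambda>t. R t x)"
    and a: "continuous_on S \<alpha>" "\<And>z. z \<in> S \<Longrightarrow> \<alpha> z \<in> {0..T}" and y: "continuous_on S y"
  shows "continuous_on S (\<lambda>z. R (\<alpha> z) (y z))"
  unfolding continuous_on_def
proof
  fix z assume z: "z \<in> S"
  show "((\<lambda>z. R (\<alpha> z) (y z)) \<longlongrightarrow> R (\<alpha> z) (y z)) (at z within S)"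
  proof (rule blinfun_tendsto_strong)
    show "\<forall>\<^sub>F u in at z within S. norm (R (\<alpha> u)) \<le> D"
      unfolding eventually_at_filter using RD a(2) by (auto intro!: always_eventually)
    show "(y \<longlongrightarrow> y z) (at z within S)" using y z by (simp add: continuous_on_def)
    have "continuous_on S (\<lambda>u. R (\<alpha> u) (y z))"
      by (rule continuous_on_compose2[OF Rc a(1)]) (use a(2) in auto)
    then show "((\<lambda>u. R (\<alpha> u) (y z)) \<longlongrightarrow> R (\<alpha> z) (y z)) (at z within S)"
      using z by (simp add: continuous_on_def)
  qed
qed

section \<open>Convolution with the singular kernel, one coordinate at a time\<close>

locale convolution_kernel =
  fixes T H D \<delta> :: real
    and R :: "real \<Rightarrow> 'x::{real_inner,banach,second_countable_topology} \<Rightarrow>\<^sub>L 'x"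
  assumes T: "0 < T" and H: "0 < H" "H < 1/2" and D: "0 \<le> D" and \<delta>: "0 < H - 1/2 + \<delta>"
    and RD: "\<And>t. t \<in> {0..T} \<Longrightarrow> norm (R t) \<le> D"
    and Rc: "\<And>x. continuous_on {0..} (\<lambda>t. R t x)"
    and KL2: "\<And>t. t \<in> {0..T} \<Longrightarrow> K_H H t \<in> L2 (lebesgue_on {0..t})"
begin

definition k0 :: real where "k0 = \<bar>c_H H * (H - 1/2)\<bar>"
text \<open>The mass of the weight \<open>k0 * r powr (H - 3/2 + \<delta>)\<close> on
  \<open>{0<..<T}\<close>; it is finite exactly because \<open>H - 1/2 + \<delta>\<close> is
  positive.\<close>

definition \<kappa> :: real where "\<kappa> = k0 * (T powr (H - 1/2 + \<delta>) / (H - 1/2 + \<delta>))"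

lemma k0_nonneg: "0 \<le> k0" by (simp add: k0_def)
lemma \<kappa>_nonneg: "0 \<le> \<kappa>" using k0_nonneg \<delta> by (simp add: \<kappa>_def)

lemma RD': "t \<in> {0..T} \<Longrightarrow> norm (R t x) \<le> D * norm x"
  using norm_blinfun[of "R t" x] mult_right_mono[OF RD[of t], of "norm x"] by simp

lemma kernel_integral_le:
  assumes s: "0 \<le> s" "s \<le> T"
  shows "(\<integral>\<^sup>+r. indicator {s<..<T} r * ennreal (k0 * (r - s) powr (H - 3/2 + \<delta>)) \<partial>lborel) \<le> ennreal \<kappa>"
proof -
  have "(\<integral>\<^sup>+r. indicator {s<..<T} r * ennreal (k0 * (r - s) powr (H - 3/2 + \<delta>)) \<partial>lborel)
    \<le> (\<integral>\<^sup>+r. ennreal k0 * (ennreal ((r - s) powr (H - 3/2 + \<delta>)) * indicator {s..T} r) \<partial>lborel)"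
    using k0_nonneg by (intro nn_integral_mono) (auto simp: indicator_def ennreal_mult)
  also have "\<dots> = ennreal k0 * ennreal ((T - s) powr (H - 3/2 + \<delta> + 1) / (H - 3/2 + \<delta> + 1))"
    using \<delta> s by (subst nn_integral_cmult) (simp_all add: nn_integral_powr_shift)
  also have "\<dots> = ennreal (k0 * ((T - s) powr (H - 1/2 + \<delta>) / (H - 1/2 + \<delta>)))"
    using k0_nonneg \<delta> by (simp add: ennreal_mult[symmetric] algebra_simps)
  also have "\<dots> \<le> ennreal \<kappa>"
    unfolding \<kappa>_def using \<delta> s k0_nonneg
    by (intro ennreal_leI mult_left_mono divide_right_mono powr_mono2) auto
  finally show ?thesis .
qed

lemma K_ext: "indicat_real {0..t} s *\<^sub>R (K_H H t s) = K_H H t s" if "0 \<le> s"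
  using that by (simp add: K_H_def indicator_def)

lemma KL2_ext: "t \<in> {0..T} \<Longrightarrow> K_H H t \<in> L2 (lebesgue_on {0..T})"
proof -
  assume t: "t \<in> {0..T}"
  have L: "(\<lambda>s. indicat_real {0..t} s *\<^sub>R K_H H t s) \<in> L2 (lebesgue_on {0..T})"
    using KL2[OF t] indicator_cut(3)[of t T "K_H H t"] t by auto
  have "K_H H t \<in> borel_measurable (lebesgue_on {0..T}) \<longleftrightarrow>
     (\<lambda>s. indicat_real {0..t} s *\<^sub>R K_H H t s) \<in> borel_measurable (lebesgue_on {0..T})"
    by (rule measurable_cong) (simp add: K_ext[unfolded real_scaleR_def] space_restrict_space)
  then show ?thesis
    using L2_measurable[OF L]
    by (intro L2_cong_AE(1)[OF L] AE_I2 K_ext[symmetric]) (simp_all add: space_restrict_space)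
qed

lemma indicator_Ioo_measurable: "(\<lambda>(s, r). indicat_real {s<..<t :: real} r) \<in> borel_measurable (borel \<Otimes>\<^sub>M borel)"
proof -
  have "(\<lambda>(s, r). indicat_real {s<..<t} r) = (\<lambda>p. if fst p < snd p \<and> snd p < t then 1 else 0)"
    by (auto simp: indicator_def)
  moreover have "(\<lambda>p. if fst p < snd p \<and> snd p < t then 1 else 0 :: real) \<in> borel_measurable (borel \<Otimes>\<^sub>M borel)"
    by measurable
  ultimately show ?thesis by (simp only:)
qed

end

text \<open>In the application \<open>v\<close> is one coordinate of \<sigma>, that is
  \<open>sqrt (lam n) *\<^sub>R \<sigma> s (e n)\<close> cut off outside \<open>{0..T}\<close>, and
  \<open>p\<close> is its graph norm on that interval; \<open>C\<close> then comes from
  \<open>resolvent_Lipschitz\<close>.\<close>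

locale convolution = convolution_kernel T H D \<delta> R for T H D \<delta> R +
  fixes v :: "real \<Rightarrow> 'x::{real_inner,banach,second_countable_topology}" and p :: "real \<Rightarrow> real" and C :: real
  assumes v [measurable]: "v \<in> borel_measurable borel" and vc: "continuous_on {0..T} v" and v0: "\<And>s. s \<notin> {0..T} \<Longrightarrow> v s = 0"
    and p [measurable]: "p \<in> borel_measurable borel" and p0: "\<And>s. 0 \<le> p s" and C: "0 \<le> C"
    and Lip: "\<And>s u w. s \<in> {0..T} \<Longrightarrow> u \<in> {0..T} \<Longrightarrow> w \<in> {0..T} \<Longrightarrow> norm (R u (v s) - R w (v s)) \<le> C * \<bar>u - w\<bar> * p s"
begin

text \<open>Up to \<open>s = t\<close> this is the integrand of the convolution. Freezing the time
  of \<open>R\<close> at 0 beyond \<open>t\<close> keeps \<open>cf t\<close> continuous and bounded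
  on all of \<open>{0..T}\<close>.\<close>

definition cf :: "real \<Rightarrow> real \<Rightarrow> 'x" where "cf t s = R (max 0 (t - s)) (v s)"
text \<open>Majorant of the increment of \<open>cf t\<close> between \<open>s\<close> and
  \<open>r\<close>. It does not involve \<open>t\<close>, and everything derived from it is uniform
  in \<open>t\<close>.\<close>

definition q :: "real \<Rightarrow> real \<Rightarrow> real" where "q r s = D * norm (v r - v s) + C * \<bar>r - s\<bar> * p s"
text \<open>The resulting majorant of \<open>G t s\<close> for all \<open>t\<close>. Infinite values
  are allowed, as finiteness will hold only for almost every \<open>s\<close>.\<close>

definition \<Gamma>e :: "real \<Rightarrow> ennreal" where
  "\<Gamma>e s = (\<integral>\<^sup>+r. indicator {s<..<T} r * ennreal (k0 * (r - s) powr (H - 3/2) * q r s) \<partial>lborel)"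
text \<open>Bound for the square of \<open>\<Gamma>e\<close> that is linear in the square of
  \<open>q\<close>, and can thus be summed over coordinates before integrating.\<close>

definition P :: "real \<Rightarrow> ennreal" where
  "P s = ennreal \<kappa> * (\<integral>\<^sup>+r. indicator {s<..<T} r * ennreal (k0 * (r - s) powr (H - 3/2 - \<delta>) * (q r s)\<^sup>2) \<partial>lborel)"
definition G :: "real \<Rightarrow> real \<Rightarrow> 'x" where
  "G t s = (\<integral>r. indicat_real {s<..<t} r *\<^sub>R (dK H r s *\<^sub>R (cf t r - cf t s)) \<partial>lborel)"
text \<open>The value of \<open>K_star\<close> on the convolution integrand, rewritten with Borel
  data; it is defined for every \<open>s\<close>.\<close>

definition h :: "real \<Rightarrow> real \<Rightarrow> 'x" where "h t s = K_H H t s *\<^sub>R cf t s + G t s"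
definition \<Gamma> :: "real \<Rightarrow> real" where "\<Gamma> s = enn2real (\<Gamma>e s)"

lemma q_nonneg: "0 \<le> q r s" using D C p0 by (simp add: q_def)

lemma cf_bound: "t \<in> {0..T} \<Longrightarrow> norm (cf t s) \<le> D * norm (v s)"
proof (cases "s \<in> {0..T}")
  case True
  then show "t \<in> {0..T} \<Longrightarrow> norm (cf t s) \<le> D * norm (v s)" unfolding cf_def by (intro RD') auto
qed (simp add: cf_def v0)

lemma cf_diff:
  assumes "0 \<le> s" "s < r" "r < t" "t \<le> T"
  shows "norm (cf t r - cf t s) \<le> q r s"
proof -
  \<comment> \<open>The increment is split into one of \<open>v\<close>, controlled by the norm of
    \<open>R\<close>, and one of \<open>R\<close> at the fixed vector \<open>v s\<close>, controlled
    by its Lipschitz constant.\<close>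
  have "cf t r - cf t s = R (t - r) (v r - v s) + (R (t - r) (v s) - R (t - s) (v s))"
    using assms by (simp add: cf_def blinfun.diff_right)
  also have "norm \<dots> \<le> norm (R (t - r) (v r - v s)) + norm (R (t - r) (v s) - R (t - s) (v s))"
    by (rule norm_triangle_ineq)
  also have "\<dots> \<le> D * norm (v r - v s) + C * \<bar>(t - r) - (t - s)\<bar> * p s"
    using assms by (intro add_mono RD' Lip) auto
  finally show ?thesis by (simp add: q_def abs_minus_commute)
qed

lemma cf_continuous: "t \<in> {0..T} \<Longrightarrow> continuous_on {0..T} (cf t)"
  unfolding cf_def[abs_def] by (rule continuous_on_strong[OF RD Rc]) (auto intro!: continuous_intros vc)

lemma cf_continuous_time: "s \<in> {0..T} \<Longrightarrow> continuous_on {0..T} (\<lambda>t. cf t s)"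
  unfolding cf_def[abs_def] by (rule continuous_on_strong[OF RD Rc]) (auto intro!: continuous_intros)

lemma cf_measurable: "t \<in> {0..T} \<Longrightarrow> cf t \<in> borel_measurable borel"
proof -
  assume t: "t \<in> {0..T}"
  have "(\<lambda>s. indicat_real {0..T} s *\<^sub>R cf t s) \<in> borel_measurable borel"
    by (intro borel_measurable_continuous_on_indicator cf_continuous t) simp
  moreover have "(\<lambda>s. indicat_real {0..T} s *\<^sub>R cf t s) = cf t"
    using v0 by (auto simp: cf_def indicator_def)
  ultimately show ?thesis by simp
qed

lemma q_measurable: "(\<lambda>(s, r). q r s) \<in> borel_measurable (borel \<Otimes>\<^sub>M borel)"
  unfolding q_def by measurable

lemma \<Gamma>e_measurable [measurable]: "\<Gamma>e \<in> borel_measurable borel"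
proof -
  have [measurable]: "(\<lambda>x. indicat_real {fst x<..<T} (snd x)) \<in> borel_measurable (borel \<Otimes>\<^sub>M borel)"
    using indicator_Ioo_measurable[of T] by (simp add: case_prod_beta')
  have [measurable]: "(\<lambda>x. q (snd x) (fst x)) \<in> borel_measurable (borel \<Otimes>\<^sub>M borel)"
    using q_measurable by (simp add: case_prod_beta')
  have "(\<lambda>(s, r). ennreal (indicat_real {s<..<T} r * (k0 * (r - s) powr (H - 3/2) * q r s))) \<in> borel_measurable (borel \<Otimes>\<^sub>M lborel)"
    unfolding case_prod_beta' by measurable
  moreover have "ennreal (indicat_real {s<..<T} r * (k0 * (r - s) powr (H - 3/2) * q r s))
     = indicator {s<..<T} r * ennreal (k0 * (r - s) powr (H - 3/2) * q r s)" for s r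
    by (simp add: indicator_def)
  ultimately have "(\<lambda>(s, r). indicator {s<..<T} r * ennreal (k0 * (r - s) powr (H - 3/2) * q r s)) \<in> borel_measurable (borel \<Otimes>\<^sub>M lborel)"
    by (simp only:)
  then show ?thesis
    unfolding \<Gamma>e_def[abs_def] by (rule lborel.borel_measurable_nn_integral)
qed

lemma section_measurable:
  assumes "t \<in> {0..T}"
  shows "(\<lambda>r. indicat_real {s<..<t} r *\<^sub>R (dK H r s *\<^sub>R (cf t r - w))) \<in> borel_measurable borel"
  using cf_measurable[OF assms] unfolding dK_def by measurable

lemma G_measurable: "t \<in> {0..T} \<Longrightarrow> G t \<in> borel_measurable borel"
proof -
  assume t: "t \<in> {0..T}"
  note [measurable] = cf_measurable[OF t]
  have [measurable]: "(\<lambda>x. indicat_real {fst x<..<t} (snd x)) \<in> borel_measurable (borel \<Otimes>\<^sub>M borel)"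
    using indicator_Ioo_measurable[of t] by (simp add: case_prod_beta')
  have "(\<lambda>(s, r). indicat_real {s<..<t} r *\<^sub>R (dK H r s *\<^sub>R (cf t r - cf t s))) \<in> borel_measurable (borel \<Otimes>\<^sub>M lborel)"
    unfolding case_prod_beta' dK_def by measurable
  then show ?thesis
    unfolding G_def[abs_def] by (rule lborel.borel_measurable_lebesgue_integral)
qed

text \<open>Cauchy-Schwarz after splitting the exponent \<open>H - 3/2\<close> as the mean of
  \<open>H - 3/2 + \<delta>\<close> and \<open>H - 3/2 - \<delta>\<close>. The first factor
  integrates to at most \<open>\<kappa>\<close>; the stronger singularity in the second is left to
  the smallness of \<open>q\<close> near the diagonal.\<close>

lemma \<Gamma>e_sq_le:
  assumes s: "0 \<le> s" "s \<le> T"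
  shows "(\<Gamma>e s)\<^sup>2 \<le> P s"
proof -
  let ?u = "\<lambda>r. indicator {s<..<T} r * ennreal (sqrt k0 * (r - s) powr ((H - 3/2 + \<delta>) / 2))"
  let ?w = "\<lambda>r. indicator {s<..<T} r * ennreal (sqrt k0 * (r - s) powr ((H - 3/2 - \<delta>) / 2) * q r s)"
  have qm [measurable]: "(\<lambda>r. q r s) \<in> borel_measurable borel" unfolding q_def by measurable
  have "(\<Gamma>e s)\<^sup>2 = (\<integral>\<^sup>+r. ?u r * ?w r \<partial>lborel)\<^sup>2"
    unfolding \<Gamma>e_def
  proof (intro arg_cong[where f = "\<lambda>x. x\<^sup>2"] nn_integral_cong)
    fix r
    have "k0 * (r - s) powr (H - 3/2) * q r s = sqrt k0 * (r - s) powr ((H - 3/2 + \<delta>) / 2) * (sqrt k0 * (r - s) powr ((H - 3/2 - \<delta>) / 2) * q r s)"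
    proof -
      have "(H - 3/2 + \<delta>) / 2 + (H - 3/2 - \<delta>) / 2 = H - 3/2" by (simp add: field_simps)
      then have e: "(r - s) powr ((H - 3/2 + \<delta>) / 2) * (r - s) powr ((H - 3/2 - \<delta>) / 2) = (r - s) powr (H - 3/2)"
        by (simp only: powr_add[symmetric])
      have k: "sqrt k0 * sqrt k0 = k0" using k0_nonneg by simp
      have "sqrt k0 * (r - s) powr ((H - 3/2 + \<delta>) / 2) * (sqrt k0 * (r - s) powr ((H - 3/2 - \<delta>) / 2) * q r s)
        = (sqrt k0 * sqrt k0) * ((r - s) powr ((H - 3/2 + \<delta>) / 2) * (r - s) powr ((H - 3/2 - \<delta>) / 2)) * q r s"
        by (simp only: mult_ac)
      also have "\<dots> = k0 * (r - s) powr (H - 3/2) * q r s" by (simp only: e k)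
      finally show ?thesis by (rule sym)
    qed
    then show "indicator {s<..<T} r * ennreal (k0 * (r - s) powr (H - 3/2) * q r s) = ?u r * ?w r"
      using k0_nonneg q_nonneg by (simp add: indicator_def ennreal_mult[symmetric])
  qed
  also have "\<dots> \<le> (\<integral>\<^sup>+r. (?u r)\<^sup>2 \<partial>lborel) * (\<integral>\<^sup>+r. (?w r)\<^sup>2 \<partial>lborel)"
    by (rule Cauchy_Schwarz_nn_integral) measurable
  also have "(\<integral>\<^sup>+r. (?u r)\<^sup>2 \<partial>lborel) = (\<integral>\<^sup>+r. indicator {s<..<T} r * ennreal (k0 * (r - s) powr (H - 3/2 + \<delta>)) \<partial>lborel)"
  proof (intro nn_integral_cong)
    fix r show "(?u r)\<^sup>2 = indicator {s<..<T} r * ennreal (k0 * (r - s) powr (H - 3/2 + \<delta>))"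
      using k0_nonneg by (simp add: indicator_def ennreal_power power_mult_distrib power2_eq_square[of "_ powr _"] powr_add[symmetric])
  qed
  also have "(\<integral>\<^sup>+r. (?w r)\<^sup>2 \<partial>lborel) = (\<integral>\<^sup>+r. indicator {s<..<T} r * ennreal (k0 * (r - s) powr (H - 3/2 - \<delta>) * (q r s)\<^sup>2) \<partial>lborel)"
  proof (intro nn_integral_cong)
    fix r show "(?w r)\<^sup>2 = indicator {s<..<T} r * ennreal (k0 * (r - s) powr (H - 3/2 - \<delta>) * (q r s)\<^sup>2)"
      using k0_nonneg q_nonneg by (simp add: indicator_def ennreal_power power_mult_distrib power2_eq_square[of "_ powr _"] powr_add[symmetric])
  qed
  also have "(\<integral>\<^sup>+r. indicator {s<..<T} r * ennreal (k0 * (r - s) powr (H - 3/2 + \<delta>)) \<partial>lborel) *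
      (\<integral>\<^sup>+r. indicator {s<..<T} r * ennreal (k0 * (r - s) powr (H - 3/2 - \<delta>) * (q r s)\<^sup>2) \<partial>lborel) \<le> P s"
    unfolding P_def by (rule mult_right_mono[OF kernel_integral_le[OF s]]) simp
  finally show ?thesis .
qed

lemma integrand_le:
  assumes s: "0 < s" and t: "t \<le> T"
  shows "norm (indicat_real {s<..<t} r *\<^sub>R (dK H r s *\<^sub>R (cf t r - cf t s)))
    \<le> indicat_real {s<..<T} r * (k0 * (r - s) powr (H - 3/2) * q r s)"
proof (cases "r \<in> {s<..<t}")
  case True
  have "norm (dK H r s *\<^sub>R (cf t r - cf t s)) \<le> (k0 * (r - s) powr (H - 3/2)) * q r s"
    unfolding norm_scaleR real_norm_def k0_def using True s t H
    by (intro mult_mono cf_diff dK_bound) auto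
  then show ?thesis using True t by (simp add: indicator_def)
qed (use k0_nonneg q_nonneg in auto)

lemma \<Gamma>e_finite_integrable:
  assumes s: "\<Gamma>e s < \<infinity>"
  shows "integrable lborel (\<lambda>r. indicat_real {s<..<T} r * (k0 * (r - s) powr (H - 3/2) * q r s))"
    and "(\<integral>r. indicat_real {s<..<T} r * (k0 * (r - s) powr (H - 3/2) * q r s) \<partial>lborel) = \<Gamma> s"
proof -
  let ?f = "\<lambda>r. indicat_real {s<..<T} r * (k0 * (r - s) powr (H - 3/2) * q r s)"
  have qm [measurable]: "(\<lambda>r. q r s) \<in> borel_measurable borel" unfolding q_def by measurable
  have f0: "0 \<le> ?f r" for r using k0_nonneg q_nonneg by simp
  have eq: "(\<integral>\<^sup>+r. ennreal (?f r) \<partial>lborel) = \<Gamma>e s"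
    unfolding \<Gamma>e_def by (intro nn_integral_cong) (simp add: indicator_def)
  have m: "?f \<in> borel_measurable lborel" by measurable
  show "integrable lborel ?f"
    by (rule integrableI_nonneg[OF m]) (use f0 eq s in auto)
  show "(\<integral>r. ?f r \<partial>lborel) = \<Gamma> s"
    unfolding \<Gamma>_def eq[symmetric] by (rule integral_eq_nn_integral[OF m]) (use f0 in auto)
qed

lemma G_integrable:
  assumes s: "0 < s" "\<Gamma>e s < \<infinity>" and t: "t \<in> {0..T}"
  shows "integrable lborel (\<lambda>r. indicat_real {s<..<t} r *\<^sub>R (dK H r s *\<^sub>R (cf t r - cf t s)))"
  by (rule Bochner_Integration.integrable_bound[OF \<Gamma>e_finite_integrable(1)[OF s(2)]])
    (use section_measurable[OF t] integrand_le[OF s(1)] t in \<open>auto intro!: AE_I2 intro: order_trans[OF _ abs_ge_self]\<close>)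

lemma G_bound:
  assumes s: "0 < s" "\<Gamma>e s < \<infinity>" and t: "t \<in> {0..T}"
  shows "norm (G t s) \<le> \<Gamma> s"
  unfolding G_def \<Gamma>e_finite_integrable(2)[OF s(2), symmetric]
  by (rule Bochner_Integration.integral_norm_bound_integral[OF G_integrable[OF s t] \<Gamma>e_finite_integrable(1)[OF s(2)] integrand_le[OF s(1)]])
    (use t in simp)

text \<open>Dominated convergence with the majorant behind \<open>\<Gamma>e\<close>. Both the upper
  limit and the integrand move with \<open>t\<close>; the indicators converge for every
  \<open>r\<close> except \<open>r = t\<close>.\<close>

lemma G_tendsto:
  assumes s: "0 < s" "s \<le> T" "\<Gamma>e s < \<infinity>" and t: "t \<in> {0..T}" and X: "\<And>k. X k \<in> {0..T}" "X \<longlonglongrightarrow> t"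
  shows "(\<lambda>k. G (X k) s) \<longlonglongrightarrow> G t s"
  unfolding G_def
proof (rule integral_dominated_convergence[OF _ _ \<Gamma>e_finite_integrable(1)[OF s(3)]])
  have cft: "(\<lambda>k. cf (X k) r) \<longlonglongrightarrow> cf t r" if "r \<in> {0..T}" for r
    using continuous_on_tendsto_compose[OF cf_continuous_time[OF that] X(2) t] X(1) by simp
  have "AE r in lborel. r \<noteq> t" by (rule AE_lborel_singleton)
  then show "AE r in lborel. (\<lambda>k. indicat_real {s<..<X k} r *\<^sub>R (dK H r s *\<^sub>R (cf (X k) r - cf (X k) s)))
     \<longlonglongrightarrow> indicat_real {s<..<t} r *\<^sub>R (dK H r s *\<^sub>R (cf t r - cf t s))"
  proof eventually_elim
    case (elim r)
    consider "r \<le> s" | "s < r" "r < t" | "s < r" "t < r" using elim by linarith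
    then show ?case
    proof cases
      case 2
      have "\<forall>\<^sub>F k in sequentially. r < X k" by (rule order_tendstoD(1)[OF X(2) 2(2)])
      then have "\<forall>\<^sub>F k in sequentially. dK H r s *\<^sub>R (cf (X k) r - cf (X k) s) = indicat_real {s<..<X k} r *\<^sub>R (dK H r s *\<^sub>R (cf (X k) r - cf (X k) s))"
        by eventually_elim (use 2 in simp)
      moreover have "(\<lambda>k. dK H r s *\<^sub>R (cf (X k) r - cf (X k) s)) \<longlonglongrightarrow> dK H r s *\<^sub>R (cf t r - cf t s)"
        using 2 s t by (intro tendsto_intros cft) auto
      ultimately have "(\<lambda>k. indicat_real {s<..<X k} r *\<^sub>R (dK H r s *\<^sub>R (cf (X k) r - cf (X k) s))) \<longlonglongrightarrow> dK H r s *\<^sub>R (cf t r - cf t s)"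
        by (rule Lim_transform_eventually[rotated])
      then show ?thesis using 2 by simp
    next
      case 3
      have "\<forall>\<^sub>F k in sequentially. X k < r" by (rule order_tendstoD(2)[OF X(2) 3(2)])
      then have "\<forall>\<^sub>F k in sequentially. indicat_real {s<..<X k} r *\<^sub>R (dK H r s *\<^sub>R (cf (X k) r - cf (X k) s)) = 0"
        by eventually_elim simp
      then show ?thesis using 3 by (simp add: tendsto_eventually)
    qed simp
  qed
  show "AE r in lborel. norm (indicat_real {s<..<X k} r *\<^sub>R (dK H r s *\<^sub>R (cf (X k) r - cf (X k) s)))
     \<le> indicat_real {s<..<T} r * (k0 * (r - s) powr (H - 3/2) * q r s)" for k
    using integrand_le[OF s(1), of "X k"] X(1)[of k] by (intro AE_I2) auto
qed (use section_measurable[OF t] section_measurable[OF X(1)] in auto)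

lemma h_zero: "t \<le> s \<Longrightarrow> h t s = 0"
  by (simp add: h_def K_H_def G_def)

end

text \<open>Finiteness of this integral is obtained later from the sum over all coordinates, hence
  the separate locale.\<close>

locale convolution_finite = convolution +
  assumes Pfin: "(\<integral>\<^sup>+s. P s * indicator {0..T} s \<partial>lborel) < \<infinity>"
begin

lemma \<Gamma>_L2_le: "(\<integral>\<^sup>+s. ennreal ((norm (\<Gamma> s))\<^sup>2) \<partial>lebesgue_on {0..T}) \<le> (\<integral>\<^sup>+s. P s * indicator {0..T} s \<partial>lborel)"
proof -
  have "(\<integral>\<^sup>+s. ennreal ((norm (\<Gamma> s))\<^sup>2) \<partial>lebesgue_on {0..T}) = (\<integral>\<^sup>+s. ennreal ((norm (\<Gamma> s))\<^sup>2) * indicator {0..T} s \<partial>lborel)"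
    unfolding \<Gamma>_def by (rule nn_integral_lebesgue_on_borel) measurable
  also have "\<dots> \<le> (\<integral>\<^sup>+s. P s * indicator {0..T} s \<partial>lborel)"
  proof (rule nn_integral_mono)
    fix s
    \<comment> \<open>Only an inequality: where \<open>\<Gamma>e s\<close> is infinite, its real
      version is 0.\<close>
    have "ennreal ((norm (\<Gamma> s))\<^sup>2) \<le> (\<Gamma>e s)\<^sup>2"
      by (cases "\<Gamma>e s") (auto simp: \<Gamma>_def ennreal_power)
    then show "ennreal ((norm (\<Gamma> s))\<^sup>2) * indicator {0..T} s \<le> P s * indicator {0..T} s"
      using \<Gamma>e_sq_le[of s] by (auto simp: indicator_def intro: order_trans)
  qed
  finally show ?thesis .
qed

lemma \<Gamma>_L2: "\<Gamma> \<in> L2 (lebesgue_on {0..T})"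
proof -
  have "\<Gamma> \<in> borel_measurable (lebesgue_on {0..T})"
    unfolding \<Gamma>_def[abs_def] by (intro borel_measurable_lebesgue_onI) measurable
  then show ?thesis using le_less_trans[OF \<Gamma>_L2_le Pfin] by (simp add: L2_iff)
qed

lemma AE_good: "AE s in lebesgue_on {0..T}. 0 < s \<and> s \<le> T \<and> \<Gamma>e s < \<infinity>"
proof -
  have "(\<integral>\<^sup>+s. (\<Gamma>e s)\<^sup>2 * indicator {0..T} s \<partial>lborel) \<le> (\<integral>\<^sup>+s. P s * indicator {0..T} s \<partial>lborel)"
    using \<Gamma>e_sq_le by (intro nn_integral_mono) (auto simp: indicator_def)
  then have "(\<integral>\<^sup>+s. (\<Gamma>e s)\<^sup>2 \<partial>lebesgue_on {0..T}) < \<infinity>"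
    using Pfin by (subst nn_integral_lebesgue_on_borel) (auto intro: le_less_trans)
  then have "AE s in lebesgue_on {0..T}. (\<Gamma>e s)\<^sup>2 \<noteq> \<infinity>"
    by (intro nn_integral_noteq_infinite borel_measurable_lebesgue_onI) auto
  moreover have "AE s in lebesgue_on {0..T}. s \<noteq> 0" by (rule AE_lebesgue_on_neq) simp
  moreover have "AE s in lebesgue_on {0..T}. s \<in> {0..T}" by (rule AE_I2) (simp add: space_restrict_space)
  ultimately show ?thesis
    by eventually_elim (auto simp: less_top power_eq_top_ennreal)
qed

lemma G_L2: assumes t: "t \<in> {0..T}" shows "G t \<in> L2 (lebesgue_on {0..T})"
proof (rule L2_bound(1)[OF \<Gamma>_L2, of _ 1])
  show "G t \<in> borel_measurable (lebesgue_on {0..T})" by (intro borel_measurable_lebesgue_onI G_measurable t)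
  show "AE s in lebesgue_on {0..T}. norm (G t s) \<le> 1 * norm (\<Gamma> s)"
    using AE_good by eventually_elim (use G_bound[OF _ _ t] in \<open>auto intro: order_trans[OF _ abs_ge_self]\<close>)
qed simp

lemma G_diff_le:
  assumes t: "t \<in> {0..T}" "u \<in> {0..T}"
  shows "L2_norm (lebesgue_on {0..T}) (\<lambda>s. G u s - G t s) \<le> 2 * L2_norm (lebesgue_on {0..T}) \<Gamma>"
proof (rule L2_bound(2)[OF \<Gamma>_L2])
  show "(\<lambda>s. G u s - G t s) \<in> borel_measurable (lebesgue_on {0..T})"
    by (intro borel_measurable_diff borel_measurable_lebesgue_onI G_measurable t)
  show "AE s in lebesgue_on {0..T}. norm (G u s - G t s) \<le> 2 * norm (\<Gamma> s)"
    using AE_good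
  proof eventually_elim
    case (elim s)
    then have "norm (G u s) \<le> \<Gamma> s" "norm (G t s) \<le> \<Gamma> s" using G_bound t by auto
    then show ?case using norm_triangle_ineq4[of "G u s" "G t s"] by simp
  qed
qed simp

lemma G_L2_tendsto:
  assumes t: "t \<in> {0..T}" and X: "\<And>k. X k \<in> {0..T}" "X \<longlonglongrightarrow> t"
  shows "(\<lambda>k. L2_norm (lebesgue_on {0..T}) (\<lambda>s. G (X k) s - G t s)) \<longlonglongrightarrow> 0"
proof (rule L2_dominated[where G = "\<lambda>s. 2 *\<^sub>R \<Gamma> s"])
  show "(\<lambda>s. 2 *\<^sub>R \<Gamma> s) \<in> L2 (lebesgue_on {0..T})" by (rule L2_scaleR[OF \<Gamma>_L2])
  show "AE s in lebesgue_on {0..T}. norm (G (X k) s - G t s) \<le> norm (2 *\<^sub>R \<Gamma> s)" for k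
    using AE_good
  proof eventually_elim
    case (elim s)
    then have "norm (G (X k) s) \<le> \<Gamma> s" "norm (G t s) \<le> \<Gamma> s" using G_bound t X by auto
    then show ?case using norm_triangle_ineq4[of "G (X k) s" "G t s"] by simp
  qed
  show "AE s in lebesgue_on {0..T}. (\<lambda>k. G (X k) s) \<longlonglongrightarrow> G t s"
    using AE_good by eventually_elim (use G_tendsto[OF _ _ _ t X] in auto)
qed (auto intro!: borel_measurable_lebesgue_onI G_measurable t X)

abbreviation "LL \<equiv> lebesgue_on {0..T}"

lemma v_bounded: obtains V where "0 \<le> V" "\<And>s. norm (v s) \<le> V"
proof -
  have "bounded (v ` {0..T})" by (intro compact_imp_bounded compact_continuous_image vc) simp
  then obtain V where V: "\<forall>x\<in>v ` {0..T}. norm x \<le> V" unfolding bounded_iff by (elim exE)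
  show ?thesis
  proof (rule that)
    show "0 \<le> max V 0" by simp
    fix s
    have "norm (v s) \<le> V" if "s \<in> {0..T}" by (intro bspec[OF V] imageI that)
    then show "norm (v s) \<le> max V 0" using v0[of s] by (cases "s \<in> {0..T}") auto
  qed
qed

lemma Kw_L2:
  assumes t: "t \<in> {0..T}" and w: "w \<in> borel_measurable borel" "\<And>s. norm (w s) \<le> V"
  shows "(\<lambda>s. K_H H t s *\<^sub>R w s) \<in> L2 LL"
proof (rule L2_bound(1)[OF KL2_ext[OF t]])
  show "(\<lambda>s. K_H H t s *\<^sub>R w s) \<in> borel_measurable LL"
    using L2_measurable[OF KL2_ext[OF t]] borel_measurable_lebesgue_onI[OF w(1)] by (rule borel_measurable_scaleR)
  show "0 \<le> V" using w(2)[of 0] norm_ge_zero[of "w 0"] by linarith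
  show "AE s in LL. norm (K_H H t s *\<^sub>R w s) \<le> V * norm (K_H H t s)"
    using w(2) by (auto intro!: AE_I2 simp: mult.commute mult_right_mono)
qed

lemma Kv_L2: assumes t: "t \<in> {0..T}" shows "(\<lambda>s. K_H H t s *\<^sub>R norm (v s)) \<in> L2 LL"
proof -
  obtain V where V: "0 \<le> V" "\<And>s. norm (v s) \<le> V" using v_bounded by blast
  show ?thesis
  proof (rule L2_bound(1)[OF KL2_ext[OF t] _ _ V(1)])
    have "(\<lambda>s. norm (v s)) \<in> borel_measurable LL" by (intro borel_measurable_lebesgue_onI) measurable
    then show "(\<lambda>s. K_H H t s *\<^sub>R norm (v s)) \<in> borel_measurable LL"
      using L2_measurable[OF KL2_ext[OF t]] by (intro borel_measurable_scaleR)
    show "AE s in LL. norm (K_H H t s *\<^sub>R norm (v s)) \<le> V * norm (K_H H t s)"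
      using V(2) by (intro AE_I2) (simp add: abs_mult mult.commute mult_right_mono)
  qed
qed

lemma Kcf_L2: assumes t: "t \<in> {0..T}" "u \<in> {0..T}" shows "(\<lambda>s. K_H H t s *\<^sub>R cf u s) \<in> L2 LL"
proof -
  obtain V where V: "0 \<le> V" "\<And>s. norm (v s) \<le> V" using v_bounded by blast
  have "norm (cf u s) \<le> D * V" for s
    using cf_bound[OF t(2), of s] mult_left_mono[OF V(2)[of s] D] by linarith
  then show ?thesis by (intro Kw_L2 t cf_measurable)
qed

lemma h_L2: "t \<in> {0..T} \<Longrightarrow> h t \<in> L2 LL"
  unfolding h_def[abs_def] by (intro L2_add Kcf_L2 G_L2)

text \<open>The three terms stem from the increment of the kernel, of the semigroup factor, and of the
  singular integral.\<close>

lemma h_diff_le: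
  assumes t: "t \<in> {0..T}" "u \<in> {0..T}"
  shows "L2_norm LL (\<lambda>s. h u s - h t s) \<le> D * L2_norm LL (\<lambda>s. (K_H H u s - K_H H t s) *\<^sub>R norm (v s))
     + L2_norm LL (\<lambda>s. K_H H t s *\<^sub>R (cf u s - cf t s)) + L2_norm LL (\<lambda>s. G u s - G t s)"
proof -
  let ?a = "\<lambda>s. (K_H H u s - K_H H t s) *\<^sub>R cf u s" and ?b = "\<lambda>s. K_H H t s *\<^sub>R (cf u s - cf t s)"
  have aL: "?a \<in> L2 LL"
    using L2_diff[OF Kcf_L2[OF t(2) t(2)] Kcf_L2[OF t(1) t(2)]] by (simp add: scaleR_left_diff_distrib)
  have bL: "?b \<in> L2 LL"
    using L2_diff[OF Kcf_L2[OF t(1) t(2)] Kcf_L2[OF t(1) t(1)]] by (simp add: scaleR_right_diff_distrib)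
  have vL: "(\<lambda>s. (K_H H u s - K_H H t s) *\<^sub>R norm (v s)) \<in> L2 LL"
    using L2_diff[OF Kv_L2[OF t(2)] Kv_L2[OF t(1)]] by (simp add: left_diff_distrib)
  have a: "L2_norm LL ?a \<le> D * L2_norm LL (\<lambda>s. (K_H H u s - K_H H t s) *\<^sub>R norm (v s))"
  proof (rule L2_bound(2)[OF vL L2_measurable[OF aL] _ D], intro AE_I2)
    fix s
    have "\<bar>K_H H u s - K_H H t s\<bar> * norm (cf u s) \<le> \<bar>K_H H u s - K_H H t s\<bar> * (D * norm (v s))"
      by (intro mult_left_mono cf_bound t) simp
    then show "norm (?a s) \<le> D * norm ((K_H H u s - K_H H t s) *\<^sub>R norm (v s))"
      by (simp add: abs_mult mult_ac)
  qed
  have "L2_norm LL (\<lambda>s. h u s - h t s) = L2_norm LL (\<lambda>s. (?a s + ?b s) + (G u s - G t s))"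
    by (intro L2_norm_cong) (simp add: h_def scaleR_left_diff_distrib scaleR_right_diff_distrib algebra_simps)
  also have "\<dots> \<le> L2_norm LL (\<lambda>s. ?a s + ?b s) + L2_norm LL (\<lambda>s. G u s - G t s)"
    by (intro L2_norm_triangle L2_add aL bL L2_diff G_L2 t)
  also have "L2_norm LL (\<lambda>s. ?a s + ?b s) \<le> L2_norm LL ?a + L2_norm LL ?b"
    by (rule L2_norm_triangle[OF aL bL])
  finally show ?thesis using a by linarith
qed

lemma Kcf_diff_le:
  assumes t: "t \<in> {0..T}" "u \<in> {0..T}"
  shows "L2_norm LL (\<lambda>s. K_H H t s *\<^sub>R (cf u s - cf t s)) \<le> 2 * D * L2_norm LL (\<lambda>s. K_H H t s *\<^sub>R norm (v s))"
proof (rule L2_bound(2)[OF Kv_L2[OF t(1)]])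
  show "(\<lambda>s. K_H H t s *\<^sub>R (cf u s - cf t s)) \<in> borel_measurable LL"
    using L2_measurable[OF L2_diff[OF Kcf_L2[OF t(1) t(2)] Kcf_L2[OF t(1) t(1)]]] by (simp add: scaleR_right_diff_distrib)
  show "AE s in LL. norm (K_H H t s *\<^sub>R (cf u s - cf t s)) \<le> 2 * D * norm (K_H H t s *\<^sub>R norm (v s))"
  proof (rule AE_I2)
    fix s
    have "norm (cf u s - cf t s) \<le> 2 * D * norm (v s)"
      using norm_triangle_ineq4[of "cf u s" "cf t s"] cf_bound[OF t(1), of s] cf_bound[OF t(2), of s] by linarith
    then have "\<bar>K_H H t s\<bar> * norm (cf u s - cf t s) \<le> \<bar>K_H H t s\<bar> * (2 * D * norm (v s))"
      by (intro mult_left_mono) auto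
    then show "norm (K_H H t s *\<^sub>R (cf u s - cf t s)) \<le> 2 * D * norm (K_H H t s *\<^sub>R norm (v s))"
      by (simp add: abs_mult mult_ac)
  qed
qed (use D in simp)

lemma Kcf_tendsto:
  assumes t: "t \<in> {0..T}" and X: "\<And>k. X k \<in> {0..T}" "X \<longlonglongrightarrow> t"
  shows "(\<lambda>k. L2_norm LL (\<lambda>s. K_H H t s *\<^sub>R (cf (X k) s - cf t s))) \<longlonglongrightarrow> 0"
proof -
  have "(\<lambda>k. L2_norm LL (\<lambda>s. K_H H t s *\<^sub>R cf (X k) s - K_H H t s *\<^sub>R cf t s)) \<longlonglongrightarrow> 0"
  proof (rule L2_dominated[where G = "\<lambda>s. (2 * D) *\<^sub>R (K_H H t s *\<^sub>R norm (v s))"])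
    show "(\<lambda>s. (2 * D) *\<^sub>R (K_H H t s *\<^sub>R norm (v s))) \<in> L2 LL" by (rule L2_scaleR[OF Kv_L2[OF t]])
    show "AE s in LL. norm (K_H H t s *\<^sub>R cf (X k) s - K_H H t s *\<^sub>R cf t s) \<le> norm ((2 * D) *\<^sub>R (K_H H t s *\<^sub>R norm (v s)))" for k
    proof (rule AE_I2)
      fix s
      have "norm (cf (X k) s - cf t s) \<le> 2 * D * norm (v s)"
        using norm_triangle_ineq4[of "cf (X k) s" "cf t s"] cf_bound[OF t, of s] cf_bound[OF X(1), of k s] by linarith
      then have "\<bar>K_H H t s\<bar> * norm (cf (X k) s - cf t s) \<le> \<bar>K_H H t s\<bar> * (2 * D * norm (v s))"
        by (intro mult_left_mono) auto
      then show "norm (K_H H t s *\<^sub>R cf (X k) s - K_H H t s *\<^sub>R cf t s) \<le> norm ((2 * D) *\<^sub>R (K_H H t s *\<^sub>R norm (v s)))"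
        using D by (simp add: scaleR_right_diff_distrib[symmetric] abs_mult mult_ac)
    qed
    show "AE s in LL. (\<lambda>k. K_H H t s *\<^sub>R cf (X k) s) \<longlonglongrightarrow> K_H H t s *\<^sub>R cf t s"
    proof (rule AE_I2)
      fix s assume "s \<in> space LL"
      then have s: "s \<in> {0..T}" by (simp add: space_restrict_space)
      have "(\<lambda>k. cf (X k) s) \<longlonglongrightarrow> cf t s"
        using continuous_on_tendsto_compose[OF cf_continuous_time[OF s] X(2) t] X(1) by simp
      then show "(\<lambda>k. K_H H t s *\<^sub>R cf (X k) s) \<longlonglongrightarrow> K_H H t s *\<^sub>R cf t s" by (intro tendsto_intros)
    qed
  qed (use L2_measurable[OF Kcf_L2[OF t]] X t in auto)
  then show ?thesis by (simp add: scaleR_right_diff_distrib)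
qed

text \<open>The integrand of the theorem contains \<open>R (t - s)\<close>, about which nothing is
  known for \<open>s > t\<close>. \<open>K_star\<close> evaluates it only on \<open>{s..t}\<close>,
  so agreement with \<open>cf t\<close> up to time \<open>t\<close> is enough.\<close>

lemma K_star_eq:
  assumes t: "t \<in> {0..T}" and s: "0 < s" "s \<le> t" and \<phi>: "\<And>r. r \<in> {0..t} \<Longrightarrow> \<phi> r = cf t r"
  shows "K_star H t \<phi> s = h t s"
proof -
  have s': "s \<in> {0..t}" using s by simp
  have "(\<integral>r. deriv (\<lambda>r. K_H H r s) r *\<^sub>R (\<phi> r - \<phi> s) \<partial>lebesgue_on {s..t})
      = (\<integral>r. deriv (\<lambda>r. K_H H r s) r *\<^sub>R (cf t r - cf t s) \<partial>lebesgue_on {s..t})"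
    using s \<phi> \<phi>[OF s'] by (intro Bochner_Integration.integral_cong refl) (simp add: space_restrict_space)
  also have "\<dots> = G t s"
    unfolding G_def by (rule deriv_K_H_integral(2)[OF H s(1) section_measurable[OF t]])
  finally show ?thesis using \<phi>[OF s'] by (simp add: K_star_def h_def)
qed

lemma K_star_integrable:
  assumes t: "t \<in> {0..T}" and \<phi>: "\<And>r. r \<in> {0..t} \<Longrightarrow> \<phi> r = cf t r"
  shows "AE s in lebesgue_on {0..t}. integrable (lebesgue_on {s..t}) (\<lambda>r. deriv (\<lambda>r. K_H H r s) r *\<^sub>R (\<phi> r - \<phi> s))"
proof -
  have "AE s in lebesgue. s \<in> {0..T} \<longrightarrow> 0 < s \<and> s \<le> T \<and> \<Gamma>e s < \<infinity>"
    using AE_good by (subst (asm) AE_restrict_space_iff) auto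
  then have "AE s in lebesgue. s \<in> {0..t} \<longrightarrow> 0 < s \<and> \<Gamma>e s < \<infinity>" by eventually_elim (use t in auto)
  then have "AE s in lebesgue_on {0..t}. s \<in> {0..t} \<and> 0 < s \<and> \<Gamma>e s < \<infinity>"
    by (subst AE_restrict_space_iff) (auto elim: eventually_mono)
  then show ?thesis
  proof eventually_elim
    case (elim s)
    have "integrable (lebesgue_on {s..t}) (\<lambda>r. deriv (\<lambda>r. K_H H r s) r *\<^sub>R (cf t r - cf t s))"
      using G_integrable[of s t] elim t deriv_K_H_integral(1)[OF H, of s t "\<lambda>r. cf t r - cf t s"] section_measurable[OF t] by auto
    moreover have "integrable (lebesgue_on {s..t}) (\<lambda>r. deriv (\<lambda>r. K_H H r s) r *\<^sub>R (cf t r - cf t s))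
      \<longleftrightarrow> integrable (lebesgue_on {s..t}) (\<lambda>r. deriv (\<lambda>r. K_H H r s) r *\<^sub>R (\<phi> r - \<phi> s))"
      using elim \<phi> by (intro Bochner_Integration.integrable_cong refl) (auto simp: space_restrict_space)
    ultimately show ?case by simp
  qed
qed

lemma K_star_L2:
  assumes t: "t \<in> {0..T}" and \<phi>: "\<And>r. r \<in> {0..t} \<Longrightarrow> \<phi> r = cf t r"
  shows "K_star H t \<phi> \<in> L2 (lebesgue_on {0..t})"
    and "AE s in LL. indicat_real {0..t} s *\<^sub>R K_star H t \<phi> s = h t s"
    and "(\<integral>\<^sup>+s. ennreal ((norm (K_star H t \<phi> s))\<^sup>2) \<partial>lebesgue_on {0..t}) = ennreal ((L2_norm LL (h t))\<^sup>2)"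
proof -
  have t': "0 \<le> t" "t \<le> T" using t by auto
  let ?f = "\<lambda>s. indicat_real {0..t} s *\<^sub>R K_star H t \<phi> s"
  \<comment> \<open>The point \<open>s = 0\<close> stays exceptional because the formula for the
    derivative of the kernel needs \<open>s > 0\<close>; beyond \<open>t\<close> both sides
    vanish.\<close>
  have eq: "?f s = (if s = 0 then K_star H t \<phi> 0 else h t s)" if "s \<in> {0..T}" for s
    using that K_star_eq[OF t _ _ \<phi>, of s] h_zero[of t s] t' by (cases "s \<le> t") (auto simp: indicator_def)
  have "?f \<in> borel_measurable LL \<longleftrightarrow> (\<lambda>s. if s = 0 then K_star H t \<phi> 0 else h t s) \<in> borel_measurable LL"
    by (rule measurable_cong) (use eq in \<open>simp add: space_restrict_space\<close>)
  moreover have "(\<lambda>s. if s = 0 then K_star H t \<phi> 0 else h t s) \<in> borel_measurable LL"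
  proof (rule measurable_If)
    have "{s \<in> space LL. s = 0} = {0}" using T by (auto simp: space_restrict_space)
    also have "{0} \<in> sets LL" using T by (simp add: sets_restrict_space_iff)
    finally show "{s \<in> space LL. s = 0} \<in> sets LL" .
  qed (use L2_measurable[OF h_L2[OF t]] in auto)
  ultimately have m: "?f \<in> borel_measurable LL" by simp
  have "AE s in LL. s \<noteq> 0" by (rule AE_lebesgue_on_neq) simp
  moreover have "AE s in LL. s \<in> {0..T}" by (rule AE_I2) (simp add: space_restrict_space)
  ultimately show ae: "AE s in LL. ?f s = h t s"
    by eventually_elim (use eq in auto)
  note L = L2_cong_AE[OF h_L2[OF t] m ae]
  show *: "K_star H t \<phi> \<in> L2 (lebesgue_on {0..t})"
    using L(1) indicator_cut(3)[OF t', of "K_star H t \<phi>"] by simp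
  show "(\<integral>\<^sup>+s. ennreal ((norm (K_star H t \<phi> s))\<^sup>2) \<partial>lebesgue_on {0..t}) = ennreal ((L2_norm LL (h t))\<^sup>2)"
    using nn_integral_L2_norm[OF *] L(2) indicator_cut(4)[OF t', of "K_star H t \<phi>"] by simp
qed

end

section \<open>Series of Wiener integrals and the stochastic convolution\<close>

lemma C_L2_sequentially:
  assumes L: "\<And>t. t \<in> S \<Longrightarrow> x t \<in> L2 M"
    and seq: "\<And>X t. t \<in> S \<Longrightarrow> (\<And>k. X k \<in> S) \<Longrightarrow> X \<longlonglongrightarrow> t \<Longrightarrow> (\<lambda>k. L2_norm M (\<lambda>\<omega>. x (X k) \<omega> - x t \<omega>)) \<longlonglongrightarrow> 0"
  shows "x \<in> C_L2 M S"
  unfolding C_L2_def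
proof (intro CollectI conjI ballI)
  fix t assume t: "t \<in> S"
  show "((\<lambda>u. \<integral>\<omega>. (norm (x u \<omega> - x t \<omega>))\<^sup>2 \<partial>M) \<longlongrightarrow> 0) (at t within S)"
    unfolding tendsto_at_iff_sequentially
  proof (intro allI impI)
    fix X assume X: "\<forall>i::nat. X i \<in> S - {t}" "X \<longlonglongrightarrow> t"
    have "(\<lambda>k. (L2_norm M (\<lambda>\<omega>. x (X k) \<omega> - x t \<omega>))\<^sup>2) \<longlonglongrightarrow> 0\<^sup>2"
      using X by (intro tendsto_power seq t) auto
    then show "((\<lambda>u. \<integral>\<omega>. (norm (x u \<omega> - x t \<omega>))\<^sup>2 \<partial>M) \<circ> X) \<longlonglongrightarrow> 0"
      by (simp add: L2_norm_power2 o_def)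
  qed
qed (rule L)

lemma summable_ennreal_le:
  fixes a :: "nat \<Rightarrow> real"
  assumes "\<And>n. 0 \<le> a n" "(\<Sum>n. ennreal (a n)) \<le> ennreal B" "0 \<le> B"
  shows "summable a" "suminf a \<le> B"
proof -
  show s: "summable a"
    by (rule summable_suminf_not_top) (use assms in \<open>auto simp: top_unique\<close>)
  have "(\<Sum>n. ennreal (a n)) = ennreal (suminf a)" by (rule suminf_ennreal2[OF assms(1) s])
  then show "suminf a \<le> B" using assms(2,3) by (simp add: ennreal_le_iff)
qed

lemma suminf_tendsto_zero:
  fixes a :: "nat \<Rightarrow> nat \<Rightarrow> real"
  assumes lim: "\<And>n. (\<lambda>k. a n k) \<longlonglongrightarrow> 0" and bd: "\<And>n k. \<bar>a n k\<bar> \<le> B n" and B: "summable B"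
  shows "(\<lambda>k. \<Sum>n. a n k) \<longlonglongrightarrow> 0"
proof -
  have "(\<lambda>k. \<Sum>n. a n k) \<longlonglongrightarrow> (\<Sum>n. 0)"
    using tannerys_theorem[where a = a and b = "\<lambda>_. 0" and F = sequentially and M = B, OF lim _ B] bd
    by (auto intro: always_eventually)
  then show ?thesis by simp
qed

text \<open>The difference of two candidates is a Wiener integral of zero, and the isometry makes
  its norm zero.\<close>

lemma has_wiener_integral_unique:
  fixes h :: "real \<Rightarrow> 'x::{real_inner, banach, second_countable_topology}"
  assumes b: "\<And>t. t \<in> {0..T} \<Longrightarrow> b t \<in> L2 M"
    and cov: "\<And>s t. s \<in> {0..T} \<Longrightarrow> t \<in> {0..T} \<Longrightarrow> (\<integral>\<omega>. b s \<omega> * b t \<omega> \<partial>M) = min s t"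
    and t: "0 \<le> t" "t \<le> T" and w: "has_wiener_integral M b t h Z" "has_wiener_integral M b t h Z'"
  shows "AE \<omega> in M. Z \<omega> = Z' \<omega>"
proof -
  have "wiener_pair M b T (\<lambda>s. indicat_real {0..t} s *\<^sub>R h s - indicat_real {0..t} s *\<^sub>R h s) (\<lambda>\<omega>. Z \<omega> - Z' \<omega>)"
    by (rule wiener_pair_diff[OF b has_wiener_integral_pair[OF b t w(1)] has_wiener_integral_pair[OF b t w(2)]])
  from wiener_pair_isometry[OF b cov this]
  have "L2_norm M (\<lambda>\<omega>. Z \<omega> - Z' \<omega>) = 0" by simp
  moreover have "(\<lambda>\<omega>. Z \<omega> - Z' \<omega>) \<in> L2 M" using w by (intro L2_diff) (auto simp: has_wiener_integral_def)
  ultimately show ?thesis using L2_norm_eq_0_AE by fastforce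
qed

lemma nn_sq_tendsto_zero_iff:
  assumes "\<And>k. f k \<in> L2 M"
  shows "(\<lambda>k. \<integral>\<^sup>+x. ennreal ((norm (f k x))\<^sup>2) \<partial>M) \<longlonglongrightarrow> 0 \<longleftrightarrow> (\<lambda>k. L2_norm M (f k)) \<longlonglongrightarrow> 0"
proof -
  have "(\<lambda>k. \<integral>\<^sup>+x. ennreal ((norm (f k x))\<^sup>2) \<partial>M) \<longlonglongrightarrow> 0 \<longleftrightarrow> (\<lambda>k. ennreal ((L2_norm M (f k))\<^sup>2)) \<longlonglongrightarrow> ennreal 0"
    by (simp add: nn_integral_L2_norm[OF assms])
  also have "\<dots> \<longleftrightarrow> (\<lambda>k. (L2_norm M (f k))\<^sup>2) \<longlonglongrightarrow> 0"
    by (rule tendsto_ennreal_iff) auto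
  also have "\<dots> \<longleftrightarrow> (\<lambda>k. L2_norm M (f k)) \<longlonglongrightarrow> 0"
  proof
    assume "(\<lambda>k. (L2_norm M (f k))\<^sup>2) \<longlonglongrightarrow> 0"
    from tendsto_real_sqrt[OF this] show "(\<lambda>k. L2_norm M (f k)) \<longlonglongrightarrow> 0" by simp
  next
    assume "(\<lambda>k. L2_norm M (f k)) \<longlonglongrightarrow> 0"
    from tendsto_power[OF this, of 2] show "(\<lambda>k. (L2_norm M (f k))\<^sup>2) \<longlonglongrightarrow> 0" by simp
  qed
  finally show ?thesis .
qed

text \<open>A mild solution brings its own stochastic integral, chosen anew at each time; comparing
  two solutions requires that these agree. They do so summand by summand, hence for finite partial
  sums and for the limits.\<close>

lemma (in prob_space) has_fbm_integral_unique:
  fixes \<phi> :: "real \<Rightarrow> 'y::real_normed_vector \<Rightarrow>\<^sub>L 'x::{real_inner, banach, second_countable_topology}"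
  assumes bm: "\<And>n. n \<in> I \<Longrightarrow> standard_brownian_motion M T (\<beta> n)" and t: "t \<in> {0..T}"
    and F: "has_fbm_integral M H I lam e \<beta> t \<phi> Z" "has_fbm_integral M H I lam e \<beta> t \<phi> Z'"
  shows "AE \<omega> in M. Z \<omega> = Z' \<omega>"
proof -
  have t': "0 \<le> t" "t \<le> T" using t by auto
  let ?h = "\<lambda>n s. sqrt (lam n) *\<^sub>R K_star H t (\<lambda>r. \<phi> r (e n)) s"
  have Z: "Z \<in> L2 M" "Z' \<in> L2 M" using F unfolding has_fbm_integral_def by auto
  have "\<exists>J. (\<forall>n\<in>I. has_wiener_integral M (\<beta> n) t (?h n) (J n)) \<and>
        (\<lambda>k. \<integral>\<^sup>+\<omega>. ennreal ((norm (Z \<omega> - (\<Sum>n\<in>I \<inter> {..<k}. J n \<omega>)))\<^sup>2) \<partial>M) \<longlonglongrightarrow> 0"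
    using F(1) unfolding has_fbm_integral_def by (elim conjE)
  then obtain J where J: "\<forall>n\<in>I. has_wiener_integral M (\<beta> n) t (?h n) (J n)"
    "(\<lambda>k. \<integral>\<^sup>+\<omega>. ennreal ((norm (Z \<omega> - (\<Sum>n\<in>I \<inter> {..<k}. J n \<omega>)))\<^sup>2) \<partial>M) \<longlonglongrightarrow> 0" by (elim exE conjE)
  have "\<exists>J. (\<forall>n\<in>I. has_wiener_integral M (\<beta> n) t (?h n) (J n)) \<and>
        (\<lambda>k. \<integral>\<^sup>+\<omega>. ennreal ((norm (Z' \<omega> - (\<Sum>n\<in>I \<inter> {..<k}. J n \<omega>)))\<^sup>2) \<partial>M) \<longlonglongrightarrow> 0"
    using F(2) unfolding has_fbm_integral_def by (elim conjE)
  then obtain J' where J': "\<forall>n\<in>I. has_wiener_integral M (\<beta> n) t (?h n) (J' n)"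
    "(\<lambda>k. \<integral>\<^sup>+\<omega>. ennreal ((norm (Z' \<omega> - (\<Sum>n\<in>I \<inter> {..<k}. J' n \<omega>)))\<^sup>2) \<partial>M) \<longlonglongrightarrow> 0" by (elim exE conjE)
  have JL: "J n \<in> L2 M" "J' n \<in> L2 M" if "n \<in> I" for n
    using J(1) J'(1) that by (auto simp: has_wiener_integral_def)
  define S S' where "S k = (\<lambda>\<omega>. \<Sum>n\<in>I \<inter> {..<k}. J n \<omega>)" and "S' k = (\<lambda>\<omega>. \<Sum>n\<in>I \<inter> {..<k}. J' n \<omega>)" for k
  have SL: "S k \<in> L2 M" "S' k \<in> L2 M" for k unfolding S_def S'_def by (intro L2_sum JL; simp)+
  have lim: "(\<lambda>k. L2_norm M (\<lambda>\<omega>. Z \<omega> - S k \<omega>)) \<longlonglongrightarrow> 0" "(\<lambda>k. L2_norm M (\<lambda>\<omega>. Z' \<omega> - S' k \<omega>)) \<longlonglongrightarrow> 0"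
    using J(2) J'(2) nn_sq_tendsto_zero_iff[OF L2_diff[OF Z(1) SL(1)]] nn_sq_tendsto_zero_iff[OF L2_diff[OF Z(2) SL(2)]]
    by (simp_all add: S_def S'_def)
  have JJ: "AE \<omega> in M. J n \<omega> = J' n \<omega>" if n: "n \<in> I" for n
    by (rule has_wiener_integral_unique[OF brownian_motion_L2(1)[OF bm[OF n]] brownian_motion_covariance[OF bm[OF n]] t'
        bspec[OF J(1) n] bspec[OF J'(1) n]])
  have SS: "L2_norm M (\<lambda>\<omega>. S k \<omega> - S' k \<omega>) = 0" for k
  proof -
    have "AE \<omega> in M. \<forall>n\<in>I \<inter> {..<k}. J n \<omega> = J' n \<omega>"
      by (rule AE_finite_allI) (use JJ in auto)
    then have "AE \<omega> in M. S k \<omega> - S' k \<omega> = 0"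
      by eventually_elim (simp add: S_def S'_def)
    then have "L2_norm M (\<lambda>\<omega>. S k \<omega> - S' k \<omega>) = L2_norm M (\<lambda>\<omega>. 0 :: 'x)"
      using L2_measurable[OF L2_diff[OF SL(1) SL(2)]] by (intro L2_cong_AE(2)) auto
    then show ?thesis by simp
  qed
  have "L2_norm M (\<lambda>\<omega>. Z \<omega> - Z' \<omega>) \<le> 0"
  proof (rule tendsto_lowerbound)
    show "(\<lambda>k. L2_norm M (\<lambda>\<omega>. Z \<omega> - S k \<omega>) + L2_norm M (\<lambda>\<omega>. Z' \<omega> - S' k \<omega>)) \<longlonglongrightarrow> 0"
      using tendsto_add[OF lim] by simp
    show "\<forall>\<^sub>F k in sequentially. L2_norm M (\<lambda>\<omega>. Z \<omega> - Z' \<omega>) \<le> L2_norm M (\<lambda>\<omega>. Z \<omega> - S k \<omega>) + L2_norm M (\<lambda>\<omega>. Z' \<omega> - S' k \<omega>)"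
    proof (intro always_eventually allI)
      fix k
      show "L2_norm M (\<lambda>\<omega>. Z \<omega> - Z' \<omega>) \<le> L2_norm M (\<lambda>\<omega>. Z \<omega> - S k \<omega>) + L2_norm M (\<lambda>\<omega>. Z' \<omega> - S' k \<omega>)"
        using L2_norm_dist_triangle[OF Z(1) SL(1) Z(2), of k] L2_norm_dist_triangle[OF SL(1) SL(2) Z(2), of k k] SS[of k]
          L2_norm_minus_commute[of M "S' k" Z'] by linarith
    qed
  qed simp
  then have "L2_norm M (\<lambda>\<omega>. Z \<omega> - Z' \<omega>) = 0" using L2_norm_nonneg[of M "\<lambda>\<omega>. Z \<omega> - Z' \<omega>"] by linarith
  from L2_norm_eq_0_AE[OF L2_diff[OF Z] this] show ?thesis by simp
qed

text \<open>The isometry for the representation of fractional Brownian motion gives the modulus of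
  continuity of its kernel.\<close>

lemma (in prob_space) K_H_increment:
  assumes bm: "standard_brownian_motion M T b" and fbm: "fractional_brownian_motion M H T bH" and H: "0 < H"
    and w: "\<And>t. t \<in> {0..T} \<Longrightarrow> has_wiener_integral M b t (K_H H t) (bH t)"
    and t: "t \<in> {0..T}" "u \<in> {0..T}"
  shows "(L2_norm (lebesgue_on {0..T}) (\<lambda>s. K_H H u s - K_H H t s))\<^sup>2 = \<bar>u - t\<bar> powr (2 * H)"
proof -
  note b = brownian_motion_L2(1)[OF bm]
  have t': "0 \<le> t" "t \<le> T" "0 \<le> u" "u \<le> T" using t by auto
  have bL: "bH t \<in> L2 M" "bH u \<in> L2 M" using w t by (auto simp: has_wiener_integral_def)
  have "L2_norm M (\<lambda>\<omega>. bH u \<omega> - bH t \<omega>)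
    = L2_norm (lebesgue_on {0..T}) (\<lambda>s. indicat_real {0..u} s *\<^sub>R K_H H u s - indicat_real {0..t} s *\<^sub>R K_H H t s)"
    by (rule wiener_pair_isometry[OF b brownian_motion_covariance[OF bm]
        wiener_pair_diff[OF b has_wiener_integral_pair[OF b t'(3,4) w[OF t(2)]] has_wiener_integral_pair[OF b t'(1,2) w[OF t(1)]]]])
  \<comment> \<open>\<open>K_H H t s\<close> is 0 for \<open>s >= t\<close> by definition, so the
    cut-offs may be dropped.\<close>
  also have "\<dots> = L2_norm (lebesgue_on {0..T}) (\<lambda>s. K_H H u s - K_H H t s)"
    by (intro L2_norm_cong) (simp add: space_restrict_space K_H_def indicator_def)
  finally have e: "L2_norm M (\<lambda>\<omega>. bH u \<omega> - bH t \<omega>) = L2_norm (lebesgue_on {0..T}) (\<lambda>s. K_H H u s - K_H H t s)" .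
  have "(L2_norm (lebesgue_on {0..T}) (\<lambda>s. K_H H u s - K_H H t s))\<^sup>2 = (\<integral>\<omega>. (norm (bH u \<omega> - bH t \<omega>))\<^sup>2 \<partial>M)"
    unfolding e[symmetric] by (rule L2_norm_power2)
  also have "\<dots> = (\<integral>\<omega>. bH u \<omega> * bH u \<omega> - 2 * (bH u \<omega> * bH t \<omega>) + bH t \<omega> * bH t \<omega> \<partial>M)"
    by (intro Bochner_Integration.integral_cong refl) (simp add: power2_eq_square algebra_simps)
  also have "\<dots> = (\<integral>\<omega>. bH u \<omega> * bH u \<omega> \<partial>M) - 2 * (\<integral>\<omega>. bH u \<omega> * bH t \<omega> \<partial>M) + (\<integral>\<omega>. bH t \<omega> * bH t \<omega> \<partial>M)"
    using L2_inner_integrable[OF bL(2) bL(2)] L2_inner_integrable[OF bL(2) bL(1)] L2_inner_integrable[OF bL(1) bL(1)]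
    by simp
  also have "\<dots> = \<bar>u - t\<bar> powr (2 * H)"
  proof -
    have cov: "\<forall>s\<in>{0..T}. \<forall>t\<in>{0..T}. (\<integral>\<omega>. bH s \<omega> * bH t \<omega> \<partial>M) =
        (t powr (2 * H) + s powr (2 * H) - \<bar>t - s\<bar> powr (2 * H)) / 2"
      using fbm unfolding fractional_brownian_motion_def by (elim conjE)
    show ?thesis
      unfolding cov[rule_format, OF t(2) t(2)] cov[rule_format, OF t(2) t(1)] cov[rule_format, OF t(1) t(1)]
      by (simp add: abs_minus_commute field_simps)
  qed
  finally show ?thesis .
qed

lemma (in convolution_kernel) kernel_measurable:
  "(\<lambda>r. indicator {s<..<T} r * ennreal (k0 * (r - s) powr (H - 3/2 + \<delta>))) \<in> borel_measurable lborel"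
  by measurable

text \<open>All coordinates together. \<open>E\<close> is the Hoelder constant of \<sigma> and
  \<open>S0\<close> its bound, both for squared Hilbert-Schmidt norms, and \<open>pfin\<close> is
  square integrability of the graph norm. The condition \<open>\<delta> \<le> 1\<close> lets the
  Lipschitz part of \<open>q\<close> be treated as Hoelder of order \<delta>.\<close>

locale fbm_convolution = prob_space M + convolution_kernel T H D \<delta> R
  for M :: "'w measure" and T H D \<delta> and R :: "real \<Rightarrow> 'x::{real_inner,banach,second_countable_topology} \<Rightarrow>\<^sub>L 'x" +
  fixes I :: "nat set" and \<beta> :: "nat \<Rightarrow> real \<Rightarrow> 'w \<Rightarrow> real"
    and v :: "nat \<Rightarrow> real \<Rightarrow> 'x" and p :: "nat \<Rightarrow> real \<Rightarrow> real" and C E S0 :: real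
    and \<phi> :: "real \<Rightarrow> nat \<Rightarrow> real \<Rightarrow> 'x"
  assumes conv: "\<And>n. convolution T H D \<delta> R (v n) (p n) C"
    and \<delta>1: "\<delta> \<le> 1"
    and bm: "\<And>n. n \<in> I \<Longrightarrow> standard_brownian_motion M T (\<beta> n)"
    and ind: "independent_processes M T \<beta> I"
    and Kinc: "\<And>t u. t \<in> {0..T} \<Longrightarrow> u \<in> {0..T} \<Longrightarrow>
      (L2_norm (lebesgue_on {0..T}) (\<lambda>s. K_H H u s - K_H H t s))\<^sup>2 = \<bar>u - t\<bar> powr (2 * H)"
    and E: "0 \<le> E" "\<And>r s. r \<in> {0..T} \<Longrightarrow> s \<in> {0..T} \<Longrightarrow>
      (\<Sum>n. ennreal ((norm (v n r - v n s))\<^sup>2)) \<le> ennreal (E * \<bar>r - s\<bar> powr (2 * \<delta>))"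
    and S0: "0 \<le> S0" "\<And>s. s \<in> {0..T} \<Longrightarrow> (\<Sum>n. ennreal ((norm (v n s))\<^sup>2)) \<le> ennreal S0"
    and pfin: "(\<integral>\<^sup>+s. (\<Sum>n. ennreal ((p n s)\<^sup>2)) * indicator {0..T} s \<partial>lborel) < \<infinity>"
    and \<phi>: "\<And>t n r. t \<in> {0..T} \<Longrightarrow> r \<in> {0..t} \<Longrightarrow> \<phi> t n r = R (t - r) (v n r)"
begin

abbreviation "LL \<equiv> lebesgue_on {0..T}"

sublocale c: convolution T H D \<delta> R "v n" "p n" C for n by (rule conv)

text \<open>The factor that remains when the kernel weight is taken out of the sum over the
  coordinates: a Hoelder part and a Lipschitz part.\<close>

definition \<Xi> :: "real \<Rightarrow> ennreal" where
  "\<Xi> s = ennreal (2 * D\<^sup>2 * E) + ennreal (2 * C\<^sup>2 * T powr (2 - 2 * \<delta>)) * (\<Sum>n. ennreal ((p n s)\<^sup>2))"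

text \<open>The sum of the squared increments is of order \<open>2 * \<delta>\<close> at the
  diagonal. This lifts the exponent from \<open>H - 3/2 - \<delta>\<close> to
  \<open>H - 3/2 + \<delta>\<close>, which is integrable.\<close>

lemma sum_q_le:
  assumes s: "0 \<le> s" "s < r" "r < T"
  shows "(\<Sum>n. ennreal (k0 * (r - s) powr (H - 3/2 - \<delta>) * (c.q n r s)\<^sup>2)) \<le> ennreal (k0 * (r - s) powr (H - 3/2 + \<delta>)) * \<Xi> s"
proof -
  let ?k = "k0 * (r - s) powr (H - 3/2 - \<delta>)"
  have k: "0 \<le> ?k" using k0_nonneg by simp
  have le: "ennreal (?k * (c.q n r s)\<^sup>2) \<le> ennreal (?k * (2 * D\<^sup>2)) * ennreal ((norm (v n r - v n s))\<^sup>2)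
     + ennreal (?k * (2 * C\<^sup>2 * (r - s)\<^sup>2)) * ennreal ((p n s)\<^sup>2)" for n
  proof -
    have "(c.q n r s)\<^sup>2 \<le> 2 * (D * norm (v n r - v n s))\<^sup>2 + 2 * (C * \<bar>r - s\<bar> * p n s)\<^sup>2"
      unfolding c.q_def using norm_add_sq_le[of "D * norm (v n r - v n s)" "C * \<bar>r - s\<bar> * p n s"] by simp
    then have "?k * (c.q n r s)\<^sup>2 \<le> ?k * (2 * (D * norm (v n r - v n s))\<^sup>2 + 2 * (C * \<bar>r - s\<bar> * p n s)\<^sup>2)"
      by (rule mult_left_mono[OF _ k])
    also have "\<dots> = ?k * (2 * D\<^sup>2) * (norm (v n r - v n s))\<^sup>2 + ?k * (2 * C\<^sup>2 * (r - s)\<^sup>2) * (p n s)\<^sup>2"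
      by (simp add: power_mult_distrib algebra_simps)
    also have "ennreal \<dots> = ennreal (?k * (2 * D\<^sup>2)) * ennreal ((norm (v n r - v n s))\<^sup>2)
      + ennreal (?k * (2 * C\<^sup>2 * (r - s)\<^sup>2)) * ennreal ((p n s)\<^sup>2)"
      using k by (simp add: ennreal_plus ennreal_mult)
    finally show ?thesis by (simp add: ennreal_leI)
  qed
  have "(\<Sum>n. ennreal (?k * (c.q n r s)\<^sup>2)) \<le> (\<Sum>n. ennreal (?k * (2 * D\<^sup>2)) * ennreal ((norm (v n r - v n s))\<^sup>2)
     + ennreal (?k * (2 * C\<^sup>2 * (r - s)\<^sup>2)) * ennreal ((p n s)\<^sup>2))"
    by (rule suminf_le) (use le in auto)
  also have "\<dots> = ennreal (?k * (2 * D\<^sup>2)) * (\<Sum>n. ennreal ((norm (v n r - v n s))\<^sup>2))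
     + ennreal (?k * (2 * C\<^sup>2 * (r - s)\<^sup>2)) * (\<Sum>n. ennreal ((p n s)\<^sup>2))"
    by (simp add: suminf_add[symmetric] ennreal_suminf_cmult)
  also have "\<dots> \<le> ennreal (k0 * (r - s) powr (H - 3/2 + \<delta>)) * ennreal (2 * D\<^sup>2 * E)
     + ennreal (k0 * (r - s) powr (H - 3/2 + \<delta>)) * ennreal (2 * C\<^sup>2 * T powr (2 - 2 * \<delta>)) * (\<Sum>n. ennreal ((p n s)\<^sup>2))"
  proof (rule add_mono)
    have pw: "(r - s) powr (H - 3/2 - \<delta>) * (r - s) powr (2 * \<delta>) = (r - s) powr (H - 3/2 + \<delta>)"
    proof -
      have "H - 3/2 - \<delta> + 2 * \<delta> = H - 3/2 + \<delta>" by simp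
      then show ?thesis by (simp only: powr_add[symmetric])
    qed
    have "(\<Sum>n. ennreal ((norm (v n r - v n s))\<^sup>2)) \<le> ennreal (E * (r - s) powr (2 * \<delta>))"
    proof -
      have a: "\<bar>r - s\<bar> = r - s" using s by simp
      have "r \<in> {0..T}" "s \<in> {0..T}" using s by auto
      from E(2)[OF this] show ?thesis unfolding a .
    qed
    then have "ennreal (?k * (2 * D\<^sup>2)) * (\<Sum>n. ennreal ((norm (v n r - v n s))\<^sup>2)) \<le> ennreal (?k * (2 * D\<^sup>2)) * ennreal (E * (r - s) powr (2 * \<delta>))"
      by (rule mult_left_mono) simp
    also have "\<dots> = ennreal (?k * (2 * D\<^sup>2) * (E * (r - s) powr (2 * \<delta>)))"
      by (rule ennreal_mult[symmetric]) (use k E(1) in auto)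
    also have "?k * (2 * D\<^sup>2) * (E * (r - s) powr (2 * \<delta>)) = k0 * ((r - s) powr (H - 3/2 - \<delta>) * (r - s) powr (2 * \<delta>)) * (2 * D\<^sup>2 * E)"
      by (simp only: mult_ac)
    also have "ennreal \<dots> = ennreal (k0 * (r - s) powr (H - 3/2 + \<delta>)) * ennreal (2 * D\<^sup>2 * E)"
      unfolding pw by (rule ennreal_mult) (use k0_nonneg E(1) in auto)
    finally show "ennreal (?k * (2 * D\<^sup>2)) * (\<Sum>n. ennreal ((norm (v n r - v n s))\<^sup>2))
       \<le> ennreal (k0 * (r - s) powr (H - 3/2 + \<delta>)) * ennreal (2 * D\<^sup>2 * E)" .
    \<comment> \<open>From the quadratic factor only the power \<open>2 * \<delta>\<close> is spent
      on the singularity; the rest is bounded on \<open>{0..T}\<close>.\<close>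
    have "(r - s)\<^sup>2 = (r - s) powr (2 * \<delta>) * (r - s) powr (2 - 2 * \<delta>)"
      using s by (simp add: powr_add[symmetric])
    also have "\<dots> \<le> (r - s) powr (2 * \<delta>) * T powr (2 - 2 * \<delta>)"
      using s \<delta>1 by (intro mult_left_mono powr_mono2) auto
    finally have "?k * (2 * C\<^sup>2 * (r - s)\<^sup>2) \<le> ?k * (2 * C\<^sup>2 * ((r - s) powr (2 * \<delta>) * T powr (2 - 2 * \<delta>)))"
      using k by (intro mult_left_mono) auto
    also have "\<dots> = k0 * ((r - s) powr (H - 3/2 - \<delta>) * (r - s) powr (2 * \<delta>)) * (2 * C\<^sup>2 * T powr (2 - 2 * \<delta>))"
      by (simp only: mult_ac)
    finally have "ennreal (?k * (2 * C\<^sup>2 * (r - s)\<^sup>2)) \<le> ennreal (k0 * (r - s) powr (H - 3/2 + \<delta>) * (2 * C\<^sup>2 * T powr (2 - 2 * \<delta>)))"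
      unfolding pw by (rule ennreal_leI)
    also have "\<dots> = ennreal (k0 * (r - s) powr (H - 3/2 + \<delta>)) * ennreal (2 * C\<^sup>2 * T powr (2 - 2 * \<delta>))"
      by (rule ennreal_mult) (use k0_nonneg in auto)
    finally show "ennreal (?k * (2 * C\<^sup>2 * (r - s)\<^sup>2)) * (\<Sum>n. ennreal ((p n s)\<^sup>2))
      \<le> ennreal (k0 * (r - s) powr (H - 3/2 + \<delta>)) * ennreal (2 * C\<^sup>2 * T powr (2 - 2 * \<delta>)) * (\<Sum>n. ennreal ((p n s)\<^sup>2))"
      by (rule mult_right_mono) simp
  qed
  also have "\<dots> = ennreal (k0 * (r - s) powr (H - 3/2 + \<delta>)) * \<Xi> s"
    by (simp add: \<Xi>_def distrib_left mult.assoc)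
  finally show ?thesis .
qed

text \<open>One \<open>\<kappa>\<close> is the factor in the definition of \<open>P\<close>, the
  other comes from integrating the weight left by \<open>sum_q_le\<close>.\<close>

lemma sum_P_le:
  assumes s: "s \<in> {0..T}"
  shows "(\<Sum>n. c.P n s) \<le> ennreal \<kappa> * (ennreal \<kappa> * \<Xi> s)"
proof -
  let ?F = "\<lambda>n r. indicator {s<..<T} r * ennreal (k0 * (r - s) powr (H - 3/2 - \<delta>) * (c.q n r s)\<^sup>2)"
  have [measurable]: "(\<lambda>r. c.q n r s) \<in> borel_measurable borel" for n
    unfolding c.q_def using c.v[of n] by measurable
  have e: "(\<Sum>n. c.P n s) = ennreal \<kappa> * (\<Sum>n. \<integral>\<^sup>+r. ?F n r \<partial>lborel)"
    unfolding c.P_def by (rule ennreal_suminf_cmult)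
  have "(\<Sum>n. \<integral>\<^sup>+r. ?F n r \<partial>lborel) = (\<integral>\<^sup>+r. (\<Sum>n. ?F n r) \<partial>lborel)"
    by (rule nn_integral_suminf[symmetric]) measurable
  also have "\<dots> \<le> (\<integral>\<^sup>+r. indicator {s<..<T} r * ennreal (k0 * (r - s) powr (H - 3/2 + \<delta>)) * \<Xi> s \<partial>lborel)"
  proof (rule nn_integral_mono)
    fix r
    show "(\<Sum>n. ?F n r) \<le> indicator {s<..<T} r * ennreal (k0 * (r - s) powr (H - 3/2 + \<delta>)) * \<Xi> s"
    proof (cases "r \<in> {s<..<T}")
      case True
      then show ?thesis using sum_q_le[of s r] s by simp
    qed simp
  qed
  also have "\<dots> = (\<integral>\<^sup>+r. indicator {s<..<T} r * ennreal (k0 * (r - s) powr (H - 3/2 + \<delta>)) \<partial>lborel) * \<Xi> s"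
    by (rule nn_integral_multc[OF kernel_measurable])
  also have "\<dots> \<le> ennreal \<kappa> * \<Xi> s"
    by (rule mult_right_mono[OF kernel_integral_le]) (use s in auto)
  finally show ?thesis unfolding e by (rule mult_left_mono) simp
qed

lemma P_measurable: "c.P n \<in> borel_measurable borel"
proof -
  have [measurable]: "(\<lambda>x. indicat_real {fst x<..<T} (snd x)) \<in> borel_measurable (borel \<Otimes>\<^sub>M borel)"
    using indicator_Ioo_measurable[of T] by (simp add: case_prod_beta')
  have [measurable]: "(\<lambda>x. c.q n (snd x) (fst x)) \<in> borel_measurable (borel \<Otimes>\<^sub>M borel)"
    using c.q_measurable[of n] by (simp add: case_prod_beta')
  have "(\<lambda>(s, r). ennreal (indicat_real {s<..<T} r * (k0 * (r - s) powr (H - 3/2 - \<delta>) * (c.q n r s)\<^sup>2))) \<in> borel_measurable (borel \<Otimes>\<^sub>M lborel)"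
    unfolding case_prod_beta' by measurable
  moreover have "ennreal (indicat_real {s<..<T} r * (k0 * (r - s) powr (H - 3/2 - \<delta>) * (c.q n r s)\<^sup>2))
     = indicator {s<..<T} r * ennreal (k0 * (r - s) powr (H - 3/2 - \<delta>) * (c.q n r s)\<^sup>2)" for s r
    by (simp add: indicator_def)
  ultimately have "(\<lambda>(s, r). indicator {s<..<T} r * ennreal (k0 * (r - s) powr (H - 3/2 - \<delta>) * (c.q n r s)\<^sup>2)) \<in> borel_measurable (borel \<Otimes>\<^sub>M lborel)"
    by (simp only:)
  then have "(\<lambda>s. \<integral>\<^sup>+r. indicator {s<..<T} r * ennreal (k0 * (r - s) powr (H - 3/2 - \<delta>) * (c.q n r s)\<^sup>2) \<partial>lborel) \<in> borel_measurable borel"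
    by (rule lborel.borel_measurable_nn_integral)
  then show ?thesis unfolding c.P_def[abs_def] by measurable
qed

lemma sum_P_finite: "(\<Sum>n. \<integral>\<^sup>+s. c.P n s * indicator {0..T} s \<partial>lborel) < \<infinity>"
proof -
  note [measurable] = P_measurable c.p
  have "(\<Sum>n. \<integral>\<^sup>+s. c.P n s * indicator {0..T} s \<partial>lborel) = (\<integral>\<^sup>+s. (\<Sum>n. c.P n s * indicator {0..T} s) \<partial>lborel)"
    by (rule nn_integral_suminf[symmetric]) measurable
  also have "\<dots> \<le> (\<integral>\<^sup>+s. ennreal (\<kappa> * \<kappa> * (2 * D\<^sup>2 * E)) * indicator {0..T} s + ennreal (\<kappa> * \<kappa> * (2 * C\<^sup>2 * T powr (2 - 2 * \<delta>))) * ((\<Sum>n. ennreal ((p n s)\<^sup>2)) * indicator {0..T} s) \<partial>lborel)"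
  proof (rule nn_integral_mono)
    fix s
    show "(\<Sum>n. c.P n s * indicator {0..T} s) \<le> ennreal (\<kappa> * \<kappa> * (2 * D\<^sup>2 * E)) * indicator {0..T} s + ennreal (\<kappa> * \<kappa> * (2 * C\<^sup>2 * T powr (2 - 2 * \<delta>))) * ((\<Sum>n. ennreal ((p n s)\<^sup>2)) * indicator {0..T} s)"
    proof (cases "s \<in> {0..T}")
      case True
      have "ennreal \<kappa> * (ennreal \<kappa> * \<Xi> s) = ennreal (\<kappa> * \<kappa> * (2 * D\<^sup>2 * E)) + ennreal (\<kappa> * \<kappa> * (2 * C\<^sup>2 * T powr (2 - 2 * \<delta>))) * (\<Sum>n. ennreal ((p n s)\<^sup>2))"
        unfolding \<Xi>_def using \<kappa>_nonneg E(1)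
        by (simp only: distrib_left mult.assoc[symmetric] ennreal_mult[symmetric] mult_nonneg_nonneg zero_le_power2 zero_le_numeral powr_ge_zero)
      then show ?thesis using True sum_P_le[OF True] by simp
    qed simp
  qed
  also have "\<dots> = (\<integral>\<^sup>+s. ennreal (\<kappa> * \<kappa> * (2 * D\<^sup>2 * E)) * indicator {0..T} s \<partial>lborel) + ennreal (\<kappa> * \<kappa> * (2 * C\<^sup>2 * T powr (2 - 2 * \<delta>))) * (\<integral>\<^sup>+s. (\<Sum>n. ennreal ((p n s)\<^sup>2)) * indicator {0..T} s \<partial>lborel)"
    by (simp add: nn_integral_add nn_integral_cmult)
  also have "\<dots> < \<infinity>"
    using pfin T by (simp add: nn_integral_cmult_indicator ennreal_mult_less_top)
  finally show ?thesis .
qed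

lemma P_finite: "(\<integral>\<^sup>+s. c.P n s * indicator {0..T} s \<partial>lborel) < \<infinity>"
proof -
  have "(\<integral>\<^sup>+s. c.P n s * indicator {0..T} s \<partial>lborel) \<le> (\<Sum>n. \<integral>\<^sup>+s. c.P n s * indicator {0..T} s \<partial>lborel)"
    using sum_le_suminf[of "\<lambda>n. \<integral>\<^sup>+s. c.P n s * indicator {0..T} s \<partial>lborel" "{n}"] by simp
  then show ?thesis using sum_P_finite by (rule le_less_trans)
qed

sublocale f: convolution_finite T H D \<delta> R "v n" "p n" C for n
  by unfold_locales (rule P_finite)

lemma \<Gamma>_summable: "summable (\<lambda>n. (L2_norm LL (c.\<Gamma> n))\<^sup>2)"
proof -
  have "(\<Sum>n. ennreal ((L2_norm LL (c.\<Gamma> n))\<^sup>2)) \<le> (\<Sum>n. \<integral>\<^sup>+s. c.P n s * indicator {0..T} s \<partial>lborel)"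
  proof (rule suminf_le)
    show "ennreal ((L2_norm LL (c.\<Gamma> n))\<^sup>2) \<le> (\<integral>\<^sup>+s. c.P n s * indicator {0..T} s \<partial>lborel)" for n
      unfolding nn_integral_L2_norm[OF f.\<Gamma>_L2, symmetric] by (rule f.\<Gamma>_L2_le)
  qed auto
  from le_less_trans[OF this sum_P_finite] show ?thesis
    by (intro summable_suminf_not_top) auto
qed

text \<open>Sum and integral are exchanged, and the inner sum is bounded by \<open>S0\<close> at
  each time. It is applied with \<open>w\<close> a kernel \<open>K_H H t\<close> and with the
  difference of two such kernels.\<close>

lemma weighted_sum_le:
  assumes w: "w \<in> L2 LL" and wv: "\<And>n. (\<lambda>s. w s *\<^sub>R norm (v n s)) \<in> L2 LL"
  shows "summable (\<lambda>n. (L2_norm LL (\<lambda>s. w s *\<^sub>R norm (v n s)))\<^sup>2)"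
    "(\<Sum>n. (L2_norm LL (\<lambda>s. w s *\<^sub>R norm (v n s)))\<^sup>2) \<le> S0 * (L2_norm LL w)\<^sup>2"
proof -
  have [measurable]: "v n \<in> borel_measurable LL" for n by (intro borel_measurable_lebesgue_onI c.v)
  note [measurable] = L2_measurable[OF w]
  have "(\<Sum>n. ennreal ((L2_norm LL (\<lambda>s. w s *\<^sub>R norm (v n s)))\<^sup>2)) = (\<Sum>n. \<integral>\<^sup>+s. ennreal ((norm (w s))\<^sup>2) * ennreal ((norm (v n s))\<^sup>2) \<partial>LL)"
    using nn_integral_L2_norm[OF wv] by (simp add: power_mult_distrib ennreal_mult)
  also have "\<dots> = (\<integral>\<^sup>+s. (\<Sum>n. ennreal ((norm (w s))\<^sup>2) * ennreal ((norm (v n s))\<^sup>2)) \<partial>LL)"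
    by (rule nn_integral_suminf[symmetric]) measurable
  also have "\<dots> \<le> (\<integral>\<^sup>+s. ennreal ((norm (w s))\<^sup>2) * ennreal S0 \<partial>LL)"
  proof (rule nn_integral_mono)
    fix s assume "s \<in> space LL"
    then have s: "s \<in> {0..T}" by (simp add: space_restrict_space)
    show "(\<Sum>n. ennreal ((norm (w s))\<^sup>2) * ennreal ((norm (v n s))\<^sup>2)) \<le> ennreal ((norm (w s))\<^sup>2) * ennreal S0"
      unfolding ennreal_suminf_cmult by (rule mult_left_mono[OF S0(2)[OF s]]) simp
  qed
  also have "\<dots> = ennreal ((L2_norm LL w)\<^sup>2) * ennreal S0"
    using nn_integral_L2_norm[OF w] by (subst nn_integral_multc) auto
  also have "\<dots> = ennreal (S0 * (L2_norm LL w)\<^sup>2)"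
    using S0(1) by (simp add: ennreal_mult mult.commute)
  finally have *: "(\<Sum>n. ennreal ((L2_norm LL (\<lambda>s. w s *\<^sub>R norm (v n s)))\<^sup>2)) \<le> ennreal (S0 * (L2_norm LL w)\<^sup>2)" .
  show "summable (\<lambda>n. (L2_norm LL (\<lambda>s. w s *\<^sub>R norm (v n s)))\<^sup>2)"
    "(\<Sum>n. (L2_norm LL (\<lambda>s. w s *\<^sub>R norm (v n s)))\<^sup>2) \<le> S0 * (L2_norm LL w)\<^sup>2"
    using summable_ennreal_le[OF _ *] S0(1) by auto
qed

lemma three_squares: "(a + b + c)\<^sup>2 \<le> 3 * a\<^sup>2 + 3 * b\<^sup>2 + 3 * (c::real)\<^sup>2"
  using zero_le_power2[of "a - b"] zero_le_power2[of "b - c"] zero_le_power2[of "a - c"]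
  by (simp add: power2_eq_square algebra_simps)

lemma Kdiff_L2: "t \<in> {0..T} \<Longrightarrow> u \<in> {0..T} \<Longrightarrow> (\<lambda>s. (K_H H u s - K_H H t s) *\<^sub>R norm (v n s)) \<in> L2 LL"
  using L2_diff[OF f.Kv_L2[of u n] f.Kv_L2[of t n]] by (simp add: left_diff_distrib)

text \<open>The kernel increment is estimated by an explicit power of the time difference. The other
  two groups are kept as series: they have summable majorants, but tend to zero only by dominated
  convergence.\<close>

lemma h_diff_summable:
  assumes t: "t \<in> {0..T}" "u \<in> {0..T}"
  shows "summable (\<lambda>n. (L2_norm LL (\<lambda>s. c.h n u s - c.h n t s))\<^sup>2)"
    and "(\<Sum>n. (L2_norm LL (\<lambda>s. c.h n u s - c.h n t s))\<^sup>2) \<le> 3 * D\<^sup>2 * S0 * \<bar>u - t\<bar> powr (2 * H)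
      + 3 * (\<Sum>n. (L2_norm LL (\<lambda>s. K_H H t s *\<^sub>R (c.cf n u s - c.cf n t s)))\<^sup>2)
      + 3 * (\<Sum>n. (L2_norm LL (\<lambda>s. c.G n u s - c.G n t s))\<^sup>2)"
proof -
  let ?a = "\<lambda>n. (L2_norm LL (\<lambda>s. (K_H H u s - K_H H t s) *\<^sub>R norm (v n s)))\<^sup>2"
  let ?b = "\<lambda>n. (L2_norm LL (\<lambda>s. K_H H t s *\<^sub>R (c.cf n u s - c.cf n t s)))\<^sup>2"
  let ?g = "\<lambda>n. (L2_norm LL (\<lambda>s. c.G n u s - c.G n t s))\<^sup>2"
  let ?x = "\<lambda>n. (L2_norm LL (\<lambda>s. c.h n u s - c.h n t s))\<^sup>2"
  note A = weighted_sum_le[OF L2_diff[OF KL2_ext[OF t(2)] KL2_ext[OF t(1)]] Kdiff_L2[OF t]]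
  have sb: "summable ?b"
  proof (rule summable_comparison_test')
    show "summable (\<lambda>n. (2 * D)\<^sup>2 * (L2_norm LL (\<lambda>s. K_H H t s *\<^sub>R norm (v n s)))\<^sup>2)"
      by (intro summable_mult weighted_sum_le(1) KL2_ext f.Kv_L2 t)
    show "norm (?b n) \<le> (2 * D)\<^sup>2 * (L2_norm LL (\<lambda>s. K_H H t s *\<^sub>R norm (v n s)))\<^sup>2" if "n \<ge> 0" for n
      using power_mono[OF f.Kcf_diff_le[OF t, of n] L2_norm_nonneg, of 2] by (simp add: power_mult_distrib)
  qed
  have sg: "summable ?g"
  proof (rule summable_comparison_test')
    show "summable (\<lambda>n. 4 * (L2_norm LL (c.\<Gamma> n))\<^sup>2)" by (intro summable_mult \<Gamma>_summable)
    show "norm (?g n) \<le> 4 * (L2_norm LL (c.\<Gamma> n))\<^sup>2" if "n \<ge> 0" for n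
      using power_mono[OF f.G_diff_le[OF t, of n] L2_norm_nonneg, of 2] by (simp add: power_mult_distrib)
  qed
  have le: "?x n \<le> 3 * D\<^sup>2 * ?a n + 3 * ?b n + 3 * ?g n" for n
  proof -
    have "?x n \<le> (D * L2_norm LL (\<lambda>s. (K_H H u s - K_H H t s) *\<^sub>R norm (v n s))
     + L2_norm LL (\<lambda>s. K_H H t s *\<^sub>R (c.cf n u s - c.cf n t s)) + L2_norm LL (\<lambda>s. c.G n u s - c.G n t s))\<^sup>2"
      by (rule power_mono[OF f.h_diff_le[OF t] L2_norm_nonneg])
    also have "\<dots> \<le> 3 * (D * L2_norm LL (\<lambda>s. (K_H H u s - K_H H t s) *\<^sub>R norm (v n s)))\<^sup>2 + 3 * ?b n + 3 * ?g n"
      by (rule three_squares)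
    finally show ?thesis by (simp add: power_mult_distrib mult.assoc)
  qed
  have sR: "summable (\<lambda>n. 3 * D\<^sup>2 * ?a n + 3 * ?b n + 3 * ?g n)"
    by (intro summable_add summable_mult A(1) sb sg)
  show sx: "summable ?x"
    by (rule summable_comparison_test'[OF sR]) (use le in simp)
  have "(\<Sum>n. ?x n) \<le> (\<Sum>n. 3 * D\<^sup>2 * ?a n + 3 * ?b n + 3 * ?g n)"
    by (rule suminf_le[OF le sx sR])
  also have "\<dots> = 3 * D\<^sup>2 * (\<Sum>n. ?a n) + 3 * (\<Sum>n. ?b n) + 3 * (\<Sum>n. ?g n)"
    using A(1) sb sg by (simp add: suminf_add[symmetric] suminf_mult summable_add summable_mult)
  also have "\<dots> \<le> 3 * D\<^sup>2 * (S0 * \<bar>u - t\<bar> powr (2 * H)) + 3 * (\<Sum>n. ?b n) + 3 * (\<Sum>n. ?g n)"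
    using A(2) unfolding Kinc[OF t] by (intro add_mono mult_left_mono order_refl) auto
  finally show "(\<Sum>n. ?x n) \<le> 3 * D\<^sup>2 * S0 * \<bar>u - t\<bar> powr (2 * H) + 3 * (\<Sum>n. ?b n) + 3 * (\<Sum>n. ?g n)"
    by (simp add: mult.assoc)
qed

text \<open>The explicit power tends to zero, and the two remaining series do so term by term under
  summable majorants.\<close>

lemma h_diff_tendsto:
  assumes t: "t \<in> {0..T}" and X: "\<And>k. X k \<in> {0..T}" "X \<longlonglongrightarrow> t"
  shows "(\<lambda>k. \<Sum>n. (L2_norm LL (\<lambda>s. c.h n (X k) s - c.h n t s))\<^sup>2) \<longlonglongrightarrow> 0"
proof -
  let ?b = "\<lambda>n k. (L2_norm LL (\<lambda>s. K_H H t s *\<^sub>R (c.cf n (X k) s - c.cf n t s)))\<^sup>2"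
  let ?g = "\<lambda>n k. (L2_norm LL (\<lambda>s. c.G n (X k) s - c.G n t s))\<^sup>2"
  have b: "(\<lambda>k. \<Sum>n. ?b n k) \<longlonglongrightarrow> 0"
  proof (rule suminf_tendsto_zero)
    show "(\<lambda>k. ?b n k) \<longlonglongrightarrow> 0" for n using tendsto_power[OF f.Kcf_tendsto[OF t X, of n], of 2] by simp
    show "\<bar>?b n k\<bar> \<le> (2 * D)\<^sup>2 * (L2_norm LL (\<lambda>s. K_H H t s *\<^sub>R norm (v n s)))\<^sup>2" for n k
      using power_mono[OF f.Kcf_diff_le[OF t X(1), of n k] L2_norm_nonneg, of 2] by (simp add: power_mult_distrib)
    show "summable (\<lambda>n. (2 * D)\<^sup>2 * (L2_norm LL (\<lambda>s. K_H H t s *\<^sub>R norm (v n s)))\<^sup>2)"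
      by (intro summable_mult weighted_sum_le(1) KL2_ext f.Kv_L2 t)
  qed
  have g: "(\<lambda>k. \<Sum>n. ?g n k) \<longlonglongrightarrow> 0"
  proof (rule suminf_tendsto_zero)
    show "(\<lambda>k. ?g n k) \<longlonglongrightarrow> 0" for n using tendsto_power[OF f.G_L2_tendsto[OF t X, of n], of 2] by simp
    show "\<bar>?g n k\<bar> \<le> 4 * (L2_norm LL (c.\<Gamma> n))\<^sup>2" for n k
      using power_mono[OF f.G_diff_le[OF t X(1), of n k] L2_norm_nonneg, of 2] by (simp add: power_mult_distrib)
    show "summable (\<lambda>n. 4 * (L2_norm LL (c.\<Gamma> n))\<^sup>2)" by (intro summable_mult \<Gamma>_summable)
  qed
  have a: "(\<lambda>k. \<bar>X k - t\<bar> powr (2 * H)) \<longlonglongrightarrow> 0"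
  proof (rule tendsto_zero_powrI[OF _ tendsto_const])
    show "(\<lambda>k. \<bar>X k - t\<bar>) \<longlonglongrightarrow> 0" using tendsto_rabs_zero[OF LIM_zero[OF X(2)]] .
  qed (use H in auto)
  have "(\<lambda>k. 3 * D\<^sup>2 * S0 * \<bar>X k - t\<bar> powr (2 * H) + 3 * (\<Sum>n. ?b n k) + 3 * (\<Sum>n. ?g n k))
     \<longlonglongrightarrow> 3 * D\<^sup>2 * S0 * 0 + 3 * 0 + 3 * 0"
    by (intro tendsto_intros a b g)
  then have lim: "(\<lambda>k. 3 * D\<^sup>2 * S0 * \<bar>X k - t\<bar> powr (2 * H) + 3 * (\<Sum>n. ?b n k) + 3 * (\<Sum>n. ?g n k)) \<longlonglongrightarrow> 0" by simp
  show ?thesis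
  proof (rule Lim_null_comparison[OF _ lim], intro always_eventually allI)
    fix k
    have "0 \<le> (\<Sum>n. (L2_norm LL (\<lambda>s. c.h n (X k) s - c.h n t s))\<^sup>2)"
      by (intro suminf_nonneg h_diff_summable(1) t X) simp
    then show "norm (\<Sum>n. (L2_norm LL (\<lambda>s. c.h n (X k) s - c.h n t s))\<^sup>2)
      \<le> 3 * D\<^sup>2 * S0 * \<bar>X k - t\<bar> powr (2 * H) + 3 * (\<Sum>n. ?b n k) + 3 * (\<Sum>n. ?g n k)"
      using h_diff_summable(2)[OF t X(1), of k] by simp
  qed
qed

lemma h_at_0: "L2_norm LL (c.h n 0) = 0"
proof -
  have "L2_norm LL (c.h n 0) = L2_norm LL (\<lambda>s. 0 :: 'x)"
    by (intro L2_norm_cong) (simp add: space_restrict_space c.h_zero)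
  then show ?thesis by simp
qed

text \<open>The integrand for the upper limit 0 vanishes on \<open>{0..T}\<close>, so this is the
  increment estimate taken from time 0.\<close>

lemma h_summable: "t \<in> {0..T} \<Longrightarrow> summable (\<lambda>n. (L2_norm LL (c.h n t))\<^sup>2)"
proof -
  assume t: "t \<in> {0..T}"
  have 0: "0 \<in> {0..T}" using T by simp
  have "L2_norm LL (\<lambda>s. c.h n t s - c.h n 0 s) = L2_norm LL (c.h n t)" for n
    by (intro L2_norm_cong) (simp add: space_restrict_space c.h_zero)
  then show ?thesis using h_diff_summable(1)[OF 0 t] by simp
qed

lemma \<phi>_cf: "t \<in> {0..T} \<Longrightarrow> r \<in> {0..t} \<Longrightarrow> \<phi> t n r = c.cf n t r"
  using \<phi>[of t r n] by (simp add: c.cf_def)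

lemma J_exists:
  "\<exists>J. \<forall>n t. n \<in> I \<longrightarrow> t \<in> {0..T} \<longrightarrow> has_wiener_integral M (\<beta> n) t (K_star H t (\<phi> t n)) (J n t)"
proof -
  have ex: "\<exists>Z. has_wiener_integral M (\<beta> n) t (K_star H t (\<phi> t n)) Z" if n: "n \<in> I" and t: "t \<in> {0..T}" for n t
    using has_wiener_integral_exists[OF finite_measure_axioms brownian_motion_L2(1)[OF bm[OF n]] brownian_motion_covariance[OF bm[OF n]] _ _
      f.K_star_L2(1)[OF t \<phi>_cf[OF t]]] t by auto
  define J where "J n t = (SOME Z. has_wiener_integral M (\<beta> n) t (K_star H t (\<phi> t n)) Z)" for n t
  have "has_wiener_integral M (\<beta> n) t (K_star H t (\<phi> t n)) (J n t)" if "n \<in> I" "t \<in> {0..T}" for n t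
    unfolding J_def by (rule someI_ex[OF ex[OF that]])
  then show ?thesis by (intro exI[of _ J]) simp
qed

text \<open>Integrals along different Brownian motions are orthogonal, so by Pythagoras and the
  isometry the norms of partial sums are partial sums of the series of \<open>h\<close>. Convergence
  of the series and mean-square continuity of its sum are thus purely deterministic facts.\<close>

lemma stochastic_convolution:
  obtains J Z where
    "\<And>n t. n \<in> I \<Longrightarrow> t \<in> {0..T} \<Longrightarrow> has_wiener_integral M (\<beta> n) t (K_star H t (\<phi> t n)) (J n t)"
    "\<And>t. t \<in> {0..T} \<Longrightarrow> (\<lambda>k. \<integral>\<^sup>+\<omega>. ennreal ((norm (Z t \<omega> - (\<Sum>n\<in>I \<inter> {..<k}. J n t \<omega>)))\<^sup>2) \<partial>M) \<longlonglongrightarrow> 0"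
    "Z \<in> C_L2 M {0..T}" "AE \<omega> in M. Z 0 \<omega> = 0"
proof -
  from J_exists obtain J
    where J0: "\<forall>n t. n \<in> I \<longrightarrow> t \<in> {0..T} \<longrightarrow> has_wiener_integral M (\<beta> n) t (K_star H t (\<phi> t n)) (J n t)"
    by (elim exE)
  have J: "has_wiener_integral M (\<beta> n) t (K_star H t (\<phi> t n)) (J n t)" if "n \<in> I" "t \<in> {0..T}" for n t
    using J0 that by simp
  have JL: "J n t \<in> L2 M" if "n \<in> I" "t \<in> {0..T}" for n t
    using J[OF that] by (simp add: has_wiener_integral_def)
  note b = brownian_motion_L2(1)[OF bm]
  define k where "k n t s = indicat_real {0..t} s *\<^sub>R K_star H t (\<phi> t n) s" for n t s
  have wp: "wiener_pair M (\<beta> n) T (k n t) (J n t)" if n: "n \<in> I" and t: "t \<in> {0..T}" for n t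
    unfolding k_def[abs_def] using t by (intro has_wiener_integral_pair b[OF n] J n) auto
  have kL: "k n t \<in> L2 LL" if "n \<in> I" "t \<in> {0..T}" for n t
    using wp[OF that] by (simp add: wiener_pair_def)
  have kh: "AE s in LL. k n t s = c.h n t s" if t: "t \<in> {0..T}" for n t
    unfolding k_def by (rule f.K_star_L2(2)[OF t \<phi>_cf[OF t]])
  have wd: "wiener_pair M (\<beta> n) T (\<lambda>s. k n u s - k n t s) (\<lambda>\<omega>. J n u \<omega> - J n t \<omega>)"
    if "n \<in> I" "t \<in> {0..T}" "u \<in> {0..T}" for n t u
    using that by (intro wiener_pair_diff b wp) auto
  have J_diff: "L2_norm M (\<lambda>\<omega>. J n u \<omega> - J n t \<omega>) = L2_norm LL (\<lambda>s. c.h n u s - c.h n t s)"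
    if n: "n \<in> I" and t: "t \<in> {0..T}" and u: "u \<in> {0..T}" for n t u
  proof -
    have "L2_norm M (\<lambda>\<omega>. J n u \<omega> - J n t \<omega>) = L2_norm LL (\<lambda>s. k n u s - k n t s)"
      by (rule wiener_pair_isometry[OF b[OF n] brownian_motion_covariance[OF bm[OF n]] wd[OF n t u]])
    also have "\<dots> = L2_norm LL (\<lambda>s. c.h n u s - c.h n t s)"
    proof (rule L2_cong_AE(2)[OF L2_diff[OF f.h_L2[OF u] f.h_L2[OF t]]])
      show "(\<lambda>s. k n u s - k n t s) \<in> borel_measurable LL" by (intro L2_measurable L2_diff kL n t u)
      show "AE s in LL. k n u s - k n t s = c.h n u s - c.h n t s"
        using kh[OF u, of n] kh[OF t, of n] by eventually_elim simp
    qed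
    finally show ?thesis .
  qed
  have J_norm: "L2_norm M (J n t) = L2_norm LL (c.h n t)" if n: "n \<in> I" and t: "t \<in> {0..T}" for n t
  proof -
    have "L2_norm M (J n t) = L2_norm LL (k n t)"
      by (rule wiener_pair_isometry[OF b[OF n] brownian_motion_covariance[OF bm[OF n]] wp[OF n t]])
    also have "\<dots> = L2_norm LL (c.h n t)"
      by (rule L2_cong_AE(2)[OF f.h_L2[OF t] L2_measurable[OF kL[OF n t]] kh[OF t]])
    finally show ?thesis .
  qed
  \<comment> \<open>Independence makes the covariance vanish, which is the case \<kappa> = 0 of the
    inner product formula.\<close>
  have orth: "L2_inner M Z Z' = 0" if n: "n \<in> I" "m \<in> I" "n \<noteq> m" and w: "wiener_pair M (\<beta> n) T h Z" "wiener_pair M (\<beta> m) T h' Z'"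
    for n m h h' and Z Z' :: "'w \<Rightarrow> 'x"
  proof -
    have cov: "(\<integral>\<omega>. \<beta> n s \<omega> * \<beta> m t \<omega> \<partial>M) = 0 * min s t" if "s \<in> {0..T}" "t \<in> {0..T}" for s t
      using independent_brownian_motions_covariance[OF ind n bm[OF n(1)] bm[OF n(2)] that] by simp
    show ?thesis using wiener_pair_inner[OF b[OF n(1)] b[OF n(2)] cov w] by simp
  qed
  define S where "S k t \<omega> = (\<Sum>n\<in>I \<inter> {..<k}. J n t \<omega>)" for k t \<omega>
  have SL: "S k t \<in> L2 M" if "t \<in> {0..T}" for k t
    unfolding S_def[abs_def] by (intro L2_sum JL that) auto
  have S_diff: "(L2_norm M (\<lambda>\<omega>. S k u \<omega> - S k t \<omega>))\<^sup>2 = (\<Sum>n\<in>I \<inter> {..<k}. (L2_norm LL (\<lambda>s. c.h n u s - c.h n t s))\<^sup>2)"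
    if t: "t \<in> {0..T}" and u: "u \<in> {0..T}" for k t u
  proof -
    have "(L2_norm M (\<lambda>\<omega>. S k u \<omega> - S k t \<omega>))\<^sup>2 = (L2_norm M (\<lambda>\<omega>. \<Sum>n\<in>I \<inter> {..<k}. J n u \<omega> - J n t \<omega>))\<^sup>2"
      by (simp add: S_def sum_subtractf)
    also have "\<dots> = (\<Sum>n\<in>I \<inter> {..<k}. (L2_norm M (\<lambda>\<omega>. J n u \<omega> - J n t \<omega>))\<^sup>2)"
    proof (rule L2_norm_sum_orthogonal)
      show "(\<lambda>\<omega>. J n u \<omega> - J n t \<omega>) \<in> L2 M" if "n \<in> I \<inter> {..<k}" for n
        using that by (intro L2_diff JL t u) auto
      show "L2_inner M (\<lambda>\<omega>. J n u \<omega> - J n t \<omega>) (\<lambda>\<omega>. J m u \<omega> - J m t \<omega>) = 0"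
        if "n \<in> I \<inter> {..<k}" "m \<in> I \<inter> {..<k}" "n \<noteq> m" for n m
        using that by (intro orth[OF _ _ _ wd[OF _ t u] wd[OF _ t u]]) auto
    qed simp
    also have "\<dots> = (\<Sum>n\<in>I \<inter> {..<k}. (L2_norm LL (\<lambda>s. c.h n u s - c.h n t s))\<^sup>2)"
      using J_diff t u by (intro sum.cong refl) auto
    finally show ?thesis .
  qed
  have S_tail: "(L2_norm M (\<lambda>\<omega>. S k t \<omega> - S l t \<omega>))\<^sup>2 \<le> (\<Sum>n\<in>{l..<k}. (L2_norm LL (c.h n t))\<^sup>2)"
    if t: "t \<in> {0..T}" and kl: "l \<le> k" for k l t
  proof -
    have "S k t \<omega> = S l t \<omega> + (\<Sum>n\<in>I \<inter> {l..<k}. J n t \<omega>)" for \<omega>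
    proof -
      have "I \<inter> {..<k} = I \<inter> {..<l} \<union> I \<inter> {l..<k}" using kl by auto
      then show ?thesis unfolding S_def by (simp add: sum.union_disjoint[of "I \<inter> {..<l}"] disjoint_iff)
    qed
    then have "(L2_norm M (\<lambda>\<omega>. S k t \<omega> - S l t \<omega>))\<^sup>2 = (L2_norm M (\<lambda>\<omega>. \<Sum>n\<in>I \<inter> {l..<k}. J n t \<omega>))\<^sup>2" by simp
    also have "\<dots> = (\<Sum>n\<in>I \<inter> {l..<k}. (L2_norm M (J n t))\<^sup>2)"
    proof (rule L2_norm_sum_orthogonal)
      show "J n t \<in> L2 M" if "n \<in> I \<inter> {l..<k}" for n using that by (intro JL t) auto
      show "L2_inner M (J n t) (J m t) = 0" if "n \<in> I \<inter> {l..<k}" "m \<in> I \<inter> {l..<k}" "n \<noteq> m" for n m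
        using that by (intro orth[OF _ _ _ wp[OF _ t] wp[OF _ t]]) auto
    qed simp
    also have "\<dots> = (\<Sum>n\<in>I \<inter> {l..<k}. (L2_norm LL (c.h n t))\<^sup>2)"
      using J_norm t by (intro sum.cong refl) auto
    also have "\<dots> \<le> (\<Sum>n\<in>{l..<k}. (L2_norm LL (c.h n t))\<^sup>2)" by (intro sum_mono2) auto
    finally show ?thesis .
  qed
  have "\<exists>Z. Z \<in> L2 M \<and> (\<lambda>k. L2_norm M (\<lambda>\<omega>. S k t \<omega> - Z \<omega>)) \<longlonglongrightarrow> 0" if t: "t \<in> {0..T}" for t
  proof -
    have "\<exists>N. \<forall>k\<ge>N. \<forall>l\<ge>N. L2_norm M (\<lambda>\<omega>. S k t \<omega> - S l t \<omega>) < \<epsilon>" if e: "0 < \<epsilon>" for \<epsilon>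
    proof -
      have "0 < \<epsilon>\<^sup>2" using e by simp
      with h_summable[OF t] have "\<exists>N. \<forall>m\<ge>N. \<forall>n. norm (\<Sum>i\<in>{m..<n}. (L2_norm LL (c.h i t))\<^sup>2) < \<epsilon>\<^sup>2"
        unfolding summable_Cauchy by (elim allE impE)
      then obtain N where N: "\<And>m n. m \<ge> N \<Longrightarrow> norm (\<Sum>i\<in>{m..<n}. (L2_norm LL (c.h i t))\<^sup>2) < \<epsilon>\<^sup>2" by blast
      have *: "L2_norm M (\<lambda>\<omega>. S k t \<omega> - S l t \<omega>) < \<epsilon>" if "l \<ge> N" "l \<le> k" for k l
      proof -
        have "(L2_norm M (\<lambda>\<omega>. S k t \<omega> - S l t \<omega>))\<^sup>2 < \<epsilon>\<^sup>2"
          using S_tail[OF t that(2)] N[OF that(1), of k] by simp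
        then show ?thesis using e by (simp add: power2_less_imp_less)
      qed
      have "L2_norm M (\<lambda>\<omega>. S k t \<omega> - S l t \<omega>) < \<epsilon>" if "k \<ge> N" "l \<ge> N" for k l
        using *[of l k] *[of k l] that L2_norm_minus_commute[of M "S k t" "S l t"] by (cases "l \<le> k") auto
      then show ?thesis by blast
    qed
    from L2_complete[OF finite_measure_axioms SL[OF t] this]
    show ?thesis by blast
  qed
  then have "\<forall>t. \<exists>Z. t \<in> {0..T} \<longrightarrow> Z \<in> L2 M \<and> (\<lambda>k. L2_norm M (\<lambda>\<omega>. S k t \<omega> - Z \<omega>)) \<longlonglongrightarrow> 0" by blast
  from choice[OF this] obtain Z where Z0: "\<forall>t. t \<in> {0..T} \<longrightarrow> Z t \<in> L2 M \<and> (\<lambda>k. L2_norm M (\<lambda>\<omega>. S k t \<omega> - Z t \<omega>)) \<longlonglongrightarrow> 0"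
    by (elim exE)
  have Z: "\<And>t. t \<in> {0..T} \<Longrightarrow> Z t \<in> L2 M" "\<And>t. t \<in> {0..T} \<Longrightarrow> (\<lambda>k. L2_norm M (\<lambda>\<omega>. S k t \<omega> - Z t \<omega>)) \<longlonglongrightarrow> 0"
    using Z0 by auto
  \<comment> \<open>Each partial sum satisfies the bound by the full series, and norms pass to the
    limit.\<close>
  have Z_diff: "(L2_norm M (\<lambda>\<omega>. Z u \<omega> - Z t \<omega>))\<^sup>2 \<le> (\<Sum>n. (L2_norm LL (\<lambda>s. c.h n u s - c.h n t s))\<^sup>2)"
    if t: "t \<in> {0..T}" and u: "u \<in> {0..T}" for t u
  proof -
    have "(\<lambda>k. L2_norm M (\<lambda>\<omega>. (S k u \<omega> - S k t \<omega>) - (Z u \<omega> - Z t \<omega>))) \<longlonglongrightarrow> 0"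
      by (rule L2_norm_tendsto_diff[OF SL[OF u] Z(1)[OF u] SL[OF t] Z(1)[OF t] Z(2)[OF u] Z(2)[OF t]])
    note L = L2_diff[OF SL[OF u] SL[OF t]] L2_diff[OF Z(1)[OF u] Z(1)[OF t]]
    have "(\<lambda>k. L2_inner M (\<lambda>\<omega>. S k u \<omega> - S k t \<omega>) (\<lambda>\<omega>. S k u \<omega> - S k t \<omega>)) \<longlonglongrightarrow> L2_inner M (\<lambda>\<omega>. Z u \<omega> - Z t \<omega>) (\<lambda>\<omega>. Z u \<omega> - Z t \<omega>)"
      by (rule L2_inner_tendsto[OF L L]) fact+
    then have lim: "(\<lambda>k. (L2_norm M (\<lambda>\<omega>. S k u \<omega> - S k t \<omega>))\<^sup>2) \<longlonglongrightarrow> (L2_norm M (\<lambda>\<omega>. Z u \<omega> - Z t \<omega>))\<^sup>2"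
      by (simp add: L2_inner_self)
    show ?thesis
    proof (rule tendsto_upperbound[OF lim], intro always_eventually allI)
      fix k
      show "(L2_norm M (\<lambda>\<omega>. S k u \<omega> - S k t \<omega>))\<^sup>2 \<le> (\<Sum>n. (L2_norm LL (\<lambda>s. c.h n u s - c.h n t s))\<^sup>2)"
        unfolding S_diff[OF t u] by (rule sum_le_suminf[OF h_diff_summable(1)[OF t u]]) auto
    qed simp
  qed
  have C: "Z \<in> C_L2 M {0..T}"
  proof (rule C_L2_sequentially[OF Z(1)])
    fix X t assume t: "t \<in> {0..T}" and X: "\<And>k::nat. X k \<in> {0..T}" "X \<longlonglongrightarrow> t"
    have "(\<lambda>k. (L2_norm M (\<lambda>\<omega>. Z (X k) \<omega> - Z t \<omega>))\<^sup>2) \<longlonglongrightarrow> 0"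
      by (rule Lim_null_comparison[OF _ h_diff_tendsto[OF t X]]) (use Z_diff[OF t X(1)] in \<open>auto intro: always_eventually\<close>)
    from tendsto_real_sqrt[OF this] show "(\<lambda>k. L2_norm M (\<lambda>\<omega>. Z (X k) \<omega> - Z t \<omega>)) \<longlonglongrightarrow> 0" by simp
  qed
  have 0: "0 \<in> {0..T}" using T by simp
  \<comment> \<open>The partial sum with no terms is zero, so the tail estimate from index 0 bounds
    the whole sum.\<close>
  have "L2_norm M (S k 0) = 0" for k
    using S_tail[OF 0, of 0 k] by (simp add: h_at_0 S_def[of 0])
  then have "L2_norm M (Z 0) \<le> L2_norm M (\<lambda>\<omega>. S k 0 \<omega> - Z 0 \<omega>)" for k
    using L2_norm_diff_abs[OF SL[OF 0] Z(1)[OF 0], of k] by simp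
  then have "L2_norm M (Z 0) \<le> 0"
    by (intro tendsto_lowerbound[OF Z(2)[OF 0]]) (auto intro: always_eventually)
  then have "L2_norm M (Z 0) = 0" using L2_norm_nonneg[of M "Z 0"] by linarith
  then have Z00: "AE \<omega> in M. Z 0 \<omega> = 0" by (rule L2_norm_eq_0_AE[OF Z(1)[OF 0]])
  show ?thesis
  proof (rule that[OF J _ C Z00])
    fix t assume t: "t \<in> {0..T}"
    have "(\<lambda>k. L2_norm M (\<lambda>\<omega>. Z t \<omega> - S k t \<omega>)) \<longlonglongrightarrow> 0"
      using Z(2)[OF t] by (subst L2_norm_minus_commute)
    then show "(\<lambda>k. \<integral>\<^sup>+\<omega>. ennreal ((norm (Z t \<omega> - (\<Sum>n\<in>I \<inter> {..<k}. J n t \<omega>)))\<^sup>2) \<partial>M) \<longlonglongrightarrow> 0"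
      unfolding S_def[symmetric] by (simp only: nn_sq_tendsto_zero_iff[OF L2_diff[OF Z(1)[OF t] SL[OF t]]])
  qed
qed

lemma K_star_sum_finite:
  assumes t: "t \<in> {0..T}"
  shows "(\<Sum>n. \<integral>\<^sup>+s. ennreal ((norm (K_star H t (\<phi> t n) s))\<^sup>2) \<partial>lebesgue_on {0..t}) < \<infinity>"
proof -
  have "(\<Sum>n. \<integral>\<^sup>+s. ennreal ((norm (K_star H t (\<phi> t n) s))\<^sup>2) \<partial>lebesgue_on {0..t}) = (\<Sum>n. ennreal ((L2_norm LL (c.h n t))\<^sup>2))"
    using f.K_star_L2(3)[OF t \<phi>_cf[OF t]] by simp
  also have "\<dots> = ennreal (\<Sum>n. (L2_norm LL (c.h n t))\<^sup>2)"
    by (rule suminf_ennreal2[OF _ h_summable[OF t]]) simp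
  finally show ?thesis by simp
qed

end

section \<open>The stochastic integral process under the assumptions on \<sigma>\<close>

lemma closed_linear_operator_scaleR:
  "closed_linear_operator DA A \<Longrightarrow> y \<in> DA \<Longrightarrow> a *\<^sub>R y \<in> DA \<and> A (a *\<^sub>R y) = a *\<^sub>R A y"
  unfolding closed_linear_operator_def by (auto intro: subspace_scale)

lemma ennreal_le_suminf: "f n \<le> (\<Sum>n. f n :: ennreal)"
  using sum_le_suminf[of f "{n}"] by simp

lemma continuous_on_Hoelder:
  fixes y :: "real \<Rightarrow> 'x::real_normed_vector"
  assumes "\<And>r s. r \<in> S \<Longrightarrow> s \<in> S \<Longrightarrow> norm (y r - y s) \<le> K * \<bar>r - s\<bar> powr \<gamma>" and \<gamma>: "0 < \<gamma>"
  shows "continuous_on S y"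
  unfolding continuous_on_def
proof
  fix s assume s: "s \<in> S"
  have "((\<lambda>r. \<bar>r - s\<bar>) \<longlongrightarrow> \<bar>s - s\<bar>) (at s within S)" by (intro tendsto_intros)
  then have "((\<lambda>r. \<bar>r - s\<bar> powr \<gamma>) \<longlongrightarrow> 0) (at s within S)"
    using \<gamma> by (intro tendsto_zero_powrI[OF _ tendsto_const]) auto
  then have "((\<lambda>r. K * \<bar>r - s\<bar> powr \<gamma>) \<longlongrightarrow> 0) (at s within S)"
    by (rule tendsto_mult_right_zero)
  then have "((\<lambda>r. y r - y s) \<longlongrightarrow> 0) (at s within S)"
  proof (rule Lim_null_comparison[rotated])
    show "\<forall>\<^sub>F r in at s within S. norm (y r - y s) \<le> K * \<bar>r - s\<bar> powr \<gamma>"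
      unfolding eventually_at_filter using assms(1)[OF _ s] by (intro always_eventually) simp
  qed
  then show "(y \<longlongrightarrow> y s) (at s within S)" by (rule LIM_zero_cancel)
qed

text \<open>The real norm passes through \<open>enn2real\<close>, under which an infinite value
  would read as 0. Finiteness of the difference is therefore derived first, from that of
  \<open>\<sigma> r\<close> and \<open>\<sigma> s\<close>.\<close>

lemma L20_sq_Hoelder:
  assumes lam: "\<forall>n\<in>I. 0 \<le> lam n" and \<sigma>: "\<forall>t\<ge>0. \<sigma> t \<in> L20 I lam e"
    and Ho: "\<forall>t\<in>{0..T}. \<forall>s\<in>{0..T}. L20_norm I lam e (\<sigma> t - \<sigma> s) \<le> C5 * \<bar>t - s\<bar> powr \<gamma>"
    and r: "r \<in> {0..T}" and s: "s \<in> {0..T}"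
  shows "L20_sq I lam e (blinfun_apply (\<sigma> r - \<sigma> s)) \<le> ennreal (C5\<^sup>2 * \<bar>r - s\<bar> powr (2 * \<gamma>))"
proof -
  let ?X = "L20_sq I lam e (blinfun_apply (\<sigma> r - \<sigma> s))"
  have "?X = L20_sq I lam e (\<lambda>y. \<sigma> r y + - \<sigma> s y)"     by (rule arg_cong[where f = "L20_sq I lam e"]) (simp add: fun_eq_iff blinfun.diff_left)
  also have "\<dots> \<le> 2 * L20_sq I lam e (\<sigma> r) + 2 * L20_sq I lam e (\<lambda>y. - \<sigma> s y)" by (rule L20_sq_add_le[OF lam])
  also have "\<dots> = 2 * L20_sq I lam e (\<sigma> r) + 2 * L20_sq I lam e (\<sigma> s)" by (simp add: L20_sq_def)
  also have "\<dots> < \<infinity>" using \<sigma> r s by (auto simp: L20_def ennreal_mult_less_top)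
  finally have fin: "?X < \<infinity>" .
  have "sqrt (enn2real ?X) \<le> C5 * \<bar>r - s\<bar> powr \<gamma>"
    using Ho r s unfolding L20_norm_def by blast
  then have "(sqrt (enn2real ?X))\<^sup>2 \<le> (C5 * \<bar>r - s\<bar> powr \<gamma>)\<^sup>2" by (intro power_mono) auto
  also have "(\<bar>r - s\<bar> powr \<gamma>)\<^sup>2 = \<bar>r - s\<bar> powr (2 * \<gamma>)"
    by (simp only: power2_eq_square powr_add[symmetric] mult_2)
  then have "(C5 * \<bar>r - s\<bar> powr \<gamma>)\<^sup>2 = C5\<^sup>2 * \<bar>r - s\<bar> powr (2 * \<gamma>)" by (simp add: power_mult_distrib)
  finally have "enn2real ?X \<le> C5\<^sup>2 * \<bar>r - s\<bar> powr (2 * \<gamma>)" by simp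
  then have "ennreal (enn2real ?X) \<le> ennreal (C5\<^sup>2 * \<bar>r - s\<bar> powr (2 * \<gamma>))" by (rule ennreal_leI)
  moreover have "ennreal (enn2real ?X) = ?X" using fin by simp
  ultimately show ?thesis by (simp only:)
qed

lemma (in prob_space) fbm_integral_process:
  fixes \<sigma> :: "real \<Rightarrow> 'y::{real_inner,banach,second_countable_topology} \<Rightarrow>\<^sub>L 'x::{real_inner,banach,second_countable_topology}"
    and R :: "real \<Rightarrow> 'x \<Rightarrow>\<^sub>L 'x"
  assumes T: "0 < T" and H: "0 < H" "H < 1/2"
    and lam: "\<forall>n\<in>I. 0 \<le> lam n"
    and Q: "Q_fractional_brownian_motion M H T I lam e \<beta> BH"
    and A: "closed_linear_operator DA A" "\<exists>S. C0_semigroup S \<and> infinitesimal_generator DA A S"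
    and B0: "\<exists>K. \<forall>y\<in>DA. norm (B 0 y) \<le> K * graph_norm A y"
    and c: "\<forall>t\<ge>0. 0 \<le> c t" "integrable (lebesgue_on {0..T}) c"
    and W: "\<forall>y\<in>DA. \<exists>w. has_W11_derivative (\<lambda>t. B t y) w \<and>
           (AE t in lebesgue_on {0..}. norm (w t) \<le> c t * graph_norm A y)"
    and R: "resolvent_operator DA A B R" and D: "D = (SUP t\<in>{0..T}. norm (R t))"
    and \<sigma>: "\<forall>t\<ge>0. \<sigma> t \<in> L20 I lam e" and \<gamma>: "\<gamma> > 1/2 - H"
    and Ho: "\<forall>t\<in>{0..T}. \<forall>s\<in>{0..T}. L20_norm I lam e (\<sigma> t - \<sigma> s) \<le> C5 * \<bar>t - s\<bar> powr \<gamma>"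
    and \<sigma>D: "\<forall>t\<in>{0..T}. \<forall>y. \<sigma> t y \<in> DA"
    and A\<sigma>: "(\<integral>\<^sup>+t. L20_sq I lam e (\<lambda>y. A (\<sigma> t y)) \<partial>lebesgue_on {0..T}) \<le> ennreal C6"
  shows "\<exists>Z. Z \<in> C_L2 M {0..T} \<and> (AE \<omega> in M. Z 0 \<omega> = 0) \<and>
    (\<forall>t\<in>{0..T}. has_fbm_integral M H I lam e \<beta> t (\<lambda>s. R (t - s) o\<^sub>L \<sigma> s) (Z t))"
\<comment> \<open>The properties of \<open>K_H\<close> are taken from one coordinate of the
  fractional Brownian motion, which requires an index. Without any index the integral is
  zero.\<close>
proof (cases "I = {}")
  case True
  have "(\<lambda>t \<omega>. 0) \<in> C_L2 M {0..T}" by (simp add: C_L2_def)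
  moreover have "has_fbm_integral M H I lam e \<beta> t (\<lambda>s. R (t - s) o\<^sub>L \<sigma> s) (\<lambda>\<omega>. 0)" for t
    unfolding has_fbm_integral_def using True by simp
  ultimately show ?thesis by (intro exI[of _ "\<lambda>t \<omega>. 0"]) simp
next
  case False
  then obtain n0 where n0: "n0 \<in> I" by blast
  have bm: "\<And>n. n \<in> I \<Longrightarrow> standard_brownian_motion M T (\<beta> n)" and ind: "independent_processes M T \<beta> I"
    using Q unfolding Q_fractional_brownian_motion_def by auto
  have "\<exists>\<beta>H. (\<forall>n\<in>I. fractional_brownian_motion M H T (\<beta>H n)) \<and>
        (\<forall>n\<in>I. \<forall>t\<in>{0..T}. has_wiener_integral M (\<beta> n) t (K_H H t) (\<beta>H n t))"
    using Q unfolding Q_fractional_brownian_motion_def by (elim conjE exE) (rule exI, rule conjI)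
  then obtain \<beta>H where \<beta>H: "\<forall>n\<in>I. fractional_brownian_motion M H T (\<beta>H n)"
    "\<forall>n\<in>I. \<forall>t\<in>{0..T}. has_wiener_integral M (\<beta> n) t (K_H H t) (\<beta>H n t)" by (elim exE conjE)
  have fbm: "fractional_brownian_motion M H T (\<beta>H n0)" using \<beta>H(1) n0 by simp
  have wK: "has_wiener_integral M (\<beta> n0) t (K_H H t) (\<beta>H n0 t)" if "t \<in> {0..T}" for t
    using \<beta>H(2) n0 that by simp
  have Kinc: "(L2_norm (lebesgue_on {0..T}) (\<lambda>s. K_H H u s - K_H H t s))\<^sup>2 = \<bar>u - t\<bar> powr (2 * H)"
    if "t \<in> {0..T}" "u \<in> {0..T}" for t u
    by (rule K_H_increment[OF bm[OF n0] fbm H(1) wK that])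
  \<comment> \<open>The Hoelder exponent may exceed 1, but the Lipschitz part of the increments
    permits at most 1; in both cases \<open>H - 1/2 + \<delta>\<close> stays positive.\<close>
  define \<delta> where "\<delta> = min \<gamma> 1"
  have \<delta>: "0 < H - 1/2 + \<delta>" "\<delta> \<le> 1" "\<delta> \<le> \<gamma>" using \<gamma> H by (auto simp: \<delta>_def)
  have T0: "0 \<le> T" using T by simp
  note RD = resolvent_bounded[OF R T0 D]
  have Rc: "continuous_on {0..} (\<lambda>t. R t x)" for x using R unfolding resolvent_operator_def by simp
  obtain C where C: "0 \<le> C" and Lip: "\<And>x u v. x \<in> DA \<Longrightarrow> u \<in> {0..T} \<Longrightarrow> v \<in> {0..T} \<Longrightarrow>
     norm (R u x - R v x) \<le> C * \<bar>u - v\<bar> * graph_norm A x"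
    using resolvent_Lipschitz[OF R T0 D B0 c W] by metis
  interpret ck: convolution_kernel T H D \<delta> R
    by unfold_locales (use T H RD \<delta> Rc wK in \<open>auto simp: has_wiener_integral_def\<close>)
  define w where "w n = sqrt (weight I lam n)" for n
  have w2: "(w n)\<^sup>2 = weight I lam n" for n using weight_nonneg[OF lam, of n] by (simp add: w_def)
  have wn: "w n = sqrt (lam n)" if "n \<in> I" for n using that by (simp add: w_def weight_def)
  define y where "y n s = w n *\<^sub>R \<sigma> s (e n)" for n s
  have yD: "y n s \<in> DA" "A (y n s) = w n *\<^sub>R A (\<sigma> s (e n))" if "s \<in> {0..T}" for n s
    using closed_linear_operator_scaleR[OF A(1), of "\<sigma> s (e n)" "w n"] \<sigma>D that by (auto simp: y_def)
  \<comment> \<open>The cut-off makes each coordinate Borel measurable on the line, since it is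
    continuous on \<open>{0..T}\<close>.\<close>
  define v where "v n s = indicat_real {0..T} s *\<^sub>R y n s" for n s
  define p where "p n s = indicat_real {0..T} s * norm (A (y n s)) + norm (v n s)" for n s
  have vy: "v n s = y n s" if "s \<in> {0..T}" for n s using that by (simp add: v_def)
  have diff_sum: "(\<Sum>n. ennreal ((norm (y n r - y n s))\<^sup>2)) = L20_sq I lam e (blinfun_apply (\<sigma> r - \<sigma> s))" for r s
  proof -
    have "(norm (y n r - y n s))\<^sup>2 = weight I lam n * (norm ((\<sigma> r - \<sigma> s) (e n)))\<^sup>2" for n
      by (simp add: y_def scaleR_diff_right[symmetric] power_mult_distrib w2 blinfun.diff_left)
    then show ?thesis by (simp add: L20_sq_eq)
  qed
  have Hoe: "(\<Sum>n. ennreal ((norm (y n r - y n s))\<^sup>2)) \<le> ennreal (C5\<^sup>2 * \<bar>r - s\<bar> powr (2 * \<gamma>))"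
    if "r \<in> {0..T}" "s \<in> {0..T}" for r s
    unfolding diff_sum by (rule L20_sq_Hoelder[OF lam \<sigma> Ho that])
  have y_cont: "continuous_on {0..T} (y n)" for n
  proof (rule continuous_on_Hoelder)
    show "0 < \<gamma>" using \<gamma> H by simp
    fix r s assume rs: "r \<in> {0..T}" "s \<in> {0..T}"
    have "ennreal ((norm (y n r - y n s))\<^sup>2) \<le> (\<Sum>n. ennreal ((norm (y n r - y n s))\<^sup>2))"
      by (rule ennreal_le_suminf)
    also have "\<dots> \<le> ennreal (C5\<^sup>2 * \<bar>r - s\<bar> powr (2 * \<gamma>))" by (rule Hoe[OF rs])
    finally have "(norm (y n r - y n s))\<^sup>2 \<le> C5\<^sup>2 * \<bar>r - s\<bar> powr (2 * \<gamma>)"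
      by (rule ennreal_le_iff[THEN iffD1, rotated]) simp
    also have "\<dots> = (\<bar>C5\<bar> * \<bar>r - s\<bar> powr \<gamma>)\<^sup>2"
      by (simp only: power_mult_distrib power2_abs power2_eq_square[of "_ powr _"] powr_add[symmetric] mult_2)
    finally show "norm (y n r - y n s) \<le> \<bar>C5\<bar> * \<bar>r - s\<bar> powr \<gamma>" by (rule power2_le_imp_le) simp
  qed
  have v_meas: "v n \<in> borel_measurable borel" for n
    unfolding v_def[abs_def] by (intro borel_measurable_continuous_on_indicator y_cont) simp
  obtain S where S: "infinitesimal_generator DA A S" using A(2) by (elim exE conjE)
  have Ay_meas: "(\<lambda>s. indicat_real {0..T} s *\<^sub>R A (y n s)) \<in> borel_measurable borel" for n
    by (rule generator_measurable[OF S y_cont yD(1)])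
  have p_meas: "p n \<in> borel_measurable borel" for n
  proof -
    have "p n = (\<lambda>s. norm (indicat_real {0..T} s *\<^sub>R A (y n s)) + norm (v n s))" by (auto simp: p_def)
    moreover have "(\<lambda>s. norm (indicat_real {0..T} s *\<^sub>R A (y n s)) + norm (v n s)) \<in> borel_measurable borel"
      by (intro borel_measurable_add measurable_compose[OF Ay_meas borel_measurable_norm]
          measurable_compose[OF v_meas borel_measurable_norm])
    ultimately show ?thesis by (simp only:)
  qed
  have conv: "convolution T H D \<delta> R (v n) (p n) C" for n
  proof unfold_locales
    show "continuous_on {0..T} (v n)"
      using y_cont[of n] by (rule continuous_on_cong[THEN iffD1, rotated 2]) (auto simp: vy)
    show "norm (R u (v n s) - R w (v n s)) \<le> C * \<bar>u - w\<bar> * p n s"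
      if "s \<in> {0..T}" "u \<in> {0..T}" "w \<in> {0..T}" for s u w
      using Lip[OF yD(1)[OF that(1)] that(2,3), of n] that(1) by (simp add: vy p_def graph_norm_def)
  qed (use v_meas p_meas C in \<open>auto simp: v_def p_def\<close>)
  \<comment> \<open>The power of \<open>T\<close> is the price of lowering the exponent from
    \<gamma> to \<delta>.\<close>
  define E where "E = C5\<^sup>2 * T powr (2 * \<gamma> - 2 * \<delta>)"
  have E0: "0 \<le> E" by (simp add: E_def)
  have E: "(\<Sum>n. ennreal ((norm (v n r - v n s))\<^sup>2)) \<le> ennreal (E * \<bar>r - s\<bar> powr (2 * \<delta>))"
    if r: "r \<in> {0..T}" and s: "s \<in> {0..T}" for r s
  proof -
    have "(\<Sum>n. ennreal ((norm (v n r - v n s))\<^sup>2)) \<le> ennreal (C5\<^sup>2 * \<bar>r - s\<bar> powr (2 * \<gamma>))"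
      unfolding vy[OF r] vy[OF s] by (rule Hoe[OF r s])
    also have "\<dots> \<le> ennreal (E * \<bar>r - s\<bar> powr (2 * \<delta>))"
    proof (rule ennreal_leI)
      have "\<bar>r - s\<bar> powr (2 * \<gamma>) = \<bar>r - s\<bar> powr (2 * \<gamma> - 2 * \<delta>) * \<bar>r - s\<bar> powr (2 * \<delta>)"
        by (simp add: powr_add[symmetric])
      also have "\<dots> \<le> T powr (2 * \<gamma> - 2 * \<delta>) * \<bar>r - s\<bar> powr (2 * \<delta>)"
        using r s \<delta>(3) by (intro mult_right_mono powr_mono2) auto
      finally have "C5\<^sup>2 * \<bar>r - s\<bar> powr (2 * \<gamma>) \<le> C5\<^sup>2 * (T powr (2 * \<gamma> - 2 * \<delta>) * \<bar>r - s\<bar> powr (2 * \<delta>))"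
        by (rule mult_left_mono) simp
      then show "C5\<^sup>2 * \<bar>r - s\<bar> powr (2 * \<gamma>) \<le> E * \<bar>r - s\<bar> powr (2 * \<delta>)" by (simp add: E_def mult.assoc)
    qed
    finally show ?thesis .
  qed
  \<comment> \<open>Obtained by writing \<open>\<sigma> s\<close> as \<open>\<sigma> 0\<close> plus
    an increment, so that the bound is uniform in time.\<close>
  define S0 where "S0 = 2 * enn2real (L20_sq I lam e (\<sigma> 0)) + 2 * (C5\<^sup>2 * T powr (2 * \<gamma>))"
  have S00: "0 \<le> S0" by (simp add: S0_def)
  have v_sum: "(\<Sum>n. ennreal ((norm (v n s))\<^sup>2)) = L20_sq I lam e (\<sigma> s)" if s: "s \<in> {0..T}" for s
    unfolding L20_sq_eq using s by (simp add: vy y_def power_mult_distrib w2)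
  have S0: "(\<Sum>n. ennreal ((norm (v n s))\<^sup>2)) \<le> ennreal S0" if s: "s \<in> {0..T}" for s
  proof -
    have 0: "0 \<in> {0..T}" using T by simp
    have "(\<Sum>n. ennreal ((norm (v n s))\<^sup>2)) = L20_sq I lam e (\<lambda>y. \<sigma> 0 y + (\<sigma> s - \<sigma> 0) y)"
      unfolding v_sum[OF s] by (simp add: blinfun.diff_left)
    also have "\<dots> \<le> 2 * L20_sq I lam e (\<sigma> 0) + 2 * L20_sq I lam e (\<sigma> s - \<sigma> 0)" by (rule L20_sq_add_le[OF lam])
    also have "\<dots> \<le> 2 * ennreal (enn2real (L20_sq I lam e (\<sigma> 0))) + 2 * ennreal (C5\<^sup>2 * T powr (2 * \<gamma>))"
    proof (intro add_mono mult_left_mono)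
      have "L20_sq I lam e (\<sigma> 0) < \<infinity>" using \<sigma> by (simp add: L20_def)
      then show "L20_sq I lam e (\<sigma> 0) \<le> ennreal (enn2real (L20_sq I lam e (\<sigma> 0)))" by simp
      have "\<bar>s - 0\<bar> powr (2 * \<gamma>) \<le> T powr (2 * \<gamma>)" using s \<gamma> H by (intro powr_mono2) auto
      then have "C5\<^sup>2 * \<bar>s - 0\<bar> powr (2 * \<gamma>) \<le> C5\<^sup>2 * T powr (2 * \<gamma>)" by (rule mult_left_mono) simp
      then show "L20_sq I lam e (\<sigma> s - \<sigma> 0) \<le> ennreal (C5\<^sup>2 * T powr (2 * \<gamma>))"
        by (rule order_trans[OF L20_sq_Hoelder[OF lam \<sigma> Ho s 0] ennreal_leI])
    qed auto
    also have "\<dots> = ennreal S0" by (simp add: S0_def ennreal_mult ennreal_plus)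
    finally show ?thesis .
  qed
  have pfin: "(\<integral>\<^sup>+s. (\<Sum>n. ennreal ((p n s)\<^sup>2)) * indicator {0..T} s \<partial>lborel) < \<infinity>"
  proof -
    define X where "X s = (\<Sum>n. ennreal ((norm (indicat_real {0..T} s *\<^sub>R A (y n s)))\<^sup>2))" for s
    have Xm [measurable]: "X \<in> borel_measurable borel"
      unfolding X_def
      by (intro borel_measurable_suminf_order measurable_compose[OF _ measurable_ennreal] borel_measurable_power
          measurable_compose[OF Ay_meas borel_measurable_norm])
    have X_eq: "X s = L20_sq I lam e (\<lambda>y. A (\<sigma> s y))" if s: "s \<in> {0..T}" for s
      unfolding X_def L20_sq_eq using s by (simp add: yD(2) power_mult_distrib w2)
    have "(\<integral>\<^sup>+s. X s * indicator {0..T} s \<partial>lborel) = (\<integral>\<^sup>+s. X s \<partial>lebesgue_on {0..T})"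
      by (rule nn_integral_lebesgue_on_borel[symmetric]) auto
    also have "\<dots> = (\<integral>\<^sup>+s. L20_sq I lam e (\<lambda>y. A (\<sigma> s y)) \<partial>lebesgue_on {0..T})"
      by (rule nn_integral_cong) (simp add: space_restrict_space X_eq)
    finally have Xfin: "(\<integral>\<^sup>+s. X s * indicator {0..T} s \<partial>lborel) < \<infinity>"
      using le_less_trans[OF A\<sigma>, of \<infinity>] by simp
    have px: "(\<Sum>n. ennreal ((p n s)\<^sup>2)) \<le> 2 * X s + 2 * ennreal S0" if s: "s \<in> {0..T}" for s
    proof -
      have "(\<Sum>n. ennreal ((p n s)\<^sup>2)) \<le> (\<Sum>n. 2 * ennreal ((norm (indicat_real {0..T} s *\<^sub>R A (y n s)))\<^sup>2) + 2 * ennreal ((norm (v n s))\<^sup>2))"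
      proof (rule suminf_le)
        fix n
        have "(p n s)\<^sup>2 \<le> 2 * (norm (indicat_real {0..T} s *\<^sub>R A (y n s)))\<^sup>2 + 2 * (norm (v n s))\<^sup>2"
          unfolding p_def using norm_add_sq_le[of "norm (indicat_real {0..T} s *\<^sub>R A (y n s))" "norm (v n s)"] by simp
        then have "ennreal ((p n s)\<^sup>2) \<le> ennreal (2 * (norm (indicat_real {0..T} s *\<^sub>R A (y n s)))\<^sup>2 + 2 * (norm (v n s))\<^sup>2)"
          by (rule ennreal_leI)
        also have "\<dots> = 2 * ennreal ((norm (indicat_real {0..T} s *\<^sub>R A (y n s)))\<^sup>2) + 2 * ennreal ((norm (v n s))\<^sup>2)"
          by (simp only: ennreal_plus ennreal_mult zero_le_power2 zero_le_numeral mult_nonneg_nonneg ennreal_numeral)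
        finally show "ennreal ((p n s)\<^sup>2) \<le> 2 * ennreal ((norm (indicat_real {0..T} s *\<^sub>R A (y n s)))\<^sup>2) + 2 * ennreal ((norm (v n s))\<^sup>2)" .
      qed auto
      also have "\<dots> = 2 * X s + 2 * (\<Sum>n. ennreal ((norm (v n s))\<^sup>2))"
        unfolding X_def by (simp add: suminf_add[symmetric] ennreal_suminf_cmult)
      also have "\<dots> \<le> 2 * X s + 2 * ennreal S0" by (intro add_left_mono mult_left_mono S0 s) simp
      finally show ?thesis .
    qed
    have "(\<integral>\<^sup>+s. (\<Sum>n. ennreal ((p n s)\<^sup>2)) * indicator {0..T} s \<partial>lborel)
      \<le> (\<integral>\<^sup>+s. 2 * (X s * indicator {0..T} s) + (2 * ennreal S0) * indicator {0..T} s \<partial>lborel)"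
    proof (rule nn_integral_mono)
      fix s
      show "(\<Sum>n. ennreal ((p n s)\<^sup>2)) * indicator {0..T} s \<le> 2 * (X s * indicator {0..T} s) + (2 * ennreal S0) * indicator {0..T} s"
      proof (cases "s \<in> {0..T}")
        case True
        from px[OF True] show ?thesis using True by (simp only: indicator_simps mult_1_right)
      next
        case False
        show ?thesis unfolding indicator_simps(2)[OF False] mult_zero_right by simp
      qed
    qed
    also have "\<dots> = 2 * (\<integral>\<^sup>+s. X s * indicator {0..T} s \<partial>lborel) + (2 * ennreal S0) * emeasure lborel {0..T}"
      by (subst nn_integral_add) (simp_all add: nn_integral_cmult nn_integral_cmult_indicator)
    also have "\<dots> < \<infinity>" using Xfin T by (simp add: ennreal_mult_less_top)
    finally show ?thesis .
  qed
  \<comment> \<open>\<open>\<psi>\<close> is the integrand occurring in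
    \<open>has_fbm_integral\<close>; \<open>\<phi>\<close> carries the weight inside, as the
    estimates have it. \<open>K_star_scaleR\<close> translates between the two.\<close>
  define \<psi> where "\<psi> t n r = (R (t - r) o\<^sub>L \<sigma> r) (e n)" for t n r
  define \<phi> where "\<phi> t n r = w n *\<^sub>R \<psi> t n r" for t n r
  interpret fc: fbm_convolution M T H D \<delta> R I \<beta> v p C E S0 \<phi>
  proof (intro fbm_convolution.intro fbm_convolution_axioms.intro)
    show "\<phi> t n r = R (t - r) (v n r)" if "t \<in> {0..T}" "r \<in> {0..t}" for t n r
      using that by (simp add: \<phi>_def \<psi>_def vy y_def blinfun.scaleR_right)
  qed (fact prob_space_axioms ck.convolution_kernel_axioms conv \<delta>(2) bm ind Kinc E0 E S00 S0 pfin)+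
  have K\<phi>: "K_star H t (\<phi> t n) = (\<lambda>s. w n *\<^sub>R K_star H t (\<psi> t n) s)" for t n
    unfolding \<phi>_def by (rule ext) (rule K_star_scaleR)
  obtain J Z where J: "\<And>n t. n \<in> I \<Longrightarrow> t \<in> {0..T} \<Longrightarrow> has_wiener_integral M (\<beta> n) t (K_star H t (\<phi> t n)) (J n t)"
    and Z: "\<And>t. t \<in> {0..T} \<Longrightarrow> (\<lambda>k. \<integral>\<^sup>+\<omega>. ennreal ((norm (Z t \<omega> - (\<Sum>n\<in>I \<inter> {..<k}. J n t \<omega>)))\<^sup>2) \<partial>M) \<longlonglongrightarrow> 0"
    and ZC: "Z \<in> C_L2 M {0..T}" "AE \<omega> in M. Z 0 \<omega> = 0"
    by (rule fc.stochastic_convolution) (rule that)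
  have "has_fbm_integral M H I lam e \<beta> t (\<lambda>s. R (t - s) o\<^sub>L \<sigma> s) (Z t)" if t: "t \<in> {0..T}" for t
    unfolding has_fbm_integral_def \<psi>_def[symmetric]
  proof (intro conjI ballI impI)
    fix n assume n: "n \<in> I" "lam n \<noteq> 0"
    have wn0: "w n \<noteq> 0" using n by (simp add: wn)
    have "AE s in lebesgue_on {0..t}. integrable (lebesgue_on {s..t}) (\<lambda>r. deriv (\<lambda>r. K_H H r s) r *\<^sub>R (\<phi> t n r - \<phi> t n s))"
      by (rule fc.f.K_star_integrable[OF t fc.\<phi>_cf[OF t]])
    then show "AE s in lebesgue_on {0..t}. integrable (lebesgue_on {s..t}) (\<lambda>r. deriv (\<lambda>r. K_H H r s) r *\<^sub>R (\<psi> t n r - \<psi> t n s))"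
    proof eventually_elim
      case (elim s)
      from integrable_scaleR_right[OF this, of "1 / w n"]
      have "integrable (lebesgue_on {s..t}) (\<lambda>r. (1 / w n) *\<^sub>R (deriv (\<lambda>r. K_H H r s) r *\<^sub>R (\<phi> t n r - \<phi> t n s)))" by simp
      \<comment> \<open>Here \<open>lam n \<noteq> 0\<close> is used: integrability is transferred
        by dividing by the weight.\<close>
      moreover have "(1 / w n) *\<^sub>R (deriv (\<lambda>r. K_H H r s) r *\<^sub>R (\<phi> t n r - \<phi> t n s)) = deriv (\<lambda>r. K_H H r s) r *\<^sub>R (\<psi> t n r - \<psi> t n s)" for r
        using wn0 by (simp add: \<phi>_def scaleR_diff_right[symmetric])
      ultimately show ?case by (simp only:)
    qed
  next
    have "(\<Sum>\<^sub>\<infinity>n\<in>I. \<integral>\<^sup>+s. ennreal (lam n * (norm (K_star H t (\<psi> t n) s))\<^sup>2) \<partial>lebesgue_on {0..t})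
       = (\<Sum>n. if n \<in> I then \<integral>\<^sup>+s. ennreal (lam n * (norm (K_star H t (\<psi> t n) s))\<^sup>2) \<partial>lebesgue_on {0..t} else 0)"
      by (rule infsum_ennreal_eq_suminf)
    also have "\<dots> \<le> (\<Sum>n. \<integral>\<^sup>+s. ennreal ((norm (K_star H t (\<phi> t n) s))\<^sup>2) \<partial>lebesgue_on {0..t})"
    proof (rule suminf_le)
      fix n
      have "lam n = (w n)\<^sup>2" if "n \<in> I" using that lam by (simp add: wn)
      then show "(if n \<in> I then \<integral>\<^sup>+s. ennreal (lam n * (norm (K_star H t (\<psi> t n) s))\<^sup>2) \<partial>lebesgue_on {0..t} else 0)
        \<le> (\<integral>\<^sup>+s. ennreal ((norm (K_star H t (\<phi> t n) s))\<^sup>2) \<partial>lebesgue_on {0..t})"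
        by (simp add: K\<phi> power_mult_distrib)
    qed auto
    also have "\<dots> < \<infinity>" by (rule fc.K_star_sum_finite[OF t])
    finally show "(\<Sum>\<^sub>\<infinity>n\<in>I. \<integral>\<^sup>+s. ennreal (lam n * (norm (K_star H t (\<psi> t n) s))\<^sup>2) \<partial>lebesgue_on {0..t}) < \<infinity>" .
    show "Z t \<in> L2 M" by (rule C_L2_D[OF ZC(1) t])
    have "has_wiener_integral M (\<beta> n) t (\<lambda>s. sqrt (lam n) *\<^sub>R K_star H t (\<psi> t n) s) (J n t)" if "n \<in> I" for n
      using J[OF that t] unfolding K\<phi> wn[OF that] .
    then show "\<exists>J. (\<forall>n\<in>I. has_wiener_integral M (\<beta> n) t (\<lambda>s. sqrt (lam n) *\<^sub>R K_star H t (\<psi> t n) s) (J n)) \<and>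
        (\<lambda>k. \<integral>\<^sup>+\<omega>. ennreal ((norm (Z t \<omega> - (\<Sum>n\<in>I \<inter> {..<k}. J n \<omega>)))\<^sup>2) \<partial>M) \<longlonglongrightarrow> 0"
      using Z[OF t] by (intro exI[of _ "\<lambda>n. J n t"]) simp
  qed
  then show ?thesis using ZC by blast
qed

section \<open>Integrating along strongly continuous operator families\<close>

text \<open>Clamping the time to \<open>{0..T}\<close> makes the evaluation map continuous on all of
  the product space, hence Borel, although \<open>R\<close> is only strongly continuous.\<close>

lemma strong_measurable:
  fixes R :: "real \<Rightarrow> 'x::{banach,second_countable_topology} \<Rightarrow>\<^sub>L 'y::{banach,second_countable_topology}"
  assumes T: "0 \<le> T" and RD: "\<And>t. t \<in> {0..T} \<Longrightarrow> norm (R t) \<le> D"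
    and Rc: "\<And>x. continuous_on {0..} (\<lambda>t. R t x)"
    and a: "\<alpha> \<in> borel_measurable N" and y: "y \<in> borel_measurable N"
  shows "(\<lambda>z. R (max 0 (min T (\<alpha> z))) (y z)) \<in> borel_measurable N"
proof -
  have "continuous_on UNIV (\<lambda>p :: real \<times> 'x. R (max 0 (min T (fst p))) (snd p))"
    by (rule continuous_on_strong[OF RD Rc]) (use T in \<open>auto intro!: continuous_intros\<close>)
  then have m: "(\<lambda>p :: real \<times> 'x. R (max 0 (min T (fst p))) (snd p)) \<in> borel_measurable (borel \<Otimes>\<^sub>M borel)"
    unfolding borel_prod by (rule borel_measurable_continuous_onI)
  have "(\<lambda>z. (\<alpha> z, y z)) \<in> measurable N (borel \<Otimes>\<^sub>M borel)" by (rule measurable_Pair[OF a y])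
  from measurable_compose[OF this m] show ?thesis by simp
qed

lemma L2_finite_integrable:
  fixes f :: "'a \<Rightarrow> 'b::{banach, second_countable_topology}"
  assumes M: "finite_measure M" and f: "f \<in> L2 M"
  shows "integrable M f" "norm (\<integral>x. f x \<partial>M) \<le> sqrt (measure M (space M)) * L2_norm M f"
proof -
  interpret finite_measure M by (rule M)
  have one: "(\<lambda>x. 1 :: real) \<in> L2 M" by (simp add: L2_def)
  have one_norm: "L2_norm M (\<lambda>x. 1 :: real) = sqrt (measure M (space M))" by (simp add: L2_norm_def)
  have n: "integrable M (\<lambda>x. norm (f x))" using L2_integrable_mult[OF f one] by simp
  show "integrable M f" using L2_measurable[OF f] n by (rule integrable_norm_cancel[rotated])
  have "norm (\<integral>x. f x \<partial>M) \<le> (\<integral>x. norm (f x) * norm (1 :: real) \<partial>M)" using integral_norm_bound[of M f] by simp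
  also have "\<dots> \<le> L2_norm M f * L2_norm M (\<lambda>x. 1 :: real)" by (rule L2_Cauchy_Schwarz[OF f one])
  finally show "norm (\<integral>x. f x \<partial>M) \<le> sqrt (measure M (space M)) * L2_norm M f"
    by (simp add: one_norm mult.commute)
qed

locale bounded_family =
  fixes T D :: real and R :: "real \<Rightarrow> 'x::{real_inner,banach,second_countable_topology} \<Rightarrow>\<^sub>L 'x"
  assumes T: "0 < T" and D: "0 \<le> D"
    and RD: "\<And>t. t \<in> {0..T} \<Longrightarrow> norm (R t) \<le> D"
    and Rc: "\<And>x. continuous_on {0..} (\<lambda>t. R t x)"
begin

abbreviation "LL \<equiv> lebesgue_on {0..T}"

lemma RDx: "t \<in> {0..T} \<Longrightarrow> norm (R t x) \<le> D * norm x"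
  using norm_blinfun[of "R t" x] mult_right_mono[OF RD[of t], of "norm x"] by simp

lemma measure_LL: "measure LL (space LL) = T"
  using T by (simp add: measure_restrict_space space_restrict_space)

lemma LL_id_measurable: "(\<lambda>s. s) \<in> borel_measurable LL"
  by (rule borel_measurable_lebesgue_onI) simp

lemma R_measurable:
  assumes t: "t \<in> {0..T}" and y: "y \<in> borel_measurable (lebesgue_on {0..t})"
  shows "(\<lambda>s. R (t - s) (y s)) \<in> borel_measurable (lebesgue_on {0..t})"
proof -
  have T0: "0 \<le> T" using T by simp
  have "(\<lambda>s. t - s) \<in> borel_measurable (lebesgue_on {0..t})" by (rule borel_measurable_lebesgue_onI) simp
  from strong_measurable[OF T0 RD Rc this y]
  have "(\<lambda>s. R (max 0 (min T (t - s))) (y s)) \<in> borel_measurable (lebesgue_on {0..t})" .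
  then show ?thesis
    by (rule measurable_cong[THEN iffD1, rotated]) (use t in \<open>simp add: space_restrict_space max_absorb2 min_absorb2\<close>)
qed

lemma R_L2:
  assumes t: "t \<in> {0..T}" and y: "y \<in> L2 (lebesgue_on {0..t})"
  shows "(\<lambda>s. R (t - s) (y s)) \<in> L2 (lebesgue_on {0..t})"
proof (rule L2_bound(1)[OF y R_measurable[OF t L2_measurable[OF y]] _ D], rule AE_I2)
  fix s assume "s \<in> space (lebesgue_on {0..t})"
  then show "norm (R (t - s) (y s)) \<le> D * norm (y s)"
    using t by (intro RDx) (auto simp: space_restrict_space)
qed

end

section \<open>The control\<close>

locale control = bounded_family T D R
  for T D and R :: "real \<Rightarrow> 'x::{real_inner,banach,second_countable_topology} \<Rightarrow>\<^sub>L 'x" +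
  fixes L :: "'u::{real_inner,banach,second_countable_topology} \<Rightarrow>\<^sub>L 'x" and Winv :: "'x \<Rightarrow> real \<Rightarrow> 'u" and M_W :: real
  assumes inv: "inverse_of_W T R L Winv" and MW: "0 < M_W"
    and Wb: "\<forall>x. L2_norm (lebesgue_on {0..T}) (Winv x) \<le> M_W * norm x"
begin

lemma L_L2: "u \<in> L2 N \<Longrightarrow> (\<lambda>s. L (u s)) \<in> L2 N"
proof (rule L2_bound(1)[of u])
  assume u: "u \<in> L2 N"
  have "continuous_on UNIV (blinfun_apply L)" by (intro continuous_intros)
  then show "(\<lambda>s. L (u s)) \<in> borel_measurable N"
    by (intro measurable_compose[OF L2_measurable[OF u]] borel_measurable_continuous_onI)
  show "AE s in N. norm (L (u s)) \<le> norm L * norm (u s)" by (intro AE_I2 norm_blinfun)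
qed auto

lemma W_integrable: "u \<in> L2 LL \<Longrightarrow> integrable LL (\<lambda>s. R (T - s) (L (u s)))"
  using T by (intro L2_finite_integrable(1) finite_measure_lebesgue_on R_L2 L_L2) auto

lemma Winv_L2: "Winv x \<in> L2 LL"
  using inv by (simp add: inverse_of_W_def ker_W_perp_def)

lemma W_Winv: "W_op T R L (Winv x) = x"
  using inv by (simp add: inverse_of_W_def)

text \<open>Linearity of \<open>Winv\<close> is derived: the difference of two of its values lies
  again in the orthogonal complement of the kernel and is mapped by \<open>W_op\<close> to
  \<open>x - y\<close>, and on this complement \<open>Winv\<close> inverts \<open>W_op\<close> up to
  null sets.\<close>

lemma Winv_diff: "AE s in LL. Winv (x - y) s = Winv x s - Winv y s"
proof -
  have perp: "Winv x \<in> ker_W_perp T R L" for x using inv by (simp add: inverse_of_W_def)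
  have kL: "w \<in> L2 LL" if "w \<in> ker_W T R L" for w using that by (simp add: ker_W_def)
  have d: "(\<lambda>s. Winv x s - Winv y s) \<in> ker_W_perp T R L"
    unfolding ker_W_perp_def
  proof (intro CollectI conjI ballI L2_diff Winv_L2)
    fix w assume w: "w \<in> ker_W T R L"
    have "L2_inner LL (Winv x) w = 0" "L2_inner LL (Winv y) w = 0"
      using perp w by (auto simp: ker_W_perp_def)
    then show "L2_inner LL (\<lambda>s. Winv x s - Winv y s) w = 0"
      by (simp add: L2_inner_diff_left[OF Winv_L2 Winv_L2 kL[OF w]])
  qed
  have "W_op T R L (\<lambda>s. Winv x s - Winv y s) = W_op T R L (Winv x) - W_op T R L (Winv y)"
    unfolding W_op_def by (simp add: blinfun.diff_right Bochner_Integration.integral_diff W_integrable Winv_L2)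
  then have e: "W_op T R L (\<lambda>s. Winv x s - Winv y s) = x - y" by (simp add: W_Winv)
  have "\<forall>u\<in>ker_W_perp T R L. AE s in LL. Winv (W_op T R L u) s = u s"
    using inv unfolding inverse_of_W_def by (rule conjunct2)
  from bspec[OF this d] show ?thesis unfolding e .
qed

lemma Winv_dist: "L2_norm LL (\<lambda>s. Winv x s - Winv y s) \<le> M_W * norm (x - y)"
proof -
  have "L2_norm LL (\<lambda>s. Winv x s - Winv y s) = L2_norm LL (Winv (x - y))"
  proof (rule L2_cong_AE(2)[OF Winv_L2])
    show "(\<lambda>s. Winv x s - Winv y s) \<in> borel_measurable LL" by (intro L2_measurable L2_diff Winv_L2)
    show "AE s in LL. Winv x s - Winv y s = Winv (x - y) s" using Winv_diff[of x y] by eventually_elim simp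
  qed
  then show ?thesis using Wb by simp
qed

text \<open>Controls must be jointly measurable for the Borel sets of the time interval, whereas
  elements of \<open>L2 LL\<close> are only Lebesgue measurable; step functions provide nearby Borel
  representatives.\<close>

lemma step_approximation:
  assumes h: "h \<in> L2 LL" and e: "0 < \<epsilon>"
  shows "\<exists>g. g \<in> borel_measurable borel \<and> g \<in> L2 LL \<and> L2_norm LL (\<lambda>s. h s - g s) < \<epsilon>"
proof -
  have "\<forall>\<epsilon>>0. \<exists>N>0. \<forall>m\<ge>N. \<exists>c. L2_norm LL (\<lambda>s. h s - step_function m (\<lambda>i. T * real i / real m) c s) < \<epsilon>"
    using grid_approximable_L2[OF T h] by (simp add: grid_approximable_def)
  then have "\<exists>N>0. \<forall>m\<ge>N. \<exists>c. L2_norm LL (\<lambda>s. h s - step_function m (\<lambda>i. T * real i / real m) c s) < \<epsilon>"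
    using e by simp
  then obtain m c where *: "L2_norm LL (\<lambda>s. h s - step_function m (\<lambda>i. T * real i / real m) c s) < \<epsilon>" by blast
  show ?thesis
  proof (intro exI conjI)
    show "step_function m (\<lambda>i. T * real i / real m) c \<in> borel_measurable borel"
      unfolding step_function_def[abs_def] by measurable
  qed (rule step_function_L2, rule *)
qed

text \<open>A random target is approximated by countably many values, and for each of these the
  equivalence class of the control by a step function; this selects the representatives of
  \<open>Winv (\<xi> \<omega>)\<close> in a jointly measurable way.\<close>

lemma control_exists:
  assumes \<xi> [measurable]: "\<xi> \<in> borel_measurable M"
  shows "\<exists>u. stochastic_control M T u \<and> (\<forall>\<omega>\<in>space M. AE s in LL. u s \<omega> = Winv (\<xi> \<omega>) s)"
proof -
  obtain E :: "'x set" where E: "countable E" "\<And>X. open X \<Longrightarrow> X \<noteq> {} \<Longrightarrow> \<exists>d\<in>E. d \<in> X"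
    by (rule countable_dense_setE) blast
  have "E \<noteq> {}" using E(2)[of UNIV] by auto
  define d where "d = from_nat_into E"
  have dE: "range d = E" unfolding d_def by (rule range_from_nat_into[OF \<open>E \<noteq> {}\<close> E(1)])
  \<comment> \<open>Multiplied by the Lipschitz constant \<open>M_W\<close> this gives (1/2)^(k+2),
    the same error as that of the step function.\<close>
  define \<eta> where "\<eta> k = (1/2) ^ Suc (Suc k) / M_W" for k :: nat
  have \<eta>: "0 < \<eta> k" for k using MW by (simp add: \<eta>_def)
  have dense: "\<exists>i. dist (d i) x < \<eta> k" for x k
  proof -
    have "\<exists>z\<in>E. z \<in> ball x (\<eta> k)" using E(2)[of "ball x (\<eta> k)"] \<eta>[of k] by auto
    then obtain z where z: "z \<in> E" "dist x z < \<eta> k" by auto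
    then obtain i where "z = d i" using dE by auto
    then show ?thesis using z by (auto simp: dist_commute)
  qed
  \<comment> \<open>Taking the least index makes the choice of the approximating target
    measurable.\<close>
  define j where "j k \<omega> = (LEAST i. dist (d i) (\<xi> \<omega>) < \<eta> k)" for k \<omega>
  have j: "dist (d (j k \<omega>)) (\<xi> \<omega>) < \<eta> k" for k \<omega>
    unfolding j_def by (rule LeastI_ex[OF dense])
  have jm: "j k \<in> measurable M (count_space UNIV)" for k
    unfolding j_def[abs_def] by (rule measurable_Least) measurable
  have "\<forall>p. \<exists>g. g \<in> borel_measurable borel \<and> g \<in> L2 LL \<and> L2_norm LL (\<lambda>s. Winv (d (snd p)) s - g s) < (1/2) ^ Suc (Suc (fst p))"
    by (intro allI step_approximation Winv_L2) simp
  from choice[OF this] obtain G where G0: "\<forall>p. G p \<in> borel_measurable borel \<and> G p \<in> L2 LL \<and>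
      L2_norm LL (\<lambda>s. Winv (d (snd p)) s - G p s) < (1/2) ^ Suc (Suc (fst p))"
    by (elim exE)
  define g where "g k i = G (k, i)" for k i
  have g: "g k i \<in> borel_measurable borel" "g k i \<in> L2 LL" "L2_norm LL (\<lambda>s. Winv (d i) s - g k i s) < (1/2) ^ Suc (Suc k)" for k i
    using G0[rule_format, of "(k, i)"] by (simp_all add: g_def)
  define U where "U k s \<omega> = g k (j k \<omega>) s" for k s \<omega>
  have UL: "(\<lambda>s. U k s \<omega>) \<in> L2 LL" for k \<omega> unfolding U_def by (rule g(2))
  have UW: "L2_norm LL (\<lambda>s. U k s \<omega> - Winv (\<xi> \<omega>) s) \<le> (1/2) ^ Suc k" for k \<omega>
  proof -
    have "L2_norm LL (\<lambda>s. U k s \<omega> - Winv (\<xi> \<omega>) s)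
      \<le> L2_norm LL (\<lambda>s. U k s \<omega> - Winv (d (j k \<omega>)) s) + L2_norm LL (\<lambda>s. Winv (d (j k \<omega>)) s - Winv (\<xi> \<omega>) s)"
      by (rule L2_norm_dist_triangle[OF UL Winv_L2 Winv_L2])
    also have "\<dots> \<le> (1/2) ^ Suc (Suc k) + (1/2) ^ Suc (Suc k)"
    proof (rule add_mono)
      show "L2_norm LL (\<lambda>s. U k s \<omega> - Winv (d (j k \<omega>)) s) \<le> (1/2) ^ Suc (Suc k)"
        using g(3)[of "j k \<omega>" k] unfolding U_def by (subst L2_norm_minus_commute) simp
      have "L2_norm LL (\<lambda>s. Winv (d (j k \<omega>)) s - Winv (\<xi> \<omega>) s) \<le> M_W * dist (d (j k \<omega>)) (\<xi> \<omega>)"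
        unfolding dist_norm by (rule Winv_dist)
      also have "\<dots> \<le> M_W * \<eta> k" using j[of k \<omega>] MW by (intro mult_left_mono) auto
      also have "\<dots> = (1/2) ^ Suc (Suc k)" using MW by (simp add: \<eta>_def)
      finally show "L2_norm LL (\<lambda>s. Winv (d (j k \<omega>)) s - Winv (\<xi> \<omega>) s) \<le> (1/2) ^ Suc (Suc k)" .
    qed
    also have "\<dots> = (1/2) ^ Suc k" by simp
    finally show ?thesis .
  qed
  have st: "L2_norm LL (\<lambda>s. U (Suc k) s \<omega> - U k s \<omega>) \<le> (1/2) ^ k" for k \<omega>
  proof -
    have "L2_norm LL (\<lambda>s. U (Suc k) s \<omega> - U k s \<omega>)
      \<le> L2_norm LL (\<lambda>s. U (Suc k) s \<omega> - Winv (\<xi> \<omega>) s) + L2_norm LL (\<lambda>s. Winv (\<xi> \<omega>) s - U k s \<omega>)"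
      by (rule L2_norm_dist_triangle[OF UL Winv_L2 UL])
    also have "\<dots> \<le> (1/2) ^ Suc (Suc k) + (1/2) ^ Suc k"
      using UW[of "Suc k" \<omega>] UW[of k \<omega>] L2_norm_minus_commute[of LL "Winv (\<xi> \<omega>)" "\<lambda>s. U k s \<omega>"] by linarith
    also have "\<dots> \<le> (1/2) ^ k" by simp
    finally show ?thesis .
  qed
  have idm: "(\<lambda>t. t) \<in> borel_measurable (restrict_space borel {0..T})"
    by (rule measurable_restrict_space1) simp
  have Um: "(\<lambda>q. U k (fst q) (snd q)) \<in> borel_measurable (restrict_space borel {0..T} \<Otimes>\<^sub>M M)" for k
    unfolding U_def
  proof (rule measurable_compose_countable[of "\<lambda>i q. g k i (fst q)"])
    show "(\<lambda>q. g k i (fst q)) \<in> borel_measurable (restrict_space borel {0..T} \<Otimes>\<^sub>M M)" for i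
      by (rule measurable_compose[OF measurable_compose[OF measurable_fst idm] g(1)])
    show "(\<lambda>q. j k (snd q)) \<in> measurable (restrict_space borel {0..T} \<Otimes>\<^sub>M M) (count_space UNIV)"
      by (rule measurable_compose[OF measurable_snd jm])
  qed
  define u where "u s \<omega> = lim (\<lambda>k. U k s \<omega>)" for s \<omega>
  have um: "measurable_process M {0..T} u"
    unfolding measurable_process_def u_def case_prod_beta' by (rule borel_measurable_lim_metric[OF Um])
  have uW: "(\<lambda>s. u s \<omega>) \<in> L2 LL \<and> (AE s in LL. u s \<omega> = Winv (\<xi> \<omega>) s)" for \<omega>
  proof -
    have fin: "finite_measure LL" by (rule finite_measure_lebesgue_on)
    have uL: "(\<lambda>s. u s \<omega>) \<in> borel_measurable LL"
      unfolding u_def by (rule borel_measurable_lim_metric) (rule L2_measurable[OF UL])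
    have lim: "AE s in LL. (\<lambda>k. U k s \<omega>) \<longlonglongrightarrow> u s \<omega>"
      using L2_geometric_convergent[OF fin UL[of _ \<omega>] st[of _ \<omega>]] unfolding u_def
      by eventually_elim (simp add: convergent_LIMSEQ_iff)
    note L = L2_geometric_limit[OF fin UL[of _ \<omega>] st[of _ \<omega>] lim uL]
    have "L2_norm LL (\<lambda>s. u s \<omega> - Winv (\<xi> \<omega>) s) \<le> 3 * (1/2) ^ k" for k
    proof -
      have "L2_norm LL (\<lambda>s. u s \<omega> - Winv (\<xi> \<omega>) s)
        \<le> L2_norm LL (\<lambda>s. u s \<omega> - U k s \<omega>) + L2_norm LL (\<lambda>s. U k s \<omega> - Winv (\<xi> \<omega>) s)"
        by (rule L2_norm_dist_triangle[OF L(1) UL Winv_L2])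
      also have "\<dots> \<le> 2 * (1/2) ^ k + (1/2) ^ Suc k"
        using L(2)[of k] UW[of k \<omega>] L2_norm_minus_commute[of LL "\<lambda>s. u s \<omega>" "\<lambda>s. U k s \<omega>"] by linarith
      also have "\<dots> \<le> 3 * (1/2) ^ k" by simp
      finally show ?thesis .
    qed
    moreover have "(\<lambda>k. 3 * (1/2 :: real) ^ k) \<longlonglongrightarrow> 0"
      by (intro tendsto_mult_right_zero LIMSEQ_power_zero) simp
    ultimately have "L2_norm LL (\<lambda>s. u s \<omega> - Winv (\<xi> \<omega>) s) \<le> 0"
      by (intro tendsto_lowerbound[of "\<lambda>k. 3 * (1/2 :: real) ^ k" _ sequentially]) auto
    then have "L2_norm LL (\<lambda>s. u s \<omega> - Winv (\<xi> \<omega>) s) = 0"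
      using L2_norm_nonneg[of LL "\<lambda>s. u s \<omega> - Winv (\<xi> \<omega>) s"] by linarith
    from L2_norm_eq_0_AE[OF L2_diff[OF L(1) Winv_L2] this] L(1) show ?thesis by simp
  qed
  show ?thesis
    by (rule exI[of _ u]) (use um uW in \<open>simp add: stochastic_control_def\<close>)
qed

end

section \<open>The drift convolution\<close>

locale drift = bounded_family T D R + prob_space M
  for T D and R :: "real \<Rightarrow> 'x::{real_inner,banach,second_countable_topology} \<Rightarrow>\<^sub>L 'x" and M :: "'w measure"
begin

abbreviation "N \<equiv> LL \<Otimes>\<^sub>M M"

interpretation LL: finite_measure LL by (rule finite_measure_lebesgue_on)
interpretation P: pair_sigma_finite LL M ..

lemma section_nn:
  assumes Y: "Y \<in> L2 N"
  shows "(\<integral>\<^sup>+\<omega>. (\<integral>\<^sup>+s. ennreal ((norm (Y (s, \<omega>)))\<^sup>2) \<partial>LL) \<partial>M) = ennreal ((L2_norm N Y)\<^sup>2)"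
proof -
  have "(\<lambda>z. ennreal ((norm (Y z))\<^sup>2)) \<in> borel_measurable N" using L2_measurable[OF Y] by measurable
  from P.nn_integral_snd[OF this] show ?thesis by (simp add: nn_integral_L2_norm[OF Y])
qed

lemma section_nn_measurable:
  assumes Y: "Y \<in> borel_measurable N"
  shows "(\<lambda>\<omega>. \<integral>\<^sup>+s. ennreal ((norm (Y (s, \<omega>)))\<^sup>2) \<partial>LL) \<in> borel_measurable M"
proof -
  have m: "(\<lambda>z. Y (snd z, fst z)) \<in> borel_measurable (M \<Otimes>\<^sub>M LL)"
    by (rule measurable_compose[OF _ Y]) measurable
  have "(\<lambda>z. ennreal ((norm (Y (snd z, fst z)))\<^sup>2)) \<in> borel_measurable (M \<Otimes>\<^sub>M LL)"
    using m by measurable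
  from LL.borel_measurable_nn_integral_fst[OF this] show ?thesis by simp
qed

lemma section_L2:
  assumes Y: "Y \<in> L2 N"
  shows "AE \<omega> in M. (\<lambda>s. Y (s, \<omega>)) \<in> L2 LL"
proof -
  have "AE \<omega> in M. (\<integral>\<^sup>+s. ennreal ((norm (Y (s, \<omega>)))\<^sup>2) \<partial>LL) \<noteq> \<infinity>"
    by (rule nn_integral_noteq_infinite[OF section_nn_measurable[OF L2_measurable[OF Y]]]) (simp add: section_nn[OF Y])
  moreover have "AE \<omega> in M. \<omega> \<in> space M" by simp
  ultimately show ?thesis
  proof eventually_elim
    case (elim \<omega>)
    have "(\<lambda>s. Y (s, \<omega>)) \<in> borel_measurable LL"
      by (rule measurable_compose[OF _ L2_measurable[OF Y]]) (use elim in measurable)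
    then show ?case using elim by (simp add: L2_iff less_top)
  qed
qed

text \<open>Cauchy-Schwarz in time along almost every path, then integration over the paths; the
  length of the interval enters through \<open>sqrt T\<close>.\<close>

lemma section_integral:
  fixes Y :: "real \<times> 'w \<Rightarrow> 'x"
  assumes Y: "Y \<in> L2 N"
  shows "(\<lambda>\<omega>. \<integral>s. Y (s, \<omega>) \<partial>LL) \<in> L2 M" "L2_norm M (\<lambda>\<omega>. \<integral>s. Y (s, \<omega>) \<partial>LL) \<le> sqrt T * L2_norm N Y"
proof -
  have m: "(\<lambda>z. Y (snd z, fst z)) \<in> borel_measurable (M \<Otimes>\<^sub>M LL)"
    by (rule measurable_compose[OF _ L2_measurable[OF Y]]) measurable
  then have m': "case_prod (\<lambda>\<omega> s. Y (s, \<omega>)) \<in> borel_measurable (M \<Otimes>\<^sub>M LL)" by (simp add: case_prod_beta')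
  have M1: "(\<lambda>\<omega>. \<integral>s. Y (s, \<omega>) \<partial>LL) \<in> borel_measurable M"
    by (rule LL.borel_measurable_lebesgue_integral[OF m'])
  have "(\<integral>\<^sup>+\<omega>. ennreal ((norm (\<integral>s. Y (s, \<omega>) \<partial>LL))\<^sup>2) \<partial>M) \<le> (\<integral>\<^sup>+\<omega>. ennreal T * (\<integral>\<^sup>+s. ennreal ((norm (Y (s, \<omega>)))\<^sup>2) \<partial>LL) \<partial>M)"
  proof (rule nn_integral_mono_AE)
    show "AE \<omega> in M. ennreal ((norm (\<integral>s. Y (s, \<omega>) \<partial>LL))\<^sup>2) \<le> ennreal T * (\<integral>\<^sup>+s. ennreal ((norm (Y (s, \<omega>)))\<^sup>2) \<partial>LL)"
      using section_L2[OF Y]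
    proof eventually_elim
      case (elim \<omega>)
      have "norm (\<integral>s. Y (s, \<omega>) \<partial>LL) \<le> sqrt T * L2_norm LL (\<lambda>s. Y (s, \<omega>))"
        using L2_finite_integrable(2)[OF LL.finite_measure_axioms elim] by (simp only: measure_LL)
      then have "(norm (\<integral>s. Y (s, \<omega>) \<partial>LL))\<^sup>2 \<le> (sqrt T * L2_norm LL (\<lambda>s. Y (s, \<omega>)))\<^sup>2" by (rule power_mono) simp
      also have "\<dots> = T * (L2_norm LL (\<lambda>s. Y (s, \<omega>)))\<^sup>2" using T by (simp add: power_mult_distrib)
      finally have "ennreal ((norm (\<integral>s. Y (s, \<omega>) \<partial>LL))\<^sup>2) \<le> ennreal (T * (L2_norm LL (\<lambda>s. Y (s, \<omega>)))\<^sup>2)" by (rule ennreal_leI)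
      also have "\<dots> = ennreal T * (\<integral>\<^sup>+s. ennreal ((norm (Y (s, \<omega>)))\<^sup>2) \<partial>LL)"
        unfolding nn_integral_L2_norm[OF elim] using T by (intro ennreal_mult) auto
      finally show ?case .
    qed
  qed
  also have "\<dots> = ennreal T * ennreal ((L2_norm N Y)\<^sup>2)"
    unfolding section_nn[OF Y, symmetric] by (rule nn_integral_cmult[OF section_nn_measurable[OF L2_measurable[OF Y]]])
  also have "\<dots> = ennreal ((sqrt T * L2_norm N Y)\<^sup>2)"
    using T by (simp add: power_mult_distrib ennreal_mult)
  finally show "(\<lambda>\<omega>. \<integral>s. Y (s, \<omega>) \<partial>LL) \<in> L2 M" "L2_norm M (\<lambda>\<omega>. \<integral>s. Y (s, \<omega>) \<partial>LL) \<le> sqrt T * L2_norm N Y"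
    using L2_le_nn[OF M1, of "sqrt T * L2_norm N Y"] T by simp_all
qed

lemma L2_N_le:
  assumes Y: "Y \<in> borel_measurable N" and B: "0 \<le> B"
    and le: "\<And>s. s \<in> {0..T} \<Longrightarrow> (\<lambda>\<omega>. Y (s, \<omega>)) \<in> L2 M \<and> L2_norm M (\<lambda>\<omega>. Y (s, \<omega>)) \<le> B"
  shows "Y \<in> L2 N" "L2_norm N Y \<le> sqrt T * B"
proof -
  have m: "(\<lambda>z. ennreal ((norm (Y z))\<^sup>2)) \<in> borel_measurable N" using Y by measurable
  have "(\<integral>\<^sup>+z. ennreal ((norm (Y z))\<^sup>2) \<partial>N) = (\<integral>\<^sup>+s. (\<integral>\<^sup>+\<omega>. ennreal ((norm (Y (s, \<omega>)))\<^sup>2) \<partial>M) \<partial>LL)"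
    by (rule nn_integral_fst[OF m, symmetric])
  also have "\<dots> \<le> (\<integral>\<^sup>+s. ennreal (B\<^sup>2) \<partial>LL)"
  proof (rule nn_integral_mono)
    fix s assume "s \<in> space LL"
    then have s: "s \<in> {0..T}" by (simp add: space_restrict_space)
    have "(\<integral>\<^sup>+\<omega>. ennreal ((norm (Y (s, \<omega>)))\<^sup>2) \<partial>M) = ennreal ((L2_norm M (\<lambda>\<omega>. Y (s, \<omega>)))\<^sup>2)"
      using le[OF s] by (intro nn_integral_L2_norm) simp
    also have "\<dots> \<le> ennreal (B\<^sup>2)" using le[OF s] by (intro ennreal_leI power_mono) auto
    finally show "(\<integral>\<^sup>+\<omega>. ennreal ((norm (Y (s, \<omega>)))\<^sup>2) \<partial>M) \<le> ennreal (B\<^sup>2)" .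
  qed
  also have "\<dots> = ennreal (B\<^sup>2) * ennreal T"
    using measure_LL by (simp add: LL.emeasure_eq_measure)
  also have "\<dots> = ennreal ((sqrt T * B)\<^sup>2)" using T by (simp add: power_mult_distrib ennreal_mult mult.commute)
  finally show "Y \<in> L2 N" "L2_norm N Y \<le> sqrt T * B"
    using L2_le_nn[OF Y, of "sqrt T * B"] T B by simp_all
qed

lemma measurable_process_N:
  assumes "measurable_process M {0..T} x"
  shows "(\<lambda>z. x (fst z) (snd z)) \<in> borel_measurable N"
proof -
  have "(\<lambda>s. s) \<in> measurable LL (restrict_space borel {0..T})"
    by (rule measurable_restrict_space2) (auto simp: space_restrict_space intro: LL_id_measurable)
  then have "(\<lambda>z. (fst z, snd z)) \<in> measurable N (restrict_space borel {0..T} \<Otimes>\<^sub>M M)"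
    by (intro measurable_Pair measurable_compose[OF measurable_fst] measurable_snd)
  from measurable_compose[OF this assms[unfolded measurable_process_def]] show ?thesis by simp
qed

definition V :: "(real \<Rightarrow> 'w \<Rightarrow> 'x) \<Rightarrow> real \<Rightarrow> 'w \<Rightarrow> 'x" where
  "V F t \<omega> = (\<integral>s. R (t - s) (F s \<omega>) \<partial>lebesgue_on {0..t})"

text \<open>The integrand of \<open>V F t\<close>, set to zero after \<open>t\<close>. In this form
  the integrals for all \<open>t\<close> run over one interval and can be compared in the product
  space.\<close>

definition cut :: "(real \<Rightarrow> 'w \<Rightarrow> 'x) \<Rightarrow> real \<Rightarrow> real \<times> 'w \<Rightarrow> 'x" where
  "cut F t z = indicat_real {0..t} (fst z) *\<^sub>R R (max 0 (min T (t - fst z))) (F (fst z) (snd z))"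

lemma cut_eq: "t \<in> {0..T} \<Longrightarrow> indicat_real {0..t} s *\<^sub>R R (t - s) (F s \<omega>) = cut F t (s, \<omega>)"
  by (auto simp: cut_def indicator_def max_absorb2 min_absorb2)

lemma V_eq: "t \<in> {0..T} \<Longrightarrow> V F t \<omega> = (\<integral>s. cut F t (s, \<omega>) \<partial>LL)"
proof -
  assume t: "t \<in> {0..T}"
  have "V F t \<omega> = (\<integral>s. cut F t (s, \<omega>) \<partial>lebesgue)"
    unfolding V_def by (subst integral_restrict_space) (simp_all add: cut_eq[OF t])
  moreover have "(\<integral>s. cut F t (s, \<omega>) \<partial>LL) = (\<integral>s. indicat_real {0..T} s *\<^sub>R cut F t (s, \<omega>) \<partial>lebesgue)"
    by (rule integral_restrict_space) simp
  moreover have "indicat_real {0..T} s *\<^sub>R cut F t (s, \<omega>) = cut F t (s, \<omega>)" for s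
    using t by (auto simp: cut_def indicator_def)
  ultimately show ?thesis by simp
qed

lemma cut_L2:
  assumes F: "(\<lambda>z. F (fst z) (snd z)) \<in> L2 N"
  shows "cut F t \<in> L2 N" "L2_norm N (cut F t) \<le> D * L2_norm N (\<lambda>z. F (fst z) (snd z))"
proof -
  have T0: "0 \<le> T" using T by simp
  have fm: "(\<lambda>z. fst z) \<in> borel_measurable N" by (rule measurable_compose[OF measurable_fst LL_id_measurable])
  have "(\<lambda>z. t - fst z) \<in> borel_measurable N" using fm by (intro borel_measurable_diff) auto
  from strong_measurable[OF T0 RD Rc this L2_measurable[OF F]]
  have 1: "(\<lambda>z. R (max 0 (min T (t - fst z))) (F (fst z) (snd z))) \<in> borel_measurable N" .
  have "(\<lambda>z. indicat_real {0..t} (fst z)) \<in> borel_measurable N"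
    by (rule measurable_compose[OF fm]) simp
  then have m: "cut F t \<in> borel_measurable N"
    unfolding cut_def[abs_def] using 1 by (rule borel_measurable_scaleR)
  have "norm (cut F t z) \<le> D * norm (F (fst z) (snd z))" for z
    using RDx[of "max 0 (min T (t - fst z))" "F (fst z) (snd z)"] T D by (auto simp: cut_def indicator_def)
  then show "cut F t \<in> L2 N" "L2_norm N (cut F t) \<le> D * L2_norm N (\<lambda>z. F (fst z) (snd z))"
    using L2_bound[OF F m _ D] by auto
qed

lemma V_L2:
  assumes F: "(\<lambda>z. F (fst z) (snd z)) \<in> L2 N" and t: "t \<in> {0..T}"
  shows "V F t \<in> L2 M" "L2_norm M (V F t) \<le> sqrt T * D * L2_norm N (\<lambda>z. F (fst z) (snd z))"
proof -
  have e: "V F t = (\<lambda>\<omega>. \<integral>s. cut F t (s, \<omega>) \<partial>LL)" by (rule ext) (rule V_eq[OF t])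
  show "V F t \<in> L2 M" unfolding e by (rule section_integral(1)[OF cut_L2(1)[OF F]])
  have "L2_norm M (V F t) \<le> sqrt T * L2_norm N (cut F t)" unfolding e by (rule section_integral(2)[OF cut_L2(1)[OF F]])
  also have "\<dots> \<le> sqrt T * (D * L2_norm N (\<lambda>z. F (fst z) (snd z)))"
    by (rule mult_left_mono[OF cut_L2(2)[OF F]]) (use T in simp)
  finally show "L2_norm M (V F t) \<le> sqrt T * D * L2_norm N (\<lambda>z. F (fst z) (snd z))" by (simp add: mult.assoc)
qed

lemma V_integrable:
  assumes F: "(\<lambda>z. F (fst z) (snd z)) \<in> L2 N" and t: "t \<in> {0..T}"
  shows "AE \<omega> in M. integrable (lebesgue_on {0..t}) (\<lambda>s. R (t - s) (F s \<omega>))"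
  using section_L2[OF cut_L2(1)[OF F, of t]]
proof eventually_elim
  case (elim \<omega>)
  have t': "0 \<le> t" "t \<le> T" using t by auto
  have "(\<lambda>s. R (t - s) (F s \<omega>)) \<in> L2 (lebesgue_on {0..t})"
    using elim indicator_cut(3)[OF t', of "\<lambda>s. R (t - s) (F s \<omega>)"] by (simp add: cut_eq[OF t])
  then show ?case by (rule L2_finite_integrable(1)[OF finite_measure_lebesgue_on])
qed

lemma V_diff:
  assumes F: "(\<lambda>z. F (fst z) (snd z)) \<in> L2 N" and F': "(\<lambda>z. F' (fst z) (snd z)) \<in> L2 N" and t: "t \<in> {0..T}"
  shows "AE \<omega> in M. V F t \<omega> - V F' t \<omega> = V (\<lambda>s \<omega>. F s \<omega> - F' s \<omega>) t \<omega>"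
  using V_integrable[OF F t] V_integrable[OF F' t]
  by eventually_elim (simp add: V_def blinfun.diff_right Bochner_Integration.integral_diff)

text \<open>Dominated convergence in the product space with a multiple of \<open>F\<close> as
  majorant; the cut integrands converge wherever the time coordinate differs from \<open>t\<close>.
  \<open>section_integral\<close> then transfers the limit to the integrals.\<close>

lemma V_C_L2:
  assumes F: "(\<lambda>z. F (fst z) (snd z)) \<in> L2 N"
  shows "V F \<in> C_L2 M {0..T}"
proof (rule C_L2_sequentially)
  show "V F t \<in> L2 M" if "t \<in> {0..T}" for t by (rule V_L2(1)[OF F that])
  fix X t assume t: "t \<in> {0..T}" and X: "\<And>k::nat. X k \<in> {0..T}" "X \<longlonglongrightarrow> t"
  have c: "(\<lambda>k. L2_norm N (\<lambda>z. cut F (X k) z - cut F t z)) \<longlonglongrightarrow> 0"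
  proof (rule L2_dominated[where G = "\<lambda>z. (2 * D) *\<^sub>R F (fst z) (snd z)"])
    show "(\<lambda>z. (2 * D) *\<^sub>R F (fst z) (snd z)) \<in> L2 N" by (rule L2_scaleR[OF F])
    have b: "norm (cut F t z) \<le> D * norm (F (fst z) (snd z))" for t z
      using RDx[of "max 0 (min T (t - fst z))" "F (fst z) (snd z)"] T D by (auto simp: cut_def indicator_def)
    show "AE z in N. norm (cut F (X k) z - cut F t z) \<le> norm ((2 * D) *\<^sub>R F (fst z) (snd z))" for k
    proof (rule AE_I2)
      fix z
      show "norm (cut F (X k) z - cut F t z) \<le> norm ((2 * D) *\<^sub>R F (fst z) (snd z))"
        using norm_triangle_ineq4[of "cut F (X k) z" "cut F t z"] b[of "X k" z] b[of t z] D by simp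
    qed
    have "AE s in LL. s \<noteq> t" by (rule AE_lebesgue_on_neq) simp
    then have "AE s in LL. AE \<omega> in M. fst (s, \<omega>) \<noteq> t" by eventually_elim simp
    then have "AE z in N. fst z \<noteq> t"
    proof (rule P.AE_pair_measure[rotated])
      have [measurable]: "(\<lambda>z. fst z) \<in> borel_measurable N" by (rule measurable_compose[OF measurable_fst LL_id_measurable])
      show "{z \<in> space N. fst z \<noteq> t} \<in> sets N" by measurable
    qed
    moreover have "AE z in N. z \<in> space N" by simp
    ultimately show "AE z in N. (\<lambda>k. cut F (X k) z) \<longlonglongrightarrow> cut F t z"
    proof eventually_elim
      case (elim z)
      then have s: "fst z \<in> {0..T}" by (simp add: space_pair_measure space_restrict_space mem_Times_iff)
      have "(\<lambda>k. max 0 (min T (X k - fst z))) \<longlonglongrightarrow> max 0 (min T (t - fst z))"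
        by (intro tendsto_intros X)
      then have R: "(\<lambda>k. R (max 0 (min T (X k - fst z))) (F (fst z) (snd z))) \<longlonglongrightarrow> R (max 0 (min T (t - fst z))) (F (fst z) (snd z))"
        by (intro continuous_on_tendsto_compose[OF Rc]) (auto intro: always_eventually)
      have I: "(\<lambda>k. indicat_real {0..X k} (fst z)) \<longlonglongrightarrow> indicat_real {0..t} (fst z)"
      proof (cases "fst z < t")
        case True
        have "\<forall>\<^sub>F k in sequentially. fst z < X k" by (rule order_tendstoD(1)[OF X(2) True])
        then have "\<forall>\<^sub>F k in sequentially. indicat_real {0..X k} (fst z) = 1"
          by eventually_elim (use s in simp)
        then show ?thesis using s True by (simp add: tendsto_eventually)
      next
        case False
        then have lt: "t < fst z" using elim by simp
        have "\<forall>\<^sub>F k in sequentially. X k < fst z" by (rule order_tendstoD(2)[OF X(2) lt])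
        then have "\<forall>\<^sub>F k in sequentially. indicat_real {0..X k} (fst z) = 0"
          by eventually_elim simp
        then show ?thesis using lt by (simp add: tendsto_eventually)
      qed
      show ?case unfolding cut_def by (rule tendsto_scaleR[OF I R])
    qed
  qed (intro L2_measurable cut_L2(1) F)+
  have le: "L2_norm M (\<lambda>\<omega>. V F (X k) \<omega> - V F t \<omega>) \<le> sqrt T * L2_norm N (\<lambda>z. cut F (X k) z - cut F t z)" for k
  proof -
    note Y = L2_diff[OF cut_L2(1)[OF F, of "X k"] cut_L2(1)[OF F, of t]]
    have m: "(\<lambda>\<omega>. V F (X k) \<omega> - V F t \<omega>) \<in> borel_measurable M"
      by (intro L2_measurable L2_diff V_L2(1) F t X)
    have ae: "AE \<omega> in M. V F (X k) \<omega> - V F t \<omega> = (\<integral>s. cut F (X k) (s, \<omega>) - cut F t (s, \<omega>) \<partial>LL)"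
      using section_L2[OF cut_L2(1)[OF F, of "X k"]] section_L2[OF cut_L2(1)[OF F, of t]]
    proof eventually_elim
      case (elim \<omega>)
      note i = L2_finite_integrable(1)[OF LL.finite_measure_axioms]
      show ?case unfolding V_eq[OF t] V_eq[OF X(1)]
        by (rule Bochner_Integration.integral_diff[OF i[OF elim(1)] i[OF elim(2)], symmetric])
    qed
    have "L2_norm M (\<lambda>\<omega>. V F (X k) \<omega> - V F t \<omega>) = L2_norm M (\<lambda>\<omega>. \<integral>s. cut F (X k) (s, \<omega>) - cut F t (s, \<omega>) \<partial>LL)"
      by (rule L2_cong_AE(2)[OF section_integral(1)[OF Y] m ae])
    also have "\<dots> \<le> sqrt T * L2_norm N (\<lambda>z. cut F (X k) z - cut F t z)" by (rule section_integral(2)[OF Y])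
    finally show ?thesis .
  qed
  show "(\<lambda>k. L2_norm M (\<lambda>\<omega>. V F (X k) \<omega> - V F t \<omega>)) \<longlonglongrightarrow> 0"
    by (rule Lim_null_comparison[OF _ tendsto_mult_right_zero[OF c, of "sqrt T"]]) (use le in \<open>auto intro: always_eventually\<close>)
qed

text \<open>Only the sections \<open>f \<cdot> x\<close> are measurable; the Lipschitz condition makes \<open>f\<close> a Caratheodory function.\<close>

lemma Caratheodory_measurable:
  fixes f :: "real \<Rightarrow> 'x \<Rightarrow> 'x"
  assumes f: "\<forall>x. (\<lambda>t. f t x) \<in> borel_measurable LL"
    and Lip: "\<forall>t\<in>{0..T}. \<forall>x y. norm (f t x - f t y) \<le> C1 * norm (x - y)"
    and X: "X \<in> borel_measurable N"
  shows "(\<lambda>z. f (fst z) (X z)) \<in> borel_measurable N"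
proof -
  \<comment> \<open>A simple approximation takes finitely many values, and with the second argument
    of \<open>f\<close> fixed the section is measurable by assumption.\<close>
  obtain S where S: "\<And>i. simple_function N (S i)" "\<And>z. z \<in> space N \<Longrightarrow> (\<lambda>i. S i z) \<longlonglongrightarrow> X z"
    using borel_measurable_implies_sequence_metric[OF X, of 0] by blast
  show ?thesis
  proof (rule borel_measurable_LIMSEQ_metric)
    fix i
    show "(\<lambda>z. f (fst z) (S i z)) \<in> borel_measurable N"
    proof (rule measurable_compose_countable'[where I = "S i ` space N" and f = "\<lambda>x z. f (fst z) x" and g = "S i"])
      show "(\<lambda>z. f (fst z) x) \<in> borel_measurable N" for x
        using f by (intro measurable_compose[OF measurable_fst]) simp
      show "S i \<in> measurable N (count_space (S i ` space N))"
        using simple_function_def[of N "S i"] S(1)[of i] by (intro measurable_count_space_eq2[THEN iffD2]) (auto dest: simple_functionD)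
      show "countable (S i ` space N)" using simple_functionD(1)[OF S(1)] by (rule countable_finite)
    qed
  next
    fix z assume z: "z \<in> space N"
    then have s: "fst z \<in> {0..T}" by (simp add: space_pair_measure space_restrict_space mem_Times_iff)
    have "(\<lambda>i. C1 * norm (S i z - X z)) \<longlonglongrightarrow> 0"
      by (intro tendsto_mult_right_zero tendsto_norm_zero LIM_zero S(2) z)
    then have "(\<lambda>i. f (fst z) (S i z) - f (fst z) (X z)) \<longlonglongrightarrow> 0"
      by (rule Lim_null_comparison[rotated]) (use Lip s in \<open>auto intro: always_eventually\<close>)
    then show "(\<lambda>i. f (fst z) (S i z)) \<longlonglongrightarrow> f (fst z) (X z)" by (rule LIM_zero_cancel)
  qed
qed

end

lemma Lipschitz_measurable:
  fixes h :: "'x::{real_normed_vector,second_countable_topology} \<Rightarrow> 'y::real_normed_vector"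
  assumes "\<forall>x y. norm (h x - h y) \<le> C * norm (x - y)"
  shows "h \<in> borel_measurable borel"
proof -
  have "norm (h x - h y) \<le> \<bar>C\<bar> * norm (x - y)" for x y
    using order_trans[OF assms[rule_format, of x y] mult_right_mono[OF abs_ge_self[of C], of "norm (x - y)"]] by simp
  then have "\<bar>C\<bar>-lipschitz_on UNIV h" by (intro lipschitz_onI) (auto simp: dist_norm)
  then have "continuous_on UNIV h" by (rule lipschitz_on_continuous_on)
  then show ?thesis by (rule borel_measurable_continuous_onI)
qed

lemma (in prob_space) const_L2: "(\<lambda>\<omega>. c) \<in> L2 M" "L2_norm M (\<lambda>\<omega>. c) = norm c"
  by (simp_all add: L2_def L2_norm_def prob_space)

text \<open>The second constant allows for Lipschitz constants without a known sign: for
  \<open>g\<close> it is the absolute value of \<open>C3\<close>.\<close>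

lemma (in prob_space) Lipschitz_L2_diff:
  fixes h :: "'x::{real_normed_vector,second_countable_topology} \<Rightarrow> 'y::{real_normed_vector,second_countable_topology}"
  assumes h: "\<forall>x y. norm (h x - h y) \<le> C * norm (x - y)" and C: "C \<le> C'" "0 \<le> C'" and x: "x \<in> L2 M" "y \<in> L2 M"
  shows "(\<lambda>\<omega>. h (x \<omega>) - h (y \<omega>)) \<in> L2 M" "L2_norm M (\<lambda>\<omega>. h (x \<omega>) - h (y \<omega>)) \<le> C' * L2_norm M (\<lambda>\<omega>. x \<omega> - y \<omega>)"
proof -
  have m: "(\<lambda>\<omega>. h (x \<omega>) - h (y \<omega>)) \<in> borel_measurable M"
    using x by (intro borel_measurable_diff measurable_compose[OF L2_measurable Lipschitz_measurable[OF h]])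
  have "norm (h (x \<omega>) - h (y \<omega>)) \<le> C' * norm (x \<omega> - y \<omega>)" for \<omega>
    using order_trans[OF h[rule_format, of "x \<omega>" "y \<omega>"] mult_right_mono[OF C(1), of "norm (x \<omega> - y \<omega>)"]] by simp
  then show "(\<lambda>\<omega>. h (x \<omega>) - h (y \<omega>)) \<in> L2 M" "L2_norm M (\<lambda>\<omega>. h (x \<omega>) - h (y \<omega>)) \<le> C' * L2_norm M (\<lambda>\<omega>. x \<omega> - y \<omega>)"
    using L2_bound[OF L2_diff[OF x] m _ C(2)] by auto
qed

lemma (in prob_space) Lipschitz_L2:
  fixes h :: "'x::{real_normed_vector,second_countable_topology} \<Rightarrow> 'y::{real_normed_vector,second_countable_topology}"
  assumes h: "\<forall>x y. norm (h x - h y) \<le> C * norm (x - y)" and C: "C \<le> C'" "0 \<le> C'" and x: "x \<in> L2 M"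
  shows "(\<lambda>\<omega>. h (x \<omega>)) \<in> L2 M" "L2_norm M (\<lambda>\<omega>. h (x \<omega>)) \<le> C' * L2_norm M x + norm (h 0)"
proof -
  note d = Lipschitz_L2_diff[OF h C x const_L2(1)[of 0]]
  show "(\<lambda>\<omega>. h (x \<omega>)) \<in> L2 M" using L2_add[OF d(1) const_L2(1)[of "h 0"]] by simp
  show "L2_norm M (\<lambda>\<omega>. h (x \<omega>)) \<le> C' * L2_norm M x + norm (h 0)"
    using L2_norm_triangle[OF d(1) const_L2(1)[of "h 0"]] d(2) by (simp add: const_L2(2))
qed

text \<open>Tonelli with time as the inner variable. The control is estimated path by path through
  \<open>Winv\<close>, and this turns such estimates into one over the product space.\<close>

lemma (in drift) L2_N_from_paths:
  fixes U :: "real \<times> 'w \<Rightarrow> 'u::{real_normed_vector,second_countable_topology}" and \<eta> :: "'w \<Rightarrow> 'x"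
  assumes U: "U \<in> borel_measurable N" and \<eta>: "\<eta> \<in> L2 M" and K: "0 \<le> K"
    and path: "\<And>\<omega>. \<omega> \<in> space M \<Longrightarrow> (\<lambda>s. U (s, \<omega>)) \<in> L2 LL \<and> L2_norm LL (\<lambda>s. U (s, \<omega>)) \<le> K * norm (\<eta> \<omega>)"
  shows "U \<in> L2 N" "L2_norm N U \<le> K * L2_norm M \<eta>"
proof -
  interpret FL: finite_measure LL by (rule finite_measure_lebesgue_on)
  interpret PL: pair_sigma_finite LL M ..
  have m: "(\<lambda>z. ennreal ((norm (U z))\<^sup>2)) \<in> borel_measurable N" using U by measurable
  have "(\<integral>\<^sup>+z. ennreal ((norm (U z))\<^sup>2) \<partial>N) = (\<integral>\<^sup>+\<omega>. (\<integral>\<^sup>+s. ennreal ((norm (U (s, \<omega>)))\<^sup>2) \<partial>LL) \<partial>M)"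
    by (rule PL.nn_integral_snd[OF m, symmetric])
  also have "\<dots> \<le> (\<integral>\<^sup>+\<omega>. ennreal (K\<^sup>2) * ennreal ((norm (\<eta> \<omega>))\<^sup>2) \<partial>M)"
  proof (rule nn_integral_mono)
    fix \<omega> assume w: "\<omega> \<in> space M"
    have "(\<integral>\<^sup>+s. ennreal ((norm (U (s, \<omega>)))\<^sup>2) \<partial>LL) = ennreal ((L2_norm LL (\<lambda>s. U (s, \<omega>)))\<^sup>2)"
      using path[OF w] by (intro nn_integral_L2_norm) simp
    also have "\<dots> \<le> ennreal ((K * norm (\<eta> \<omega>))\<^sup>2)" using path[OF w] by (intro ennreal_leI power_mono) auto
    also have "\<dots> = ennreal (K\<^sup>2) * ennreal ((norm (\<eta> \<omega>))\<^sup>2)" by (simp add: power_mult_distrib ennreal_mult)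
    finally show "(\<integral>\<^sup>+s. ennreal ((norm (U (s, \<omega>)))\<^sup>2) \<partial>LL) \<le> ennreal (K\<^sup>2) * ennreal ((norm (\<eta> \<omega>))\<^sup>2)" .
  qed
  also have "\<dots> = ennreal (K\<^sup>2) * ennreal ((L2_norm M \<eta>)\<^sup>2)"
    unfolding nn_integral_L2_norm[OF \<eta>, symmetric] using L2_measurable[OF \<eta>] by (intro nn_integral_cmult) measurable
  also have "\<dots> = ennreal ((K * L2_norm M \<eta>)\<^sup>2)" by (simp add: power_mult_distrib ennreal_mult)
  finally show "U \<in> L2 N" "L2_norm N U \<le> K * L2_norm M \<eta>"
    using L2_le_nn[OF U, of "K * L2_norm M \<eta>"] K by simp_all
qed

section \<open>The fixed point\<close>

locale controlled_system = drift T D R M + control T D R L Winv M_W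
  for T :: real and D :: real and R :: "real \<Rightarrow> 'x::{real_inner,banach,second_countable_topology} \<Rightarrow>\<^sub>L 'x" and M :: "'w measure"
    and L :: "'u::{real_inner,banach,second_countable_topology} \<Rightarrow>\<^sub>L 'x" and Winv :: "'x \<Rightarrow> real \<Rightarrow> 'u" and M_W :: real +
  fixes \<tau> C1 C2 C3 M_L :: real and f g :: "real \<Rightarrow> 'x \<Rightarrow> 'x" and r \<rho> :: "real \<Rightarrow> real"
    and Z \<phi> :: "real \<Rightarrow> 'w \<Rightarrow> 'x" and x1 :: 'x
  assumes \<tau>: "0 < \<tau>" and C1: "0 \<le> C1" and norm_L: "norm L \<le> M_L"
    and r: "continuous_on {0..} r" "\<forall>t\<ge>0. r t \<in> {0..\<tau>}"
    and \<rho>: "continuous_on {0..} \<rho>" "\<forall>t\<ge>0. \<rho> t \<in> {0..\<tau>}"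
    and f_meas: "\<forall>x. (\<lambda>t. f t x) \<in> borel_measurable (lebesgue_on {0..T})"
    and f_Lip: "\<forall>t\<in>{0..T}. \<forall>x y. norm (f t x - f t y) \<le> C1 * norm (x - y)"
    and f_0: "\<And>t. t \<in> {0..T} \<Longrightarrow> norm (f t 0) \<le> C2"
    and g_Lip: "\<forall>t\<in>{0..T}. \<forall>x y. norm (g t x - g t y) \<le> C3 * norm (x - y)"
    and g_cont: "\<forall>x\<in>C_L2 M {0..T}. \<forall>s\<in>{0..T}.
           ((\<lambda>t. \<integral>\<omega>. (norm (g t (x t \<omega>) - g s (x s \<omega>)))\<^sup>2 \<partial>M) \<longlongrightarrow> 0) (at s within {0..T})"
    and Z: "Z \<in> C_L2 M {0..T}" "AE \<omega> in M. Z 0 \<omega> = 0" and R0: "R 0 = id_blinfun"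
    and \<phi>: "\<phi> \<in> C_L2 M {-\<tau>..0}"
begin

text \<open>Lipschitz constant of the right-hand side of the mild equation for a fixed control: the
  contributions of \<open>g\<close> and of the convolution with \<open>f\<close>.\<close>

definition cc :: real where "cc = \<bar>C3\<bar> + D * C1 * T"
text \<open>Here the control reacts as well. The required target is again Lipschitz with constant
  \<open>cc\<close>; \<open>Winv\<close> contributes \<open>M_W\<close>, \<open>L\<close>
  contributes \<open>M_L\<close>, and the convolution contributes \<open>sqrt T * D\<close>.\<close>

definition ll :: real where "ll = cc + sqrt T * D * M_L * M_W * cc"

lemma cc_nonneg: "0 \<le> cc" using D C1 T by (simp add: cc_def)
lemma M_L0: "0 \<le> M_L" using norm_L norm_ge_zero[of L] by linarith
lemma cc_le_ll: "cc \<le> ll" using cc_nonneg M_L0 MW D T by (simp add: ll_def)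
lemma z0: "0 \<in> {0..T}" and zT: "T \<in> {0..T}" using T by auto

definition admissible :: "(real \<Rightarrow> 'w \<Rightarrow> 'x) \<Rightarrow> bool" where
  "admissible x \<longleftrightarrow> x \<in> C_L2 M {-\<tau>..T} \<and> measurable_process M {-\<tau>..T} x \<and> (\<forall>t\<in>{-\<tau>..0}. AE \<omega> in M. x t \<omega> = \<phi> t \<omega>)"
definition ini :: "'w \<Rightarrow> 'x" where "ini \<omega> = \<phi> 0 \<omega> + g 0 (\<phi> (- r 0) \<omega>)"
definition base :: "real \<Rightarrow> 'w \<Rightarrow> 'x" where "base t \<omega> = R t (ini \<omega>) + Z t \<omega>"
definition gx :: "(real \<Rightarrow> 'w \<Rightarrow> 'x) \<Rightarrow> real \<Rightarrow> 'w \<Rightarrow> 'x" where "gx x t \<omega> = g t (x (t - r t) \<omega>)"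
definition fx :: "(real \<Rightarrow> 'w \<Rightarrow> 'x) \<Rightarrow> real \<Rightarrow> 'w \<Rightarrow> 'x" where "fx x s \<omega> = f s (x (s - \<rho> s) \<omega>)"
text \<open>The right-hand side of the mild equation at time \<open>T\<close>, set equal to
  \<open>x1\<close> and solved for the contribution of the control.\<close>

definition target :: "(real \<Rightarrow> 'w \<Rightarrow> 'x) \<Rightarrow> 'w \<Rightarrow> 'x" where
  "target x \<omega> = x1 - base T \<omega> + gx x T \<omega> - V (fx x) T \<omega>"
text \<open>\<open>Winv\<close> fixes the path only up to null sets in time; the choice singles out
  a jointly measurable representative.\<close>

definition ctrl :: "(real \<Rightarrow> 'w \<Rightarrow> 'x) \<Rightarrow> real \<Rightarrow> 'w \<Rightarrow> 'u" where
  "ctrl x = (SOME u. stochastic_control M T u \<and> (\<forall>\<omega>\<in>space M. AE s in LL. u s \<omega> = Winv (target x \<omega>) s))"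
definition \<Phi> :: "(real \<Rightarrow> 'w \<Rightarrow> 'u) \<Rightarrow> (real \<Rightarrow> 'w \<Rightarrow> 'x) \<Rightarrow> real \<Rightarrow> 'w \<Rightarrow> 'x" where
  "\<Phi> u x t \<omega> = base t \<omega> - gx x t \<omega> + V (\<lambda>s \<omega>. L (u s \<omega>) + fx x s \<omega>) t \<omega>"

lemma delay: "t \<in> {0..T} \<Longrightarrow> t - r t \<in> {-\<tau>..T}" "t \<in> {0..T} \<Longrightarrow> t - \<rho> t \<in> {-\<tau>..T}"
  using r(2)[rule_format, of t] \<rho>(2)[rule_format, of t] by auto

lemma delay_r_continuous: "continuous_on {0..T} (\<lambda>t. t - r t)"
  by (intro continuous_intros continuous_on_subset[OF r(1)]) auto

lemma admissible_L2: "admissible x \<Longrightarrow> t \<in> {-\<tau>..T} \<Longrightarrow> x t \<in> L2 M"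
  unfolding admissible_def by (elim conjE) (rule C_L2_D)

lemma \<phi>_L2: "t \<in> {-\<tau>..0} \<Longrightarrow> \<phi> t \<in> L2 M" by (rule C_L2_D[OF \<phi>])

lemma g_L2:
  assumes "t \<in> {0..T}" "y \<in> L2 M" shows "(\<lambda>\<omega>. g t (y \<omega>)) \<in> L2 M"
  by (rule Lipschitz_L2(1)[OF bspec[OF g_Lip assms(1)] abs_ge_self abs_ge_zero assms(2)])

lemma ini_L2: "ini \<in> L2 M"
proof -
  have "- r 0 \<in> {-\<tau>..0}" using r(2)[rule_format, of 0] by auto
  then have g: "(\<lambda>\<omega>. g 0 (\<phi> (- r 0) \<omega>)) \<in> L2 M"
    by (rule g_L2[OF z0 \<phi>_L2])
  have "\<phi> 0 \<in> L2 M" by (rule \<phi>_L2) (use \<tau> in simp)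
  then show ?thesis unfolding ini_def[abs_def] by (rule L2_add[OF _ g])
qed

lemma base_C_L2: "base \<in> C_L2 M {0..T}"
proof -
  have m: "(\<lambda>\<omega>. R t (ini \<omega>)) \<in> borel_measurable M" for t
  proof -
    have "continuous_on UNIV (blinfun_apply (R t))" by (intro continuous_intros)
    then show ?thesis by (intro measurable_compose[OF L2_measurable[OF ini_L2]] borel_measurable_continuous_onI)
  qed
  have b: "norm (R t (ini \<omega>)) \<le> D * norm (ini \<omega>)" if "t \<in> {0..T}" for t \<omega> by (rule RDx[OF that])
  have "(\<lambda>t \<omega>. R t (ini \<omega>)) \<in> C_L2 M {0..T}"
  proof (rule C_L2_sequentially)
    fix t assume t: "t \<in> {0..T}"
    show "(\<lambda>\<omega>. R t (ini \<omega>)) \<in> L2 M" by (rule L2_bound(1)[OF ini_L2 m _ D]) (intro AE_I2 b t)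
    fix X assume X: "\<And>k::nat. X k \<in> {0..T}" "X \<longlonglongrightarrow> t"
    show "(\<lambda>k. L2_norm M (\<lambda>\<omega>. R (X k) (ini \<omega>) - R t (ini \<omega>))) \<longlonglongrightarrow> 0"
    proof (rule L2_dominated[OF m m L2_scaleR[OF ini_L2, of "2 * D"]])
      show "AE \<omega> in M. norm (R (X k) (ini \<omega>) - R t (ini \<omega>)) \<le> norm ((2 * D) *\<^sub>R ini \<omega>)" for k
      proof (rule AE_I2)
        fix \<omega>
        show "norm (R (X k) (ini \<omega>) - R t (ini \<omega>)) \<le> norm ((2 * D) *\<^sub>R ini \<omega>)"
          using norm_triangle_ineq4[of "R (X k) (ini \<omega>)" "R t (ini \<omega>)"] b[OF X(1), of k \<omega>] b[OF t, of \<omega>] D by simp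
      qed
      show "AE \<omega> in M. (\<lambda>k. R (X k) (ini \<omega>)) \<longlonglongrightarrow> R t (ini \<omega>)"
        using t X by (intro AE_I2 continuous_on_tendsto_compose[OF Rc X(2)]) (auto intro: always_eventually)
    qed
  qed
  then show ?thesis unfolding base_def[abs_def] by (intro C_L2_add Z(1))
qed

text \<open>The continuity assumption on \<open>g\<close> concerns processes on
  \<open>{0..T}\<close>. It is applied to the delayed process, which lives there even though its
  values reach back into the past.\<close>

lemma gx_C_L2: assumes x: "admissible x" shows "gx x \<in> C_L2 M {0..T}"
proof -
  have y: "(\<lambda>t. x (t - r t)) \<in> C_L2 M {0..T}"
  proof (rule C_L2_compose[OF _ delay_r_continuous])
    show "x \<in> C_L2 M {-\<tau>..T}" using x by (simp add: admissible_def)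
    show "(\<lambda>t. t - r t) ` {0..T} \<subseteq> {-\<tau>..T}" using delay(1) by (rule image_subsetI)
  qed
  have "gx x t \<in> L2 M" if t: "t \<in> {0..T}" for t
    unfolding gx_def[abs_def] by (rule g_L2[OF t C_L2_D[OF y t]])
  then show ?thesis using g_cont[rule_format, OF y] unfolding C_L2_def gx_def by simp
qed

lemma gx_diff:
  assumes x: "admissible x" "admissible y" and B: "\<And>t. t \<in> {-\<tau>..T} \<Longrightarrow> L2_norm M (\<lambda>\<omega>. x t \<omega> - y t \<omega>) \<le> B" and t: "t \<in> {0..T}"
  shows "L2_norm M (\<lambda>\<omega>. gx x t \<omega> - gx y t \<omega>) \<le> \<bar>C3\<bar> * B"
proof -
  note d = delay(1)[OF t]
  have "L2_norm M (\<lambda>\<omega>. gx x t \<omega> - gx y t \<omega>) \<le> \<bar>C3\<bar> * L2_norm M (\<lambda>\<omega>. x (t - r t) \<omega> - y (t - r t) \<omega>)"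
    unfolding gx_def
    by (rule Lipschitz_L2_diff(2)[OF bspec[OF g_Lip t] abs_ge_self abs_ge_zero admissible_L2[OF x(1) d] admissible_L2[OF x(2) d]])
  also have "\<dots> \<le> \<bar>C3\<bar> * B" by (intro mult_left_mono B d) simp
  finally show ?thesis .
qed

lemma delayed_measurable:
  assumes x: "admissible x"
  shows "(\<lambda>z. x (fst z - \<rho> (fst z)) (snd z)) \<in> borel_measurable N"
proof -
  have c: "continuous_on {0..T} (\<lambda>s. s - \<rho> s)"
    by (intro continuous_intros continuous_on_subset[OF \<rho>(1)]) auto
  have "(\<lambda>s. indicat_real {0..T} s *\<^sub>R (s - \<rho> s)) \<in> borel_measurable LL"
    by (intro borel_measurable_lebesgue_onI borel_measurable_continuous_on_indicator c) simp
  then have "(\<lambda>s. s - \<rho> s) \<in> borel_measurable LL"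
    by (rule measurable_cong[THEN iffD1, rotated]) (simp add: space_restrict_space)
  then have "(\<lambda>s. s - \<rho> s) \<in> measurable LL (restrict_space borel {-\<tau>..T})"
    using delay(2) by (intro measurable_restrict_space2) (auto simp: space_restrict_space)
  then have "(\<lambda>z. (fst z - \<rho> (fst z), snd z)) \<in> measurable N (restrict_space borel {-\<tau>..T} \<Otimes>\<^sub>M M)"
    by (intro measurable_Pair measurable_compose[OF measurable_fst] measurable_snd)
  moreover have "(\<lambda>(t, \<omega>). x t \<omega>) \<in> borel_measurable (restrict_space borel {-\<tau>..T} \<Otimes>\<^sub>M M)"
    using x by (simp add: admissible_def measurable_process_def)
  ultimately have "(\<lambda>z. (\<lambda>(t, \<omega>). x t \<omega>) (fst z - \<rho> (fst z), snd z)) \<in> borel_measurable N"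
    by (rule measurable_compose)
  then show ?thesis by simp
qed

lemma fx_measurable: "admissible x \<Longrightarrow> (\<lambda>z. fx x (fst z) (snd z)) \<in> borel_measurable N"
  unfolding fx_def by (rule Caratheodory_measurable[OF f_meas f_Lip delayed_measurable])

lemma fx_L2: assumes x: "admissible x" shows "(\<lambda>z. fx x (fst z) (snd z)) \<in> L2 N"
proof -
  have "x \<in> C_L2 M {-\<tau>..T}" using x by (simp add: admissible_def)
  then obtain B where B: "0 \<le> B" "\<And>t. t \<in> {-\<tau>..T} \<Longrightarrow> L2_norm M (x t) \<le> B" by (rule C_L2_bounded) blast
  have C2: "0 \<le> C2" using f_0[OF z0] norm_ge_zero[of "f 0 0"] by linarith
  show ?thesis
  proof (rule L2_N_le(1)[OF fx_measurable[OF x], of "C1 * B + C2"])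
    show "0 \<le> C1 * B + C2" using C1 B(1) C2 by simp
    fix s assume s: "s \<in> {0..T}"
    note d = delay(2)[OF s]
    have fL: "\<forall>x y. norm (f s x - f s y) \<le> C1 * norm (x - y)" using f_Lip s by (rule bspec)
    note F = Lipschitz_L2[OF fL order_refl C1 admissible_L2[OF x d]]
    have "C1 * L2_norm M (x (s - \<rho> s)) + norm (f s 0) \<le> C1 * B + C2"
      by (intro add_mono mult_left_mono B(2) d C1 f_0 s)
    then show "(\<lambda>\<omega>. fx x (fst (s, \<omega>)) (snd (s, \<omega>))) \<in> L2 M \<and> L2_norm M (\<lambda>\<omega>. fx x (fst (s, \<omega>)) (snd (s, \<omega>))) \<le> C1 * B + C2"
      using F by (simp add: fx_def)
  qed
qed

lemma fx_diff:
  assumes x: "admissible x" "admissible y" and B: "0 \<le> B" "\<And>t. t \<in> {-\<tau>..T} \<Longrightarrow> L2_norm M (\<lambda>\<omega>. x t \<omega> - y t \<omega>) \<le> B"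
  shows "L2_norm N (\<lambda>z. fx x (fst z) (snd z) - fx y (fst z) (snd z)) \<le> sqrt T * (C1 * B)"
proof (rule L2_N_le(2))
  show "(\<lambda>z. fx x (fst z) (snd z) - fx y (fst z) (snd z)) \<in> borel_measurable N"
    by (intro borel_measurable_diff fx_measurable x)
  show "0 \<le> C1 * B" using C1 B(1) by simp
  fix s assume s: "s \<in> {0..T}"
  note d = delay(2)[OF s]
  have fL: "\<forall>x y. norm (f s x - f s y) \<le> C1 * norm (x - y)" using f_Lip s by (rule bspec)
  note F = Lipschitz_L2_diff[OF fL order_refl C1 admissible_L2[OF x(1) d] admissible_L2[OF x(2) d]]
  have "C1 * L2_norm M (\<lambda>\<omega>. x (s - \<rho> s) \<omega> - y (s - \<rho> s) \<omega>) \<le> C1 * B" by (intro mult_left_mono B(2) d C1)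
  then show "(\<lambda>\<omega>. fx x (fst (s, \<omega>)) (snd (s, \<omega>)) - fx y (fst (s, \<omega>)) (snd (s, \<omega>))) \<in> L2 M
     \<and> L2_norm M (\<lambda>\<omega>. fx x (fst (s, \<omega>)) (snd (s, \<omega>)) - fx y (fst (s, \<omega>)) (snd (s, \<omega>))) \<le> C1 * B"
    using F by (simp add: fx_def)
qed

lemma V_diff_le:
  assumes F: "(\<lambda>z. F (fst z) (snd z)) \<in> L2 N" "(\<lambda>z. F' (fst z) (snd z)) \<in> L2 N" and t: "t \<in> {0..T}"
  shows "L2_norm M (\<lambda>\<omega>. V F t \<omega> - V F' t \<omega>) \<le> sqrt T * D * L2_norm N (\<lambda>z. F (fst z) (snd z) - F' (fst z) (snd z))"
proof -
  note dL = L2_diff[OF F]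
  have dV: "V (\<lambda>s \<omega>. F s \<omega> - F' s \<omega>) t \<in> L2 M" by (rule V_L2(1)[OF dL t])
  have "L2_norm M (\<lambda>\<omega>. V F t \<omega> - V F' t \<omega>) = L2_norm M (V (\<lambda>s \<omega>. F s \<omega> - F' s \<omega>) t)"
    by (rule L2_cong_AE(2)[OF dV _ V_diff[OF F t]]) (intro L2_measurable L2_diff V_L2(1) F t)
  also have "\<dots> \<le> sqrt T * D * L2_norm N (\<lambda>z. F (fst z) (snd z) - F' (fst z) (snd z))" by (rule V_L2(2)[OF dL t])
  finally show ?thesis .
qed

lemma Vfx_diff:
  assumes x: "admissible x" "admissible y" and B: "0 \<le> B" "\<And>t. t \<in> {-\<tau>..T} \<Longrightarrow> L2_norm M (\<lambda>\<omega>. x t \<omega> - y t \<omega>) \<le> B" and t: "t \<in> {0..T}"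
  shows "L2_norm M (\<lambda>\<omega>. V (fx x) t \<omega> - V (fx y) t \<omega>) \<le> D * C1 * T * B"
proof -
  \<comment> \<open>One factor \<open>sqrt T\<close> stems from Cauchy-Schwarz in the time integral,
    the other from passing from a bound at each time to the norm over the product space.\<close>
  have "sqrt T * D * L2_norm N (\<lambda>z. fx x (fst z) (snd z) - fx y (fst z) (snd z)) \<le> sqrt T * D * (sqrt T * (C1 * B))"
    by (intro mult_left_mono fx_diff x B) (use T D in auto)
  also have "\<dots> = (sqrt T * sqrt T) * (D * C1 * B)" by (simp only: mult_ac)
  also have "\<dots> = D * C1 * T * B" using T by simp
  finally show ?thesis using V_diff_le[OF fx_L2[OF x(1)] fx_L2[OF x(2)] t] by linarith
qed

lemma target_L2: "admissible x \<Longrightarrow> target x \<in> L2 M"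
  unfolding target_def[abs_def]
  by (intro L2_diff L2_add const_L2 C_L2_D[OF base_C_L2 zT] C_L2_D[OF gx_C_L2 zT] V_L2(1) fx_L2 zT)

text \<open>In the difference of two targets \<open>x1\<close> and \<open>base\<close> cancel; what
  is left are the increments of \<open>g\<close> and of the convolution with \<open>f\<close> at
  time \<open>T\<close>, whence the constant \<open>cc\<close>.\<close>

lemma target_diff:
  assumes x: "admissible x" "admissible y" and B: "0 \<le> B" "\<And>t. t \<in> {-\<tau>..T} \<Longrightarrow> L2_norm M (\<lambda>\<omega>. x t \<omega> - y t \<omega>) \<le> B"
  shows "L2_norm M (\<lambda>\<omega>. target x \<omega> - target y \<omega>) \<le> cc * B"
proof -
  have gL: "(\<lambda>\<omega>. gx x T \<omega> - gx y T \<omega>) \<in> L2 M" by (intro L2_diff C_L2_D[OF gx_C_L2 zT] x)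
  have VL: "(\<lambda>\<omega>. V (fx x) T \<omega> - V (fx y) T \<omega>) \<in> L2 M" by (intro L2_diff V_L2(1) fx_L2 x zT)
  have "L2_norm M (\<lambda>\<omega>. target x \<omega> - target y \<omega>) = L2_norm M (\<lambda>\<omega>. (gx x T \<omega> - gx y T \<omega>) - (V (fx x) T \<omega> - V (fx y) T \<omega>))"
    by (intro L2_norm_cong) (simp add: target_def algebra_simps)
  also have "\<dots> \<le> \<bar>C3\<bar> * B + D * C1 * T * B"
    using L2_norm_triangle_diff[OF gL VL] gx_diff[OF x B(2) zT] Vfx_diff[OF x B zT] by linarith
  finally show ?thesis by (simp add: cc_def distrib_right)
qed

lemma ctrl:
  assumes x: "admissible x"
  shows "stochastic_control M T (ctrl x)" "\<And>\<omega>. \<omega> \<in> space M \<Longrightarrow> AE s in LL. ctrl x s \<omega> = Winv (target x \<omega>) s"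
proof -
  have "stochastic_control M T (ctrl x) \<and> (\<forall>\<omega>\<in>space M. AE s in LL. ctrl x s \<omega> = Winv (target x \<omega>) s)"
    unfolding ctrl_def by (rule someI_ex[OF control_exists[OF L2_measurable[OF target_L2[OF x]]]])
  then show "stochastic_control M T (ctrl x)" "\<And>\<omega>. \<omega> \<in> space M \<Longrightarrow> AE s in LL. ctrl x s \<omega> = Winv (target x \<omega>) s"
    by auto
qed

lemma ctrl_path: "admissible x \<Longrightarrow> \<omega> \<in> space M \<Longrightarrow> (\<lambda>s. ctrl x s \<omega>) \<in> L2 LL"
  using ctrl(1) by (simp add: stochastic_control_def)

lemma ctrl_measurable: "admissible x \<Longrightarrow> (\<lambda>z. ctrl x (fst z) (snd z)) \<in> borel_measurable N"
  using ctrl(1) by (intro measurable_process_N) (simp add: stochastic_control_def)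

lemma ctrl_diff:
  assumes x: "admissible x" "admissible y"
  shows "(\<lambda>z. ctrl x (fst z) (snd z) - ctrl y (fst z) (snd z)) \<in> L2 N"
    "L2_norm N (\<lambda>z. ctrl x (fst z) (snd z) - ctrl y (fst z) (snd z)) \<le> M_W * L2_norm M (\<lambda>\<omega>. target x \<omega> - target y \<omega>)"
proof -
  have m: "(\<lambda>z. ctrl x (fst z) (snd z) - ctrl y (fst z) (snd z)) \<in> borel_measurable N"
    by (intro borel_measurable_diff ctrl_measurable x)
  have path: "(\<lambda>s. ctrl x (fst (s, \<omega>)) (snd (s, \<omega>)) - ctrl y (fst (s, \<omega>)) (snd (s, \<omega>))) \<in> L2 LL \<and>
    L2_norm LL (\<lambda>s. ctrl x (fst (s, \<omega>)) (snd (s, \<omega>)) - ctrl y (fst (s, \<omega>)) (snd (s, \<omega>))) \<le> M_W * norm (target x \<omega> - target y \<omega>)"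
    if w: "\<omega> \<in> space M" for \<omega>
  proof -
    have pL: "(\<lambda>s. ctrl x s \<omega> - ctrl y s \<omega>) \<in> L2 LL" by (intro L2_diff ctrl_path x w)
    have "AE s in LL. ctrl x s \<omega> - ctrl y s \<omega> = Winv (target x \<omega>) s - Winv (target y \<omega>) s"
      using ctrl(2)[OF x(1) w] ctrl(2)[OF x(2) w] by eventually_elim simp
    from L2_cong_AE(2)[OF L2_diff[OF Winv_L2 Winv_L2] L2_measurable[OF pL] this]
    have "L2_norm LL (\<lambda>s. ctrl x s \<omega> - ctrl y s \<omega>) = L2_norm LL (\<lambda>s. Winv (target x \<omega>) s - Winv (target y \<omega>) s)" .
    then show ?thesis using pL Winv_dist[of "target x \<omega>" "target y \<omega>"] by simp
  qed
  have MW0: "0 \<le> M_W" using MW by simp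
  note tL = L2_diff[OF target_L2[OF x(1)] target_L2[OF x(2)]]
  show "(\<lambda>z. ctrl x (fst z) (snd z) - ctrl y (fst z) (snd z)) \<in> L2 N"
    by (rule L2_N_from_paths(1)[OF m tL MW0 path])
  show "L2_norm N (\<lambda>z. ctrl x (fst z) (snd z) - ctrl y (fst z) (snd z)) \<le> M_W * L2_norm M (\<lambda>\<omega>. target x \<omega> - target y \<omega>)"
    by (rule L2_N_from_paths(2)[OF m tL MW0 path])
qed

lemma ctrl_L2:
  assumes x: "admissible x"
  shows "(\<lambda>z. ctrl x (fst z) (snd z)) \<in> L2 N"
proof (rule L2_N_from_paths(1)[OF ctrl_measurable[OF x] target_L2[OF x]])
  show "0 \<le> M_W" using MW by simp
  fix \<omega> assume w: "\<omega> \<in> space M"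
  have "L2_norm LL (\<lambda>s. ctrl x s \<omega>) = L2_norm LL (Winv (target x \<omega>))"
    by (rule L2_cong_AE(2)[OF Winv_L2 L2_measurable[OF ctrl_path[OF x w]] ctrl(2)[OF x w]])
  then show "(\<lambda>s. ctrl x (fst (s, \<omega>)) (snd (s, \<omega>))) \<in> L2 LL \<and> L2_norm LL (\<lambda>s. ctrl x (fst (s, \<omega>)) (snd (s, \<omega>))) \<le> M_W * norm (target x \<omega>)"
    using ctrl_path[OF x w] Wb by simp
qed

lemma Lu_fx_L2:
  assumes x: "admissible x" "admissible y"
  shows "(\<lambda>z. L (ctrl x (fst z) (snd z)) + fx y (fst z) (snd z)) \<in> L2 N"
  by (intro L2_add L_L2[OF ctrl_L2] fx_L2 x)

lemma \<Phi>_C_L2: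
  assumes x: "admissible x" "admissible y" shows "\<Phi> (ctrl x) y \<in> C_L2 M {0..T}"
  unfolding \<Phi>_def[abs_def] using Lu_fx_L2[OF x] by (intro C_L2_add C_L2_diff base_C_L2 gx_C_L2 V_C_L2 x) simp

text \<open>At time 0 the two \<open>g\<close> terms cancel, the integral runs over a null set and
  \<open>Z\<close> vanishes. The image therefore fits the prescribed past, as
  \<open>C_L2_glue\<close> requires.\<close>

lemma \<Phi>_0:
  assumes x: "admissible y" shows "AE \<omega> in M. \<Phi> u y 0 \<omega> = \<phi> 0 \<omega>"
proof -
  have "- r 0 \<in> {-\<tau>..0}" using r(2)[rule_format, of 0] by auto
  then have ae: "AE \<omega> in M. y (- r 0) \<omega> = \<phi> (- r 0) \<omega>" using x by (simp add: admissible_def)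
  have V0: "V F 0 \<omega> = 0" for F \<omega>
  proof -
    have "AE s in lebesgue_on {0..0}. s \<noteq> (0::real)" by (rule AE_lebesgue_on_neq) simp
    moreover have "AE s in lebesgue_on {0..0}. s \<in> {0..0 :: real}" by (rule AE_I2) (simp add: space_restrict_space)
    ultimately have "AE s in lebesgue_on {0..0}. R (0 - s) (F s \<omega>) = 0" by eventually_elim simp
    then show ?thesis unfolding V_def by (rule integral_eq_zero_AE)
  qed
  from ae Z(2) show ?thesis by eventually_elim (simp add: \<Phi>_def base_def gx_def ini_def R0 V0)
qed

lemma \<Phi>_diff_same_control:
  assumes x: "admissible w" "admissible x" "admissible y"
    and B: "0 \<le> B" "\<And>t. t \<in> {-\<tau>..T} \<Longrightarrow> L2_norm M (\<lambda>\<omega>. x t \<omega> - y t \<omega>) \<le> B" and t: "t \<in> {0..T}"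
  shows "L2_norm M (\<lambda>\<omega>. \<Phi> (ctrl w) x t \<omega> - \<Phi> (ctrl w) y t \<omega>) \<le> cc * B"
proof -
  let ?F = "\<lambda>x s \<omega>. L (ctrl w s \<omega>) + fx x s \<omega>"
  note FL = Lu_fx_L2[OF x(1,2)] Lu_fx_L2[OF x(1,3)]
  have gL: "(\<lambda>\<omega>. gx y t \<omega> - gx x t \<omega>) \<in> L2 M" by (intro L2_diff C_L2_D[OF gx_C_L2 t] x)
  have VL: "(\<lambda>\<omega>. V (?F x) t \<omega> - V (?F y) t \<omega>) \<in> L2 M" by (intro L2_diff V_L2(1) FL t)
  have "L2_norm M (\<lambda>\<omega>. V (?F x) t \<omega> - V (?F y) t \<omega>)
    \<le> sqrt T * D * L2_norm N (\<lambda>z. ?F x (fst z) (snd z) - ?F y (fst z) (snd z))"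
    by (rule V_diff_le[OF FL t])
  also have "\<dots> = sqrt T * D * L2_norm N (\<lambda>z. fx x (fst z) (snd z) - fx y (fst z) (snd z))" by simp
  also have "\<dots> \<le> sqrt T * D * (sqrt T * (C1 * B))"
    by (intro mult_left_mono fx_diff x B) (use T D in auto)
  also have "\<dots> = (sqrt T * sqrt T) * (D * C1 * B)" by (simp only: mult_ac)
  also have "\<dots> = D * C1 * T * B" using T by simp
  finally have V: "L2_norm M (\<lambda>\<omega>. V (?F x) t \<omega> - V (?F y) t \<omega>) \<le> D * C1 * T * B" .
  have "L2_norm M (\<lambda>\<omega>. \<Phi> (ctrl w) x t \<omega> - \<Phi> (ctrl w) y t \<omega>)
    = L2_norm M (\<lambda>\<omega>. (gx y t \<omega> - gx x t \<omega>) + (V (?F x) t \<omega> - V (?F y) t \<omega>))"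
    by (intro L2_norm_cong) (simp add: \<Phi>_def algebra_simps)
  also have "\<dots> \<le> \<bar>C3\<bar> * B + D * C1 * T * B"
    using L2_norm_triangle[OF gL VL] gx_diff[OF x(2,3) B(2) t] V L2_norm_minus_commute[of M "gx y t" "gx x t"] by linarith
  finally show ?thesis by (simp add: cc_def distrib_right)
qed

text \<open>The mixed process with the control of \<open>x\<close> and the state of \<open>y\<close>
  is inserted. The first step costs \<open>cc\<close>; in the second only the control terms
  differ.\<close>

lemma \<Phi>_diff:
  assumes x: "admissible x" "admissible y"
    and B: "0 \<le> B" "\<And>t. t \<in> {-\<tau>..T} \<Longrightarrow> L2_norm M (\<lambda>\<omega>. x t \<omega> - y t \<omega>) \<le> B" and t: "t \<in> {0..T}"
  shows "L2_norm M (\<lambda>\<omega>. \<Phi> (ctrl x) x t \<omega> - \<Phi> (ctrl y) y t \<omega>) \<le> ll * B"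
proof -
  let ?F = "\<lambda>x y s \<omega>. L (ctrl x s \<omega>) + fx y s \<omega>"
  note FL = Lu_fx_L2[OF x(1) x(2)] Lu_fx_L2[OF x(2) x(2)]
  note \<Phi>L = C_L2_D[OF \<Phi>_C_L2[OF x(1) x(1)] t] C_L2_D[OF \<Phi>_C_L2[OF x(1) x(2)] t] C_L2_D[OF \<Phi>_C_L2[OF x(2) x(2)] t]
  have 1: "L2_norm M (\<lambda>\<omega>. \<Phi> (ctrl x) x t \<omega> - \<Phi> (ctrl x) y t \<omega>) \<le> cc * B"
    by (rule \<Phi>_diff_same_control[OF x(1) x B t])
  have "L2_norm M (\<lambda>\<omega>. \<Phi> (ctrl x) y t \<omega> - \<Phi> (ctrl y) y t \<omega>) = L2_norm M (\<lambda>\<omega>. V (?F x y) t \<omega> - V (?F y y) t \<omega>)"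
    by (intro L2_norm_cong) (simp add: \<Phi>_def)
  also have "\<dots> \<le> sqrt T * D * L2_norm N (\<lambda>z. ?F x y (fst z) (snd z) - ?F y y (fst z) (snd z))"
    by (rule V_diff_le[OF FL t])
  also have "\<dots> = sqrt T * D * L2_norm N (\<lambda>z. L (ctrl x (fst z) (snd z) - ctrl y (fst z) (snd z)))"
    by (simp add: blinfun.diff_right)
  also have "\<dots> \<le> sqrt T * D * (M_L * (M_W * (cc * B)))"
  proof (rule mult_left_mono)
    have "L2_norm N (\<lambda>z. L (ctrl x (fst z) (snd z) - ctrl y (fst z) (snd z))) \<le> M_L * L2_norm N (\<lambda>z. ctrl x (fst z) (snd z) - ctrl y (fst z) (snd z))"
    proof (rule L2_bound(2)[OF ctrl_diff(1)[OF x] L2_measurable[OF L_L2[OF ctrl_diff(1)[OF x]]] _ M_L0], rule AE_I2)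
      fix z
      show "norm (L (ctrl x (fst z) (snd z) - ctrl y (fst z) (snd z))) \<le> M_L * norm (ctrl x (fst z) (snd z) - ctrl y (fst z) (snd z))"
        by (rule order_trans[OF norm_blinfun mult_right_mono[OF norm_L]]) simp
    qed
    also have "\<dots> \<le> M_L * (M_W * (cc * B))"
    proof (rule mult_left_mono[OF _ M_L0])
      have "M_W * L2_norm M (\<lambda>\<omega>. target x \<omega> - target y \<omega>) \<le> M_W * (cc * B)"
        using MW by (intro mult_left_mono target_diff x B) auto
      then show "L2_norm N (\<lambda>z. ctrl x (fst z) (snd z) - ctrl y (fst z) (snd z)) \<le> M_W * (cc * B)"
        using ctrl_diff(2)[OF x] by linarith
    qed
    finally show "L2_norm N (\<lambda>z. L (ctrl x (fst z) (snd z) - ctrl y (fst z) (snd z))) \<le> M_L * (M_W * (cc * B))" .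
  qed (use T D in simp)
  finally have 2: "L2_norm M (\<lambda>\<omega>. \<Phi> (ctrl x) y t \<omega> - \<Phi> (ctrl y) y t \<omega>) \<le> sqrt T * D * (M_L * (M_W * (cc * B)))" .
  have "ll * B = cc * B + sqrt T * D * (M_L * (M_W * (cc * B)))" by (simp add: ll_def algebra_simps)
  then show ?thesis using L2_norm_dist_triangle[OF \<Phi>L] 1 2 by linarith
qed

text \<open>A relation instead of a map, because the measurable version of an image is determined
  only up to null sets.\<close>

definition image_of :: "(real \<Rightarrow> 'w \<Rightarrow> 'x) \<Rightarrow> (real \<Rightarrow> 'w \<Rightarrow> 'x) \<Rightarrow> bool" where
  "image_of x y \<longleftrightarrow> (\<forall>t\<in>{0..T}. AE \<omega> in M. y t \<omega> = \<Phi> (ctrl x) x t \<omega>)"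

lemma admissible_diff_past:
  assumes "admissible x" "admissible y" "t \<in> {-\<tau>..0}"
  shows "L2_norm M (\<lambda>\<omega>. x t \<omega> - y t \<omega>) = 0"
proof -
  have t: "t \<in> {-\<tau>..T}" using assms(3) T by auto
  have "AE \<omega> in M. x t \<omega> = \<phi> t \<omega>" "AE \<omega> in M. y t \<omega> = \<phi> t \<omega>"
    using assms by (simp_all add: admissible_def)
  then have "AE \<omega> in M. x t \<omega> - y t \<omega> = 0" by eventually_elim simp
  from L2_cong_AE(2)[OF L2_0 L2_measurable[OF L2_diff[OF admissible_L2[OF assms(1) t] admissible_L2[OF assms(2) t]]] this]
  show ?thesis by simp
qed

lemma admissible_version:
  assumes x: "x \<in> C_L2 M {-\<tau>..T}" "\<forall>t\<in>{-\<tau>..0}. AE \<omega> in M. x t \<omega> = \<phi> t \<omega>"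
  shows "\<exists>y. admissible y \<and> (\<forall>t\<in>{-\<tau>..T}. AE \<omega> in M. y t \<omega> = x t \<omega>)"
proof -
  obtain y where y: "y \<in> C_L2 M {-\<tau>..T}" "measurable_process M {-\<tau>..T} y"
    "\<And>t. t \<in> {-\<tau>..T} \<Longrightarrow> AE \<omega> in M. y t \<omega> = x t \<omega>"
    by (rule C_L2_measurable_version[OF finite_measure_axioms x(1)]) blast
  have "AE \<omega> in M. y t \<omega> = \<phi> t \<omega>" if t: "t \<in> {-\<tau>..0}" for t
  proof -
    have "t \<in> {-\<tau>..T}" using t T by auto
    from y(3)[OF this] x(2)[rule_format, OF t] show ?thesis by eventually_elim simp
  qed
  then show ?thesis using y by (intro exI[of _ y]) (simp add: admissible_def)
qed

lemma image_exists:
  assumes x: "admissible x" shows "\<exists>y. admissible y \<and> image_of x y"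
proof -
  let ?y = "\<lambda>t. if t \<le> 0 then \<phi> t else \<Phi> (ctrl x) x t"
  have C: "?y \<in> C_L2 M {-\<tau>..T}"
    by (rule C_L2_glue[OF \<phi> \<Phi>_C_L2[OF x x] \<Phi>_0[OF x]]) (use T \<tau> in auto)
  have "\<forall>t\<in>{-\<tau>..0}. AE \<omega> in M. ?y t \<omega> = \<phi> t \<omega>" by simp
  from admissible_version[OF C this] obtain y where y: "admissible y" "\<forall>t\<in>{-\<tau>..T}. AE \<omega> in M. y t \<omega> = ?y t \<omega>"
    by (elim exE conjE)
  have "AE \<omega> in M. y t \<omega> = \<Phi> (ctrl x) x t \<omega>" if t: "t \<in> {0..T}" for t
  proof -
    have "t \<in> {-\<tau>..T}" using t \<tau> by auto
    then have e: "AE \<omega> in M. y t \<omega> = ?y t \<omega>" by (rule bspec[OF y(2)])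
    show ?thesis
    \<comment> \<open>At 0 the glued process takes its value from the past, which agrees with the
      image only almost surely.\<close>
    proof (cases "t = 0")
      case True
      then have "AE \<omega> in M. y 0 \<omega> = \<phi> 0 \<omega>" using e by simp
      with \<Phi>_0[OF x, of "ctrl x"] have "AE \<omega> in M. y 0 \<omega> = \<Phi> (ctrl x) x 0 \<omega>" by eventually_elim simp
      then show ?thesis using True by simp
    next
      case False
      then show ?thesis using e t by simp
    qed
  qed
  then show ?thesis using y(1) by (intro exI[of _ y]) (simp add: image_of_def)
qed

lemma fixed_point:
  assumes ll: "ll < 1"
  shows "\<exists>x. admissible x \<and> image_of x x"
proof -
  \<comment> \<open>The iteration starts from the past, continued by its value at 0.\<close>
  have "(\<lambda>t. \<phi> (min t 0)) \<in> C_L2 M {-\<tau>..T}"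
    by (rule C_L2_compose[OF \<phi>]) (use \<tau> in \<open>auto intro!: continuous_intros\<close>)
  moreover have "\<forall>t\<in>{-\<tau>..0}. AE \<omega> in M. \<phi> (min t 0) \<omega> = \<phi> t \<omega>" by (simp add: min_absorb1)
  ultimately obtain x0 where x0: "admissible x0" using admissible_version by blast
  show ?thesis
  proof (rule C_L2_fixed_point[where a = "-\<tau>" and b = T and l = ll and M = M and ?x0.0 = x0 and Q = admissible and P = image_of])
    show "finite_measure M" by (rule finite_measure_axioms)
    show "0 \<le> ll" using cc_nonneg cc_le_ll by linarith
    show "ll < 1" by (rule ll)
    show "admissible x0" by (rule x0)
    show "x \<in> C_L2 M {-\<tau>..T}" if "admissible x" for x using that by (simp add: admissible_def)
    show "\<exists>y. admissible y \<and> image_of x y" if "admissible x" for x by (rule image_exists[OF that])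
    show "L2_norm M (\<lambda>\<omega>. y t \<omega> - y' t \<omega>) \<le> ll * B"
      if x: "admissible x" "admissible x'" "admissible y" "admissible y'" and im: "image_of x y" "image_of x' y'" and B: "0 \<le> B"
        "\<And>t. t \<in> {-\<tau>..T} \<Longrightarrow> L2_norm M (\<lambda>\<omega>. x t \<omega> - x' t \<omega>) \<le> B" and t: "t \<in> {-\<tau>..T}" for x x' y y' B t
    proof (cases "t \<le> 0")
      case True
      then have "L2_norm M (\<lambda>\<omega>. y t \<omega> - y' t \<omega>) = 0" using t by (intro admissible_diff_past x) auto
      then show ?thesis using B(1) cc_nonneg cc_le_ll by simp
    next
      case False
      then have t': "t \<in> {0..T}" using t by auto
      have "AE \<omega> in M. y t \<omega> = \<Phi> (ctrl x) x t \<omega>" "AE \<omega> in M. y' t \<omega> = \<Phi> (ctrl x') x' t \<omega>"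
        using im t' by (simp_all add: image_of_def)
      then have "AE \<omega> in M. y t \<omega> - y' t \<omega> = \<Phi> (ctrl x) x t \<omega> - \<Phi> (ctrl x') x' t \<omega>" by eventually_elim simp
      from L2_cong_AE(2)[OF L2_diff[OF C_L2_D[OF \<Phi>_C_L2[OF x(1) x(1)] t'] C_L2_D[OF \<Phi>_C_L2[OF x(2) x(2)] t']]
        L2_measurable[OF L2_diff[OF admissible_L2[OF x(3) t] admissible_L2[OF x(4) t]]] this]
      show ?thesis using \<Phi>_diff[OF x(1,2) B t'] by simp
    qed
    show "\<exists>z. admissible z \<and> (\<forall>t\<in>{-\<tau>..T}. AE \<omega> in M. z t \<omega> = y t \<omega>)"
      if X: "\<And>k. admissible (X k)" and y: "y \<in> C_L2 M {-\<tau>..T}"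
        and lim: "\<And>t. t \<in> {-\<tau>..T} \<Longrightarrow> (\<lambda>k. L2_norm M (\<lambda>\<omega>. X k t \<omega> - y t \<omega>)) \<longlonglongrightarrow> 0" for X y
    proof (rule admissible_version[OF y], intro ballI)
      fix t assume t: "t \<in> {-\<tau>..0}"
      then have t': "t \<in> {-\<tau>..T}" using T by auto
      note L = \<phi>_L2[OF t] C_L2_D[OF y t']
      have "L2_norm M (\<lambda>\<omega>. X k t \<omega> - y t \<omega>) = L2_norm M (\<lambda>\<omega>. \<phi> t \<omega> - y t \<omega>)" for k
      proof (rule L2_cong_AE(2)[OF L2_diff[OF L]])
        have "AE \<omega> in M. X k t \<omega> = \<phi> t \<omega>" using X[of k] t by (simp add: admissible_def)
        then show "AE \<omega> in M. X k t \<omega> - y t \<omega> = \<phi> t \<omega> - y t \<omega>" by eventually_elim simp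
      qed (rule L2_measurable[OF L2_diff[OF admissible_L2[OF X t'] L(2)]])
      then have "(\<lambda>k::nat. L2_norm M (\<lambda>\<omega>. \<phi> t \<omega> - y t \<omega>)) \<longlonglongrightarrow> 0" using lim[OF t'] by simp
      then have "L2_norm M (\<lambda>\<omega>. \<phi> t \<omega> - y t \<omega>) = 0" by (simp add: LIMSEQ_const_iff)
      from L2_norm_eq_0_AE[OF L2_diff[OF L] this] show "AE \<omega> in M. y t \<omega> = \<phi> t \<omega>" by eventually_elim simp
    qed
    show "image_of x y'" if "admissible x" "admissible y" "image_of x y" "admissible y'"
      and e: "\<And>t. t \<in> {-\<tau>..T} \<Longrightarrow> AE \<omega> in M. y' t \<omega> = y t \<omega>" for x y y'
      unfolding image_of_def
    proof
      fix t assume t: "t \<in> {0..T}"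
      then have t': "t \<in> {-\<tau>..T}" using \<tau> by auto
      have "AE \<omega> in M. y t \<omega> = \<Phi> (ctrl x) x t \<omega>" using \<open>image_of x y\<close> t by (simp add: image_of_def)
      with e[OF t'] show "AE \<omega> in M. y' t \<omega> = \<Phi> (ctrl x) x t \<omega>" by eventually_elim simp
    qed
  qed
qed

text \<open>Path by path, \<open>W_op\<close> undoes \<open>Winv\<close>, so the control contributes
  precisely \<open>target x\<close>. As this target was computed from the fixed point itself, all
  other terms cancel against it and leave \<open>x1\<close>.\<close>

lemma reaches_target:
  assumes x: "admissible x" and im: "image_of x x"
  shows "AE \<omega> in M. x T \<omega> = x1"
proof -
  have "AE \<omega> in M. x T \<omega> = \<Phi> (ctrl x) x T \<omega>" using im zT by (simp add: image_of_def)
  moreover have "AE \<omega> in M. \<omega> \<in> space M" by simp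
  moreover have "AE \<omega> in M. integrable LL (\<lambda>s. R (T - s) (fx x s \<omega>))" by (rule V_integrable[OF fx_L2[OF x] zT])
  ultimately show ?thesis
  proof eventually_elim
    case (elim \<omega>)
    note uL = ctrl_path[OF x elim(2)]
    have "V (\<lambda>s \<omega>. L (ctrl x s \<omega>) + fx x s \<omega>) T \<omega> = W_op T R L (\<lambda>s. ctrl x s \<omega>) + V (fx x) T \<omega>"
      unfolding V_def W_op_def
      by (simp add: blinfun.add_right Bochner_Integration.integral_add[OF W_integrable[OF uL] elim(3)])
    moreover have "W_op T R L (\<lambda>s. ctrl x s \<omega>) = W_op T R L (Winv (target x \<omega>))"
      unfolding W_op_def
    proof (rule integral_cong_AE)
      show "AE s in LL. R (T - s) (L (ctrl x s \<omega>)) = R (T - s) (L (Winv (target x \<omega>) s))"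
        using ctrl(2)[OF x elim(2)] by eventually_elim simp
    qed (rule borel_measurable_integrable[OF W_integrable[OF uL]], rule borel_measurable_integrable[OF W_integrable[OF Winv_L2]])
    ultimately have "V (\<lambda>s \<omega>. L (ctrl x s \<omega>) + fx x s \<omega>) T \<omega> = target x \<omega> + V (fx x) T \<omega>"
      by (simp add: W_Winv)
    then show ?case using elim(1) by (simp add: \<Phi>_def target_def)
  qed
qed

text \<open>With the control of \<open>w\<close> frozen, every application of the equation
  multiplies the distance of two solutions by \<open>cc\<close>. Starting from a bound
  \<open>B\<close> and iterating, the distance is below every \<open>cc ^ n * B\<close>.\<close>

lemma unique:
  assumes cc: "cc < 1" and x: "admissible x" "admissible y"
    and im: "\<And>t. t \<in> {0..T} \<Longrightarrow> AE \<omega> in M. x t \<omega> = \<Phi> (ctrl w) x t \<omega>"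
      "\<And>t. t \<in> {0..T} \<Longrightarrow> AE \<omega> in M. y t \<omega> = \<Phi> (ctrl w) y t \<omega>" and w: "admissible w" and t: "t \<in> {0..T}"
  shows "AE \<omega> in M. x t \<omega> = y t \<omega>"
proof -
  have xC: "x \<in> C_L2 M {-\<tau>..T}" "y \<in> C_L2 M {-\<tau>..T}" using x by (simp_all add: admissible_def)
  obtain B where B: "0 \<le> B" "\<And>t. t \<in> {-\<tau>..T} \<Longrightarrow> L2_norm M (\<lambda>\<omega>. x t \<omega> - y t \<omega>) \<le> B"
    by (rule C_L2_bounded[OF C_L2_diff[OF xC]]) blast
  have it: "L2_norm M (\<lambda>\<omega>. x t \<omega> - y t \<omega>) \<le> cc ^ n * B" if "t \<in> {-\<tau>..T}" for n t
    using that
  proof (induction n arbitrary: t)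
    case 0 then show ?case using B(2) by simp
  next
    case (Suc n)
    have Bn: "0 \<le> cc ^ n * B" using cc_nonneg B(1) by simp
    show ?case
    proof (cases "t \<le> 0")
      case True
      then have "L2_norm M (\<lambda>\<omega>. x t \<omega> - y t \<omega>) = 0" using Suc.prems by (intro admissible_diff_past x) auto
      then show ?thesis using B(1) cc_nonneg by simp
    next
      case False
      then have t': "t \<in> {0..T}" using Suc.prems by auto
      have "AE \<omega> in M. x t \<omega> - y t \<omega> = \<Phi> (ctrl w) x t \<omega> - \<Phi> (ctrl w) y t \<omega>"
        using im(1)[OF t'] im(2)[OF t'] by eventually_elim simp
      from L2_cong_AE(2)[OF L2_diff[OF C_L2_D[OF \<Phi>_C_L2[OF w x(1)] t'] C_L2_D[OF \<Phi>_C_L2[OF w x(2)] t']]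
        L2_measurable[OF L2_diff[OF admissible_L2[OF x(1) Suc.prems] admissible_L2[OF x(2) Suc.prems]]] this]
      show ?thesis using \<Phi>_diff_same_control[OF w x Bn Suc.IH t'] by (simp add: mult.assoc)
    qed
  qed
  have t': "t \<in> {-\<tau>..T}" using t \<tau> by auto
  have "(\<lambda>n. cc ^ n * B) \<longlonglongrightarrow> 0"
    using cc cc_nonneg by (intro tendsto_mult_left_zero LIMSEQ_power_zero) simp
  then have "L2_norm M (\<lambda>\<omega>. x t \<omega> - y t \<omega>) \<le> 0"
    by (rule tendsto_lowerbound) (use it[OF t'] in \<open>auto intro: always_eventually\<close>)
  then have "L2_norm M (\<lambda>\<omega>. x t \<omega> - y t \<omega>) = 0" using L2_norm_nonneg[of M "\<lambda>\<omega>. x t \<omega> - y t \<omega>"] by linarith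
  from L2_norm_eq_0_AE[OF L2_diff[OF admissible_L2[OF x(1) t'] admissible_L2[OF x(2) t']] this] show ?thesis by simp
qed

end

section \<open>The contraction constant and the conclusion\<close>

lemma four_squares: "(a + b + c + d)\<^sup>2 \<le> 4 * (a\<^sup>2 + b\<^sup>2 + c\<^sup>2 + (d::real)\<^sup>2)"
proof -
  have "(a + b + c + d)\<^sup>2 = ((a + b) + (c + d))\<^sup>2" by (simp only: add.assoc)
  also have "\<dots> \<le> 2 * (a + b)\<^sup>2 + 2 * (c + d)\<^sup>2" using norm_add_sq_le[of "a + b" "c + d"] by simp
  also have "\<dots> \<le> 2 * (2 * a\<^sup>2 + 2 * b\<^sup>2) + 2 * (2 * c\<^sup>2 + 2 * d\<^sup>2)"
    using norm_add_sq_le[of a b] norm_add_sq_le[of c d] by simp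
  finally show ?thesis by simp
qed

text \<open>Multiplied out, the constant is a sum of four terms whose squares are the summands of
  the hypothesis. The square of such a sum is at most four times the sum of squares, which is where
  1/4 comes from.\<close>

lemma contraction_constant_less_1:
  fixes C3 D C1 T M_L M_W :: real
  assumes small: "C3\<^sup>2 + D\<^sup>2 * C1\<^sup>2 * T\<^sup>2 + D\<^sup>2 * M_L\<^sup>2 * M_W\<^sup>2 * C3\<^sup>2 * T + D^4 * M_L\<^sup>2 * M_W\<^sup>2 * C1\<^sup>2 * T^3 < 1/4" and T: "0 \<le> T"
  shows "\<bar>C3\<bar> + D * C1 * T + sqrt T * D * M_L * M_W * (\<bar>C3\<bar> + D * C1 * T) < 1" (is "?l < 1")
proof -
  let ?k = "sqrt T * D * M_L * M_W"
  have s: "(sqrt T)\<^sup>2 = T" using T by simp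
  have "?l = \<bar>C3\<bar> + D * C1 * T + ?k * \<bar>C3\<bar> + ?k * (D * C1 * T)" by (simp add: distrib_left)
  then have "?l\<^sup>2 \<le> 4 * (\<bar>C3\<bar>\<^sup>2 + (D * C1 * T)\<^sup>2 + (?k * \<bar>C3\<bar>)\<^sup>2 + (?k * (D * C1 * T))\<^sup>2)"
    using four_squares by metis
  also have "\<dots> = 4 * (C3\<^sup>2 + D\<^sup>2 * C1\<^sup>2 * T\<^sup>2 + D\<^sup>2 * M_L\<^sup>2 * M_W\<^sup>2 * C3\<^sup>2 * T + D^4 * M_L\<^sup>2 * M_W\<^sup>2 * C1\<^sup>2 * T^3)"
    by (simp add: power_mult_distrib s power2_abs) (simp add: eval_nat_numeral)
  also have "\<dots> < 1\<^sup>2" using small by simp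
  finally show ?thesis by (rule power_less_imp_less_base) simp
qed

theorem theorem6:
  fixes M :: "'w measure"
    and T \<tau> H :: real
    and I :: "nat set" and lam :: "nat \<Rightarrow> real"
    and e :: "nat \<Rightarrow> 'y::{real_inner,banach,second_countable_topology}"
    and Q :: "'y \<Rightarrow>\<^sub>L 'y"
    and \<beta> :: "nat \<Rightarrow> real \<Rightarrow> 'w \<Rightarrow> real" and BH :: "real \<Rightarrow> 'w \<Rightarrow> 'y"
    and r \<rho> :: "real \<Rightarrow> real"
    and DA :: "'x::{real_inner,banach,second_countable_topology} set" and A :: "'x \<Rightarrow> 'x"
    and DB :: "real \<Rightarrow> 'x set" and B :: "real \<Rightarrow> 'x \<Rightarrow> 'x"
    and R :: "real \<Rightarrow> 'x \<Rightarrow>\<^sub>L 'x"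
    and L :: "'u::{real_inner,banach,second_countable_topology} \<Rightarrow>\<^sub>L 'x"
    and f g :: "real \<Rightarrow> 'x \<Rightarrow> 'x"
    and \<sigma> :: "real \<Rightarrow> 'y \<Rightarrow>\<^sub>L 'x"
    and Winv :: "'x \<Rightarrow> real \<Rightarrow> 'u"
    and c :: "real \<Rightarrow> real"
    and C1 C2 C3 C4 C5 C6 \<gamma> M_L M_W D :: real
  assumes "0 < T" and "0 < \<tau>" and "0 < H" and "H < 1/2"
    and "prob_space M" and "complete_measure M"
    and "orthonormal_basis I e"
    and "\<forall>n\<in>I. 0 \<le> lam n" and "lam summable_on I"
    and "\<forall>n\<in>I. Q (e n) = lam n *\<^sub>R e n"
    and "Q_fractional_brownian_motion M H T I lam e \<beta> BH"
    and "continuous_on {0..} r" and "\<forall>t\<ge>0. r t \<in> {0..\<tau>}"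
    and "continuous_on {0..} \<rho>" and "\<forall>t\<ge>0. \<rho> t \<in> {0..\<tau>}"
    and "closed_linear_operator DA A"
    and "\<forall>t\<ge>0. closed_linear_operator (DB t) (B t) \<and> DA \<subseteq> DB t"
    and "\<exists>S. C0_semigroup S \<and> infinitesimal_generator DA A S"
    and "\<forall>t\<ge>0. \<exists>K. \<forall>y\<in>DA. norm (B t y) \<le> K * graph_norm A y"
    and "\<forall>t\<ge>0. 0 \<le> c t" and "\<forall>a. integrable (lebesgue_on {0..a}) c"
    and "\<forall>y\<in>DA. \<exists>w. has_W11_derivative (\<lambda>t. B t y) w \<and>
           (AE t in lebesgue_on {0..}. norm (w t) \<le> c t * graph_norm A y)"
    and "resolvent_operator DA A B R"
    and "\<forall>x. (\<lambda>t. f t x) \<in> borel_measurable (lebesgue_on {0..T})"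
    and "0 < C1" and "0 < C2"
    and "\<forall>t\<in>{0..T}. \<forall>x y. norm (f t x - f t y) \<le> C1 * norm (x - y)"
    and "\<forall>t\<in>{0..T}. \<forall>x. (norm (f t x))\<^sup>2 \<le> C2 * (1 + (norm x)\<^sup>2)"
    and "\<forall>t\<in>{0..T}. \<forall>x y. norm (g t x - g t y) \<le> C3 * norm (x - y)"
    and "\<forall>t\<in>{0..T}. \<forall>x. (norm (g t x))\<^sup>2 \<le> C4 * (1 + (norm x)\<^sup>2)"
    and "\<forall>x\<in>C_L2 M {0..T}. \<forall>s\<in>{0..T}.
           ((\<lambda>t. \<integral>\<omega>. (norm (g t (x t \<omega>) - g s (x s \<omega>)))\<^sup>2 \<partial>M) \<longlongrightarrow> 0) (at s within {0..T})"
    and "\<forall>t\<ge>0. \<sigma> t \<in> L20 I lam e"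
    and "0 < C5" and "\<gamma> > 1/2 - H"
    and "\<forall>t\<in>{0..T}. \<forall>s\<in>{0..T}. L20_norm I lam e (\<sigma> t - \<sigma> s) \<le> C5 * \<bar>t - s\<bar> powr \<gamma>"
    and "\<forall>t\<in>{0..T}. \<forall>y. \<sigma> t y \<in> DA"
    and "0 < C6"
    and "(\<integral>\<^sup>+t. L20_sq I lam e (\<lambda>y. A (\<sigma> t y)) \<partial>lebesgue_on {0..T}) \<le> ennreal C6"
    and "inverse_of_W T R L Winv"
    and "0 < M_L" and "0 < M_W" and "norm L \<le> M_L"
    and "\<forall>x. L2_norm (lebesgue_on {0..T}) (Winv x) \<le> M_W * norm x"
    and "D = (SUP t\<in>{0..T}. norm (R t))"
    and "C3\<^sup>2 + D\<^sup>2 * C1\<^sup>2 * T\<^sup>2 + D\<^sup>2 * M_L\<^sup>2 * M_W\<^sup>2 * C3\<^sup>2 * T + D^4 * M_L\<^sup>2 * M_W\<^sup>2 * C1\<^sup>2 * T^3 < 1/4"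
  shows "\<forall>\<phi>\<in>C_L2 M {-\<tau>..0}. \<forall>x1 :: 'x. \<exists>u. stochastic_control M T u \<and>
           (\<exists>x. mild_solution M \<tau> T H I lam e \<beta> R L f g \<sigma> r \<rho> \<phi> u x) \<and>
           (\<forall>x. mild_solution M \<tau> T H I lam e \<beta> R L f g \<sigma> r \<rho> \<phi> u x \<longrightarrow> (AE \<omega> in M. x T \<omega> = x1))"
proof (intro ballI allI)
  fix \<phi> :: "real \<Rightarrow> 'w \<Rightarrow> 'x" and x1 :: 'x assume \<phi>: "\<phi> \<in> C_L2 M {-\<tau>..0}"
  interpret prob_space M by fact
  have T: "0 < T" and T0: "0 \<le> T" using assms(1) by auto
  have R: "resolvent_operator DA A B R" by fact
  have D: "D = (SUP t\<in>{0..T}. norm (R t))" by fact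
  note RD = resolvent_bounded[OF R T0 D]
  have Rc: "continuous_on {0..} (\<lambda>t. R t x)" for x using R unfolding resolvent_operator_def by simp
  have R0: "R 0 = id_blinfun" using R unfolding resolvent_operator_def by simp
  have bm: "\<And>n. n \<in> I \<Longrightarrow> standard_brownian_motion M T (\<beta> n)"
    using assms(11) unfolding Q_fractional_brownian_motion_def by auto
  have B0: "\<exists>K. \<forall>y\<in>DA. norm (B 0 y) \<le> K * graph_norm A y"
    using \<open>\<forall>t\<ge>0. \<exists>K. \<forall>y\<in>DA. norm (B t y) \<le> K * graph_norm A y\<close> by simp
  have c: "integrable (lebesgue_on {0..T}) c" using \<open>\<forall>a. integrable (lebesgue_on {0..a}) c\<close> by simp
  have "\<exists>Z. Z \<in> C_L2 M {0..T} \<and> (AE \<omega> in M. Z 0 \<omega> = 0) \<and>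
    (\<forall>t\<in>{0..T}. has_fbm_integral M H I lam e \<beta> t (\<lambda>s. R (t - s) o\<^sub>L \<sigma> s) (Z t))"
    by (rule fbm_integral_process[where B = B and c = c and DA = DA and A = A and D = D and ?C5.0 = C5 and ?C6.0 = C6 and \<gamma> = \<gamma> and BH = BH];
        fact assms B0 c)
  then obtain Z where Z: "Z \<in> C_L2 M {0..T}" "AE \<omega> in M. Z 0 \<omega> = 0"
    "\<forall>t\<in>{0..T}. has_fbm_integral M H I lam e \<beta> t (\<lambda>s. R (t - s) o\<^sub>L \<sigma> s) (Z t)" by (elim exE conjE)
  \<comment> \<open>The growth condition at the zero vector bounds the value of \<open>f\<close>
    there; together with the Lipschitz condition it keeps \<open>f\<close> along a process in
    \<open>L2\<close>.\<close>
  have f0: "norm (f t 0) \<le> sqrt C2" if "t \<in> {0..T}" for t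
  proof (rule real_le_rsqrt)
    show "(norm (f t 0))\<^sup>2 \<le> C2"
      using \<open>\<forall>t\<in>{0..T}. \<forall>x. (norm (f t x))\<^sup>2 \<le> C2 * (1 + (norm x)\<^sup>2)\<close>[rule_format, OF that, of 0] by simp
  qed
  have C1: "0 \<le> C1" using \<open>0 < C1\<close> by simp
  interpret s: controlled_system T D R M L Winv M_W \<tau> C1 "sqrt C2" C3 M_L f g r \<rho> Z \<phi> x1
    by unfold_locales (fact T RD Rc f0 Z R0 \<phi> C1 assms)+
  have ll: "s.ll < 1"
    unfolding s.ll_def s.cc_def by (rule contraction_constant_less_1[OF _ T0]) fact
  have cc: "s.cc < 1" using s.cc_le_ll ll by linarith
  obtain x where x: "s.admissible x" "s.image_of x x" using s.fixed_point[OF ll] by (elim exE conjE)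
  let ?u = "s.ctrl x"
  have Phi: "s.\<Phi> u y t \<omega> = R t (\<phi> 0 \<omega> + g 0 (\<phi> (- r 0) \<omega>)) - g t (y (t - r t) \<omega>)
              + (\<integral>s. R (t - s) (L (u s \<omega>) + f s (y (s - \<rho> s) \<omega>)) \<partial>lebesgue_on {0..t}) + Z t \<omega>" for u y t \<omega>
    by (simp add: s.\<Phi>_def s.base_def s.ini_def s.gx_def s.V_def s.fx_def algebra_simps)
  have mild: "mild_solution M \<tau> T H I lam e \<beta> R L f g \<sigma> r \<rho> \<phi> ?u x"
    unfolding mild_solution_def
  proof (intro conjI ballI)
    show "x \<in> C_L2 M {-\<tau>..T}" "measurable_process M {-\<tau>..T} x" using x(1) by (simp_all add: s.admissible_def)
    show "AE \<omega> in M. x t \<omega> = \<phi> t \<omega>" if "t \<in> {-\<tau>..0}" for t using x(1) that by (simp add: s.admissible_def)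
    fix t assume t: "t \<in> {0..T}"
    show "AE \<omega> in M. integrable (lebesgue_on {0..t}) (\<lambda>s. R (t - s) (L (?u s \<omega>) + f s (x (s - \<rho> s) \<omega>)))"
      using s.V_integrable[OF s.Lu_fx_L2[OF x(1) x(1)] t] by (simp add: s.fx_def)
    have "AE \<omega> in M. x t \<omega> = s.\<Phi> ?u x t \<omega>" using x(2) t by (simp add: s.image_of_def)
    then have "AE \<omega> in M. x t \<omega> = R t (\<phi> 0 \<omega> + g 0 (\<phi> (- r 0) \<omega>)) - g t (x (t - r t) \<omega>)
              + (\<integral>s. R (t - s) (L (?u s \<omega>) + f s (x (s - \<rho> s) \<omega>)) \<partial>lebesgue_on {0..t}) + Z t \<omega>"
      by (simp only: Phi)
    then show "\<exists>Z. has_fbm_integral M H I lam e \<beta> t (\<lambda>s. R (t - s) o\<^sub>L \<sigma> s) Z \<and>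
           (AE \<omega> in M. x t \<omega> = R t (\<phi> 0 \<omega> + g 0 (\<phi> (- r 0) \<omega>)) - g t (x (t - r t) \<omega>)
              + (\<integral>s. R (t - s) (L (?u s \<omega>) + f s (x (s - \<rho> s) \<omega>)) \<partial>lebesgue_on {0..t}) + Z \<omega>)"
      using Z(3) t by (intro exI[of _ "Z t"]) simp
  qed
  have uniq: "AE \<omega> in M. y T \<omega> = x1" if y: "mild_solution M \<tau> T H I lam e \<beta> R L f g \<sigma> r \<rho> \<phi> ?u y" for y
  proof -
    have ya: "s.admissible y" using y by (simp add: mild_solution_def s.admissible_def)
    have yPhi: "AE \<omega> in M. y t \<omega> = s.\<Phi> ?u y t \<omega>" if t: "t \<in> {0..T}" for t
    proof -
      have "\<exists>Z. has_fbm_integral M H I lam e \<beta> t (\<lambda>s. R (t - s) o\<^sub>L \<sigma> s) Z \<and>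
           (AE \<omega> in M. y t \<omega> = R t (\<phi> 0 \<omega> + g 0 (\<phi> (- r 0) \<omega>)) - g t (y (t - r t) \<omega>)
              + (\<integral>s. R (t - s) (L (?u s \<omega>) + f s (y (s - \<rho> s) \<omega>)) \<partial>lebesgue_on {0..t}) + Z \<omega>)"
        using y[unfolded mild_solution_def, THEN conjunct2, THEN conjunct2, THEN conjunct2, rule_format, OF t, THEN conjunct2] .
      then obtain Z' where Z': "has_fbm_integral M H I lam e \<beta> t (\<lambda>s. R (t - s) o\<^sub>L \<sigma> s) Z'"
        "AE \<omega> in M. y t \<omega> = R t (\<phi> 0 \<omega> + g 0 (\<phi> (- r 0) \<omega>)) - g t (y (t - r t) \<omega>)
              + (\<integral>s. R (t - s) (L (?u s \<omega>) + f s (y (s - \<rho> s) \<omega>)) \<partial>lebesgue_on {0..t}) + Z' \<omega>" by (elim exE conjE)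
      \<comment> \<open>The competing solution may use another representative of the stochastic
        integral; once it is identified with \<open>Z t\<close>, both solutions satisfy the same
        equation.\<close>
      have "AE \<omega> in M. Z' \<omega> = Z t \<omega>"
        by (rule has_fbm_integral_unique[OF bm t Z'(1) bspec[OF Z(3) t]])
      with Z'(2) show ?thesis unfolding Phi by eventually_elim simp
    qed
    have xPhi: "AE \<omega> in M. x t \<omega> = s.\<Phi> ?u x t \<omega>" if "t \<in> {0..T}" for t
      using x(2) that by (simp add: s.image_of_def)
    have "AE \<omega> in M. y T \<omega> = x T \<omega>" by (rule s.unique[OF cc ya x(1) yPhi xPhi x(1) s.zT])
    with s.reaches_target[OF x] show ?thesis by eventually_elim simp
  qed
  show "\<exists>u. stochastic_control M T u \<and>
           (\<exists>x. mild_solution M \<tau> T H I lam e \<beta> R L f g \<sigma> r \<rho> \<phi> u x) \<and>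
           (\<forall>x. mild_solution M \<tau> T H I lam e \<beta> R L f g \<sigma> r \<rho> \<phi> u x \<longrightarrow> (AE \<omega> in M. x T \<omega> = x1))"
    using s.ctrl(1)[OF x(1)] mild uniq by (intro exI[of _ ?u]) blast
qed

end
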